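(* Let $p\ge1$, $\beta_0\in\mathbb R^p$, let $X$ be a random vector in $\mathbb R^p$ with Lebesgue density $f^X$ such that $\mathbb P(\|X\|\le B)=1$ for some $B>0$ and $\mathbb P(v^\top X=0)=0$ for every $v\ne0$. Let $\epsilon$ be independent of $X$ with density $f(t)=c_\alpha\exp(-d^{-\alpha}|t|^\alpha)$, where $\alpha\ge1$ is an integer, $d>0$, $c_\alpha=\frac{\alpha}{2d\Gamma(1/\alpha)}$, and $Y=\beta_0^\top X+\epsilon$, with density $f^Y(y)=\int f(y-\beta_0^\top x)f^X(x)\,dx$. Let $\tilde X_1,\dots,\tilde X_n$ be i.i.d. copies of $X$, $\tilde Y_1,\dots,\tilde Y_n$ i.i.d. copies of $Y$, and $(X_1,Y_1),\dots,(X_m,Y_m)$ i.i.d. copies of $(X,Y)$, the three samples mutually independent, and let $n,m\to\infty$ with $m/n\to\lambda\in(0,1)$. Let $\widehat\beta_{n,m}$ be a maximizer over $\mathbb R^p$ of $$\ell_{n,m}(\beta)=\frac{1}{n+m}\sum_{j=1}^n\log\Big(\frac1n\sum_{i=1}^n f(\tilde Y_j-\beta^\top\tilde X_i)\Big)+\frac{1}{n+m}\sum_{k=1}^m\log f(Y_k-\beta^\top X_k).$$ Then $$\sqrt{m+n}\,(\widehat\beta_{n,m}-\beta_0)\to_d\mathcal N(0,\Sigma_{\mathrm{SSL}}),$$ $$\Sigma_{\mathrm{SSL}}=\Big(\tfrac{1}{1+\lambda}\Gamma_1+\tfrac{\lambda}{1+\lambda}\Sigma_2\Big)^{-1}\Big(\tfrac{1}{1+\lambda}(\Gamma_1+\Gamma_2)+\tfrac{\lambda}{1+\lambda}\Sigma_2\Big)\Big(\tfrac{1}{1+\lambda}\Gamma_1+\tfrac{\lambda}{1+\lambda}\Sigma_2\Big)^{-1},$$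 where $$\Gamma_1=\int\frac{\big(\int xf'(y-\beta_0^\top x)f^X(x)dx\big)\big(\int x^\top f'(y-\beta_0^\top x)f^X(x)dx\big)}{f^Y(y)}\,dy,$$ $$\Gamma_2=\int\Big(\int\frac{f(y-\beta_0^\top x)\int zf'(y-\beta_0^\top z)f^X(z)dz}{f^Y(y)}dy\Big)\Big(\int\frac{f(y-\beta_0^\top x)\int z^\top f'(y-\beta_0^\top z)f^X(z)dz}{f^Y(y)}dy\Big)f^X(x)\,dx,$$ $$\Sigma_2=\Big(\int\frac{(f'(t))^2}{f(t)}dt\Big)\mathbb E[XX^\top]=\frac{\alpha^2}{d^2}\frac{\Gamma(2-\frac1\alpha)}{\Gamma(\frac1\alpha)}\,\mathbb E[XX^\top].$$
   Context: $f'$ denotes the derivative of $f$ (existing everywhere except possibly at $0$ when $\alpha=1$). $\Gamma(\cdot)$ in $\Sigma_2$ is the Gamma function. Linear regression with a matched sample and an unmatched sample; $\widehat\beta_{n,m}$ is the semi-supervised empirical maximum likelihood estimator. *)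

theory Defs
  imports "HOL-Probability.Probability"
begin

definition gn_const :: "nat \<Rightarrow> real \<Rightarrow> real" where
  "gn_const \<alpha> d = real \<alpha> / (2 * d * Gamma (1 / real \<alpha>))"

definition gn_density :: "nat \<Rightarrow> real \<Rightarrow> real \<Rightarrow> real" where
  "gn_density \<alpha> d t = gn_const \<alpha> d * exp (- (d powr (- real \<alpha>)) * \<bar>t\<bar> ^ \<alpha>)"

definition ssl_loglik ::
  "(real \<Rightarrow> real) \<Rightarrow> nat \<Rightarrow> nat \<Rightarrow> (nat \<Rightarrow> real^'p) \<Rightarrow> (nat \<Rightarrow> real)
     \<Rightarrow> (nat \<Rightarrow> real^'p) \<Rightarrow> (nat \<Rightarrow> real) \<Rightarrow> real^'p \<Rightarrow> real" where
  "ssl_loglik f n m Xt Yt Xs Ys \<beta> =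
     (1 / real (n + m)) * (\<Sum>j<n. ln ((1 / real n) * (\<Sum>i<n. f (Yt j - \<beta> \<bullet> Xt i))))
   + (1 / real (n + m)) * (\<Sum>k<m. ln (f (Ys k - \<beta> \<bullet> Xs k)))"

definition centered_normal :: "real^'p^'p \<Rightarrow> (real^'p) measure \<Rightarrow> bool" where
  "centered_normal \<Sigma> \<mu> \<longleftrightarrow> prob_space \<mu> \<and> sets \<mu> = sets borel \<and>
     (\<forall>t. integral\<^sup>L \<mu> (\<lambda>x. cis (t \<bullet> x)) = complex_of_real (exp (- (t \<bullet> (\<Sigma> *v t)) / 2)))"

definition conv_in_distr :: "'a measure \<Rightarrow> (nat \<Rightarrow> 'a \<Rightarrow> real^'p) \<Rightarrow> (real^'p) measure \<Rightarrow> bool" where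
  "conv_in_distr M Z \<mu> \<longleftrightarrow>
     (\<forall>g :: real^'p \<Rightarrow> real. continuous_on UNIV g \<longrightarrow> bounded (range g) \<longrightarrow>
        (\<lambda>k. integral\<^sup>L M (\<lambda>\<omega>. g (Z k \<omega>))) \<longlonglongrightarrow> integral\<^sup>L \<mu> g)"

end

theory Submission
 imports Defs "HOL-Real_Asymp.Real_Asymp"
begin

text \<open>Write the noise density as \<^term>\<open>exp (- g t)\<close> with convex \<^term>\<open>g\<close>. The log-likelihood ratio
 at \<open>\<beta>0 + h / sqrt N\<close>, \<open>N = n + m\<close>, is approximated in mean by \<open>h \<bullet> S - (h \<bullet> A h) / 2\<close>, where the score \<open>S\<close>
 also contains the projection \<open>w\<close> caused by the empirical mixture density. As \<open>g\<close> is convex, the ratio is concave up to a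
 quadratic term of order one, so the expansion is uniform on compact sets. A bound on the mean square root of the ratio,
 integrated over large \<open>h\<close> and combined with this semiconcavity, confines the maximizer to such a set. Hence
 \<open>sqrt N (\<beta>hat - \<beta>0)\<close> is close to \<open>A\<inverse> S\<close>, whose characteristic function converges to that of the normal law.\<close>

text \<open>The density has a kink at the origin when \<alpha> = 1, so the criterion has no second
  derivative to expand. Smoothness enters only as differentiability in quadratic mean: with l the
  log of a likelihood ratio and z = exp l - 1, l = z - z^2/2 up to a cubic error in l, and the
  population version of z is exactly centred. The second obstacle is that each unmatched term
  depends on all covariates \<open>Xt\<close>. Given these, the responses are i.i.d.; the
  conditional mean of the increments follows from the fact that the empirical mixture and its mean
  have mass one for every parameter, which leaves n times a product of two errors of order n^(-1/2),
  one of them with the factor |de|. Away from the true parameter no decay is extracted from the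
  unmatched sample. All of it comes from the matched one, and the unmatched ratio costs only a
  bounded factor, measured by the chi-square distance between true and empirical mixture density.
  The projection adds variance to the score but nothing to the curvature; this produces the sandwich
  form of the limit covariance.\<close>

abbreviation NNI where "NNI \<equiv> nn_integral"

subsection \<open>Stochastic convergence\<close>

context prob_space
begin

text \<open>Convergence to zero in mean, phrased with the nonnegative integral: no integrability
  obligation arises, and the integral may be infinite for finitely many indices.\<close>

definition L1_null :: "(nat => 'a => real) => bool" where
 "L1_null W \<longleftrightarrow> (\<forall>k. W k \<in> borel_measurable M) \<and>
  (\<lambda>k. \<integral>\<^sup>+om. ennreal \<bar>W k om\<bar> \<partial>M) \<longlonglongrightarrow> 0"

lemma L1_nullI:
 assumes "\<And>k. W k \<in> borel_measurable M"
  and "\<forall>\<^sub>F k in sequentially. (NNI M (\<lambda>om. ennreal \<bar>W k om\<bar>)) <= c k" and "c \<longlonglongrightarrow> 0"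
 shows "L1_null W"
 unfolding L1_null_def
proof (intro conjI allI assms)
 show "(\<lambda>k. \<integral>\<^sup>+om. ennreal \<bar>W k om\<bar> \<partial>M) \<longlonglongrightarrow> 0"
  by (rule tendsto_sandwich[OF _ assms(2) tendsto_const assms(3)]) simp
qed

lemma L1_nullI_real:
 assumes "\<And>k. W k \<in> borel_measurable M"
  and "\<forall>\<^sub>F k in sequentially. (NNI M (\<lambda>om. ennreal \<bar>W k om\<bar>)) <= ennreal (c k)" and "c \<longlonglongrightarrow> 0"
 shows "L1_null W"
 using tendsto_ennrealI[OF assms(3)] by (intro L1_nullI[OF assms(1,2)]) auto

lemma L1_null_measurable[measurable_dest]: "L1_null W ==> W k \<in> borel_measurable M"
 by (auto simp: L1_null_def)

lemma L1_null_add: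
 assumes "L1_null V" "L1_null W"
 shows "L1_null (\<lambda>k om. V k om + W k om)"
proof (rule L1_nullI)
 note [measurable] = L1_null_measurable[OF assms(1)] L1_null_measurable[OF assms(2)]
 show "(\<lambda>om. V k om + W k om) \<in> borel_measurable M" for k by measurable
 have "(NNI M (\<lambda>om. ennreal \<bar>V k om + W k om\<bar>)) <= (NNI M (\<lambda>om. (ennreal \<bar>V k om\<bar> + ennreal \<bar>W k om\<bar>)))" for k
  by (intro nn_integral_mono) (simp flip: ennreal_plus)
 also have "... k = (NNI M (\<lambda>om. ennreal \<bar>V k om\<bar>)) + (NNI M (\<lambda>om. ennreal \<bar>W k om\<bar>))" for k
  by (subst nn_integral_add) auto
 finally show "\<forall>\<^sub>F k in sequentially. (NNI M (\<lambda>om. ennreal \<bar>V k om + W k om\<bar>)) <=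
   (NNI M (\<lambda>om. ennreal \<bar>V k om\<bar>)) + (NNI M (\<lambda>om. ennreal \<bar>W k om\<bar>))"
  by simp
 show "(\<lambda>k. (NNI M (\<lambda>om. ennreal \<bar>V k om\<bar>)) + (NNI M (\<lambda>om. ennreal \<bar>W k om\<bar>))) \<longlonglongrightarrow> 0"
  using assms by (auto simp: L1_null_def intro!: tendsto_eq_intros)
qed

lemma L1_null_minus: "L1_null W ==> L1_null (\<lambda>k om. - W k om)"
 by (auto simp: L1_null_def)

lemma L1_null_diff: "L1_null V ==> L1_null W ==> L1_null (\<lambda>k om. V k om - W k om)"
 using L1_null_add[OF _ L1_null_minus, of V W] by simp

lemma L1_null_cong:
 assumes "L1_null V" "\<And>k. W k \<in> borel_measurable M"
  and "\<forall>\<^sub>F k in sequentially. \<forall>om\<in>space M. W k om = V k om"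
 shows "L1_null W"
proof (rule L1_nullI[OF assms(2), where c="\<lambda>k. \<integral>\<^sup>+om. ennreal \<bar>V k om\<bar> \<partial>M"])
 show "\<forall>\<^sub>F k in sequentially. (NNI M (\<lambda>om. ennreal \<bar>W k om\<bar>)) <= (NNI M (\<lambda>om. ennreal \<bar>V k om\<bar>))"
  using assms(3) by eventually_elim (intro nn_integral_mono, auto)
qed (use assms(1) in \<open>auto simp: L1_null_def\<close>)

lemma L1_null_cmult: "L1_null W ==> L1_null (\<lambda>k om. c * W k om)"
proof (rule L1_nullI)
 assume W: "L1_null W"
 note [measurable] = L1_null_measurable[OF W]
 show "(\<lambda>om. c * W k om) \<in> borel_measurable M" for k by measurable
 show "\<forall>\<^sub>F k in sequentially. (NNI M (\<lambda>om. ennreal \<bar>c * W k om\<bar>)) <= ennreal \<bar>c\<bar> * (NNI M (\<lambda>om. ennreal \<bar>W k om\<bar>))"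
  by (simp add: abs_mult ennreal_mult' nn_integral_cmult)
 show "(\<lambda>k. ennreal \<bar>c\<bar> * (NNI M (\<lambda>om. ennreal \<bar>W k om\<bar>))) \<longlonglongrightarrow> 0"
  using W by (intro tendsto_eq_rhs[OF ennreal_tendsto_cmult]) (auto simp: L1_null_def)
qed

lemma L1_null_const: "c \<longlonglongrightarrow> 0 ==> L1_null (\<lambda>k om. c k)"
 by (rule L1_nullI_real[where c="\<lambda>k. \<bar>c k\<bar>"])
  (auto simp: emeasure_space_1 tendsto_rabs_zero_iff)

text \<open>Young's inequality |x| <= e + x^2/e, integrated. It takes the place of the
  Cauchy-Schwarz inequality and remains meaningful when both sides are infinite.\<close>

lemma nn_integral_abs_le_sq:
 assumes [measurable]: "W \<in> borel_measurable M" and "e > 0"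
 shows "(NNI M (\<lambda>om. ennreal \<bar>W om\<bar>)) <= ennreal e + ennreal (1/e) * (NNI M (\<lambda>om. ennreal ((W om)^2)))"
proof -
 have le: "\<bar>x\<bar> <= e + 1/e * x^2" for x :: real
 proof -
  have "0 <= (\<bar>x\<bar> - e)^2" by simp
  then have "2 * e * \<bar>x\<bar> <= e * e + x^2" by (simp add: power2_eq_square algebra_simps)
  then have "e * \<bar>x\<bar> <= e * e + x^2" using \<open>e > 0\<close> mult_nonneg_nonneg[of e "\<bar>x\<bar>"] by linarith
  then show ?thesis using \<open>e > 0\<close> by (simp add: field_simps)
 qed
 have "(NNI M (\<lambda>om. ennreal \<bar>W om\<bar>)) <= (NNI M (\<lambda>om. ennreal e + ennreal (1/e) * ennreal ((W om)^2)))"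
  using \<open>e > 0\<close> le
  by (intro nn_integral_mono) (auto simp flip: ennreal_plus ennreal_mult intro!: ennreal_leI)
 also have "... = ennreal e + ennreal (1/e) * (NNI M (\<lambda>om. ennreal ((W om)^2)))"
  by (subst nn_integral_add) (auto simp: nn_integral_cmult emeasure_space_1)
 finally show ?thesis .
qed

lemma L1_null_of_sq:
 assumes [measurable]: "\<And>k. W k \<in> borel_measurable M"
  and le: "\<forall>\<^sub>F k in sequentially. (NNI M (\<lambda>om. ennreal ((W k om)^2))) <= ennreal (c k)" and c: "c \<longlonglongrightarrow> 0"
 shows "L1_null W"
proof -
 \<comment> \<open>The root of \<open>c k\<close> is the best parameter in Young's inequality. The
   summand 1/(k+1) keeps it positive when \<open>c k\<close> vanishes, and the absolute value covers
   negative \<open>c k\<close>.\<close>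
 define e where "e k = sqrt \<bar>c k\<bar> + 1 / real (Suc k)" for k
 have e: "e k > 0" for k unfolding e_def by (simp add: add_nonneg_pos)
 have lim: "(\<lambda>k. 2 * e k) \<longlonglongrightarrow> 0"
 proof -
  have "(\<lambda>k. 2 * (sqrt \<bar>c k\<bar> + 1 / real (Suc k))) \<longlonglongrightarrow> 2 * (sqrt \<bar>0\<bar> + 0)"
   using LIMSEQ_inverse_real_of_nat unfolding inverse_eq_divide
   by (intro tendsto_intros c)
  then show ?thesis by (simp add: e_def)
 qed
 show ?thesis
 proof (rule L1_nullI_real[OF _ _ lim])
  show "\<forall>\<^sub>F k in sequentially. (NNI M (\<lambda>om. ennreal \<bar>W k om\<bar>)) <= ennreal (2 * e k)"
   using le
  proof eventually_elim
   case (elim k)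
   have "c k <= (sqrt \<bar>c k\<bar>)^2" by simp
   also have "... <= (e k)^2" by (intro power_mono) (auto simp: e_def)
   finally have ce: "c k <= (e k)^2" .
   have "(NNI M (\<lambda>om. ennreal \<bar>W k om\<bar>)) <= ennreal (e k) + ennreal (1/e k) * (NNI M (\<lambda>om. ennreal ((W k om)^2)))"
    by (intro nn_integral_abs_le_sq e) simp
   also have "... <= ennreal (e k) + ennreal (1/e k) * ennreal ((e k)^2)"
    using elim ce by (intro add_mono mult_left_mono order_refl) (auto intro: order_trans ennreal_leI)
   also have "... = ennreal (2 * e k)"
    using e[of k] by (simp flip: ennreal_mult ennreal_plus add: power2_eq_square)
   finally show ?case .
  qed
 qed simp
qed

text \<open>Markov's inequality. \<open>ennreal\<close> replaces negative values of \<open>W\<close>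
  by zero, which leaves the event unchanged because \<open>t\<close> is positive.\<close>

lemma prob_ge_le_nn_integral:
 assumes [measurable]: "W \<in> borel_measurable M" and W: "(NNI M (\<lambda>om. ennreal (W om))) <= ennreal c"
  and "t > 0" "c >= 0"
 shows "prob {om\<in>space M. W om >= t} <= c / t"
proof -
 have "emeasure M {om\<in>space M. W om >= t} = emeasure M ({om\<in>space M. 1 <= ennreal (1/t) * ennreal (W om)} \<inter> space M)"
 proof (rule arg_cong2[where f=emeasure])
  have "W om >= t \<longleftrightarrow> 1 <= ennreal (1/t) * ennreal (W om)" for om
  proof (cases "W om >= 0")
   case True
   then show ?thesis using \<open>t > 0\<close>
    by (subst ennreal_mult'[symmetric]) (auto simp: field_simps ennreal_1[symmetric] simp del: ennreal_1)
  next
   case False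
   then show ?thesis using \<open>t > 0\<close> by (auto simp: ennreal_neg)
  qed
  then show "{om\<in>space M. W om >= t} = {om\<in>space M. 1 <= ennreal (1/t) * ennreal (W om)} \<inter> space M" by auto
 qed simp
 also have "... <= ennreal (1/t) * (NNI M (\<lambda>om. ennreal (W om) * indicator (space M) om))"
  using nn_integral_Markov_inequality[of "\<lambda>om. ennreal (W om)" "space M" M "ennreal (1/t)"] by (simp add: Int_def conj_commute)
 also have "(NNI M (\<lambda>om. ennreal (W om) * indicator (space M) om)) = (NNI M (\<lambda>om. ennreal (W om)))"
  by (intro nn_integral_cong) auto
 also have "ennreal (1/t) * ... <= ennreal (1/t) * ennreal c" using W by (intro mult_left_mono) auto
 also have "... = ennreal (c / t)" using assms by (simp flip: ennreal_mult)
 finally show ?thesis using assms by (simp add: emeasure_eq_measure)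
qed

text \<open>\<open>P\<close> need not be a measurable event: later it quantifies over all parameters
  or speaks of maximizers. Asking for a measurable event \<open>E\<close> of large probability
  inside it avoids measurability questions of that kind.\<close>

definition hp :: "real => (nat => 'a => bool) => bool" where
 "hp ep P \<longleftrightarrow> (\<forall>\<^sub>F k in sequentially. \<exists>E\<in>sets M. prob E >= 1 - ep \<and> (\<forall>om\<in>E. P k om))"

lemma hp_conj:
 assumes "hp a P" "hp b Q"
 shows "hp (a + b) (\<lambda>k om. P k om \<and> Q k om)"
 using assms unfolding hp_def
proof eventually_elim
 case (elim k)
 then obtain E F where E: "E \<in> sets M" "prob E >= 1 - a" "\<forall>om\<in>E. P k om"
  and F: "F \<in> sets M" "prob F >= 1 - b" "\<forall>om\<in>F. Q k om" by auto
 have "prob (E \<union> F) = prob E + prob F - prob (E \<inter> F)"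
  using E(1) F(1) by (rule measure_Un3[OF fmeasurable_eq_sets[THEN equalityD2, THEN subsetD]
     fmeasurable_eq_sets[THEN equalityD2, THEN subsetD]])
 then have "prob (E \<inter> F) >= 1 - (a + b)" using E F prob_le_1[of "E \<union> F"] by linarith
 then show ?case using E F by (intro bexI[of _ "E \<inter> F"]) auto
qed

lemma hp_mono:
 assumes "hp a P" "a <= b" "\<forall>\<^sub>F k in sequentially. \<forall>om\<in>space M. P k om --> Q k om"
 shows "hp b Q"
 using assms(1,3) unfolding hp_def
proof eventually_elim
 case (elim k)
 then obtain E where E: "E \<in> sets M" "prob E >= 1 - a" "\<forall>om\<in>E. P k om" by auto
 then show ?case using elim assms(2) sets.sets_into_space[OF E(1)] by (intro bexI[of _ E]) auto
qed

lemma hp_AE: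
 assumes "\<And>k. AE om in M. P k om" "ep >= 0"
 shows "hp ep P"
 unfolding hp_def
proof (intro always_eventually allI)
 fix k
 from AE_E[OF assms(1)[of k]] obtain N where N: "{om \<in> space M. \<not> P k om} \<subseteq> N" "emeasure M N = 0" "N \<in> sets M"
  by metis
 have "prob (space M - N) = 1" using N by (simp add: prob_compl emeasure_eq_measure)
 then show "\<exists>E\<in>sets M. 1 - ep <= prob E \<and> (\<forall>om\<in>E. P k om)"
  using N assms(2) by (intro bexI[of _ "space M - N"]) auto
qed

lemma hp_bounded:
 assumes [measurable]: "\<And>k. W k \<in> borel_measurable M"
  and W: "\<forall>\<^sub>F k in sequentially. (NNI M (\<lambda>om. ennreal (W k om))) <= ennreal c"
  and "ep > 0" "c >= 0" "t > 0" "c / t <= ep"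
 shows "hp ep (\<lambda>k om. W k om < t)"
 using W unfolding hp_def
proof eventually_elim
 case (elim k)
 have "prob {om\<in>space M. W k om >= t} <= c / t" using prob_ge_le_nn_integral[OF _ elim] assms by auto
 moreover have "prob (space M - {om\<in>space M. W k om >= t}) = 1 - prob {om\<in>space M. W k om >= t}"
  by (subst prob_compl) auto
 ultimately show ?case using assms by (intro bexI[of _ "space M - {om\<in>space M. W k om >= t}"]) auto
qed

lemma hp_L1_null:
 assumes W: "L1_null W" and "ep > 0" "t > 0"
 shows "hp ep (\<lambda>k om. \<bar>W k om\<bar> < t)"
proof -
 note [measurable] = L1_null_measurable[OF W]
 have "(\<lambda>k. \<integral>\<^sup>+om. ennreal \<bar>W k om\<bar> \<partial>M) \<longlonglongrightarrow> 0" using W by (simp add: L1_null_def)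
 then have "\<forall>\<^sub>F k in sequentially. (NNI M (\<lambda>om. ennreal \<bar>W k om\<bar>)) < ennreal (ep * t)"
  using assms by (intro order_tendstoD(2)) auto
 then have "\<forall>\<^sub>F k in sequentially. (NNI M (\<lambda>om. ennreal \<bar>W k om\<bar>)) <= ennreal (ep * t)"
  by eventually_elim auto
 then show ?thesis using assms by (intro hp_bounded[where c="ep * t"]) auto
qed

lemma hp_finite_Ball:
 assumes "finite I" "\<And>i ep. i \<in> I ==> ep > 0 ==> hp ep (P i)" "ep > 0"
 shows "hp ep (\<lambda>k om. \<forall>i\<in>I. P i k om)"
 using assms
proof (induction I arbitrary: ep rule: finite_induct)
 case empty
 then show ?case by (auto intro!: hp_AE)
next
 case (insert i I)
 have "hp (ep/2 + ep/2) (\<lambda>k om. P i k om \<and> (\<forall>i\<in>I. P i k om))"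
  using insert by (intro hp_conj) auto
 then show ?case by simp
qed

subsection \<open>Independence\<close>

text \<open>By independence the joint law is a product, and Tonelli's theorem makes the integral an
  iterated one. The independent copy of \<open>B\<close> is \<open>B\<close> itself at a second
  sample point, so the space is not enlarged.\<close>

lemma nn_integral_indep:
 assumes ind: "indep_var N1 A N2 B" and Ph: "Ph \<in> borel_measurable (N1 \<Otimes>\<^sub>M N2)"
 shows "(NNI M (\<lambda>om. Ph (A om, B om))) = (NNI M (\<lambda>om. \<integral>\<^sup>+om'. Ph (A om, B om') \<partial>M))"
proof -
 note rv = indep_var_rv1[OF ind] indep_var_rv2[OF ind]
 note [measurable] = rv Ph
 interpret D: prob_space "distr M N2 B" by (rule prob_space_distr) fact
 have "(NNI M (\<lambda>om. Ph (A om, B om))) = (NNI (distr M (N1 \<Otimes>\<^sub>M N2) (\<lambda>om. (A om, B om))) (\<lambda>z. Ph z))"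
  by (subst nn_integral_distr) auto
 also have "... = (NNI ((distr M N1 A \<Otimes>\<^sub>M distr M N2 B)) (\<lambda>z. Ph z))"
  using ind by (simp add: indep_var_distribution_eq)
 also have "... = (NNI (distr M N1 A) (\<lambda>x. \<integral>\<^sup>+y. Ph (x, y) \<partial>distr M N2 B))"
  by (subst D.nn_integral_fst[symmetric]) auto
 also have "... = (NNI M (\<lambda>om. \<integral>\<^sup>+om'. Ph (A om, B om') \<partial>M))"
  by (subst nn_integral_distr, measurable) (auto intro!: nn_integral_cong nn_integral_distr)
 finally show ?thesis .
qed

lemma nn_integral_indep_compose:
 assumes ind: "indep_var N1 A N2 B" and [measurable]: "F \<in> measurable N1 K1" "G \<in> measurable N2 K2"
  and Ph[measurable]: "Ph \<in> borel_measurable (K1 \<Otimes>\<^sub>M K2)"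
 shows "(NNI M (\<lambda>om. Ph (F (A om), G (B om)))) = (NNI M (\<lambda>om. \<integral>\<^sup>+om'. Ph (F (A om), G (B om')) \<partial>M))"
proof -
 have "(\<lambda>z. Ph (F (fst z), G (snd z))) \<in> borel_measurable (N1 \<Otimes>\<^sub>M N2)" by measurable
 from nn_integral_indep[OF ind this] show ?thesis by simp
qed

lemma indep_vars_imp_indep_var:
 assumes ind: "indep_vars (\<lambda>_. N) W I" and "i \<in> I" "j \<in> I" "i \<noteq> j"
 shows "indep_var N (W i) N (W j)"
proof -
 have "inj (case_bool i j)" using \<open>i \<noteq> j\<close> by (auto simp: inj_def split: bool.splits)
 have "indep_vars (\<lambda>b. N) (\<lambda>b. W (case_bool i j b)) UNIV"
 proof -
  have 1: "indep_vars (\<lambda>_. N) W {i, j}" by (rule indep_vars_subset[OF ind]) (use assms in auto)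
  have "indep_vars (\<lambda>b. PiM {case_bool i j b} (\<lambda>_. N)) (\<lambda>b om. restrict (\<lambda>l. W l om) {case_bool i j b}) UNIV"
   by (rule indep_vars_restrict[OF ind])
    (use assms in \<open>auto simp: disjoint_family_on_def split: bool.splits\<close>)
  then have "indep_vars (\<lambda>b. N) (\<lambda>b. (\<lambda>x. x (case_bool i j b)) \<circ> (\<lambda>om. restrict (\<lambda>l. W l om) {case_bool i j b})) UNIV"
   by (intro indep_vars_compose) auto
  then show ?thesis by (simp add: comp_def)
 qed
 then show ?thesis unfolding indep_var_def
  by (rule indep_vars_cong[THEN iffD1, rotated -1]) (auto split: bool.splits)
qed

lemma second_moment_sum_indep:
 fixes W :: "'i => 'a => real"
 assumes ind: "indep_vars (\<lambda>_. borel) W I" and "finite I"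
  and sq: "\<And>i. i \<in> I ==> integrable M (\<lambda>om. (W i om)^2)"
  and mean: "\<And>i. i \<in> I ==> expectation (W i) = 0"
 shows "integrable M (\<lambda>om. (\<Sum>i\<in>I. W i om)^2)"
  and "expectation (\<lambda>om. (\<Sum>i\<in>I. W i om)^2) = (\<Sum>i\<in>I. expectation (\<lambda>om. (W i om)^2))"
proof -
 have rv[measurable]: "W i \<in> borel_measurable M" if "i \<in> I" for i
  using ind that by (auto simp: indep_vars_def)
 have int: "integrable M (W i)" if "i \<in> I" for i
  by (rule square_integrable_imp_integrable) (use sq rv that in auto)
 have eq: "(\<Sum>i\<in>I. W i om)^2 = (\<Sum>i\<in>I. \<Sum>j\<in>I. W i om * W j om)" for om
  by (simp add: power2_eq_square sum_product)
 have prod: "integrable M (\<lambda>om. W i om * W j om) \<and>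
  expectation (\<lambda>om. W i om * W j om) = (if i = j then expectation (\<lambda>om. (W i om)^2) else 0)"
  if "i \<in> I" "j \<in> I" for i j
 proof (cases "i = j")
  case True
  then show ?thesis using sq[OF that(1)] by (simp add: power2_eq_square)
 next
  case False
  note iv = indep_vars_imp_indep_var[OF ind that False]
  show ?thesis using indep_var_integrable[OF iv int[OF that(1)] int[OF that(2)]]
    indep_var_lebesgue_integral[OF iv int[OF that(1)] int[OF that(2)]] False mean that by auto
 qed
 show "integrable M (\<lambda>om. (\<Sum>i\<in>I. W i om)^2)" unfolding eq using prod by auto
 have "expectation (\<lambda>om. (\<Sum>i\<in>I. W i om)^2) = (\<Sum>i\<in>I. \<Sum>j\<in>I. expectation (\<lambda>om. W i om * W j om))"
  unfolding eq using prod by (simp add: Bochner_Integration.integral_sum)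
 also have "... = (\<Sum>i\<in>I. \<Sum>j\<in>I. if i = j then expectation (\<lambda>om. (W i om)^2) else 0)"
  using prod by (intro sum.cong) auto
 also have "... = (\<Sum>i\<in>I. expectation (\<lambda>om. (W i om)^2))" using \<open>finite I\<close> by (simp add: sum.delta)
 finally show "expectation (\<lambda>om. (\<Sum>i\<in>I. W i om)^2) = (\<Sum>i\<in>I. expectation (\<lambda>om. (W i om)^2))" .
qed

lemma iid_sum_sq:
 fixes V :: "nat => 'a => 'c" and ph :: "'c => real"
 assumes ind: "indep_vars (\<lambda>_. N) V UNIV" and D: "\<And>i. distr M N (V i) = distr M N (V 0)"
  and [measurable]: "ph \<in> borel_measurable N"
  and sq: "integrable M (\<lambda>om. (ph (V 0 om))^2)" and mean: "expectation (\<lambda>om. ph (V 0 om)) = 0"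
 shows "(NNI M (\<lambda>om. ennreal ((\<Sum>i<n. ph (V i om))^2))) = ennreal (real n * expectation (\<lambda>om. (ph (V 0 om))^2))"
proof -
 have [measurable]: "V i \<in> measurable M N" for i using ind by (auto simp: indep_vars_def)
 have i: "integrable M (\<lambda>om. (ph (V i om))^2)" for i
  using sq D[of i] integrable_distr_eq[of "V i" M N "\<lambda>x. (ph x)^2"] integrable_distr_eq[of "V 0" M N "\<lambda>x. (ph x)^2"] by auto
 have e: "expectation (\<lambda>om. (ph (V i om))^2) = expectation (\<lambda>om. (ph (V 0 om))^2)" for i
  using D[of i] integral_distr[of "V i" M N "\<lambda>x. (ph x)^2"] integral_distr[of "V 0" M N "\<lambda>x. (ph x)^2"] by auto
 have m: "expectation (\<lambda>om. ph (V i om)) = 0" for i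
  using D[of i] integral_distr[of "V i" M N ph] integral_distr[of "V 0" M N ph] mean by auto
 have ind': "indep_vars (\<lambda>_. borel) (\<lambda>i om. ph (V i om)) {..<n}"
  by (rule indep_vars_compose2[OF indep_vars_subset[OF ind]]) auto
 note S = second_moment_sum_indep[OF ind' _ i m]
 have "(\<Sum>i<n. expectation (\<lambda>om. (ph (V i om))^2)) = real n * expectation (\<lambda>om. (ph (V 0 om))^2)"
  by (subst e) simp
 then show ?thesis using nn_integral_eq_integral[OF S(1)] S(2) by simp
qed

lemma iid_mean_sq:
 fixes V :: "nat => 'a => 'c" and ph :: "'c => real"
 assumes ind: "indep_vars (\<lambda>_. N) V UNIV" and D: "\<And>i. distr M N (V i) = distr M N (V 0)"
  and [measurable]: "ph \<in> borel_measurable N"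
  and sq: "integrable M (\<lambda>om. (ph (V 0 om))^2)"
 shows "(NNI M (\<lambda>om. ennreal ((\<Sum>i<n. ph (V i om) - expectation (\<lambda>om. ph (V 0 om)))^2)))
  <= ennreal (real n * expectation (\<lambda>om. (ph (V 0 om))^2))"
proof -
 have [measurable]: "V i \<in> measurable M N" for i using ind by (auto simp: indep_vars_def)
 have int: "integrable M (\<lambda>om. ph (V 0 om))" by (rule square_integrable_imp_integrable[OF _ sq]) simp
 define \<mu> where "\<mu> = expectation (\<lambda>om. ph (V 0 om))"
 have eq: "(ph x - \<mu>)^2 = (ph x)^2 - 2 * \<mu> * ph x + \<mu>\<^sup>2" for x by (simp add: power2_eq_square algebra_simps)
 have "(NNI M (\<lambda>om. ennreal ((\<Sum>i<n. ph (V i om) - \<mu>)^2))) = ennreal (real n * expectation (\<lambda>om. (ph (V 0 om) - \<mu>)^2))"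
  using int sq by (intro iid_sum_sq[OF ind D]) (auto simp: eq, auto simp: \<mu>_def prob_space)
 also have "expectation (\<lambda>om. (ph (V 0 om) - \<mu>)^2) = expectation (\<lambda>om. (ph (V 0 om))^2) - \<mu>\<^sup>2"
  unfolding eq using int sq by (simp add: prob_space \<mu>_def power2_eq_square)
 finally show ?thesis unfolding \<mu>_def[symmetric]
  by (auto intro!: ennreal_leI mult_left_mono)
qed

lemma L1_null_lln:
 fixes V :: "nat => 'a => 'c" and ph :: "'c => real"
 assumes ind: "indep_vars (\<lambda>_. N) V UNIV" and D: "\<And>i. distr M N (V i) = distr M N (V 0)"
  and [measurable]: "ph \<in> borel_measurable N"
  and sq: "integrable M (\<lambda>om. (ph (V 0 om))^2)"
  and n: "filterlim n at_top sequentially"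
  and nN: "\<forall>\<^sub>F k in sequentially. real (n k) <= a k" 
 shows "L1_null (\<lambda>k om. (\<Sum>i<n k. ph (V i om) - expectation (\<lambda>om. ph (V 0 om))) / a k)"
proof -
 have [measurable]: "V i \<in> measurable M N" for i using ind by (auto simp: indep_vars_def)
 define c where "c = expectation (\<lambda>om. (ph (V 0 om))^2)"
 have c0: "c >= 0" by (simp add: c_def)
 have lim: "(\<lambda>k. c / real (n k)) \<longlonglongrightarrow> 0"
  using n by (intro real_tendsto_divide_at_top[OF tendsto_const] filterlim_compose[OF filterlim_real_sequentially])
 have pos: "\<forall>\<^sub>F k in sequentially. 0 < n k" using eventually_ge_at_top[of 1]
  by (rule filterlim_iff[THEN iffD1, rule_format, OF n, THEN eventually_mono]) simp
 show ?thesis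
 proof (rule L1_null_of_sq[OF _ _ lim])
  show "\<forall>\<^sub>F k in sequentially. (NNI M (\<lambda>om. ennreal (((\<Sum>i<n k. ph (V i om) - expectation (\<lambda>om. ph (V 0 om))) / a k)^2))) <= ennreal (c / real (n k))"
   using nN pos
  proof eventually_elim
   case (elim k)
   have ak: "a k > 0" using elim by linarith
   have "(NNI M (\<lambda>om. ennreal (((\<Sum>i<n k. ph (V i om) - expectation (\<lambda>om. ph (V 0 om))) / a k)^2)))
    = ennreal (1/(a k)^2) * (NNI M (\<lambda>om. ennreal ((\<Sum>i<n k. ph (V i om) - expectation (\<lambda>om. ph (V 0 om)))^2)))"
    by (subst nn_integral_cmult[symmetric]) (auto simp flip: ennreal_mult simp: power_divide)
   also have "... <= ennreal (1/(a k)^2) * ennreal (real (n k) * c)"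
    unfolding c_def by (intro mult_left_mono iid_mean_sq[OF ind D _ sq]) auto
   also have "... = ennreal (real (n k) * c / (a k)^2)" using c0 by (simp flip: ennreal_mult)
   also have "... <= ennreal (c / real (n k))"
   proof (rule ennreal_leI)
    have "real (n k) * real (n k) <= (a k)^2" using elim ak by (auto simp: power2_eq_square intro!: mult_mono)
    then have "c * (real (n k) * real (n k)) <= c * (a k)^2" using c0 by (rule mult_left_mono)
    then show "real (n k) * c / (a k)^2 <= c / real (n k)"
     using elim ak by (simp add: field_simps)
   qed
   finally show ?case .
  qed
 qed simp
qed

end

subsection \<open>Gaussian measures\<close>

lemma integrable_exp_minus_norm_sq:
 assumes "c > 0"
 shows "integrable lborel (\<lambda>x::'v::euclidean_space. exp (- (c * (norm x)^2)))"
proof (rule integrableI_bounded)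
 have 1: "integrable lborel (\<lambda>x::real. exp (- (c * x^2)))"
 proof -
  define s where "s = sqrt (1 / (2 * c))"
  have s: "s > 0" "2 * s^2 = 1 / c" using assms by (auto simp: s_def)
  have "integrable lborel (\<lambda>x. sqrt (2 * pi * s^2) * normal_density 0 s x)" using s by (intro integrable_mult_right) auto
  also have "(\<lambda>x. sqrt (2 * pi * s^2) * normal_density 0 s x) = (\<lambda>x::real. exp (- (c * x^2)))"
   using s(1) s(2) assms by (auto simp: normal_density_def fun_eq_iff field_simps)
  finally show ?thesis .
 qed
 have eq: "exp (- (c * (norm x)^2)) = (\<Prod>b\<in>Basis. exp (- (c * (x \<bullet> b)^2)))" for x :: 'v
  by (subst power2_norm_eq_inner, subst euclidean_inner)
   (simp add: exp_sum[symmetric] sum_negf sum_distrib_left power2_eq_square)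
 have "(NNI lborel (\<lambda>x. ennreal (norm (exp (- (c * (norm (x::'v))^2))))))
  = (NNI ((lborel::'v measure)) (\<lambda>x. (\<Prod>b\<in>Basis. ennreal (exp (- (c * (x \<bullet> b)^2))))))"
  unfolding eq by (simp add: prod_ennreal abs_prod)
 also have "... = (\<Prod>b\<in>(Basis::'v set). \<integral>\<^sup>+x. ennreal (exp (- (c * x^2))) \<partial>lborel)"
  by (rule nn_integral_lborel_prod) auto
 also have "... < \<infinity>"
  using 1 by (auto simp: ennreal_prod_eq_top less_top[symmetric] real_integrable_def power_eq_top_ennreal)
 finally show "(NNI lborel (\<lambda>x. ennreal (norm (exp (- (c * (norm (x::'v))^2)))))) < \<infinity>" .
qed simp

lemma measurable_cis[measurable]: "cis \<in> borel_measurable borel"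
 unfolding cis_conv_exp[abs_def] by (intro borel_measurable_continuous_onI continuous_intros)

lemma integral_cis_std_normal:
 "(LINT x|std_normal_distribution. cis (t * x)) = complex_of_real (exp (- t\<^sup>2 / 2))"
 using fun_cong[OF char_std_normal_distribution, of t] by (simp add: char_def cis_conv_exp)

text \<open>The law of the sum of z_i v_i with independent standard normal z_i. The vectors are
  arbitrary, so degenerate normal laws are included and no density occurs.\<close>

lemma ex_gaussian_sum_of_squares:
 fixes v :: "'i => 'v::euclidean_space"
 assumes "finite I"
 shows "\<exists>\<mu>. prob_space \<mu> \<and> sets \<mu> = sets borel \<and>
  (\<forall>t. (LINT x|\<mu>. cis (t \<bullet> x)) = complex_of_real (exp (- (\<Sum>i\<in>I. (t \<bullet> v i)^2) / 2)))"
proof -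
 interpret S: prob_space std_normal_distribution
  by (intro prob_space_normal_density) simp
 interpret P: product_prob_space "\<lambda>_::'i. std_normal_distribution" I by standard
 have F: "prob_space (PiM I (\<lambda>_::'i. std_normal_distribution))" by (rule prob_space_PiM) unfold_locales
 define W where "W z = (\<Sum>i\<in>I. z i *\<^sub>R v i)" for z :: "'i => real"
 have [measurable]: "W \<in> borel_measurable (PiM I (\<lambda>_. std_normal_distribution))"
  unfolding W_def[abs_def] using \<open>finite I\<close>
  by (intro borel_measurable_sum borel_measurable_scaleR measurable_const)
   (auto intro!: measurable_component_singleton[THEN measurable_comp, unfolded comp_def])
 define \<mu> where "\<mu> = distr (PiM I (\<lambda>_. std_normal_distribution)) borel W"
 have "prob_space \<mu>" unfolding \<mu>_def by (rule prob_space.prob_space_distr[OF F]) simp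
 moreover have "(LINT x|\<mu>. cis (t \<bullet> x)) = complex_of_real (exp (- (\<Sum>i\<in>I. (t \<bullet> v i)^2) / 2))" for t
 proof -
  have cis_sum: "cis (\<Sum>i\<in>J. a i) = (\<Prod>i\<in>J. cis (a i))" if "finite J" for J :: "'i set" and a
   using that by (induction J rule: finite_induct) (auto simp flip: cis_mult)
  have "(LINT x|\<mu>. cis (t \<bullet> x)) = (LINT z|PiM I (\<lambda>_. std_normal_distribution). cis (t \<bullet> W z))"
   unfolding \<mu>_def by (subst integral_distr) auto
  also have "... = (LINT z|PiM I (\<lambda>_. std_normal_distribution). (\<Prod>i\<in>I. cis ((t \<bullet> v i) * z i)))"
   by (simp add: W_def inner_sum_right mult.commute cis_sum[OF \<open>finite I\<close>])
  also have "... = (\<Prod>i\<in>I. LINT x|std_normal_distribution. cis ((t \<bullet> v i) * x))"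
   by (rule P.product_integral_prod)
    (use \<open>finite I\<close> in \<open>auto intro!: S.integrable_const_bound[where B=1]\<close>)
  also have "... = complex_of_real (exp (- (\<Sum>i\<in>I. (t \<bullet> v i)^2) / 2))"
   by (simp only: integral_cis_std_normal)
    (simp add: exp_sum[OF \<open>finite I\<close>, symmetric] sum_negf sum_divide_distrib flip: of_real_prod)
  finally show ?thesis .
 qed
 ultimately show ?thesis by (intro exI[of _ \<mu>]) (auto simp: \<mu>_def)
qed

text \<open>Peeling off one rank-one form at a time enlarges the kernel.\<close>

lemma psd_sum_of_squares:
 fixes S :: "'v::euclidean_space => 'v"
 assumes "linear S" "\<And>x y. x \<bullet> S y = S x \<bullet> y" "\<And>x. x \<bullet> S x >= 0"
 shows "\<exists>vs::'v list. \<forall>t. t \<bullet> S t = (\<Sum>i<length vs. (t \<bullet> vs ! i)^2)"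
 using assms
\<comment> \<open>The induction measure is the rank of \<open>S\<close>.\<close>
proof (induction "DIM('v) - dim {x. S x = 0}" arbitrary: S rule: less_induct)
 case less
 show ?case
 proof (cases "\<exists>t. t \<bullet> S t > 0")
  case False
  then have "t \<bullet> S t = 0" for t using less.prems(3)[of t] by (meson antisym not_le)
  then show ?thesis by (intro exI[of _ "[]"]) simp
 next
  case True
  then obtain t where t: "t \<bullet> S t > 0" by blast
  define a where "a = t \<bullet> S t"
  have a: "a > 0" using t by (simp add: a_def)
  define S' where "S' x = S x - ((S t \<bullet> x) / a) *\<^sub>R S t" for x
  interpret S: linear S by fact
  have lin: "linear S'"
   by (rule linearI) (simp_all add: S'_def S.add S.scaleR algebra_simps inner_add_right add_divide_distrib)
  have sym: "x \<bullet> S' y = S' x \<bullet> y" for x y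
   using less.prems(2)[of x y] by (simp add: S'_def inner_diff_left inner_diff_right inner_commute algebra_simps)
  have quad: "x \<bullet> S' x = x \<bullet> S x - (S t \<bullet> x)\<^sup>2 / a" for x
   by (simp add: S'_def inner_diff_right power2_eq_square inner_commute)
  have psd: "x \<bullet> S' x >= 0" for x
  proof -
   \<comment> \<open>This \<open>c\<close> minimizes the form of \<open>S\<close> along the line
     through x in direction t. The minimum is the value of the peeled form at x, which is therefore
     nonnegative.\<close>
   define c where "c = - (S t \<bullet> x) / a"
   have "0 <= (x + c *\<^sub>R t) \<bullet> S (x + c *\<^sub>R t)" by (rule less.prems(3))
   also have "... = x \<bullet> S x + c * (x \<bullet> S t) + c * (t \<bullet> S x) + c * c * a"
    by (simp add: S.add S.scaleR inner_add_left inner_add_right a_def algebra_simps)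
   also have "t \<bullet> S x = S t \<bullet> x" by (rule less.prems(2))
   also have "x \<bullet> S t = S t \<bullet> x" by (rule inner_commute)
   also have "x \<bullet> S x + c * (S t \<bullet> x) + c * (S t \<bullet> x) + c * c * a = x \<bullet> S x - (S t \<bullet> x)\<^sup>2 / a"
    using a by (simp add: c_def power2_eq_square field_simps)
   finally show ?thesis by (simp add: quad)
  qed
  have "dim {x. S x = 0} < dim {x. S' x = 0}"
  proof (rule dim_psubset)
   have sub1: "subspace {x. S x = 0}" "subspace {x. S' x = 0}"
    using less.prems(1) lin by (auto intro: linear_subspace_kernel)
   have "S t \<bullet> x = 0" if "S x = 0" for x using less.prems(2)[of t x] that by simp
   then have "{x. S x = 0} \<subseteq> {x. S' x = 0}" by (auto simp: S'_def)
   moreover have "t \<in> {x. S' x = 0}" using a by (simp add: S'_def a_def inner_commute)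
   moreover have "t \<notin> {x. S x = 0}" using t by auto
   ultimately show "span {x. S x = 0} \<subset> span {x. S' x = 0}"
    using sub1 by (metis psubsetI span_eq_iff)
  qed
  moreover have "dim {x. S' x = 0} <= DIM('v)" by (rule dim_subset_UNIV)
  ultimately have "\<exists>vs::'v list. \<forall>t. t \<bullet> S' t = (\<Sum>i<length vs. (t \<bullet> vs ! i)^2)"
   by (intro less.hyps lin sym psd) auto
  then obtain vs where vs: "\<And>t. t \<bullet> S' t = (\<Sum>i<length vs. (t \<bullet> vs ! i)^2)" by blast
  have "x \<bullet> S x = (\<Sum>i<length (((1 / sqrt a) *\<^sub>R S t) # vs). (x \<bullet> (((1 / sqrt a) *\<^sub>R S t) # vs) ! i)^2)" for x
   using vs[of x] a by (simp add: quad sum.lessThan_Suc_shift power_divide inner_commute del: sum.lessThan_Suc)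
  then show ?thesis by blast
 qed
qed

lemma ex_gaussian_psd:
 fixes S :: "'v::euclidean_space => 'v"
 assumes "linear S" "\<And>x y. x \<bullet> S y = S x \<bullet> y" "\<And>x. x \<bullet> S x >= 0"
 shows "\<exists>\<mu>. prob_space \<mu> \<and> sets \<mu> = sets borel \<and>
  (\<forall>t. (LINT x|\<mu>. cis (t \<bullet> x)) = complex_of_real (exp (- (t \<bullet> S t) / 2)))"
proof -
 obtain vs :: "'v list" where vs: "\<And>t. t \<bullet> S t = (\<Sum>i<length vs. (t \<bullet> vs ! i)^2)"
  using psd_sum_of_squares[OF assms] by blast
 show ?thesis
  unfolding vs by (rule ex_gaussian_sum_of_squares) simp
qed

subsection \<open>The continuity theorem in several dimensions\<close>

lemma integral_tail_small:
 fixes F :: "'v::euclidean_space => real"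
 assumes F: "integrable lborel F" and nonneg: "\<And>x. F x >= 0" and "e > 0"
 shows "\<exists>r>0. (LINT x|lborel. indicator {x. norm x >= r} x * F x) < e"
proof -
 have [measurable]: "F \<in> borel_measurable borel" using F by auto
 have "(\<lambda>k. LINT x|lborel. indicator {x. norm x >= real k} x * F x) \<longlonglongrightarrow> (LINT x|(lborel::'v measure). 0)"
 proof (rule integral_dominated_convergence[where w=F])
  show "AE x in lborel. (\<lambda>k. indicator {x. norm x >= real k} x * F x) \<longlonglongrightarrow> 0"
  proof (rule AE_I2)
   fix x :: 'v
   have "\<forall>\<^sub>F k in sequentially. indicator {x. norm x >= real k} x * F x = 0"
    using eventually_gt_at_top[of "nat \<lceil>norm x\<rceil>"]
    by eventually_elim (auto simp: indicator_def, linarith)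
   then show "(\<lambda>k. indicator {x. norm x >= real k} x * F x) \<longlonglongrightarrow> 0" by (rule tendsto_eventually)
  qed
 qed (use F nonneg in \<open>auto simp: indicator_def\<close>)
 then have "\<forall>\<^sub>F k in sequentially. (LINT x|lborel. indicator {x. norm x >= real k} x * F x) < e"
  using \<open>e > 0\<close> by (intro order_tendstoD(2)) auto
 then have "\<forall>\<^sub>F k in sequentially. (LINT x|lborel. indicator {x. norm x >= real k} x * F x) < e \<and> k > 0"
  using eventually_gt_at_top[of 0] by eventually_elim auto
 then obtain k where "(LINT x|lborel. indicator {x. norm x >= real k} x * F x) < e" "k > 0"
  by (auto dest!: eventually_happens)
 then show ?thesis by (intro exI[of _ "real k"]) auto
qed

text \<open>\<open>char_gamma\<close> says that the Gaussian kernel is an average of characters.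
  Beyond total mass one, Fourier inversion uses no other property of the standard normal law, so the
  locale records nothing else.\<close>

locale std_gauss =
 fixes \<gamma> :: "'v::euclidean_space measure"
 assumes gamma: "prob_space \<gamma>" "sets \<gamma> = sets borel"
  and char_gamma: "\<And>t. (LINT x|\<gamma>. cis (t \<bullet> x)) = complex_of_real (exp (- (norm t)\<^sup>2 / 2))"
begin

sublocale G: prob_space \<gamma> by (rule gamma)

lemmas [measurable_cong] = gamma(2)

text \<open>The substitution x = z + sg y turns the left side into a convolution with a Gaussian
  kernel, whence the factor 1 / sg^DIM. Writing the kernel as an average of characters and
  exchanging integrals leaves \<nu> only in its characteristic function.\<close>

lemma smoothing_formula:
 fixes g :: "'v => real" and \<nu> :: "'v measure"
 assumes \<nu>: "prob_space \<nu>" "sets \<nu> = sets borel" and g: "integrable lborel g" and "sg > 0"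
 shows "(LINT z|\<nu>. complex_of_real (LINT y|lborel. g (z + sg *\<^sub>R y) * exp (- (norm y)\<^sup>2 / 2)))
  = complex_of_real (1 / sg ^ DIM('v)) *
   (LINT x|lborel. LINT t|\<gamma>. g x * (cis (t \<bullet> x / sg) * (LINT z|\<nu>. cis ((- t /\<^sub>R sg) \<bullet> z))))"
proof -
 interpret N: prob_space \<nu> by fact
 interpret pair_sigma_finite \<nu> "lborel :: 'v measure" by standard
 interpret NG: pair_sigma_finite \<nu> \<gamma> by standard
 interpret NGp: prob_space "\<nu> \<Otimes>\<^sub>M \<gamma>" by (rule prob_space_pair) unfold_locales
 note [measurable_cong] = \<nu>(2)
 have [measurable]: "g \<in> borel_measurable borel" using g by auto
 define K where "K x z = exp (- (norm ((x - z) /\<^sub>R sg))\<^sup>2 / 2)" for x z :: 'v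
 have "(LINT y|lborel. g (z + sg *\<^sub>R y) * exp (- (norm y)\<^sup>2 / 2)) = (1 / sg ^ DIM('v)) * (LINT x|lborel. g x * K x z)" for z
 proof -
  have "(LINT x|lborel. g x * K x z) =
   (LINT x|density (distr lborel borel (\<lambda>x. z + sg *\<^sub>R x)) (\<lambda>_. \<bar>sg\<bar>^DIM('v)). g x * K x z)"
   using \<open>sg > 0\<close> by (subst lborel_affine[of sg z]) (auto simp: K_def)
  also have "... = (LINT x|distr lborel borel (\<lambda>x. z + sg *\<^sub>R x). \<bar>sg\<bar>^DIM('v) *\<^sub>R (g x * K x z))"
   unfolding K_def by (subst integral_density) auto
  also have "... = (LINT y|lborel. \<bar>sg\<bar>^DIM('v) *\<^sub>R (g (z + sg *\<^sub>R y) * K (z + sg *\<^sub>R y) z))"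
   unfolding K_def by (subst integral_distr) auto
  also have "... = sg^DIM('v) * (LINT y|lborel. g (z + sg *\<^sub>R y) * exp (- (norm y)\<^sup>2 / 2))"
   using \<open>sg > 0\<close> by (simp add: K_def)
  finally show ?thesis using \<open>sg > 0\<close> by simp
 qed
 then have "(LINT z|\<nu>. complex_of_real (LINT y|lborel. g (z + sg *\<^sub>R y) * exp (- (norm y)\<^sup>2 / 2)))
  = (LINT z|\<nu>. complex_of_real ((1 / sg ^ DIM('v)) * (LINT x|lborel. g x * K x z)))"
  by (simp only:)
 also have "... = complex_of_real ((1 / sg ^ DIM('v)) * (LINT z|\<nu>. LINT x|lborel. g x * K x z))"
  by (simp only: integral_complex_of_real integral_mult_right_zero)
 also have "... = complex_of_real (1 / sg ^ DIM('v)) * (LINT z|\<nu>. LINT x|lborel. complex_of_real (g x * K x z))"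
  by (simp only: integral_complex_of_real of_real_mult[of "1 / sg ^ DIM('v)"])
 also have "(LINT z|\<nu>. LINT x|lborel. complex_of_real (g x * K x z)) =
  (LINT x|lborel. LINT z|\<nu>. complex_of_real (g x * K x z))"
 proof (rule Fubini_integral[symmetric])
  have "integrable (\<nu> \<Otimes>\<^sub>M lborel) (\<lambda>(z, x). complex_of_real (g x))"
   by (rule Fubini_integrable) (use g in auto)
  then show "integrable (\<nu> \<Otimes>\<^sub>M lborel) (\<lambda>(z, x). complex_of_real (g x * K x z))"
   by (rule Bochner_Integration.integrable_bound) (auto simp: K_def abs_mult mult_left_le norm_mult intro!: AE_I2)
 qed
 also have "... = (LINT x|lborel. LINT t|\<gamma>. g x * (cis (t \<bullet> x / sg) * (LINT z|\<nu>. cis ((- t /\<^sub>R sg) \<bullet> z))))"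
 proof (rule Bochner_Integration.integral_cong[OF refl])
  fix x :: 'v
  have K: "complex_of_real (K x z) = (LINT t|\<gamma>. cis (t \<bullet> x / sg) * cis ((- t /\<^sub>R sg) \<bullet> z))" for z
   unfolding K_def char_gamma[symmetric] cis_mult
   by (intro Bochner_Integration.integral_cong refl arg_cong[where f=cis])
    (simp add: inner_diff_left inner_commute divide_inverse algebra_simps)
  have "(LINT z|\<nu>. complex_of_real (g x * K x z)) = g x * (LINT z|\<nu>. LINT t|\<gamma>. cis (t \<bullet> x / sg) * cis ((- t /\<^sub>R sg) \<bullet> z))"
   by (simp add: K)
  also have "(LINT z|\<nu>. LINT t|\<gamma>. cis (t \<bullet> x / sg) * cis ((- t /\<^sub>R sg) \<bullet> z))
   = (LINT t|\<gamma>. LINT z|\<nu>. cis (t \<bullet> x / sg) * cis ((- t /\<^sub>R sg) \<bullet> z))"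
   by (rule NG.Fubini_integral[symmetric])
    (auto intro!: NGp.integrable_const_bound[where B=1] simp: norm_mult split_beta')
  finally show "(LINT z|\<nu>. complex_of_real (g x * K x z)) =
    (LINT t|\<gamma>. g x * (cis (t \<bullet> x / sg) * (LINT z|\<nu>. cis ((- t /\<^sub>R sg) \<bullet> z))))"
   by simp
 qed
 finally show ?thesis .
qed

text \<open>Characteristic functions are bounded by one, so dominated convergence applies twice in
  the smoothing formula: under \<gamma> with the constant |g x|, and over x with |g|.\<close>

lemma smoothing_tendsto:
 fixes g :: "'v => real" and \<nu> :: "nat => 'v measure"
 assumes \<nu>: "\<And>k. prob_space (\<nu> k)" "\<And>k. sets (\<nu> k) = sets borel"
  and \<mu>: "prob_space \<mu>" "sets \<mu> = sets borel"
  and conv: "\<And>t. (\<lambda>k. LINT z|\<nu> k. cis (t \<bullet> z)) \<longlonglongrightarrow> (LINT z|\<mu>. cis (t \<bullet> z))"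
  and g: "integrable lborel g" and "sg > 0"
 shows "(\<lambda>k. LINT z|\<nu> k. LINT y|lborel. g (z + sg *\<^sub>R y) * exp (- (norm y)\<^sup>2 / 2))
  \<longlonglongrightarrow> (LINT z|\<mu>. LINT y|lborel. g (z + sg *\<^sub>R y) * exp (- (norm y)\<^sup>2 / 2))"
proof -
 have [measurable]: "g \<in> borel_measurable borel" using g by auto
 define H where "H rh t = (LINT z|rh. cis ((- t /\<^sub>R sg) \<bullet> z))" for rh :: "'v measure" and t
 have char_meas: "H rh \<in> borel_measurable borel" if "prob_space rh" "sets rh = sets borel" for rh
 proof -
  interpret prob_space rh by fact
  note [measurable_cong] = that(2)
  show ?thesis unfolding H_def by measurable
 qed
 have H_conv: "(\<lambda>k. H (\<nu> k) t) \<longlonglongrightarrow> H \<mu> t" for t unfolding H_def by (rule conv)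
 have char_le: "norm (H rh t) <= 1" if "prob_space rh" for rh t
 proof -
  interpret prob_space rh by fact
  show ?thesis unfolding H_def by (rule order_trans[OF integral_norm_bound]) (simp add: prob_space)
 qed
 note [measurable] = char_meas[OF \<mu>] char_meas[OF \<nu>]
 let ?c = "complex_of_real (1 / sg ^ DIM('v))"
 have inner: "(\<lambda>k. LINT t|\<gamma>. g x * (cis (t \<bullet> x / sg) * H (\<nu> k) t))
  \<longlonglongrightarrow> (LINT t|\<gamma>. g x * (cis (t \<bullet> x / sg) * H \<mu> t))" for x
 proof (rule integral_dominated_convergence[where w="\<lambda>_. \<bar>g x\<bar>"])
  show "AE t in \<gamma>. (\<lambda>k. g x * (cis (t \<bullet> x / sg) * H (\<nu> k) t))
   \<longlonglongrightarrow> g x * (cis (t \<bullet> x / sg) * H \<mu> t)"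
   by (intro AE_I2 tendsto_intros H_conv)
  show "AE t in \<gamma>. norm (g x * (cis (t \<bullet> x / sg) * H (\<nu> k) t)) <= \<bar>g x\<bar>" for k
   using mult_left_mono[OF char_le[OF \<nu>(1)[of k], of t for t], of "\<bar>g x\<bar>"]
   by (auto simp: norm_mult)
 qed auto
 have "(\<lambda>k. ?c * (LINT x|lborel. LINT t|\<gamma>. g x * (cis (t \<bullet> x / sg) * H (\<nu> k) t)))
  \<longlonglongrightarrow> ?c * (LINT x|lborel. LINT t|\<gamma>. g x * (cis (t \<bullet> x / sg) * H \<mu> t))"
 proof (intro tendsto_mult tendsto_const integral_dominated_convergence[where w="\<lambda>x. \<bar>g x\<bar>"])
  show "AE x in lborel. norm (LINT t|\<gamma>. g x * (cis (t \<bullet> x / sg) * H (\<nu> k) t)) <= \<bar>g x\<bar>" for k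
  proof (rule AE_I2)
   fix x
   have "norm (LINT t|\<gamma>. g x * (cis (t \<bullet> x / sg) * H (\<nu> k) t)) <= (LINT t|\<gamma>. \<bar>g x\<bar>)"
    using mult_left_mono[OF char_le[OF \<nu>(1)[of k], of t for t], of "\<bar>g x\<bar>"]
    by (intro order_trans[OF integral_norm_bound] integral_mono' G.integrable_const)
     (auto simp: norm_mult)
   then show "norm (LINT t|\<gamma>. g x * (cis (t \<bullet> x / sg) * H (\<nu> k) t)) <= \<bar>g x\<bar>" by (simp add: G.prob_space)
  qed
 qed (use g inner in auto)
 then have "(\<lambda>k. LINT z|\<nu> k. complex_of_real (LINT y|lborel. g (z + sg *\<^sub>R y) * exp (- (norm y)\<^sup>2 / 2)))
  \<longlonglongrightarrow> (LINT z|\<mu>. complex_of_real (LINT y|lborel. g (z + sg *\<^sub>R y) * exp (- (norm y)\<^sup>2 / 2)))"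
  unfolding H_def smoothing_formula[OF \<nu> g \<open>sg > 0\<close>] smoothing_formula[OF \<mu> g \<open>sg > 0\<close>] .
 then show ?thesis unfolding integral_complex_of_real tendsto_of_real_iff .
qed

text \<open>The function is compared with its Gaussian smoothing, whose integrals are controlled by
 characteristic functions.\<close>

lemma continuity_compact_support:
 fixes g :: "'v => real" and \<nu> :: "nat => 'v measure"
 assumes \<nu>: "\<And>k. prob_space (\<nu> k)" "\<And>k. sets (\<nu> k) = sets borel"
  and \<mu>: "prob_space \<mu>" "sets \<mu> = sets borel"
  and conv: "\<And>t. (\<lambda>k. LINT z|\<nu> k. cis (t \<bullet> z)) \<longlonglongrightarrow> (LINT z|\<mu>. cis (t \<bullet> z))"
  and g: "continuous_on UNIV g" and supp: "\<And>x. norm x > R ==> g x = 0"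
 shows "(\<lambda>k. LINT z|\<nu> k. g z) \<longlonglongrightarrow> (LINT z|\<mu>. g z)"
proof -
 have [measurable]: "g \<in> borel_measurable borel" using g by (rule borel_measurable_continuous_onI)
 have "bounded (g ` cball 0 R)"
  by (intro compact_imp_bounded compact_continuous_image continuous_on_subset[OF g]) auto
 then obtain b0 where "\<forall>y\<in>g ` cball 0 R. norm y <= b0" unfolding bounded_iff by blast
 then have b0: "\<And>x. norm x <= R ==> \<bar>g x\<bar> <= b0" by auto
 define b where "b = max b0 1"
 have b: "\<bar>g x\<bar> <= b" "b > 0" for x using b0[of x] supp[of x] by (cases "norm x <= R"; auto simp: b_def)+
 have g_int: "integrable lborel g"
 proof (rule Bochner_Integration.integrable_bound)
  show "integrable lborel (\<lambda>x::'v. b * indicator (cball 0 R) x)"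
   by (intro integrable_mult_right integrable_real_indicator) (use emeasure_lborel_cball_finite[of "0::'v" R] in auto)
  show "AE x in lborel. norm (g x) <= norm (b * indicator (cball 0 R) x)"
   using b supp by (auto simp: indicator_def)
 qed simp
 have unif: "\<exists>d>0. \<forall>x y. norm (x - y) < d --> \<bar>g x - g y\<bar> < e" if "e > 0" for e
 proof -
  have "uniformly_continuous_on (cball 0 (R + 1)) g"
   by (intro compact_uniformly_continuous continuous_on_subset[OF g]) auto
  from this[unfolded uniformly_continuous_on_def, rule_format, OF \<open>e > 0\<close>]
  obtain d where d: "d > 0" "\<And>x y. norm x <= R + 1 ==> norm y <= R + 1 ==> dist y x < d ==> dist (g y) (g x) < e"
   by auto
  \<comment> \<open>At distance below 1, a point outside the ball of radius R + 1 forces its partner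
    outside the ball of radius R, where both values of g are zero.\<close>
  have "\<bar>g x - g y\<bar> < e" if "norm (x - y) < min d 1" for x y
  proof (cases "norm x <= R + 1 \<and> norm y <= R + 1")
   case True
   then show ?thesis using d(2)[of y x] that by (auto simp: dist_norm)
  next
   case False
   have "norm x <= norm y + norm (x - y)" "norm y <= norm x + norm (x - y)"
    using norm_triangle_ineq[of y "x - y"] norm_triangle_ineq[of x "y - x"] by (auto simp: norm_minus_commute)
   with False that have "norm x > R" "norm y > R" by auto
   then show ?thesis using supp \<open>e > 0\<close> by simp
  qed
  then show ?thesis using d(1) by (intro exI[of _ "min d 1"]) auto
 qed
 define ph where "ph y = exp (- (norm y)\<^sup>2 / 2)" for y :: 'v
 have ph: "integrable lborel ph" "\<And>y. ph y > 0"
  using integrable_exp_minus_norm_sq[of "1/2"] by (auto simp: ph_def[abs_def])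
 have [measurable]: "ph \<in> borel_measurable borel" using ph(1) by auto
 \<comment> \<open>Total mass of the unnormalized Gaussian kernel; its exact value is irrelevant,
   only positivity is established.\<close>
 define c where "c = (LINT y|lborel. ph y)"
 have "c \<noteq> 0"
 proof
  assume "c = 0"
  then have "AE y in lborel. ph y = 0"
   using ph unfolding c_def by (subst (asm) integral_nonneg_eq_0_iff_AE) (auto intro: less_imp_le)
  then have "AE y in (lborel::'v measure). False" using ph(2) by (auto simp: less_le)
  then have "emeasure lborel (UNIV :: 'v set) = 0" by (simp add: AE_iff_measurable[OF _ refl])
  then show False by simp
 qed
 moreover have "c >= 0"
  unfolding c_def using ph(2) by (intro Bochner_Integration.integral_nonneg) (auto intro: less_imp_le)
 ultimately have c: "c > 0" by simp
 define T where "T sg z = (LINT y|lborel. g (z + sg *\<^sub>R y) * ph y)" for sg z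
 have int_T: "integrable lborel (\<lambda>y. g (z + sg *\<^sub>R y) * ph y)" for z sg
  by (rule Bochner_Integration.integrable_bound[OF integrable_mult_right[OF ph(1), of b]])
   (use b in \<open>auto simp: abs_mult intro!: AE_I2 mult_mono\<close>)
 have T_meas[measurable]: "T sg \<in> borel_measurable borel" for sg unfolding T_def by measurable
 have T_bound: "\<bar>T sg z\<bar> <= b * c" for sg z
 proof -
  have "norm (T sg z) <= (LINT y|lborel. b * ph y)"
   unfolding T_def using b ph
   by (intro Bochner_Integration.integral_norm_bound_integral int_T) (auto simp: abs_mult abs_of_pos[OF ph(2)] intro!: mult_right_mono)
  then show ?thesis by (simp add: c_def)
 qed
 have close: "\<exists>sg>0. \<forall>z. \<bar>T sg z - c * g z\<bar> <= e * c" if "e > 0" for e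
 proof -
  obtain d where d: "d > 0" "\<And>x y. norm (x - y) < d ==> \<bar>g x - g y\<bar> < e/2" using unif[of "e/2"] \<open>e > 0\<close> by auto
  have "e * c / (4 * b) > 0" using \<open>e > 0\<close> b c by simp
  from integral_tail_small[OF ph(1) less_imp_le[OF ph(2)] this] obtain r where r: "r > 0"
   "(LINT x|lborel. indicator {x. norm x >= r} x * ph x) < e * c / (4 * b)" by auto
  \<comment> \<open>A shift by sg y has length below d for every y in the ball of radius r, and the
    kernel has little mass outside that ball.\<close>
  define sg where "sg = d / (2 * r)"
  have sg: "sg > 0" "sg * r < d" using d r by (auto simp: sg_def)
  have "\<bar>T sg z - c * g z\<bar> <= e * c" for z
  proof -
   have int2: "integrable lborel (\<lambda>y. g z * ph y)" using ph by auto
   have int3: "integrable lborel (\<lambda>x::'v. indicator {x. norm x >= r} x * ph x)"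
    by (rule Bochner_Integration.integrable_bound[OF ph(1)]) (use ph(2) in \<open>auto simp: indicator_def less_imp_le\<close>)
   have "T sg z - c * g z = (LINT y|lborel. g (z + sg *\<^sub>R y) * ph y - g z * ph y)"
    using ph(1) unfolding T_def c_def by (subst Bochner_Integration.integral_diff[OF int_T int2]) simp
   also have "norm ... <= (LINT y|lborel. e/2 * ph y + 2 * b * (indicator {x. norm x >= r} y * ph y))"
   proof (rule Bochner_Integration.integral_norm_bound_integral)
    fix y :: 'v
    show "norm (g (z + sg *\<^sub>R y) * ph y - g z * ph y) <= e/2 * ph y + 2 * b * (indicator {x. norm x >= r} y * ph y)"
    proof (cases "norm y >= r")
     case False
     have "sg * norm y <= sg * r" using False sg by (intro mult_left_mono) auto
     moreover have "norm (sg *\<^sub>R y) = sg * norm y" using sg by simp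
     ultimately have "norm (sg *\<^sub>R y) < d" using sg(2) by linarith
     then have "\<bar>g (z + sg *\<^sub>R y) - g z\<bar> < e/2" using d(2)[of "z + sg *\<^sub>R y" z] by simp
     then have "\<bar>g (z + sg *\<^sub>R y) - g z\<bar> * ph y <= e/2 * ph y" using ph(2)[of y] by (intro mult_right_mono) auto
     then show ?thesis using False ph(2)[of y]
      by (simp add: left_diff_distrib[symmetric] abs_mult)
    next
     case True
     have "\<bar>g (z + sg *\<^sub>R y) - g z\<bar> <= 2 * b" using b(1)[of "z + sg *\<^sub>R y"] b(1)[of z] by linarith
     then have "\<bar>g (z + sg *\<^sub>R y) - g z\<bar> * ph y <= 2 * b * ph y" using ph(2)[of y] by (intro mult_right_mono) auto
     moreover have "0 <= e / 2 * ph y" using ph(2)[of y] \<open>e > 0\<close> by simp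
     moreover have "norm (g (z + sg *\<^sub>R y) * ph y - g z * ph y) = \<bar>g (z + sg *\<^sub>R y) - g z\<bar> * ph y"
      using ph(2)[of y] by (simp add: left_diff_distrib[symmetric] abs_mult)
     moreover have "2 * b * (indicator {x. norm x >= r} y * ph y) = 2 * b * ph y" using True by simp
     ultimately show ?thesis by linarith
    qed
   qed (use ph int_T int2 int3 in auto)
   also have "... = e/2 * c + 2 * b * (LINT x|lborel. indicator {x. norm x >= r} x * ph x)"
    using ph int3 by (simp add: c_def)
   also have "... <= e/2 * c + 2 * b * (e * c / (4 * b))" using r b by (intro add_left_mono mult_left_mono) auto
   also have "... = e * c" using b by (simp add: field_simps)
   finally show ?thesis by simp
  qed
  then show ?thesis using sg by blast
 qed
 have approx: "\<bar>(LINT z|rh. g z) - (LINT z|rh. T sg z) / c\<bar> <= e"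
  if "\<forall>z. \<bar>T sg z - c * g z\<bar> <= e * c" "prob_space rh" "sets rh = sets borel" for e sg and rh :: "'v measure"
 proof -
  interpret prob_space rh by fact
  note [measurable_cong] = that(3)
  have 1: "integrable rh g" using b by (intro integrable_const_bound[where B=b]) auto
  have 2: "integrable rh (T sg)" using T_bound by (intro integrable_const_bound[where B="b*c"]) auto
  have "(LINT z|rh. g z) - (LINT z|rh. T sg z) / c = (LINT z|rh. g z - T sg z / c)"
   using 1 2 by simp
  also have "norm ... <= (LINT z|rh. e)"
  proof (rule Bochner_Integration.integral_norm_bound_integral)
   show "norm (g z - T sg z / c) <= e" for z
   proof -
    have "g z - T sg z / c = - ((T sg z - c * g z) / c)" using c by (simp add: field_simps)
    then have "\<bar>g z - T sg z / c\<bar> = \<bar>T sg z - c * g z\<bar> / c" using c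
     by (simp only: abs_minus_cancel abs_divide abs_of_pos)
    also have "... <= e" using that(1) c by (simp add: divide_le_eq)
    finally show ?thesis by simp
   qed
  qed (use 1 2 in auto)
  finally show ?thesis by (simp add: prob_space)
 qed
 show ?thesis
 proof (rule LIMSEQ_I)
  fix e :: real assume "e > 0"
  then obtain sg where sg: "sg > 0" "\<forall>z. \<bar>T sg z - c * g z\<bar> <= (e/4) * c" using close[of "e/4"] by auto
  have "(\<lambda>k. (LINT z|\<nu> k. T sg z) / c) \<longlonglongrightarrow> (LINT z|\<mu>. T sg z) / c"
   unfolding T_def ph_def using c by (intro tendsto_divide tendsto_const smoothing_tendsto \<nu> \<mu> conv g_int sg) auto
  from LIMSEQ_D[OF this, of "e/4"] \<open>e > 0\<close> obtain k0 where
   k0: "\<And>k. k >= k0 ==> \<bar>(LINT z|\<nu> k. T sg z) / c - (LINT z|\<mu>. T sg z) / c\<bar> < e/4" by auto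
  have "\<bar>(LINT z|\<nu> k. g z) - (LINT z|\<mu>. g z)\<bar> < e" if "k >= k0" for k
   using k0[OF that] approx[OF sg(2) \<nu>(1,2)[of k]] approx[OF sg(2) \<mu>] by linarith
  then show "\<exists>k0. \<forall>k\<ge>k0. norm ((LINT z|\<nu> k. g z) - (LINT z|\<mu>. g z)) < e" by auto
 qed
qed

end

text \<open>Compactly supported functions are settled. Mass cannot escape to infinity: the cut-off
  \<open>ct R\<close> has compact support itself, so its integrals converge to its integral under
  \<mu>, which is near one for large R. Multiplying g by the cut-off therefore costs little,
  uniformly in large k.\<close>

theorem levy_continuity_euclidean:
 fixes g :: "'v::euclidean_space => real" and \<nu> :: "nat => 'v measure"
 assumes \<nu>: "\<And>k. prob_space (\<nu> k)" "\<And>k. sets (\<nu> k) = sets borel"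
  and \<mu>: "prob_space \<mu>" "sets \<mu> = sets borel"
  and conv: "\<And>t. (\<lambda>k. LINT z|\<nu> k. cis (t \<bullet> z)) \<longlonglongrightarrow> (LINT z|\<mu>. cis (t \<bullet> z))"
  and g: "continuous_on UNIV g" "bounded (range g)"
 shows "(\<lambda>k. LINT z|\<nu> k. g z) \<longlonglongrightarrow> (LINT z|\<mu>. g z)"
proof -
 obtain \<gamma> :: "'v measure" where "std_gauss \<gamma>"
 proof -
  have "(\<Sum>i\<in>Basis. (t \<bullet> i)^2) = (norm t)^2" for t :: 'v
   by (subst power2_norm_eq_inner, subst euclidean_inner) (simp add: power2_eq_square)
  then show ?thesis
   using ex_gaussian_sum_of_squares[of "Basis :: 'v set" "\<lambda>b. b"] that by (auto simp: std_gauss_def)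
 qed
 then interpret std_gauss \<gamma> .
 have [measurable]: "g \<in> borel_measurable borel" using g(1) by (rule borel_measurable_continuous_onI)
 obtain b where b: "b > 0" "\<And>x. \<bar>g x\<bar> <= b" using g(2) by (auto simp: bounded_pos)
 define ct where "ct R x = max 0 (min 1 (R + 1 - norm x))" for R and x :: 'v
 have ct_cont: "continuous_on UNIV (ct R)" for R unfolding ct_def by (intro continuous_intros)
 have [measurable]: "ct R \<in> borel_measurable borel" for R using ct_cont by (rule borel_measurable_continuous_onI)
 have ct01: "0 <= ct R x" "ct R x <= 1" for R x by (auto simp: ct_def)
 interpret \<mu>: prob_space \<mu> by fact
 note [measurable_cong] = \<mu>(2)
 have bd: "\<bar>(LINT z|rh. g z) - (LINT z|rh. g z * ct R z)\<bar> <= b * (1 - (LINT z|rh. ct R z))"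
  if "prob_space rh" "sets rh = sets borel" for R and rh :: "'v measure"
 proof -
  interpret prob_space rh by fact
  note [measurable_cong] = that(2)
  have i1: "integrable rh g" using b by (intro integrable_const_bound[where B=b]) auto
  have i2: "integrable rh (ct R)" using ct01 by (intro integrable_const_bound[where B=1]) auto
  have "\<bar>g x\<bar> * ct R x <= b" for x
   using b ct01 mult_mono[of "\<bar>g x\<bar>" b "ct R x" 1] by auto
  then have i3: "integrable rh (\<lambda>z. g z * ct R z)"
   using ct01 by (intro integrable_const_bound[where B=b]) (auto simp: abs_mult)
  note i = i1 i2 i3
  have "(LINT z|rh. g z) - (LINT z|rh. g z * ct R z) = (LINT z|rh. g z - g z * ct R z)" using i by simp
  also have "norm ... <= (LINT z|rh. b * (1 - ct R z))"
  proof (rule Bochner_Integration.integral_norm_bound_integral)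
   show "norm (g z - g z * ct R z) <= b * (1 - ct R z)" for z
   proof -
    have "\<bar>g z\<bar> * (1 - ct R z) <= b * (1 - ct R z)" using b ct01 by (intro mult_right_mono) auto
    moreover have "g z - g z * ct R z = g z * (1 - ct R z)" by (simp add: algebra_simps)
    ultimately show ?thesis using ct01[of R z] by (simp add: abs_mult)
   qed
  qed (use i in auto)
  also have "... = b * (1 - (LINT z|rh. ct R z))" using i by (simp add: prob_space)
  finally show ?thesis by simp
 qed
 have ct_lim: "(\<lambda>R. LINT z|\<mu>. ct (real R) z) \<longlonglongrightarrow> (LINT z|\<mu>. 1)"
 proof (rule integral_dominated_convergence[where w="\<lambda>_. 1"])
  show "AE z in \<mu>. (\<lambda>R. ct (real R) z) \<longlonglongrightarrow> 1"
  proof (rule AE_I2, rule tendsto_eventually)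
   fix z :: 'v
   show "\<forall>\<^sub>F R in sequentially. ct (real R) z = 1"
    using eventually_gt_at_top[of "nat \<lceil>norm z\<rceil>"]
    by eventually_elim (auto simp: ct_def min_def max_def, linarith+)
  qed
 qed (use ct01 in auto)
 show ?thesis
 proof (rule LIMSEQ_I)
  fix e :: real assume "e > 0"
  then have pos: "e / (8 * b) > 0" using b by simp
  from LIMSEQ_D[OF ct_lim this] obtain R0 where R0: "\<And>R. R >= R0 ==> \<bar>(LINT z|\<mu>. ct (real R) z) - 1\<bar> < e / (8 * b)"
   by (auto simp: \<mu>.prob_space)
  define R where "R = real R0"
  have R: "1 - (LINT z|\<mu>. ct R z) < e / (8 * b)" using R0[of R0] by (simp add: R_def)
  have 1: "(\<lambda>k. LINT z|\<nu> k. ct R z) \<longlonglongrightarrow> (LINT z|\<mu>. ct R z)"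
   by (rule continuity_compact_support[OF \<nu> \<mu> conv ct_cont, where R="R+1"]) (auto simp: ct_def)
  have 2: "(\<lambda>k. LINT z|\<nu> k. g z * ct R z) \<longlonglongrightarrow> (LINT z|\<mu>. g z * ct R z)"
   by (rule continuity_compact_support[OF \<nu> \<mu> conv, where R="R+1"])
    (auto simp: ct_def intro!: continuous_intros g)
  from LIMSEQ_D[OF 1 pos] obtain k1 where k1: "\<And>k. k >= k1 ==> \<bar>(LINT z|\<nu> k. ct R z) - (LINT z|\<mu>. ct R z)\<bar> < e / (8 * b)" by auto
  from LIMSEQ_D[OF 2, of "e/4"] \<open>e > 0\<close> obtain k2 where
   k2: "\<And>k. k >= k2 ==> \<bar>(LINT z|\<nu> k. g z * ct R z) - (LINT z|\<mu>. g z * ct R z)\<bar> < e / 4" by auto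
  have "\<bar>(LINT z|\<nu> k. g z) - (LINT z|\<mu>. g z)\<bar> < e" if k: "k >= max k1 k2" for k
  proof -
   have "1 - (LINT z|\<nu> k. ct R z) < 2 * (e / (8 * b))" using k1[of k] k R by (simp add: abs_if split: if_splits)
   then have "b * (1 - (LINT z|\<nu> k. ct R z)) < b * (2 * (e / (8 * b)))" using b by (intro mult_strict_left_mono)
   moreover have "b * (1 - (LINT z|\<mu>. ct R z)) < b * (e / (8 * b))" using b R by (intro mult_strict_left_mono)
   ultimately have "b * (1 - (LINT z|\<nu> k. ct R z)) < e/4" "b * (1 - (LINT z|\<mu>. ct R z)) < e/8"
    using b by (simp_all add: field_simps)
   then show ?thesis using bd[OF \<nu>[of k], of R] bd[OF \<mu>, of R] k2[of k] k by (simp add: abs_if split: if_splits)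
  qed
  then show "\<exists>k0. \<forall>k\<ge>k0. norm ((LINT z|\<nu> k. g z) - (LINT z|\<mu>. g z)) < e" by (intro exI[of _ "max k1 k2"]) auto
 qed
qed

subsection \<open>Elementary inequalities\<close>

lemma abs_exp_minus_one_le: "\<bar>exp x - 1\<bar> <= \<bar>x\<bar> * exp \<bar>x\<bar>" for x :: real
proof (cases "x >= 0")
 case True
 have "1 - x <= exp (- x)" using exp_ge_add_one_self[of "- x"] by simp
 then have "exp x * (1 - x) <= exp x * exp (- x)" by (intro mult_left_mono) auto
 then show ?thesis using True by (simp add: exp_minus algebra_simps)
next
 case False
 have "1 + x <= exp x" by (rule exp_ge_add_one_self)
 moreover have "- x * 1 <= - x * exp (- x)" using False by (intro mult_left_mono) auto
 ultimately have "1 - exp x <= - x * exp (- x)" by linarith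
 moreover have "\<bar>exp x - 1\<bar> = 1 - exp x" "\<bar>x\<bar> = - x" using False by auto
 ultimately show ?thesis by (simp only:)
qed

text \<open>With z = exp l - 1 this is the second-order remainder of ln (1 + z). A bound in
  \<open>l\<close> rather than in z avoids trouble for z near -1. The function inside the first
  absolute value has derivative (exp l - 1)^2, so the mean value theorem gives a cubic
  bound.\<close>

lemma ln_expansion_remainder:
 fixes l :: real
 shows "\<bar>l - (exp l - 1) + (exp l - 1)^2 / 2\<bar> <= \<bar>l\<bar> ^ 3 * exp (2 * \<bar>l\<bar>)"
proof -
 define F where "F l = l - (exp l - 1) + (exp l - 1)^2 / 2" for l :: real
 have der: "(F has_real_derivative (exp x - 1)\<^sup>2) (at x within S)" for x S
  unfolding F_def[abs_def] by (auto intro!: derivative_eq_intros simp: power2_eq_square field_simps)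
 have "\<exists>x. \<bar>x\<bar> <= \<bar>l\<bar> \<and> F l = l * (exp x - 1)^2"
 proof (cases l "0 :: real" rule: linorder_cases)
  case less
  from MVT2[OF less, of F "\<lambda>x. (exp x - 1)^2"] der obtain z where "l < z" "z < 0" "F 0 - F l = (0 - l) * (exp z - 1)^2" by blast
  then show ?thesis by (intro exI[of _ z]) (auto simp: F_def)
 next
  case equal then show ?thesis by (auto simp: F_def)
 next
  case greater
  from MVT2[OF greater, of F "\<lambda>x. (exp x - 1)^2"] der obtain z where "0 < z" "z < l" "F l - F 0 = (l - 0) * (exp z - 1)^2" by blast
  then show ?thesis by (intro exI[of _ z]) (auto simp: F_def)
 qed
 then obtain x where x: "\<bar>x\<bar> <= \<bar>l\<bar>" "F l = l * (exp x - 1)^2" by blast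
 have "\<bar>exp x - 1\<bar> <= \<bar>l\<bar> * exp \<bar>l\<bar>"
  using x(1) by (intro order_trans[OF abs_exp_minus_one_le] mult_mono) auto
 then have "\<bar>exp x - 1\<bar>\<^sup>2 <= (\<bar>l\<bar> * exp \<bar>l\<bar>)^2" by (intro power_mono) auto
 then have "\<bar>l\<bar> * (exp x - 1)^2 <= \<bar>l\<bar> * (\<bar>l\<bar> * exp \<bar>l\<bar>)^2" by (intro mult_left_mono) auto
 also have "... = \<bar>l\<bar> ^ 3 * exp (2 * \<bar>l\<bar>)"
  by (simp add: power_mult_distrib exp_double power3_eq_cube power2_eq_square)
 finally show ?thesis using x(2) by (simp add: F_def abs_mult)
qed

text \<open>After multiplication by \<^term>\<open>2 * a\<close> the difference of the two sides is
 \<^term>\<open>(sqrt (b / a) * a - c)\<^sup>2\<close>.\<close>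

lemma sqrt_ratio_le:
 fixes a b c :: real
 assumes "a > 0" "b >= 0"
 shows "sqrt (b / a) * c + a <= (a + b) / 2 + c + (c - a)^2 / (2 * a)"
proof -
 define r where "r = sqrt (b / a)"
 have b: "b = r^2 * a" using assms by (simp add: r_def)
 have "0 <= (r * a - c)^2 / (2 * a)" using assms by simp
 also have "... = (a + b) / 2 + c + (c - a)^2 / (2 * a) - (r * c + a)"
  unfolding b using assms by (simp add: field_simps power2_eq_square)
 finally show ?thesis by (simp add: r_def)
qed

subsection \<open>Semiconcavity\<close>

text \<open>Along a segment the second derivative of log-sum-exp is the variance of the increments
  under the normalized exponential weights, hence at most D^2. So D^2 s^2 / 2 minus log-sum-exp is
  convex in s. Monotonicity of log-sum-exp then admits exponents \<open>c i\<close> that merely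
  dominate the affine interpolation.\<close>

lemma log_sum_exp_semiconcave:
 fixes a b c :: "'i => real"
 assumes I: "finite I" "I \<noteq> {}" and s: "0 <= s" "s <= 1"
  and c: "\<And>i. i \<in> I ==> (1 - s) * a i + s * b i <= c i"
  and D: "\<And>i. i \<in> I ==> \<bar>a i - b i\<bar> <= D"
 shows "(1 - s) * ln (\<Sum>i\<in>I. exp (a i)) + s * ln (\<Sum>i\<in>I. exp (b i)) - D\<^sup>2 / 2 * (s * (1 - s))
  <= ln (\<Sum>i\<in>I. exp (c i))"
proof -
 define d where "d i = b i - a i" for i
 define S0 where "S0 s = (\<Sum>i\<in>I. exp (a i + s * d i))" for s
 define S1 where "S1 s = (\<Sum>i\<in>I. d i * exp (a i + s * d i))" for s
 define S2 where "S2 s = (\<Sum>i\<in>I. (d i)^2 * exp (a i + s * d i))" for s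
 have S0: "S0 s > 0" for s unfolding S0_def using I by (intro sum_pos) auto
 have D0: "D >= 0" using D I by (metis abs_ge_zero all_not_in_conv order_trans)
 have d2: "(d i)^2 <= D^2" if "i \<in> I" for i
  using D[OF that] by (intro power2_le_iff_abs_le[THEN iffD2]) (auto simp: d_def D0 abs_minus_commute)
 have S2: "S2 s <= D^2 * S0 s" for s
  unfolding S2_def S0_def sum_distrib_left using d2 by (intro sum_mono mult_right_mono) auto
 have der0: "(S0 has_real_derivative S1 s) (at s)" for s
  unfolding S0_def[abs_def] S1_def by (auto intro!: derivative_eq_intros sum.cong simp: mult.commute)
 have der1: "(S1 has_real_derivative S2 s) (at s)" for s
  unfolding S1_def[abs_def] S2_def by (auto intro!: derivative_eq_intros sum.cong simp: power2_eq_square)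
 define f where "f s = D^2 * s^2 / 2 - ln (S0 s)" for s
 have "convex_on UNIV f"
 proof (rule f''_ge0_imp_convex)
  show "(f has_real_derivative D\<^sup>2 * s - S1 s / S0 s) (at s)" for s
   unfolding f_def[abs_def] using S0[of s]
   by (auto intro!: derivative_eq_intros der0 simp: field_simps)
  show "((\<lambda>s. D^2 * s - S1 s / S0 s) has_real_derivative D\<^sup>2 - (S2 s * S0 s - S1 s * S1 s) / (S0 s * S0 s)) (at s)" for s
   using S0[of s] by (auto intro!: derivative_eq_intros der0 der1 simp: field_simps)
  show "0 <= D^2 - (S2 s * S0 s - S1 s * S1 s) / (S0 s * S0 s)" for s
  proof -
   have "(S2 s * S0 s - S1 s * S1 s) <= D^2 * S0 s * S0 s"
    using mult_right_mono[OF S2[of s] less_imp_le[OF S0[of s]]] zero_le_square[of "S1 s"] by linarith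
   then show ?thesis using S0[of s] by (simp add: divide_le_eq mult.assoc)
  qed
 qed auto
 from convex_onD[OF this s, of 0 1] have "f s <= (1 - s) * f 0 + s * f 1" by simp
 moreover have "f s = D^2 * s^2 / 2 - ln (S0 s)" "f 0 = - ln (\<Sum>i\<in>I. exp (a i))" "f 1 = D^2 / 2 - ln (\<Sum>i\<in>I. exp (b i))"
  by (simp_all add: f_def S0_def d_def)
 moreover have "ln (S0 s) <= ln (\<Sum>i\<in>I. exp (c i))"
 proof (rule ln_mono)
  show "S0 s <= (\<Sum>i\<in>I. exp (c i))"
   unfolding S0_def d_def using c by (intro sum_mono) (auto simp: algebra_simps)
 qed (use S0 S0_def I in \<open>auto intro!: sum_pos\<close>)
 ultimately show ?thesis
  by (simp add: algebra_simps power2_eq_square add_divide_distrib diff_divide_distrib)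
qed

text \<open>Cubes around finitely many centres cover the ball. On a cube a convex F is bounded above
  through its values at the vertices, and reflection in the centre turns this into a lower bound.
  \<open>G\<close> consists of centres and vertices and depends on neither F nor Q, so it can be
  fixed before random functions are inserted. Radius R + 1 leaves room for cubes that stick out of
  the ball.\<close>

lemma convex_finite_approx:
 fixes R La et :: real
 assumes "La > 0" "et > 0"
 shows "\<exists>G::'v::euclidean_space set. finite G \<and> G \<subseteq> cball 0 (R + 1) \<and>
  (\<forall>F Q. convex_on (cball 0 (R + 1)) F -->
   (\<forall>x\<in>cball 0 (R + 1). \<forall>y\<in>cball 0 (R + 1). \<bar>Q x - Q y\<bar> <= La * norm (x - y)) -->
   (\<forall>g\<in>G. \<bar>F g - Q g\<bar> <= et) --> (\<forall>x\<in>cball 0 R. \<bar>F x - Q x\<bar> <= 4 * et))"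
proof -
 define rh where "rh = min 1 (et / (2 * La))"
 have rh: "rh > 0" "rh <= 1" "La * rh <= et / 2"
  using assms by (auto simp: rh_def min_def field_simps)
 \<comment> \<open>Half the side of a cube. Division by the dimension keeps each cube within
   distance \<open>rh\<close> of its centre, by the l1 bound on the norm; there Q varies by at most
   et/2.\<close>
 define r where "r = rh / DIM('v)"
 have r: "r > 0" using rh by (simp add: r_def)
 define e where "e = (\<Sum>b\<in>Basis. r *\<^sub>R b :: 'v)"
 have in_box: "dist c x <= rh" if "x \<in> cbox (c - e) (c + e)" for c x
 proof -
  have "norm (x - c) <= (\<Sum>b\<in>Basis. \<bar>(x - c) \<bullet> b\<bar>)" by (rule norm_le_l1)
  also have "... <= (\<Sum>b\<in>(Basis::'v set). r)"
  proof (rule sum_mono)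
   fix b :: 'v assume "b \<in> Basis"
   then show "\<bar>(x - c) \<bullet> b\<bar> <= r"
    using that by (auto simp: mem_box e_def inner_diff_left inner_add_left inner_sum_left_Basis abs_le_iff dest!: bspec[of _ _ b])
  qed
  also have "... = rh" by (simp add: r_def)
  finally show ?thesis by (simp add: dist_norm norm_minus_commute)
 qed
 have "\<exists>V. finite V \<and> cbox (c - e) (c + e) = convex hull V" for c
  using cube_convex_hull[OF r, of c] unfolding e_def by metis
 then obtain V where V: "\<And>c. finite (V c)" "\<And>c. cbox (c - e) (c + e) = convex hull (V c)" by metis
 have cin: "c \<in> box (c - e) (c + e)" for c
  using r by (auto simp: mem_box e_def inner_diff_left inner_add_left)
 then have "cball 0 R \<subseteq> (\<Union>c\<in>cball 0 R. box (c - e) (c + e))" by auto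
 from compactE_image[OF compact_cball open_box this]
 obtain C where C: "C \<subseteq> cball 0 R" "finite C" "cball 0 R \<subseteq> (\<Union>c\<in>C. box (c - e) (c + e))"
  by blast
 define G where "G = (\<Union>c\<in>C. insert c (V c))"
 have sub: "cbox (c - e) (c + e) \<subseteq> cball 0 (R + 1)" if "c \<in> C" for c
 proof
  fix x assume x: "x \<in> cbox (c - e) (c + e)"
  have "norm x <= norm c + norm (x - c)" using norm_triangle_ineq[of c "x - c"] by simp
  then show "x \<in> cball 0 (R + 1)" using in_box[OF x] rh that C(1) by (force simp: dist_norm norm_minus_commute)
 qed
 have VG: "V c \<subseteq> cbox (c - e) (c + e)" for c unfolding V(2) by (rule hull_subset)
 have "finite G" using C(2) V(1) by (simp add: G_def)
 moreover have "G \<subseteq> cball 0 (R + 1)"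
  using sub VG box_subset_cbox cin unfolding G_def by blast
 moreover have "\<bar>F x - Q x\<bar> <= 4 * et"
  if F: "convex_on (cball 0 (R + 1)) F"
   and Q: "\<forall>x\<in>cball 0 (R + 1). \<forall>y\<in>cball 0 (R + 1). \<bar>Q x - Q y\<bar> <= La * norm (x - y)"
   and FQ: "\<forall>g\<in>G. \<bar>F g - Q g\<bar> <= et" and x: "x \<in> cball 0 R" for F Q x
 proof -
  from C(3) x obtain c where c: "c \<in> C" "x \<in> box (c - e) (c + e)" by auto
  then have xc: "x \<in> cbox (c - e) (c + e)" using box_subset_cbox by blast
  have cc: "c \<in> cball 0 (R + 1)" using sub[OF c(1)] cin box_subset_cbox by blast
  have Qc: "\<bar>Q y - Q c\<bar> <= et / 2" if "y \<in> cbox (c - e) (c + e)" for y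
  proof -
   have "\<bar>Q y - Q c\<bar> <= La * norm (y - c)" using Q sub[OF c(1)] that cc by blast
   also have "... <= La * rh" using in_box[OF that] assms by (intro mult_left_mono) (auto simp: dist_norm norm_minus_commute)
   finally show ?thesis using rh by simp
  qed
  have upper: "F y <= Q c + et / 2 + et" if "y \<in> cbox (c - e) (c + e)" for y
  proof -
   have "convex_on (convex hull (V c)) F"
    using convex_on_subset[OF F sub[OF c(1)]] by (simp add: V(2)[symmetric] convex_box)
   moreover have "\<forall>v\<in>V c. F v <= Q c + et / 2 + et"
   proof
    fix v assume v: "v \<in> V c"
    then have "v \<in> G" using c(1) by (auto simp: G_def)
    then have "\<bar>F v - Q v\<bar> <= et" using FQ by blast
    moreover have "\<bar>Q v - Q c\<bar> <= et / 2" using Qc v VG by blast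
    ultimately show "F v <= Q c + et / 2 + et" by linarith
   qed
   ultimately have "\<forall>z\<in>convex hull (V c). F z <= Q c + et / 2 + et"
    by (rule convex_on_convex_hull_bound)
   then show ?thesis using that V(2) by simp
  qed
  \<comment> \<open>The reflection of x in c. Midpoint convexity gives F x >= 2 F c - F x'. The
    errors add up to 4 et: twice et at c, 3/2 et at x', and et/2 for Q between c and x.\<close>
  define x' where "x' = 2 *\<^sub>R c - x"
  have x': "x' \<in> cbox (c - e) (c + e)"
   using xc by (auto simp: x'_def mem_box inner_diff_left inner_add_left algebra_simps dest!: bspec)
  have "F ((1 - 1/2) *\<^sub>R x + (1/2) *\<^sub>R x') <= (1 - 1/2) * F x + (1/2) * F x'"
   by (rule convex_onD[OF F]) (use sub[OF c(1)] xc x' in auto)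
  moreover have "(1 - 1/2) *\<^sub>R x + (1/2) *\<^sub>R x' = c" by (simp add: x'_def algebra_simps)
  ultimately have "2 * F c <= F x + F x'" by simp
  moreover have "\<bar>F c - Q c\<bar> <= et" using FQ c(1) by (auto simp: G_def)
  ultimately show ?thesis using upper[OF xc] upper[OF x'] Qc[OF xc] by (simp add: abs_if split: if_splits)
 qed
 ultimately show ?thesis by (intro exI[of _ G]) blast
qed

subsection \<open>Log-concave noise\<close>

text \<open>g is minus the log-density, g' its derivative with value 0 at the possible kink. The
  envelope supplies local Lipschitz constants with all exponential moments; weighting by exp (- g /
  2) instead of exp (- g) leaves room for moments of g itself. Linear growth yields coercivity, and
  the quadratic loss of Hellinger affinity, uniform over bounded shifts, yields identification of
  the parameter.\<close>

locale noise =
 fixes g g' :: "real => real"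
 assumes g_convex: "convex_on UNIV g"
  and g'_meas[measurable]: "g' \<in> borel_measurable borel"
  and g_deriv: "\<And>t. t \<noteq> 0 ==> (g has_real_derivative g' t) (at t)"
  and g'_0: "g' 0 = 0"
  and g_env: "\<And>R. \<exists>La\<in>borel_measurable borel. (\<forall>y. La y >= 0) \<and>
    (\<forall>y s s'. \<bar>s\<bar> <= R --> \<bar>s'\<bar> <= R --> \<bar>g (y - s) - g (y - s')\<bar> <= \<bar>s - s'\<bar> * La y) \<and>
    (\<forall>k::nat. integrable lborel (\<lambda>y. exp (real k * La y - g y / 2)))"
  and g_lower: "\<exists>c>0. \<exists>C. \<forall>t. c * \<bar>t\<bar> - C <= g t"
  and g_norm: "(NNI lborel (\<lambda>t. ennreal (exp (- g t)))) = 1"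
  and g_hell: "\<And>S. \<exists>c>0. \<forall>s. \<bar>s\<bar> <= S -->
    (NNI lborel (\<lambda>t. ennreal (exp (- (g (t - s) + g t) / 2)))) <= ennreal (1 - c * s^2)"
begin

lemma g_cont: "continuous_on UNIV g"
 using convex_on_continuous[OF open_UNIV g_convex] .

lemma g_meas[measurable]: "g \<in> borel_measurable borel"
 by (rule borel_measurable_continuous_onI[OF g_cont])

definition f :: "real => real" where "f t = exp (- g t)"

lemma f_meas[measurable]: "f \<in> borel_measurable borel"
 unfolding f_def[abs_def] by measurable

lemma f_pos: "f t > 0" and f_nonneg: "f t >= 0" by (auto simp: f_def)

lemma nn_integral_f: "(NNI lborel (\<lambda>t. ennreal (f t))) = 1"
 using g_norm by (simp add: f_def)

lemma nn_integral_translate: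
 fixes c :: real
 assumes [measurable]: "ph \<in> borel_measurable borel"
 shows "(NNI lborel (\<lambda>y. ph (y - c))) = (NNI lborel (\<lambda>y. ph y))"
 using nn_integral_real_affine[of ph 1 "- c"] by simp

lemma nn_integral_f_shift: "(NNI lborel (\<lambda>y. ennreal (f (y - c)))) = 1"
 using nn_integral_translate[of "\<lambda>t. ennreal (f t)" c] nn_integral_f by simp

lemma integrable_f_shift: "integrable lborel (\<lambda>y. f (y - c))"
 by (rule integrableI_bounded) (auto simp: f_nonneg nn_integral_f_shift)

lemma integral_f_shift: "(LINT y|lborel. f (y - c)) = 1"
 using nn_integral_f_shift by (subst integral_eq_nn_integral) (auto simp: f_nonneg)

lemma g_bounded_below: "\<exists>C. \<forall>t. - C <= g t"
proof -
 obtain c C where cC: "c > 0" "\<And>t. c * \<bar>t\<bar> - C <= g t" using g_lower by blast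
 have "- C <= g t" for t using cC(2)[of t] mult_nonneg_nonneg[of c "\<bar>t\<bar>"] cC(1) by linarith
 then show ?thesis by blast
qed

end

subsection \<open>The sampling model\<close>

text \<open>The matched sample is recorded as covariate and error instead of covariate and response.
  Covariates are bounded everywhere, so pointwise bounds have no exceptional sets. Padding with
  zeros gives all observations one type, and the sum type lets a single independence statement cover
  the three samples.\<close>

locale ssl = prob_space M + noise g g'
 for M :: "'a measure" and g g' :: "real => real" +
 fixes \<beta>0 :: "'v::euclidean_space" and B :: real
  and Xt :: "nat => 'a => 'v" and Yt :: "nat => 'a => real"
  and Xs :: "nat => 'a => 'v" and es :: "nat => 'a => real"
 assumes B: "B > 0" and Xt_le: "\<And>i om. norm (Xt i om) <= B" and Xs_le: "\<And>k om. norm (Xs k om) <= B"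
  and samples: "indep_vars (\<lambda>_. borel) (\<lambda>s om. case s of Inl i => (Xt i om, 0::real)
    | Inr (Inl j) => (0::'v, Yt j om) | Inr (Inr k) => (Xs k om, es k om)) UNIV"
  and Xt_law: "\<And>i. distr M borel (Xt i) = distr M borel (Xt 0)"
  and Yt_law: "\<And>j. distr M borel (Yt j) =
    density lborel (\<lambda>y. ennreal (expectation (\<lambda>om. exp (- g (y - \<beta>0 \<bullet> Xt 0 om)))))"
  and XE_law: "\<And>k. distr M borel (\<lambda>om. (Xs k om, es k om)) =
    distr M borel (Xt 0) \<Otimes>\<^sub>M density lborel (\<lambda>t. ennreal (exp (- g t)))"
  and nondeg: "\<exists>c>0. \<forall>v. c * (norm v)^2 <= expectation (\<lambda>om. (v \<bullet> Xt 0 om)^2)"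
begin

lemma samples_meas:
 shows Xt_meas[measurable]: "Xt i \<in> borel_measurable M"
  and Yt_meas[measurable]: "Yt i \<in> borel_measurable M"
  and Xs_meas[measurable]: "Xs i \<in> borel_measurable M"
  and es_meas[measurable]: "es i \<in> borel_measurable M"
proof -
 have m: "(\<lambda>om. case s of Inl i => (Xt i om, 0::real)
    | Inr (Inl j) => (0::'v, Yt j om) | Inr (Inr k) => (Xs k om, es k om)) \<in> borel_measurable M" for s
  using samples by (auto simp: indep_vars_def)
 have fs: "(\<lambda>om. fst (F om)) \<in> borel_measurable M" "(\<lambda>om. snd (F om)) \<in> borel_measurable M"
  if "F \<in> borel_measurable M" for F :: "'a => 'v \<times> real"
  using that by (auto simp flip: borel_prod)
 show "Xt i \<in> borel_measurable M" using fs(1)[OF m[of "Inl i"]] by simp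
 show "Yt i \<in> borel_measurable M" using fs(2)[OF m[of "Inr (Inl i)"]] by simp
 show "Xs i \<in> borel_measurable M" using fs(1)[OF m[of "Inr (Inr i)"]] by simp
 show "es i \<in> borel_measurable M" using fs(2)[OF m[of "Inr (Inr i)"]] by simp
qed

text \<open>The parameter is the deviation \<open>de\<close> from \<beta>0. The three functions are
  the conditional density of a response given its covariate, the density of a response, and the
  empirical mixture by which the estimator replaces the latter.\<close>

definition p :: "'v => 'v => real => real" where "p de x y = f (y - (\<beta>0 + de) \<bullet> x)"

definition pbar :: "'v => real => real" where "pbar de y = expectation (\<lambda>om. p de (Xt 0 om) y)"

definition av :: "nat => 'v => (nat => 'v) => real => real" where
 "av n de x y = (\<Sum>i<n. p de (x i) y) / real n"

abbreviation "XS om \<equiv> (\<lambda>i. Xt i om)"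

lemma p_meas[measurable (raw)]:
 assumes [measurable]: "a \<in> borel_measurable N" "x \<in> borel_measurable N" "y \<in> borel_measurable N"
 shows "(\<lambda>om. p (a om) (x om) (y om)) \<in> borel_measurable N"
 unfolding p_def by measurable

lemma pbar_meas[measurable]: "pbar de \<in> borel_measurable borel"
 unfolding pbar_def[abs_def] by measurable

lemma Yt_law': "distr M borel (Yt j) = density lborel (\<lambda>y. ennreal (pbar 0 y))"
 using Yt_law[of j] by (simp add: pbar_def[abs_def] p_def f_def)

lemma XE_law': "distr M borel (\<lambda>om. (Xs k om, es k om)) = distr M borel (Xt 0) \<Otimes>\<^sub>M density lborel (\<lambda>t. ennreal (f t))"
 using XE_law[of k] by (simp add: f_def)

subsection \<open>Independence of the three samples\<close>

lemma XS_meas[measurable]: "XS \<in> measurable M (PiM UNIV (\<lambda>_. borel))"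
 and YS_meas[measurable]: "(\<lambda>om j. Yt j om) \<in> measurable M (PiM UNIV (\<lambda>_. borel))"
 and ZS_meas[measurable]: "(\<lambda>om k. (Xs k om, es k om)) \<in> measurable M (PiM UNIV (\<lambda>_. borel))"
 by (auto intro!: measurable_PiM_single' simp: space_pair_measure simp flip: borel_prod)

text \<open>The samples occupy disjoint parts of the index set, so each can be integrated at its own
  sample point. Such iterated integrals stand in for conditional expectations given the
  covariates.\<close>

lemma decouple3:
 assumes Ph[measurable]: "(\<lambda>(x, y, z). Ph x y z) \<in> borel_measurable
   (PiM UNIV (\<lambda>_. borel) \<Otimes>\<^sub>M PiM UNIV (\<lambda>_. borel) \<Otimes>\<^sub>M PiM UNIV (\<lambda>_. borel))"
 shows "(NNI M (\<lambda>om. Ph (XS om) (\<lambda>j. Yt j om) (\<lambda>k. (Xs k om, es k om)))) =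
  (NNI M (\<lambda>om1. \<integral>\<^sup>+om2. \<integral>\<^sup>+om3. Ph (XS om1) (\<lambda>j. Yt j om2) (\<lambda>k. (Xs k om3, es k om3)) \<partial>M \<partial>M))"
proof -
 let ?V = "\<lambda>s om. case s of Inl i => (Xt i om, 0::real)
    | Inr (Inl j) => (0::'v, Yt j om) | Inr (Inr k) => (Xs k om, es k om)"
 let ?P = "PiM (UNIV :: nat set) (\<lambda>_. borel :: real measure)" and ?Q = "PiM (UNIV :: nat set) (\<lambda>_. borel :: ('v \<times> real) measure)"
 let ?PX = "PiM (UNIV :: nat set) (\<lambda>_. borel :: 'v measure)"
 have fst_snd: "fst \<in> borel_measurable (borel :: ('v \<times> real) measure)" "snd \<in> borel_measurable (borel :: ('v \<times> real) measure)"
  by (auto simp flip: borel_prod)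
 have comp: "(\<lambda>x. x s) \<in> borel_measurable (PiM A (\<lambda>_. borel :: ('v \<times> real) measure))" if "s \<in> A"
  for s and A :: "(nat + nat + nat) set" using that by (rule measurable_component_singleton)
 let ?A = "range Inl :: (nat + nat + nat) set" and ?B = "range Inr :: (nat + nat + nat) set"
 have ind1: "indep_var (PiM ?A (\<lambda>_. borel)) (\<lambda>om. restrict (\<lambda>s. ?V s om) ?A) (PiM ?B (\<lambda>_. borel)) (\<lambda>om. restrict (\<lambda>s. ?V s om) ?B)"
  by (rule indep_var_restrict[OF samples]) auto
 have F: "(\<lambda>x i. fst (x (Inl i))) \<in> measurable (PiM ?A (\<lambda>_. borel :: ('v \<times> real) measure)) ?PX"
 proof (rule measurable_PiM_single')
  show "(\<lambda>x. fst (x (Inl i))) \<in> borel_measurable (PiM ?A (\<lambda>_. borel :: ('v \<times> real) measure))" for i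
   using measurable_compose[OF comp[of "Inl i" ?A] fst_snd(1)] by simp
 qed simp
 have G: "(\<lambda>x. (\<lambda>j. snd (x (Inr (Inl j))), \<lambda>k. x (Inr (Inr k)))) \<in> measurable (PiM ?B (\<lambda>_. borel :: ('v \<times> real) measure)) (?P \<Otimes>\<^sub>M ?Q)"
  by (intro measurable_Pair; rule measurable_PiM_single', (rule comp measurable_compose[OF comp fst_snd(2)])) auto
 from nn_integral_indep_compose[OF ind1 F G Ph]
 have "(NNI M (\<lambda>om. Ph (XS om) (\<lambda>j. Yt j om) (\<lambda>k. (Xs k om, es k om)))) =
  (NNI M (\<lambda>om1. \<integral>\<^sup>+om. Ph (XS om1) (\<lambda>j. Yt j om) (\<lambda>k. (Xs k om, es k om)) \<partial>M))"
  by simp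
 also have "... = (NNI M (\<lambda>om1. \<integral>\<^sup>+om2. \<integral>\<^sup>+om3. Ph (XS om1) (\<lambda>j. Yt j om2) (\<lambda>k. (Xs k om3, es k om3)) \<partial>M \<partial>M))"
 proof (rule nn_integral_cong)
  let ?A = "range (Inr \<circ> Inl) :: (nat + nat + nat) set" and ?B = "range (Inr \<circ> Inr) :: (nat + nat + nat) set"
  have ind2: "indep_var (PiM ?A (\<lambda>_. borel)) (\<lambda>om. restrict (\<lambda>s. ?V s om) ?A) (PiM ?B (\<lambda>_. borel)) (\<lambda>om. restrict (\<lambda>s. ?V s om) ?B)"
   by (rule indep_var_restrict[OF samples]) auto
  have F2: "(\<lambda>x j. snd (x (Inr (Inl j)))) \<in> measurable (PiM ?A (\<lambda>_. borel :: ('v \<times> real) measure)) ?P"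
   by (rule measurable_PiM_single', rule measurable_compose[OF comp fst_snd(2)]) auto
  have G2: "(\<lambda>x k. x (Inr (Inr k))) \<in> measurable (PiM ?B (\<lambda>_. borel :: ('v \<times> real) measure)) ?Q"
   by (rule measurable_PiM_single', rule comp) auto
  fix om1 assume "om1 \<in> space M"
  have Ph1: "(\<lambda>(y, z). Ph (XS om1) y z) \<in> borel_measurable (?P \<Otimes>\<^sub>M ?Q)"
  proof -
   have "(\<lambda>w. (XS om1, w)) \<in> measurable (?P \<Otimes>\<^sub>M ?Q) (?PX \<Otimes>\<^sub>M ?P \<Otimes>\<^sub>M ?Q)"
    by (intro measurable_Pair1') (auto simp: space_PiM)
   from measurable_compose[OF this Ph] show ?thesis by (simp add: split_beta')
  qed
  from nn_integral_indep_compose[OF ind2 F2 G2 Ph1]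
  show "(NNI M (\<lambda>om. Ph (XS om1) (\<lambda>j. Yt j om) (\<lambda>k. (Xs k om, es k om))))
   = (NNI M (\<lambda>om2. \<integral>\<^sup>+om3. Ph (XS om1) (\<lambda>j. Yt j om2) (\<lambda>k. (Xs k om3, es k om3)) \<partial>M))" by simp
 qed
 finally show ?thesis .
qed

lemma decouple2:
 assumes Ph[measurable]: "(\<lambda>(x, y). Ph x y) \<in> borel_measurable (PiM UNIV (\<lambda>_. borel) \<Otimes>\<^sub>M PiM UNIV (\<lambda>_. borel))"
 shows "(NNI M (\<lambda>om. Ph (XS om) (\<lambda>j. Yt j om))) = (NNI M (\<lambda>om1. \<integral>\<^sup>+om2. Ph (XS om1) (\<lambda>j. Yt j om2) \<partial>M))"
proof -
 have "(\<lambda>(x, y, z). Ph x y) \<in> borel_measurable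
   (PiM UNIV (\<lambda>_. borel) \<Otimes>\<^sub>M PiM UNIV (\<lambda>_. borel) \<Otimes>\<^sub>M PiM UNIV (\<lambda>_. borel :: ('v \<times> real) measure))"
  using measurable_compose[OF measurable_Pair[OF measurable_fst measurable_compose[OF measurable_snd measurable_fst]] Ph]
  by (simp add: split_beta')
 from decouple3[OF this] show ?thesis by (simp add: emeasure_space_1)
qed

lemma iid_X: "indep_vars (\<lambda>_. borel) Xt UNIV"
 and iid_Y: "indep_vars (\<lambda>_. borel) Yt UNIV"
 and iid_Z: "indep_vars (\<lambda>_. borel) (\<lambda>k om. (Xs k om, es k om)) UNIV"
proof -
 let ?V = "\<lambda>s om. case s of Inl i => (Xt i om, 0::real)
    | Inr (Inl j) => (0::'v, Yt j om) | Inr (Inr k) => (Xs k om, es k om)"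
 have sub: "indep_vars (\<lambda>_. N) (\<lambda>i om. ph (?V (e i) om)) (UNIV :: nat set)"
  if "inj e" "ph \<in> measurable borel N" for e :: "nat => nat + nat + nat" and ph :: "'v \<times> real => 'd" and N
 proof -
  have "indep_vars (\<lambda>i. PiM {e i} (\<lambda>_. borel)) (\<lambda>i om. restrict (\<lambda>s. ?V s om) {e i}) UNIV"
   by (rule indep_vars_restrict[OF samples]) (use \<open>inj e\<close> in \<open>auto simp: disjoint_family_on_def inj_def\<close>)
  then have "indep_vars (\<lambda>i. N) (\<lambda>i. (\<lambda>x. ph (x (e i))) \<circ> (\<lambda>om. restrict (\<lambda>s. ?V s om) {e i})) UNIV"
   by (rule indep_vars_compose) (auto intro!: measurable_compose[OF _ that(2)])
  then show ?thesis by (simp add: comp_def)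
 qed
 have m: "fst \<in> borel_measurable (borel :: ('v \<times> real) measure)" "snd \<in> borel_measurable (borel :: ('v \<times> real) measure)"
  by (auto simp flip: borel_prod)
 show "indep_vars (\<lambda>_. borel) Xt UNIV" using sub[of Inl fst borel] m by simp
 show "indep_vars (\<lambda>_. borel) Yt UNIV" using sub[of "\<lambda>i. Inr (Inl i)" snd borel] m by (simp add: inj_def)
 show "indep_vars (\<lambda>_. borel) (\<lambda>k om. (Xs k om, es k om)) UNIV"
  using sub[of "\<lambda>i. Inr (Inr i)" "\<lambda>x. x" borel] by (simp add: inj_def)
qed

lemma Z_law: "distr M borel (\<lambda>om. (Xs k om, es k om)) = distr M borel (\<lambda>om. (Xs 0 om, es 0 om))"
 using XE_law' by simp

lemma Y_law: "distr M borel (Yt j) = distr M borel (Yt 0)"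
 using Yt_law by simp

lemma nn_integral_Y:
 assumes [measurable]: "ph \<in> borel_measurable borel"
 shows "(NNI M (\<lambda>om. ph (Yt j om))) = (NNI lborel (\<lambda>y. ennreal (pbar 0 y) * ph y))"
proof -
 have "(NNI M (\<lambda>om. ph (Yt j om))) = (NNI (distr M borel (Yt j)) (\<lambda>y. ph y))" by (simp add: nn_integral_distr)
 then show ?thesis unfolding Yt_law' by (subst (asm) nn_integral_density) auto
qed

lemma pbar_nonneg: "pbar de y >= 0"
 unfolding pbar_def p_def by (intro Bochner_Integration.integral_nonneg f_nonneg)

lemma expectation_Y:
 fixes ph :: "real => real"
 assumes [measurable]: "ph \<in> borel_measurable borel"
 shows "expectation (\<lambda>om. ph (Yt j om)) = (LINT y|lborel. pbar 0 y * ph y)"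
proof -
 have "expectation (\<lambda>om. ph (Yt j om)) = (LINT y|distr M borel (Yt j). ph y)" by (simp add: integral_distr)
 then show ?thesis unfolding Yt_law' by (subst (asm) integral_density) (auto simp: pbar_nonneg)
qed

lemma nn_integral_Z:
 assumes ph[measurable]: "(\<lambda>(x, t). ph x t) \<in> borel_measurable borel"
 shows "(NNI M (\<lambda>om. ph (Xs k om) (es k om))) = (NNI M (\<lambda>om. \<integral>\<^sup>+t. ennreal (f t) * ph (Xt 0 om) t \<partial>lborel))"
proof -
 interpret D: sigma_finite_measure "density lborel (\<lambda>t. ennreal (f t))"
  by (intro prob_space_imp_sigma_finite prob_spaceI) (simp add: emeasure_density nn_integral_f)
 have ph2: "(\<lambda>(x, t). ph x t) \<in> borel_measurable (distr M borel (Xt 0) \<Otimes>\<^sub>M density lborel (\<lambda>t. ennreal (f t)))"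
  using ph by (simp flip: borel_prod cong: measurable_cong_sets)
 have "(NNI M (\<lambda>om. ph (Xs k om) (es k om))) = (NNI (distr M borel (\<lambda>om. (Xs k om, es k om))) (\<lambda>z. (\<lambda>(x, t). ph x t) z))"
  by (subst nn_integral_distr) (auto simp flip: borel_prod simp: ph[unfolded borel_prod[symmetric]])
 also have "... = (NNI (distr M borel (Xt 0)) (\<lambda>x. \<integral>\<^sup>+t. ph x t \<partial>density lborel (\<lambda>t. ennreal (f t))))"
  unfolding XE_law' by (subst D.nn_integral_fst[symmetric, OF ph2]) simp
 also have "... = (NNI (distr M borel (Xt 0)) (\<lambda>x. \<integral>\<^sup>+t. ennreal (f t) * ph x t \<partial>lborel))"
 proof (rule nn_integral_cong)
  fix x
  have "ph x \<in> borel_measurable lborel"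
   using measurable_compose[OF measurable_Pair1'[of x borel borel] ph[unfolded borel_prod[symmetric]]] by simp
  then show "(NNI (density lborel (\<lambda>t. ennreal (f t))) (\<lambda>t. ph x t)) = (NNI lborel (\<lambda>t. ennreal (f t) * ph x t))"
   by (intro nn_integral_density) auto
 qed
 also have "... = (NNI M (\<lambda>om. \<integral>\<^sup>+t. ennreal (f t) * ph (Xt 0 om) t \<partial>lborel))"
 proof (subst nn_integral_distr)
  have "(\<lambda>(x, t). ennreal (f t) * ph x t) \<in> borel_measurable (borel \<Otimes>\<^sub>M lborel)"
   using ph[unfolded borel_prod[symmetric]] by (simp add: split_beta' cong: measurable_cong_sets)
  then have "(\<lambda>x. \<integral>\<^sup>+t. ennreal (f t) * ph x t \<partial>lborel) \<in> borel_measurable borel"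
   by (rule lborel.borel_measurable_nn_integral)
  then show "(\<lambda>x. \<integral>\<^sup>+t. ennreal (f t) * ph x t \<partial>lborel) \<in> borel_measurable (distr M borel (Xt 0))"
   by simp
 qed auto
 finally show ?thesis .
qed

lemma nn_integral_e:
 assumes [measurable]: "ph \<in> borel_measurable borel"
 shows "(NNI M (\<lambda>om. ph (es k om))) = (NNI lborel (\<lambda>t. ennreal (f t) * ph t))"
proof -
 have "(\<lambda>(x::'v, t::real). ph t) \<in> borel_measurable borel" by (simp add: split_beta' flip: borel_prod)
 from nn_integral_Z[OF this, of k] show ?thesis by (simp add: emeasure_space_1)
qed

subsection \<open>Envelopes\<close>

text \<open>Unmatched terms evaluate g at y - (\<beta>0 + de) x, matched ones at t - de x; one
  \<open>L\<close> serves both and dominates the score as well. The comparison with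
  \<open>g y\<close> makes \<open>f y\<close> a common reference for all components of a
  mixture.\<close>

definition env :: "real => (real => real) => bool" where
 "env r L \<longleftrightarrow> L \<in> borel_measurable borel \<and> (\<forall>y. L y >= 0) \<and>
  (\<forall>de de' x y. norm de <= r --> norm de' <= r --> norm x <= B -->
   \<bar>g (y - (\<beta>0 + de) \<bullet> x) - g (y - (\<beta>0 + de') \<bullet> x)\<bar> <= norm (de - de') * L y \<and>
   \<bar>g (y - de \<bullet> x) - g (y - de' \<bullet> x)\<bar> <= norm (de - de') * L y \<and>
   \<bar>g (y - (\<beta>0 + de) \<bullet> x) - g y\<bar> <= L y) \<and>
  (\<forall>t x. norm x <= B --> B * \<bar>g' (t - \<beta>0 \<bullet> x)\<bar> <= L t) \<and> (\<forall>t. B * \<bar>g' t\<bar> <= L t) \<and>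
  (\<forall>k::nat. integrable lborel (\<lambda>y. exp (real k * L y - g y / 2)))"

lemma env_exists:
 assumes "r > 0"
 shows "\<exists>L. env r L"
proof -
 \<comment> \<open>Bound for every shift (\<beta>0 + de) x and de x that can occur.\<close>
 define R where "R = (norm \<beta>0 + r) * B"
 have R: "R > 0" using assms B by (simp add: R_def add_nonneg_pos)
 obtain La where La: "La \<in> borel_measurable borel" "\<And>y. La y >= 0"
  "\<And>y s s'. \<bar>s\<bar> <= R ==> \<bar>s'\<bar> <= R ==> \<bar>g (y - s) - g (y - s')\<bar> <= \<bar>s - s'\<bar> * La y"
  "\<And>k::nat. integrable lborel (\<lambda>y. exp (real k * La y - g y / 2))"
  using g_env[of R] by blast
 \<comment> \<open>An integer above R and B: exponential moments are assumed for natural multiples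
   of \<open>La\<close> only, so the envelope has to be such a multiple.\<close>
 define K where "K = nat \<lceil>max R B\<rceil>"
 have K: "R <= real K" "B <= real K" using R B by (auto simp: K_def max_def) linarith+
 define L where "L y = real K * La y" for y
 have bound: "\<bar>g (y - s) - g (y - s')\<bar> <= d * L y"
  if "\<bar>s\<bar> <= R" "\<bar>s'\<bar> <= R" "\<bar>s - s'\<bar> <= d * real K" for y s s' d
  using La(3)[OF that(1,2), of y] mult_right_mono[OF that(3) La(2)[of y]] by (simp add: L_def mult.assoc)
 have ip: "\<bar>de \<bullet> x\<bar> <= norm de * B" if "norm x <= B" for de x :: 'v
  using Cauchy_Schwarz_ineq2[of de x] mult_left_mono[OF that norm_ge_zero[of de]] by linarith
 have ipK: "\<bar>de \<bullet> x\<bar> <= norm de * real K" if "norm x <= B" for de x :: 'v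
  using ip[OF that, of de] mult_left_mono[OF K(2) norm_ge_zero[of de]] by linarith
 have R1: "\<bar>(\<beta>0 + de) \<bullet> x\<bar> <= R" if "norm x <= B" "norm de <= r" for de x
 proof -
  have "norm (\<beta>0 + de) * B <= R" unfolding R_def using B that norm_triangle_ineq[of \<beta>0 de] by (intro mult_right_mono) auto
  then show ?thesis using ip[OF that(1), of "\<beta>0 + de"] by linarith
 qed
 have R2: "\<bar>de \<bullet> x\<bar> <= R" if "norm x <= B" "norm de <= r" for de x :: 'v
 proof -
  have "norm de * B <= R" unfolding R_def using B that norm_ge_zero[of \<beta>0] by (intro mult_right_mono) linarith+
  then show ?thesis using ip[OF that(1), of de] by linarith
 qed
 \<comment> \<open>Difference quotients are bounded by \<open>La\<close>, and the bound passes to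
   their limit; at the kink it holds because g' is 0 there.\<close>
 have der: "B * \<bar>g' (t - s)\<bar> <= L t" if s: "\<bar>s\<bar> <= norm \<beta>0 * B" for t s
 proof (cases "t - s = 0")
  case True then show ?thesis using La(2) by (simp add: g'_0 L_def)
 next
  case False
  have "\<bar>g' (t - s)\<bar> <= La t"
  proof (rule tendsto_upperbound)
   show "((\<lambda>h. \<bar>(g (t - s + h) - g (t - s)) / h\<bar>) \<longlongrightarrow> \<bar>g' (t - s)\<bar>) (at 0)"
    using g_deriv[OF False, unfolded DERIV_def] by (rule tendsto_rabs)
   have "r * B > 0" using assms B by simp
   then have "\<forall>\<^sub>F h in at 0. \<bar>h\<bar> < r * B \<and> h \<noteq> 0"
    by (auto simp: eventually_at intro!: exI[of _ "r * B"] simp: dist_real_def)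
   then show "\<forall>\<^sub>F h in at 0. \<bar>(g (t - s + h) - g (t - s)) / h\<bar> <= La t"
   proof eventually_elim
    case (elim h)
    have "\<bar>s - h\<bar> <= R" "\<bar>s\<bar> <= R" using elim s assms B by (auto simp: R_def algebra_simps)
    from La(3)[OF this, of t] show ?case using elim
     by (simp add: abs_divide divide_le_eq mult.commute algebra_simps)
   qed
  qed simp
  then show ?thesis unfolding L_def using K B by (intro mult_mono) auto
 qed
 have "env r L"
  unfolding env_def
 proof (intro conjI allI impI)
  show "L \<in> borel_measurable borel" using La(1) unfolding L_def[abs_def] by measurable
  show "L y >= 0" for y using La(2) by (simp add: L_def)
  show "integrable lborel (\<lambda>y. exp (real k * L y - g y / 2))" for k
   using La(4)[of "k * K"] by (simp add: L_def mult.assoc)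
  show "B * \<bar>g' (t - \<beta>0 \<bullet> x)\<bar> <= L t" if "norm x <= B" for t x using ip[OF that] by (rule der)
  show "B * \<bar>g' t\<bar> <= L t" for t using der[of 0 t] B by simp
  fix de de' x :: 'v and y assume a: "norm de <= r" "norm de' <= r" "norm x <= B"
  show "\<bar>g (y - (\<beta>0 + de) \<bullet> x) - g (y - (\<beta>0 + de') \<bullet> x)\<bar> <= norm (de - de') * L y"
   using ipK[OF a(3), of "de - de'"] R1 a by (intro bound) (auto simp: inner_add_left inner_diff_left)
  show "\<bar>g (y - de \<bullet> x) - g (y - de' \<bullet> x)\<bar> <= norm (de - de') * L y"
   using ipK[OF a(3), of "de - de'"] R2 a by (intro bound) (auto simp: inner_diff_left)
  show "\<bar>g (y - (\<beta>0 + de) \<bullet> x) - g y\<bar> <= L y"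
   using bound[of "(\<beta>0 + de) \<bullet> x" 0 1 y] R1[OF a(3,1)] R K by simp
 qed
 then show ?thesis by blast
qed

end

text \<open>Radius one is enough for the local analysis, where deviations shrink to zero. Confining
  the maximizer takes a larger radius, with an envelope of its own.\<close>

locale ssl_env = ssl M g g' \<beta>0 B Xt Yt Xs es
 for M :: "'a measure" and g g' :: "real => real" and \<beta>0 :: "'v::euclidean_space" and B :: real
  and Xt :: "nat => 'a => 'v" and Yt :: "nat => 'a => real"
  and Xs :: "nat => 'a => 'v" and es :: "nat => 'a => real" +
 fixes L :: "real => real"
 assumes env1: "env 1 L"
begin

lemma L_meas[measurable]: "L \<in> borel_measurable borel" and L_nonneg: "L y >= 0"
 using env1 by (auto simp: env_def)

lemma L_lip: "[|norm de <= 1; norm x <= B|] ==> \<bar>g (y - (\<beta>0 + de) \<bullet> x) - g (y - \<beta>0 \<bullet> x)\<bar> <= norm de * L y"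
 and L_lip0: "[|norm de <= 1; norm x <= B|] ==> \<bar>g (y - de \<bullet> x) - g y\<bar> <= norm de * L y"
 and L_center: "[|norm de <= 1; norm x <= B|] ==> \<bar>g (y - (\<beta>0 + de) \<bullet> x) - g y\<bar> <= L y"
 and L_score: "B * \<bar>g' t\<bar> <= L t"
 and L_score_shift: "norm x <= B ==> B * \<bar>g' (t - \<beta>0 \<bullet> x)\<bar> <= L t"
proof -
 have *: "norm de <= 1 ==> norm de' <= 1 ==> norm x <= B ==>
   \<bar>g (y - (\<beta>0 + de) \<bullet> x) - g (y - (\<beta>0 + de') \<bullet> x)\<bar> <= norm (de - de') * L y \<and>
   \<bar>g (y - de \<bullet> x) - g (y - de' \<bullet> x)\<bar> <= norm (de - de') * L y \<and>
   \<bar>g (y - (\<beta>0 + de) \<bullet> x) - g y\<bar> <= L y" for de' using env1 by (auto simp: env_def)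
 show "[|norm de <= 1; norm x <= B|] ==> \<bar>g (y - (\<beta>0 + de) \<bullet> x) - g (y - \<beta>0 \<bullet> x)\<bar> <= norm de * L y"
  "[|norm de <= 1; norm x <= B|] ==> \<bar>g (y - de \<bullet> x) - g y\<bar> <= norm de * L y"
  "[|norm de <= 1; norm x <= B|] ==> \<bar>g (y - (\<beta>0 + de) \<bullet> x) - g y\<bar> <= L y"
  using *[of 0] by auto
 show "B * \<bar>g' t\<bar> <= L t" "norm x <= B ==> B * \<bar>g' (t - \<beta>0 \<bullet> x)\<bar> <= L t" using env1 by (auto simp: env_def)
qed

text \<open>Bookkeeping: pointwise bounds are kept as multiples of \<open>ex k\<close>, exponents
  add under products, and \<open>J k\<close> is the corresponding moment. The numerals attached to
  \<open>ex\<close> and \<open>J\<close> below are counts of such factors.\<close>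

definition ex :: "nat => real => real" where "ex k y = exp (real k * L y)"

lemma ex_meas[measurable]: "ex k \<in> borel_measurable borel" unfolding ex_def[abs_def] by measurable

lemma ex_mult: "ex a y * ex b y = ex (a + b) y" by (simp add: ex_def exp_add[symmetric] algebra_simps)
lemma ex_mult_left: "ex a y * (ex b y * c) = ex (a + b) y * c" using ex_mult[of a y b] by simp
lemma ex_power: "ex a y ^ k = ex (k * a) y" by (simp add: ex_def exp_of_nat_mult[symmetric] mult_ac)
lemma ex_ge_1: "1 <= ex k y" by (simp add: ex_def L_nonneg)
lemma ex_pos: "0 < ex k y" and ex_nonneg: "0 <= ex k y" by (simp_all add: ex_def)
lemma ex_mono: "a <= b ==> ex a y <= ex b y" by (simp add: ex_def L_nonneg mult_right_mono)
lemma L_le_ex: "L y <= ex 1 y" proof -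
 have "L y <= exp (L y)" using exp_ge_add_one_self[of "L y"] by linarith
 then show ?thesis by (simp add: ex_def)
qed

definition J :: "nat => real" where "J k = (LINT y|lborel. ex k y * f y)"

lemma J_int: "integrable lborel (\<lambda>y. ex k y * f y)"
proof -
 obtain C where C: "\<And>t. - C <= g t" using g_bounded_below by blast
 have "integrable lborel (\<lambda>y. exp (real k * L y - g y / 2))" using env1 by (auto simp: env_def)
 then have "integrable lborel (\<lambda>y. exp (C / 2) * exp (real k * L y - g y / 2))" by simp
 then show ?thesis
 proof (rule Bochner_Integration.integrable_bound)
  show "AE y in lborel. norm (ex k y * f y) <= norm (exp (C / 2) * exp (real k * L y - g y / 2))"
  proof (rule AE_I2)
   fix y
   have "real k * L y - g y <= C / 2 + (real k * L y - g y / 2)" using C[of y] by simp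
   then show "norm (ex k y * f y) <= norm (exp (C / 2) * exp (real k * L y - g y / 2))"
    by (simp add: ex_def f_def flip: exp_add)
  qed
 qed simp
qed

lemma J_nonneg: "J k >= 0"
 unfolding J_def by (intro Bochner_Integration.integral_nonneg mult_nonneg_nonneg ex_nonneg f_nonneg)

lemma nn_J: "(NNI lborel (\<lambda>y. ennreal (ex k y * f y))) = ennreal (J k)"
 unfolding J_def by (rule nn_integral_eq_integral[OF J_int]) (auto simp: ex_nonneg f_nonneg)

lemma nn_J_cmult: "c >= 0 ==> (NNI lborel (\<lambda>y. ennreal (c * (ex k y * f y)))) = ennreal (c * J k)"
proof -
 assume c: "c >= 0"
 have "(NNI lborel (\<lambda>y. ennreal (c * (ex k y * f y)))) = (NNI lborel (\<lambda>y. ennreal c * ennreal (ex k y * f y)))"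
  using c by (intro nn_integral_cong ennreal_mult) (auto simp: ex_nonneg f_nonneg)
 also have "... = ennreal c * ennreal (J k)" by (subst nn_integral_cmult) (auto simp only: nn_J, measurable)
 also have "... = ennreal (c * J k)" using c J_nonneg by (intro ennreal_mult[symmetric])
 finally show ?thesis .
qed

lemma J_int_cmult: "integrable lborel (\<lambda>y. c * (ex k y * f y))"
 by (intro integrable_mult_right J_int)

lemma integrable_J_bound:
 assumes "ph \<in> borel_measurable borel" "\<And>y. \<bar>ph y\<bar> <= c * (ex k y * f y)"
 shows "integrable lborel ph"
 by (rule Bochner_Integration.integrable_bound[OF J_int_cmult[of c k]])
  (use assms in \<open>auto intro!: AE_I2 order_trans[OF _ abs_ge_self]\<close>)

lemma p_pos: "0 < p de x y" by (simp add: p_def f_pos)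

lemma p_le: "[|norm de <= 1; norm x <= B|] ==> p de x y <= ex 1 y * f y"
 and p_ge: "[|norm de <= 1; norm x <= B|] ==> f y <= ex 1 y * p de x y"
proof -
 assume "norm de <= 1" "norm x <= B"
 then have "\<bar>g (y - (\<beta>0 + de) \<bullet> x) - g y\<bar> <= L y" by (rule L_center)
 then have "- g (y - (\<beta>0 + de) \<bullet> x) <= L y + - g y" "- g y <= L y + - g (y - (\<beta>0 + de) \<bullet> x)" by auto
 then show "p de x y <= ex 1 y * f y" "f y <= ex 1 y * p de x y"
  unfolding p_def f_def ex_def of_nat_1 mult_1 exp_add[symmetric] by simp_all
qed

text \<open>The log ratio is at most |de| L. The third bound is relative to \<open>p 0\<close>, so
  it survives averaging over covariates and holds for the mean and the empirical mixture with the
  same constant.\<close>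

lemma p_ratio:
 assumes "norm de <= 1" "norm x <= B"
 shows "p de x y <= exp (norm de * L y) * p 0 x y" "p 0 x y <= exp (norm de * L y) * p de x y"
  "\<bar>p de x y - p 0 x y\<bar> <= norm de * ex 2 y * p 0 x y"
proof -
 define l where "l = g (y - \<beta>0 \<bullet> x) - g (y - (\<beta>0 + de) \<bullet> x)"
 have l: "\<bar>l\<bar> <= norm de * L y" using L_lip[OF assms, of y] by (simp add: l_def abs_minus_commute)
 have eq: "p de x y = p 0 x y * exp l" by (simp add: p_def f_def l_def flip: exp_add)
 have "exp l <= exp (norm de * L y)" "1 <= exp (norm de * L y) * exp l" using l by (auto simp flip: exp_add)
 then show "p de x y <= exp (norm de * L y) * p 0 x y" "p 0 x y <= exp (norm de * L y) * p de x y"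
  using mult_left_mono[of _ _ "p 0 x y"] p_pos[of 0 x y] unfolding eq by (auto simp: mult_ac)
 have "norm de * L y <= 1 * L y" using assms L_nonneg by (intro mult_right_mono) auto
 then have l2: "exp \<bar>l\<bar> <= ex 1 y" using l by (simp add: ex_def)
 have l1: "\<bar>l\<bar> <= norm de * ex 1 y" using l mult_left_mono[OF L_le_ex[of y] norm_ge_zero[of de]] by linarith
 have "\<bar>l\<bar> * exp \<bar>l\<bar> <= (norm de * ex 1 y) * ex 1 y"
  using ex_nonneg by (intro mult_mono l1 l2) auto
 also have "... = norm de * ex 2 y" by (simp add: mult.assoc ex_mult numeral_2_eq_2)
 finally have "\<bar>exp l - 1\<bar> <= norm de * ex 2 y" using abs_exp_minus_one_le[of l] by linarith
 then have "p 0 x y * \<bar>exp l - 1\<bar> <= p 0 x y * (norm de * ex 2 y)" using p_pos[of 0 x y] by (intro mult_left_mono) auto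
 moreover have "p de x y - p 0 x y = p 0 x y * (exp l - 1)" by (simp add: eq algebra_simps)
 ultimately show "\<bar>p de x y - p 0 x y\<bar> <= norm de * ex 2 y * p 0 x y"
  using p_pos[of 0 x y] by (simp add: abs_mult mult_ac)
qed

lemma p_abs_le: "[|norm de <= 1; norm x <= B|] ==> \<bar>p de x y\<bar> <= ex 1 y * f y"
 using p_le[of de x y] p_pos[of de x y] by simp

lemma p_diff_abs:
 assumes "norm de <= 1" "norm x <= B"
 shows "\<bar>p de x y - p 0 x y\<bar> <= norm de * (ex 3 y * f y)"
proof -
 have "norm de * ex 2 y * p 0 x y <= norm de * ex 2 y * (ex 1 y * f y)"
  using assms ex_nonneg by (intro mult_left_mono p_le) auto
 also have "... = norm de * (ex 3 y * f y)" by (simp add: mult.assoc ex_mult_left)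
 finally show ?thesis using p_ratio(3)[OF assms, of y] by linarith
qed

lemma p_integrable: "norm de <= 1 ==> integrable M (\<lambda>om. p de (Xt i om) y)"
 using p_abs_le[OF _ Xt_le] by (intro integrable_const_bound[where B="ex 1 y * f y"]) auto

lemma integral_p: "(LINT y|lborel. p de x y) = 1" and integrable_p: "integrable lborel (p de x)"
 and nn_integral_p: "(NNI lborel (\<lambda>y. ennreal (p de x y))) = 1"
 using integral_f_shift integrable_f_shift nn_integral_f_shift by (simp_all add: p_def[abs_def])

lemma pbar_le: "norm de <= 1 ==> pbar de y <= ex 1 y * f y"
 unfolding pbar_def using p_le[OF _ Xt_le] p_integrable
 by (intro integral_le_const) auto

lemma pbar_ge: "norm de <= 1 ==> f y <= ex 1 y * pbar de y"
proof -
 assume d: "norm de <= 1"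
 have "f y = expectation (\<lambda>om. f y)" by (simp add: prob_space)
 also have "... <= expectation (\<lambda>om. ex 1 y * p de (Xt 0 om) y)"
  using p_ge[OF d Xt_le] p_integrable[OF d] by (intro integral_mono) auto
 finally show ?thesis by (simp add: pbar_def)
qed

lemma pbar_pos: "norm de <= 1 ==> pbar de y > 0"
 using pbar_ge[of de y] f_pos[of y] ex_pos[of 1 y] by (metis less_le_trans zero_less_mult_pos)

lemma pbar_diff: "norm de <= 1 ==> \<bar>pbar de y - pbar 0 y\<bar> <= norm de * ex 2 y * pbar 0 y"
proof -
 assume d: "norm de <= 1"
 have "pbar de y - pbar 0 y = expectation (\<lambda>om. p de (Xt 0 om) y - p 0 (Xt 0 om) y)"
  unfolding pbar_def using p_integrable[OF d] p_integrable[of 0] by simp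
 also have "\<bar>...\<bar> <= expectation (\<lambda>om. norm de * ex 2 y * p 0 (Xt 0 om) y)"
  using p_integrable[OF d] p_integrable[of 0] p_ratio(3)[OF d Xt_le]
  by (intro order_trans[OF integral_abs_bound] integral_mono) auto
 also have "... = norm de * ex 2 y * pbar 0 y" by (simp add: pbar_def)
 finally show ?thesis .
qed

lemma nn_integral_pbar:
 assumes "norm de <= 1"
 shows "(NNI lborel (\<lambda>y. ennreal (pbar de y))) = 1"
proof -
 interpret PL: pair_sigma_finite M "lborel :: real measure" by standard
 have "(NNI lborel (\<lambda>y. ennreal (pbar de y))) = (NNI lborel (\<lambda>y. \<integral>\<^sup>+om. ennreal (p de (Xt 0 om) y) \<partial>M))"
  unfolding pbar_def using p_pos p_integrable[OF assms]
  by (intro nn_integral_cong nn_integral_eq_integral[symmetric]) (auto intro!: AE_I2 less_imp_le)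
 also have "... = (NNI M (\<lambda>om. \<integral>\<^sup>+y. ennreal (p de (Xt 0 om) y) \<partial>lborel))"
  by (rule PL.Fubini') measurable
 finally show ?thesis by (simp add: nn_integral_p emeasure_space_1)
qed

lemma integrable_pbar: "norm de <= 1 ==> integrable lborel (pbar de)"
 and integral_pbar: "norm de <= 1 ==> (LINT y|lborel. pbar de y) = 1"
proof -
 assume d: "norm de <= 1"
 show i: "integrable lborel (pbar de)"
  by (rule integrableI_bounded) (use pbar_nonneg nn_integral_pbar[OF d] in auto)
 have "ennreal (LINT y|lborel. pbar de y) = 1"
  using nn_integral_eq_integral[OF i] pbar_nonneg nn_integral_pbar[OF d] by simp
 then show "(LINT y|lborel. pbar de y) = 1"
  by (metis ennreal_1 ennreal_inj ennreal_neg linorder_le_cases zero_neq_one zero_le_one)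
qed

lemma fubini_M_lborel:
 assumes "(\<lambda>(om, y). F om y) \<in> borel_measurable (M \<Otimes>\<^sub>M lborel)"
 shows "(NNI M (\<lambda>om. \<integral>\<^sup>+y. F om y \<partial>lborel)) = (NNI ((lborel :: real measure)) (\<lambda>y. \<integral>\<^sup>+om. F om y \<partial>M))"
proof -
 interpret PL: pair_sigma_finite M "lborel :: real measure" by standard
 show ?thesis using PL.Fubini'[OF assms] by simp
qed

text \<open>The exponent rises by one because the density of a response is at most
  \<open>ex 1 y * f y\<close>.\<close>

lemma nn_Y_bound:
 assumes "ph \<in> borel_measurable borel" "\<And>y. ph y <= c * ex k y" "c >= 0"
 shows "(NNI M (\<lambda>om. ennreal (ph (Yt j om)))) <= ennreal (c * J (Suc k))"
proof -
 have "(NNI M (\<lambda>om. ennreal (ph (Yt j om)))) = (NNI lborel (\<lambda>y. ennreal (pbar 0 y) * ennreal (ph y)))"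
  using assms(1) by (intro nn_integral_Y) simp
 also have "... <= (NNI lborel (\<lambda>y. ennreal (c * (ex (Suc k) y * f y))))"
 proof (rule nn_integral_mono)
  fix y
  have "ennreal (pbar 0 y) * ennreal (ph y) <= ennreal (ex 1 y * f y) * ennreal (c * ex k y)"
   using assms(2) pbar_le[of 0 y] by (intro mult_mono ennreal_leI) auto
  also have "... = ennreal (c * (ex (Suc k) y * f y))"
   using assms(3) ex_nonneg f_nonneg ex_mult[of 1 y k] by (simp flip: ennreal_mult add: mult_ac)
  finally show "ennreal (pbar 0 y) * ennreal (ph y) <= ennreal (c * (ex (Suc k) y * f y))" .
 qed
 finally show ?thesis using nn_J_cmult[OF assms(3)] by simp
qed

lemma nn_e_bound:
 assumes "ph \<in> borel_measurable borel" "\<And>y. ph y <= c * ex k y" "c >= 0"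
 shows "(NNI M (\<lambda>om. ennreal (ph (es j om)))) <= ennreal (c * J k)"
proof -
 have "(NNI M (\<lambda>om. ennreal (ph (es j om)))) = (NNI lborel (\<lambda>y. ennreal (f y) * ennreal (ph y)))"
  using assms(1) by (intro nn_integral_e) simp
 also have "... <= (NNI lborel (\<lambda>y. ennreal (c * (ex k y * f y))))"
 proof (rule nn_integral_mono)
  fix y
  have "ennreal (f y) * ennreal (ph y) <= ennreal (f y) * ennreal (c * ex k y)"
   using assms(2) by (intro mult_left_mono ennreal_leI) auto
  also have "... = ennreal (c * (ex k y * f y))"
   using assms(3) ex_nonneg f_nonneg by (simp flip: ennreal_mult add: mult_ac)
  finally show "ennreal (f y) * ennreal (ph y) <= ennreal (c * (ex k y * f y))" .
 qed
 finally show ?thesis using nn_J_cmult[OF assms(3)] by simp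
qed

lemma integrable_Y_bound:
 assumes [measurable]: "ph \<in> borel_measurable borel" and "\<And>y. \<bar>ph y\<bar> <= c * ex k y"
 shows "integrable M (\<lambda>om. ph (Yt j om))"
proof (rule integrableI_bounded)
 have "c >= 0" using assms(2)[of 0] ex_pos[of k 0] by (metis abs_ge_zero order_trans zero_le_mult_iff not_le)
 from nn_Y_bound[of "\<lambda>y. \<bar>ph y\<bar>", OF _ assms(2) this, of j]
 show "(NNI M (\<lambda>om. ennreal (norm (ph (Yt j om))))) < \<infinity>" by (auto simp: less_top[symmetric] top_unique)
qed simp

lemma integrable_e_bound:
 assumes [measurable]: "(\<lambda>(x, t). ph x t) \<in> borel_measurable (borel \<Otimes>\<^sub>M borel)"
  and "\<And>x y. norm x <= B ==> \<bar>ph x y\<bar> <= c * ex k y"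
 shows "integrable M (\<lambda>om. ph (Xs j om) (es j om))"
proof (rule Bochner_Integration.integrable_bound)
 have "integrable M (\<lambda>om. ex k (es j om))"
 proof (rule integrableI_bounded)
  from nn_e_bound[of "ex k" 1 k j]
  show "(NNI M (\<lambda>om. ennreal (norm (ex k (es j om))))) < \<infinity>" using ex_nonneg by (auto simp: less_top[symmetric] top_unique)
 qed simp
 then show "integrable M (\<lambda>om. c * ex k (es j om))" by simp
 have "(\<lambda>om. (\<lambda>(x, t). ph x t) (Xs j om, es j om)) \<in> borel_measurable M" by measurable
 then show "(\<lambda>om. ph (Xs j om) (es j om)) \<in> borel_measurable M" by simp
 show "AE om in M. norm (ph (Xs j om) (es j om)) <= norm (c * ex k (es j om))"
  using assms(2)[OF Xs_le] by (auto intro!: AE_I2 order_trans[OF _ abs_ge_self])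
qed

subsection \<open>The empirical mixture density\<close>

lemma av_meas[measurable (raw)]:
 assumes [measurable]: "\<And>i. (\<lambda>om. x om i) \<in> borel_measurable N" "y \<in> borel_measurable N"
 shows "(\<lambda>om. av n de (x om) (y om)) \<in> borel_measurable N"
 unfolding av_def by measurable

text \<open>Likelihood ratio minus one, here for the empirical mixture and in \<open>zb\<close> for
  its mean.\<close>

definition z :: "nat => 'v => (nat => 'v) => real => real" where
 "z n de x y = (av n de x y - av n 0 x y) / av n 0 x y"

definition zb :: "'v => real => real" where "zb de y = (pbar de y - pbar 0 y) / pbar 0 y"

lemma z_meas[measurable (raw)]:
 assumes [measurable]: "\<And>i. (\<lambda>om. x om i) \<in> borel_measurable N" "y \<in> borel_measurable N"
 shows "(\<lambda>om. z n de (x om) (y om)) \<in> borel_measurable N"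
 unfolding z_def by measurable

lemma zb_meas[measurable]: "zb de \<in> borel_measurable borel" unfolding zb_def[abs_def] by measurable

lemma zb_abs: "norm de <= 1 ==> \<bar>zb de y\<bar> <= norm de * ex 2 y"
 using pbar_diff[of de y] pbar_pos[of 0 y] by (simp add: zb_def abs_divide divide_le_eq)

context
 fixes n :: nat and de :: 'v
 assumes n: "n > 0" and d: "norm de <= 1"
begin

context
 fixes x :: "nat => 'v"
 assumes x: "\<And>i. norm (x i) <= B"
begin

lemma av_pos: "av n et x y > 0"
 unfolding av_def using n p_pos by (intro divide_pos_pos sum_pos) auto

lemma av_le: "norm et <= 1 ==> av n et x y <= ex 1 y * f y"
 unfolding av_def using n sum_bounded_above[of "{..<n}" "\<lambda>i. p et (x i) y" "ex 1 y * f y"] p_le[OF _ x]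
 by (simp add: divide_le_eq mult.commute)

lemma av_ge: "f y <= ex 1 y * av n 0 x y"
proof -
 have "real n * f y <= (\<Sum>i<n. ex 1 y * p 0 (x i) y)"
  using sum_bounded_below[of "{..<n}" "f y" "\<lambda>i. ex 1 y * p 0 (x i) y"] p_ge[OF _ x, of 0] by simp
 then show ?thesis using n by (simp add: av_def sum_distrib_left[symmetric] field_simps)
qed

lemma av_ratio: "\<bar>av n de x y - av n 0 x y\<bar> <= norm de * ex 2 y * av n 0 x y"
 "\<bar>ln (av n de x y / av n 0 x y)\<bar> <= norm de * L y"
proof -
 have "\<bar>\<Sum>i<n. p de (x i) y - p 0 (x i) y\<bar> <= (\<Sum>i<n. norm de * ex 2 y * p 0 (x i) y)"
  using p_ratio(3)[OF d x] by (intro order_trans[OF sum_abs] sum_mono)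
 then show "\<bar>av n de x y - av n 0 x y\<bar> <= norm de * ex 2 y * av n 0 x y"
  using n by (simp add: av_def sum_subtractf sum_distrib_left[symmetric] diff_divide_distrib[symmetric] abs_divide divide_right_mono)
 have "(\<Sum>i<n. p de (x i) y) <= (\<Sum>i<n. exp (norm de * L y) * p 0 (x i) y)"
  "(\<Sum>i<n. p 0 (x i) y) <= (\<Sum>i<n. exp (norm de * L y) * p de (x i) y)"
  using p_ratio(1,2)[OF d x] by (auto intro!: sum_mono)
 then have le: "av n de x y <= exp (norm de * L y) * av n 0 x y" "av n 0 x y <= exp (norm de * L y) * av n de x y"
  using n by (auto simp: av_def sum_distrib_left[symmetric] divide_right_mono)
 have "ln (av n de x y) <= ln (exp (norm de * L y) * av n 0 x y)" "ln (av n 0 x y) <= ln (exp (norm de * L y) * av n de x y)"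
  using le av_pos by (auto simp: ln_mono)
 then show "\<bar>ln (av n de x y / av n 0 x y)\<bar> <= norm de * L y"
  using av_pos[of de y] av_pos[of 0 y] by (simp add: ln_mult ln_div)
qed

lemma z_abs: "\<bar>z n de x y\<bar> <= norm de * ex 2 y"
 using av_ratio(1)[of y] av_pos[of 0 y] by (simp add: z_def abs_divide divide_le_eq)

text \<open>Over the denominator \<open>pbar 0 y\<close> the difference has the numerator D - e: the
  error of the density increment minus z times the error of the denominator. Both are small in |de|.
  The factor in front comes from the lower bound \<open>f y / ex 1 y\<close> for the
  denominator.\<close>

lemma z_diff_sq:
 "(z n de x y - zb de y)^2 <= 2 * ex 2 y / (f y)^2 *
  (((av n de x y - av n 0 x y) - (pbar de y - pbar 0 y))^2 + (norm de * ex 2 y)^2 * (av n 0 x y - pbar 0 y)^2)"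
proof -
 define D where "D = (av n de x y - av n 0 x y) - (pbar de y - pbar 0 y)"
 define e where "e = z n de x y * (av n 0 x y - pbar 0 y)"
 have A: "pbar 0 y > 0" and a: "av n 0 x y > 0" using pbar_pos[of 0] av_pos by auto
 have "z n de x y - zb de y = (D - e) / pbar 0 y"
  using A a by (simp add: z_def zb_def D_def e_def field_simps)
 then have "(z n de x y - zb de y)^2 = (D - e)^2 / (pbar 0 y)^2" by (simp add: power_divide)
 also have "... <= (2 * (D^2 + e^2)) / (f y / ex 1 y)^2"
 proof (rule frac_le)
  show "(D - e)^2 <= 2 * (D^2 + e^2)" using zero_le_power2[of "D + e"] by (simp add: power2_eq_square algebra_simps)
  show "(f y / ex 1 y)^2 <= (pbar 0 y)^2"
   using pbar_ge[of 0 y] ex_pos[of 1 y] f_pos[of y] by (intro power_mono) (auto simp: divide_le_eq mult.commute)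
  show "0 < (f y / ex 1 y)^2" using ex_pos[of 1 y] f_pos[of y] by simp
 qed auto
 also have "... = 2 * ex 2 y / (f y)^2 * (D^2 + e^2)"
  using ex_mult[of 1 y 1] by (simp add: power_divide power2_eq_square numeral_2_eq_2)
 also have "... <= 2 * ex 2 y / (f y)^2 * (D^2 + (norm de * ex 2 y)^2 * (av n 0 x y - pbar 0 y)^2)"
 proof (intro mult_left_mono add_left_mono)
  have "\<bar>z n de x y\<bar>\<^sup>2 <= (norm de * ex 2 y)^2" by (intro power_mono z_abs) simp
  then show "e^2 <= (norm de * ex 2 y)^2 * (av n 0 x y - pbar 0 y)^2"
   unfolding e_def power_mult_distrib by (intro mult_right_mono) auto
 qed (use ex_nonneg in simp)
 finally show ?thesis by (simp add: D_def)
qed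

end

lemma mean_sq_X:
 assumes [measurable]: "ph \<in> borel_measurable borel" and "\<And>i om. \<bar>ph (Xt i om)\<bar> <= K"
 shows "(NNI M (\<lambda>om. ennreal (((\<Sum>i<n. ph (Xt i om)) / real n - expectation (\<lambda>om. ph (Xt 0 om)))^2))) <= ennreal (K^2 / real n)"
proof -
 have sq: "(ph (Xt i om))^2 <= K^2" for i om using power_mono[OF assms(2) abs_ge_zero, of i om 2] by simp
 have int: "integrable M (\<lambda>om. (ph (Xt 0 om))^2)" using sq by (intro integrable_const_bound[where B="K^2"]) auto
 have eq: "((\<Sum>i<n. ph (Xt i om)) / real n - expectation (\<lambda>om. ph (Xt 0 om)))^2
  = 1 / (real n)^2 * (\<Sum>i<n. ph (Xt i om) - expectation (\<lambda>om. ph (Xt 0 om)))^2" for om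
  using n by (simp add: sum_subtractf power_divide[symmetric] diff_divide_distrib)
 have "(NNI M (\<lambda>om. ennreal (((\<Sum>i<n. ph (Xt i om)) / real n - expectation (\<lambda>om. ph (Xt 0 om)))^2)))
  = ennreal (1 / (real n)^2) * (NNI M (\<lambda>om. ennreal ((\<Sum>i<n. ph (Xt i om) - expectation (\<lambda>om. ph (Xt 0 om)))^2)))"
  unfolding eq by (subst nn_integral_cmult[symmetric]) (auto simp flip: ennreal_mult)
 also have "... <= ennreal (1 / (real n)^2) * ennreal (real n * expectation (\<lambda>om. (ph (Xt 0 om))^2))"
  by (intro mult_left_mono iid_mean_sq[OF iid_X Xt_law _ int]) auto
 also have "... <= ennreal (1 / (real n)^2) * ennreal (real n * K^2)"
  using sq int by (intro mult_left_mono ennreal_leI integral_le_const) auto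
 also have "... = ennreal (K^2 / real n)" using n
  by (subst ennreal_mult[symmetric]) (auto simp: power2_eq_square)
 finally show ?thesis .
qed

lemma av_mean_sq: "(NNI M (\<lambda>om. ennreal ((av n 0 (XS om) y - pbar 0 y)^2))) <= ennreal (ex 2 y * (f y)^2 / real n)"
proof -
 have "(NNI M (\<lambda>om. ennreal (((\<Sum>i<n. p 0 (Xt i om) y) / real n - expectation (\<lambda>om. p 0 (Xt 0 om) y))^2)))
  <= ennreal ((ex 1 y * f y)^2 / real n)"
  by (rule mean_sq_X) (use p_abs_le[OF _ Xt_le, of 0] in auto)
 then show ?thesis by (simp add: av_def pbar_def power_mult_distrib ex_power)
qed

lemma av_diff_mean_sq:
 "(NNI M (\<lambda>om. ennreal (((av n de (XS om) y - av n 0 (XS om) y) - (pbar de y - pbar 0 y))^2)))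
  <= ennreal ((norm de)^2 * ex 6 y * (f y)^2 / real n)"
proof -
 have "(NNI M (\<lambda>om. ennreal (((\<Sum>i<n. p de (Xt i om) y - p 0 (Xt i om) y) / real n
   - expectation (\<lambda>om. p de (Xt 0 om) y - p 0 (Xt 0 om) y))^2)))
  <= ennreal ((norm de * (ex 3 y * f y))^2 / real n)"
  by (rule mean_sq_X) (use p_diff_abs[OF d Xt_le] in auto)
 then show ?thesis
  using p_integrable[OF d] p_integrable[of 0]
  by (simp add: av_def pbar_def power_mult_distrib ex_power sum_subtractf diff_divide_distrib mult.assoc)
qed

text \<open>The errors in \<open>z_diff_sq\<close> are centred means of n independent bounded terms,
  and each carries a factor |de|. This gives order |de| / sqrt n in quadratic mean, for each fixed
  y.\<close>

lemma z_mean_sq: "(NNI M (\<lambda>om. ennreal ((z n de (XS om) y - zb de y)^2))) <= ennreal (4 * (norm de)^2 * ex 8 y / real n)"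
proof -
 define c where "c = 2 * ex 2 y / (f y)^2"
 have c: "c >= 0" using ex_nonneg by (simp add: c_def)
 define e where "e = (norm de * ex 2 y)^2"
 have e: "e >= 0" by (simp add: e_def)
 let ?D = "\<lambda>om. ((av n de (XS om) y - av n 0 (XS om) y) - (pbar de y - pbar 0 y))^2" and ?d = "\<lambda>om. (av n 0 (XS om) y - pbar 0 y)^2"
 have "(NNI M (\<lambda>om. ennreal ((z n de (XS om) y - zb de y)^2))) <= (NNI M (\<lambda>om. ennreal c * (ennreal (?D om) + ennreal e * ennreal (?d om))))"
  using z_diff_sq[OF Xt_le, of "\<lambda>i. i" _ y for y] c e
  by (intro nn_integral_mono) (simp flip: ennreal_mult ennreal_plus add: c_def e_def z_diff_sq[OF Xt_le] ennreal_leI)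
 also have "... = ennreal c * ((NNI M (\<lambda>om. ennreal (?D om))) + ennreal e * (NNI M (\<lambda>om. ennreal (?d om))))"
  by (subst nn_integral_cmult, simp) (subst nn_integral_add; simp add: nn_integral_cmult)
 also have "... <= ennreal c * (ennreal ((norm de)^2 * ex 6 y * (f y)^2 / real n) + ennreal e * ennreal (ex 2 y * (f y)^2 / real n))"
  by (intro mult_left_mono add_mono av_mean_sq av_diff_mean_sq) auto
 also have "... = ennreal (c * ((norm de)^2 * ex 6 y * (f y)^2 / real n + e * (ex 2 y * (f y)^2 / real n)))"
  using c e ex_nonneg by (simp flip: ennreal_mult ennreal_plus)
 also have "c * ((norm de)^2 * ex 6 y * (f y)^2 / real n + e * (ex 2 y * (f y)^2 / real n)) =
   2 * (norm de)^2 * (ex 2 y * ex 6 y + ex 2 y * (ex 2 y ^ 2 * ex 2 y)) / real n"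
  using f_pos[of y] n by (simp add: c_def e_def field_simps power_mult_distrib)
 also have "... = 4 * (norm de)^2 * ex 8 y / real n"
  by (simp add: ex_mult ex_power)
 finally show ?thesis .
qed

lemma z_cross: "(NNI M (\<lambda>om. ennreal (\<bar>z n de (XS om) y - zb de y\<bar> * \<bar>av n 0 (XS om) y - pbar 0 y\<bar>)))
  <= ennreal (5 / 2 * norm de * ex 8 y * f y / real n)"
proof (cases "de = 0")
 case True
 then show ?thesis by (simp add: z_def zb_def)
next
 case False
 \<comment> \<open>Weights with 4 c e = 1, so that c times the bound of order |de|^2 for the first
   factor and e times the bound of order (f y)^2 for the second are both of order |de| f y.\<close>
 define c where "c = f y / (2 * norm de)"
 define e where "e = norm de / (2 * f y)"
 have ce: "c > 0" "e > 0" "4 * c * e = 1" using False f_pos[of y] by (auto simp: c_def e_def)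
 have amgm: "u * v <= c * u^2 + e * v^2" for u v
 proof -
  have "0 <= (2 * c * u - v)^2 / (4 * c)" using ce by simp
  also have "... = c * u^2 - u * v + v^2 / (4 * c)" using ce by (simp add: power2_eq_square field_simps)
  also have "v^2 / (4 * c) = e * v^2" using ce by (simp add: field_simps)
  finally show ?thesis by simp
 qed
 have "(NNI M (\<lambda>om. ennreal (\<bar>z n de (XS om) y - zb de y\<bar> * \<bar>av n 0 (XS om) y - pbar 0 y\<bar>)))
  <= (NNI M (\<lambda>om. ennreal c * ennreal ((z n de (XS om) y - zb de y)^2) + ennreal e * ennreal ((av n 0 (XS om) y - pbar 0 y)^2)))"
  using amgm[of "\<bar>z n de (XS om) y - zb de y\<bar>" "\<bar>av n 0 (XS om) y - pbar 0 y\<bar>" for om] ce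
  by (intro nn_integral_mono) (simp flip: ennreal_mult ennreal_plus add: ennreal_leI)
 also have "... = ennreal c * (NNI M (\<lambda>om. ennreal ((z n de (XS om) y - zb de y)^2))) + ennreal e * (NNI M (\<lambda>om. ennreal ((av n 0 (XS om) y - pbar 0 y)^2)))"
  by (subst nn_integral_add) (auto simp: nn_integral_cmult)
 also have "... <= ennreal c * ennreal (4 * (norm de)^2 * ex 8 y / real n) + ennreal e * ennreal (ex 2 y * (f y)^2 / real n)"
  by (intro add_mono mult_left_mono z_mean_sq av_mean_sq) auto
 also have "... = ennreal (c * (4 * (norm de)^2 * ex 8 y / real n) + e * (ex 2 y * (f y)^2 / real n))"
  using ce ex_nonneg by (simp flip: ennreal_mult ennreal_plus)
 also have "c * (4 * (norm de)^2 * ex 8 y / real n) + e * (ex 2 y * (f y)^2 / real n)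
  = norm de * f y / real n * (2 * ex 8 y + ex 2 y / 2)"
  using False f_pos[of y] n by (simp add: c_def e_def field_simps power2_eq_square)
 also have "... <= norm de * f y / real n * (2 * ex 8 y + ex 8 y / 2)"
  using ex_mono[of 2 8 y] f_nonneg by (intro mult_left_mono) auto
 finally show ?thesis by (simp add: algebra_simps ennreal_leI)
qed

end

end

text \<open>Nonnegativity of the weighted variance about the weighted mean. With a density as weight
  it is the form of Jensen's inequality used for the quadratic-mean bounds.\<close>

lemma weighted_Cauchy_Schwarz:
 fixes r w :: "'c => real"
 assumes w: "integrable N w" "\<And>x. w x >= 0" and rw: "integrable N (\<lambda>x. r x * w x)"
  and r2w: "integrable N (\<lambda>x. (r x)^2 * w x)" and pos: "integral\<^sup>L N w > 0"
 shows "(LINT x|N. r x * w x)^2 <= (LINT x|N. (r x)^2 * w x) * integral\<^sup>L N w"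
proof -
 define W where "W = integral\<^sup>L N w"
 define m where "m = (LINT x|N. r x * w x)"
 define c where "c = m / W"
 have eq: "(r x - c)^2 * w x = (r x)^2 * w x - 2 * c * (r x * w x) + c^2 * w x" for x
  by (simp add: power2_eq_square algebra_simps)
 have "0 <= (LINT x|N. (r x - c)^2 * w x)" using w(2) by (intro Bochner_Integration.integral_nonneg) auto
 also have "... = (LINT x|N. (r x)^2 * w x) - 2 * c * m + c^2 * W"
  unfolding eq using w rw r2w by (simp add: m_def W_def)
 also have "... = (LINT x|N. (r x)^2 * w x) - m\<^sup>2 / W"
  using pos by (simp add: c_def W_def[symmetric] power2_eq_square field_simps)
 finally show ?thesis using pos by (simp add: divide_le_eq m_def W_def)
qed

context ssl_env
begin

subsection \<open>Replacing the empirical mixture by its mean\<close>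

text \<open>Lets y be held fixed while averaging over the covariates, so that the pointwise bounds
  for sample means apply before the response is integrated out.\<close>

lemma decouple_XY:
 assumes Ph: "(\<lambda>(x, y). Ph x y) \<in> borel_measurable (PiM UNIV (\<lambda>_. borel) \<Otimes>\<^sub>M borel)"
 shows "(NNI M (\<lambda>om. Ph (XS om) (Yt j om))) = (NNI lborel (\<lambda>y. ennreal (pbar 0 y) * (NNI M (\<lambda>om. Ph (XS om) y))))"
proof -
 have m1: "(\<lambda>(x, y). Ph x (y j)) \<in> borel_measurable (PiM UNIV (\<lambda>_. borel) \<Otimes>\<^sub>M PiM UNIV (\<lambda>_. borel))"
 proof -
  have "(\<lambda>w. (fst w, snd w j)) \<in> measurable (PiM UNIV (\<lambda>_. borel) \<Otimes>\<^sub>M PiM UNIV (\<lambda>_. borel)) (PiM UNIV (\<lambda>_. borel) \<Otimes>\<^sub>M (borel :: real measure))"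
   by measurable
  from measurable_compose[OF this Ph] show ?thesis by (simp add: split_beta')
 qed
 have m2: "(\<lambda>(om, y). Ph (XS om) y) \<in> borel_measurable (M \<Otimes>\<^sub>M lborel)"
 proof -
  have "(\<lambda>w. (XS (fst w), snd w)) \<in> measurable (M \<Otimes>\<^sub>M lborel) (PiM UNIV (\<lambda>_. borel) \<Otimes>\<^sub>M (borel :: real measure))"
   by (intro measurable_Pair measurable_compose[OF measurable_fst XS_meas]) measurable
  from measurable_compose[OF this Ph] show ?thesis by (simp add: split_beta')
 qed
 note [measurable] = m2
 have "(NNI M (\<lambda>om. Ph (XS om) (Yt j om))) = (NNI M (\<lambda>om1. \<integral>\<^sup>+om2. Ph (XS om1) (Yt j om2) \<partial>M))"
  using decouple2[OF m1] by simp
 also have "... = (NNI M (\<lambda>om1. \<integral>\<^sup>+y. ennreal (pbar 0 y) * Ph (XS om1) y \<partial>lborel))"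
 proof (intro nn_integral_cong nn_integral_Y)
  fix om1
  have "(\<lambda>y. (XS om1, y)) \<in> measurable borel (PiM UNIV (\<lambda>_. borel) \<Otimes>\<^sub>M (borel :: real measure))"
   by (rule measurable_Pair1') (auto simp: space_PiM)
  from measurable_compose[OF this Ph] show "Ph (XS om1) \<in> borel_measurable borel" by simp
 qed
 also have "... = (NNI lborel (\<lambda>y. \<integral>\<^sup>+om. ennreal (pbar 0 y) * Ph (XS om) y \<partial>M))"
  by (rule fubini_M_lborel) (use m2 in measurable)
 also have "... = (NNI lborel (\<lambda>y. ennreal (pbar 0 y) * (NNI M (\<lambda>om. Ph (XS om) y))))"
 proof (intro nn_integral_cong nn_integral_cmult)
  fix y :: real
  have "(\<lambda>x. (x, y)) \<in> measurable (PiM UNIV (\<lambda>_. borel)) (PiM UNIV (\<lambda>_. borel) \<Otimes>\<^sub>M (borel :: real measure))"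
   by measurable
  from measurable_compose[OF XS_meas measurable_compose[OF this Ph]]
  show "(\<lambda>om. Ph (XS om) y) \<in> borel_measurable M" by simp
 qed
 finally show ?thesis .
qed

lemma nn_pbar_bound:
 assumes "\<And>y. F y <= ennreal (c * ex k y)" "c >= 0"
 shows "(NNI lborel (\<lambda>y. ennreal (pbar 0 y) * F y)) <= ennreal (c * J (Suc k))"
proof -
 have "(NNI lborel (\<lambda>y. ennreal (pbar 0 y) * F y)) <= (NNI lborel (\<lambda>y. ennreal (c * (ex (Suc k) y * f y))))"
 proof (rule nn_integral_mono)
  fix y
  have "ennreal (pbar 0 y) * F y <= ennreal (ex 1 y * f y) * ennreal (c * ex k y)"
   using assms(1) pbar_le[of 0 y] by (intro mult_mono ennreal_leI) auto
  also have "... = ennreal (c * (ex (Suc k) y * f y))"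
   using assms(2) ex_nonneg f_nonneg ex_mult[of 1 y k] by (simp flip: ennreal_mult add: mult_ac)
  finally show "ennreal (pbar 0 y) * F y <= ennreal (c * (ex (Suc k) y * f y))" .
 qed
 then show ?thesis using nn_J_cmult[OF assms(2)] by simp
qed

text \<open>Given the covariates, \<open>mz\<close> is the mean of z - zb at one response. To first
  order n mz is a sum over covariates, and \<open>k1\<close> is the contribution of one of them:
  minus the mean of zb under the conditional density at x.\<close>

definition mz :: "nat => 'v => (nat => 'v) => real" where
 "mz n de x = (LINT y|lborel. pbar 0 y * (z n de x y - zb de y))"

definition k1 :: "'v => 'v => real" where
 "k1 de x = - (LINT y|lborel. zb de y * p 0 x y)"

lemma mz_meas[measurable (raw)]:
 assumes [measurable]: "\<And>i. (\<lambda>om. x om i) \<in> borel_measurable N"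
 shows "(\<lambda>om. mz n de (x om)) \<in> borel_measurable N"
 unfolding mz_def by measurable

lemma k1_meas[measurable]: "k1 de \<in> borel_measurable borel"
 unfolding k1_def[abs_def] by measurable

context
 fixes n :: nat and de :: 'v
 assumes n: "n > 0" and d: "norm de <= 1"
begin

lemma zeta_abs: "(\<And>i. norm (x i) <= B) ==> \<bar>z n de x y - zb de y\<bar> <= 2 * ex 2 y"
proof -
 assume x: "\<And>i. norm (x i) <= B"
 have "norm de * ex 2 y <= 1 * ex 2 y" using d ex_nonneg by (intro mult_right_mono) auto
 then show ?thesis using z_abs[OF n d, where x=x, OF x, of y] zb_abs[OF d, of y] by linarith
qed

text \<open>Given the covariates the responses are i.i.d., so the second moment of the centred sum
  is at most n times that of one term. One term is of order |de| / sqrt n in quadratic mean, and n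
  cancels.\<close>

lemma zeta_sum_sq:
 "(NNI M (\<lambda>om. ennreal (((\<Sum>j<n. z n de (XS om) (Yt j om) - zb de (Yt j om)) - real n * mz n de (XS om))^2)))
  <= ennreal (4 * (norm de)^2 * J 9)"
proof -
 have "(NNI M (\<lambda>om. ennreal (((\<Sum>j<n. z n de (XS om) (Yt j om) - zb de (Yt j om)) - real n * mz n de (XS om))^2)))
  = (NNI M (\<lambda>om1. \<integral>\<^sup>+om2. ennreal (((\<Sum>j<n. z n de (XS om1) (Yt j om2) - zb de (Yt j om2)) - real n * mz n de (XS om1))^2) \<partial>M))"
  by (rule decouple2) measurable
 also have "... <= (NNI M (\<lambda>om1. ennreal (real n) * (NNI M (\<lambda>om2. ennreal ((z n de (XS om1) (Yt 0 om2) - zb de (Yt 0 om2))^2)))))"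
 proof (rule nn_integral_mono)
  fix om1
  define ph where "ph y = z n de (XS om1) y - zb de y" for y
  have [measurable]: "ph \<in> borel_measurable borel" unfolding ph_def by measurable
  have abs: "\<bar>ph y\<bar> <= 2 * ex 2 y" for y unfolding ph_def by (rule zeta_abs) (rule Xt_le)
  have int: "integrable M (\<lambda>om. (ph (Yt 0 om))^2)"
  proof (rule integrable_Y_bound[where c=4 and k=4])
   show "\<bar>(ph y)\<^sup>2\<bar> <= 4 * ex 4 y" for y
    using power_mono[OF abs[of y] abs_ge_zero, of 2] by (simp add: power_mult_distrib ex_power)
  qed simp
  have mean: "expectation (\<lambda>om. ph (Yt 0 om)) = mz n de (XS om1)"
   by (subst expectation_Y) (auto simp: mz_def ph_def)
  have "(NNI M (\<lambda>om2. ennreal (((\<Sum>j<n. ph (Yt j om2)) - real n * mz n de (XS om1))^2))) <= ennreal (real n * expectation (\<lambda>om. (ph (Yt 0 om))^2))"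
   using iid_mean_sq[OF iid_Y Y_law _ int, of n] by (simp add: mean sum_subtractf)
  also have "... = ennreal (real n) * (NNI M (\<lambda>om2. ennreal ((ph (Yt 0 om2))^2)))"
   using nn_integral_eq_integral[OF int] by (simp add: ennreal_mult')
  finally show "(NNI M (\<lambda>om2. ennreal (((\<Sum>j<n. z n de (XS om1) (Yt j om2) - zb de (Yt j om2)) - real n * mz n de (XS om1))^2)))
   <= ennreal (real n) * (NNI M (\<lambda>om2. ennreal ((z n de (XS om1) (Yt 0 om2) - zb de (Yt 0 om2))^2)))"
   by (simp add: ph_def)
 qed
 also have "... = ennreal (real n) * (NNI M (\<lambda>om1. \<integral>\<^sup>+om2. ennreal ((z n de (XS om1) (Yt 0 om2) - zb de (Yt 0 om2))^2) \<partial>M))"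
  by (rule nn_integral_cmult) measurable
 also have "(NNI M (\<lambda>om1. \<integral>\<^sup>+om2. ennreal ((z n de (XS om1) (Yt 0 om2) - zb de (Yt 0 om2))^2) \<partial>M))
  = (NNI M (\<lambda>om. ennreal ((z n de (XS om) (Yt 0 om) - zb de (Yt 0 om))^2)))"
  by (rule decouple2[symmetric]) measurable
 also have "... = (NNI lborel (\<lambda>y. ennreal (pbar 0 y) * (NNI M (\<lambda>om. ennreal ((z n de (XS om) y - zb de y)^2)))))"
  by (rule decouple_XY) measurable
 also have "... <= ennreal (4 * (norm de)^2 / real n * J (Suc 8))"
  using z_mean_sq[OF n d] by (intro nn_pbar_bound) auto
 also have "ennreal (real n) * ... = ennreal (4 * (norm de)^2 * J 9)"
  using n J_nonneg by (simp flip: ennreal_mult)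
 finally show ?thesis by (simp add: mult_left_mono)
qed

text \<open>All densities have mass one, so z integrates to zero against the empirical mixture and
  zb against its mean. With these two identities n mz minus the sum of \<open>k1\<close> is exactly
  -n times the integral of (z - zb) (av - pbar), a product of two errors of order n^(-1/2). This is
  the origin of the projection term.\<close>

lemma mz_k1:
 "(NNI M (\<lambda>om. ennreal \<bar>real n * mz n de (XS om) - (\<Sum>i<n. k1 de (Xt i om))\<bar>)) <= ennreal (5 / 2 * norm de * J 8)"
proof -
 have le: "\<bar>real n * mz n de (XS om) - (\<Sum>i<n. k1 de (Xt i om))\<bar>
  <= real n * (LINT y|lborel. \<bar>z n de (XS om) y - zb de y\<bar> * \<bar>av n 0 (XS om) y - pbar 0 y\<bar>)"
  and int: "integrable lborel (\<lambda>y. \<bar>z n de (XS om) y - zb de y\<bar> * \<bar>av n 0 (XS om) y - pbar 0 y\<bar>)" for om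
 proof -
  define a where "a y = av n 0 (XS om) y" for y
  define Z where "Z y = z n de (XS om) y" for y
  have [measurable]: "a \<in> borel_measurable borel" "Z \<in> borel_measurable borel" unfolding a_def Z_def by measurable
  have a: "\<bar>a y\<bar> <= ex 1 y * f y" "a y > 0" for y
   using av_le[OF n d, where x="XS om", OF Xt_le, of 0 y] av_pos[OF n d, where x="XS om", OF Xt_le, of 0 y] by (auto simp: a_def)
  have pb: "\<bar>pbar 0 y\<bar> <= ex 1 y * f y" "pbar 0 y > 0" for y using pbar_le[of 0 y] pbar_pos[of 0 y] by auto
  have dn: "norm de * ex 2 y <= 1 * ex 2 y" for y using d ex_nonneg by (intro mult_right_mono) auto
  have Zb: "\<bar>Z y\<bar> <= ex 2 y" "\<bar>zb de y\<bar> <= ex 2 y" for y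
   using z_abs[OF n d, where x="XS om", OF Xt_le, of y] zb_abs[OF d, of y] dn[of y] by (auto simp: Z_def)
  have prod: "\<bar>u * v\<bar> <= 1 * (ex 3 y * f y)" if "\<bar>u\<bar> <= ex 2 y" "\<bar>v\<bar> <= ex 1 y * f y" for u v y
  proof -
   have "\<bar>u * v\<bar> <= ex 2 y * (ex 1 y * f y)" unfolding abs_mult using that ex_nonneg by (intro mult_mono) auto
   then show ?thesis by (simp add: ex_mult_left)
  qed
  have I: "integrable lborel (\<lambda>y. Z y * a y)" "integrable lborel (\<lambda>y. Z y * pbar 0 y)"
    "integrable lborel (\<lambda>y. zb de y * a y)" "integrable lborel (\<lambda>y. zb de y * pbar 0 y)"
   using prod a pb Zb by (auto intro!: integrable_J_bound[where c=1 and k=3])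
  have av_int: "integrable lborel (av n et (XS om))" "(LINT y|lborel. av n et (XS om) y) = 1" if "norm et <= 1" for et
   unfolding av_def[abs_def] using n integrable_p integral_p by auto
  have zero1: "(LINT y|lborel. Z y * a y) = 0"
  proof -
   have "Z y * a y = av n de (XS om) y - av n 0 (XS om) y" for y
    using a(2)[of y] by (simp add: Z_def z_def a_def)
   then show ?thesis using av_int[OF d] av_int[of 0] by simp
  qed
  have zero2: "(LINT y|lborel. zb de y * pbar 0 y) = 0"
  proof -
   have "zb de y * pbar 0 y = pbar de y - pbar 0 y" for y using pb(2)[of y] by (simp add: zb_def)
   then show ?thesis using integrable_pbar[OF d] integrable_pbar[of 0] integral_pbar[OF d] integral_pbar[of 0] by simp
  qed
  have "(\<Sum>i<n. k1 de (Xt i om)) = - (\<Sum>i<n. LINT y|lborel. zb de y * p 0 (Xt i om) y)"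
   by (simp add: k1_def sum_negf)
  also have "(\<Sum>i<n. LINT y|lborel. zb de y * p 0 (Xt i om) y) = (LINT y|lborel. (\<Sum>i<n. zb de y * p 0 (Xt i om) y))"
   using prod[OF Zb(2) p_abs_le[OF _ Xt_le, of 0]]
   by (intro Bochner_Integration.integral_sum[symmetric] integrable_J_bound[where c=1 and k=3]) auto
  also have "... = (LINT y|lborel. real n * (zb de y * a y))"
   using n by (intro Bochner_Integration.integral_cong) (auto simp: a_def av_def sum_distrib_left[symmetric])
  finally have k1: "(\<Sum>i<n. k1 de (Xt i om)) = - (real n * (LINT y|lborel. zb de y * a y))" by simp
  have mz: "mz n de (XS om) = (LINT y|lborel. Z y * pbar 0 y)"
  proof -
   have "mz n de (XS om) = (LINT y|lborel. Z y * pbar 0 y - zb de y * pbar 0 y)"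
    by (simp add: mz_def Z_def algebra_simps)
   then show ?thesis using I zero2 by simp
  qed
  have intD: "integrable lborel (\<lambda>y. (Z y - zb de y) * (a y - pbar 0 y))"
  proof -
   have "(\<lambda>y. (Z y - zb de y) * (a y - pbar 0 y)) = (\<lambda>y. Z y * a y - Z y * pbar 0 y - (zb de y * a y - zb de y * pbar 0 y))"
    by (simp add: algebra_simps)
   then show ?thesis using I by simp
  qed
  have "(LINT y|lborel. (Z y - zb de y) * (a y - pbar 0 y)) =
   (LINT y|lborel. Z y * a y - Z y * pbar 0 y - (zb de y * a y - zb de y * pbar 0 y))"
   by (simp add: algebra_simps)
  also have "... = - mz n de (XS om) - (LINT y|lborel. zb de y * a y)"
   using I by (simp add: zero1 zero2 mz)
  finally have eq0: "(LINT y|lborel. (Z y - zb de y) * (a y - pbar 0 y)) = - mz n de (XS om) - (LINT y|lborel. zb de y * a y)" .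
  have arith: "c * u - - (c * v) = - (c * w)" if "w = - u - v" for c u v w :: real
   unfolding that by (simp add: algebra_simps)
  have eq: "real n * mz n de (XS om) - (\<Sum>i<n. k1 de (Xt i om)) = - (real n * (LINT y|lborel. (Z y - zb de y) * (a y - pbar 0 y)))"
   unfolding k1 by (rule arith[OF eq0])
  have "\<bar>LINT y|lborel. (Z y - zb de y) * (a y - pbar 0 y)\<bar> <= (LINT y|lborel. \<bar>Z y - zb de y\<bar> * \<bar>a y - pbar 0 y\<bar>)"
   by (rule order_trans[OF integral_abs_bound]) (simp add: abs_mult)
  then show "\<bar>real n * mz n de (XS om) - (\<Sum>i<n. k1 de (Xt i om))\<bar>
  <= real n * (LINT y|lborel. \<bar>z n de (XS om) y - zb de y\<bar> * \<bar>av n 0 (XS om) y - pbar 0 y\<bar>)"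
   unfolding eq by (simp add: abs_mult Z_def a_def mult_left_mono)
  show "integrable lborel (\<lambda>y. \<bar>z n de (XS om) y - zb de y\<bar> * \<bar>av n 0 (XS om) y - pbar 0 y\<bar>)"
   using integrable_abs[OF intD] by (simp add: abs_mult Z_def a_def)
 qed
 have "(NNI M (\<lambda>om. ennreal \<bar>real n * mz n de (XS om) - (\<Sum>i<n. k1 de (Xt i om))\<bar>))
  <= (NNI M (\<lambda>om. \<integral>\<^sup>+y. ennreal (real n) * ennreal (\<bar>z n de (XS om) y - zb de y\<bar> * \<bar>av n 0 (XS om) y - pbar 0 y\<bar>) \<partial>lborel))"
 proof (rule nn_integral_mono)
  fix om
  have "ennreal \<bar>real n * mz n de (XS om) - (\<Sum>i<n. k1 de (Xt i om))\<bar>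
   <= ennreal (real n * (LINT y|lborel. \<bar>z n de (XS om) y - zb de y\<bar> * \<bar>av n 0 (XS om) y - pbar 0 y\<bar>))"
   by (intro ennreal_leI le)
  also have "... = ennreal (real n) * (NNI lborel (\<lambda>y. ennreal (\<bar>z n de (XS om) y - zb de y\<bar> * \<bar>av n 0 (XS om) y - pbar 0 y\<bar>)))"
   using nn_integral_eq_integral[OF int] by (simp add: ennreal_mult')
  also have "... = (NNI lborel (\<lambda>y. ennreal (real n) * ennreal (\<bar>z n de (XS om) y - zb de y\<bar> * \<bar>av n 0 (XS om) y - pbar 0 y\<bar>)))"
   by (rule nn_integral_cmult[symmetric]) measurable
  finally show "ennreal \<bar>real n * mz n de (XS om) - (\<Sum>i<n. k1 de (Xt i om))\<bar> <= ..." .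
 qed
 also have "... = (NNI lborel (\<lambda>y. \<integral>\<^sup>+om. ennreal (real n) * ennreal (\<bar>z n de (XS om) y - zb de y\<bar> * \<bar>av n 0 (XS om) y - pbar 0 y\<bar>) \<partial>M))"
  by (rule fubini_M_lborel) measurable
 also have "... <= (NNI lborel (\<lambda>y. ennreal (5 / 2 * norm de * (ex 8 y * f y))))"
 proof (rule nn_integral_mono)
  fix y
  have "(NNI M (\<lambda>om. ennreal (real n) * ennreal (\<bar>z n de (XS om) y - zb de y\<bar> * \<bar>av n 0 (XS om) y - pbar 0 y\<bar>)))
   = ennreal (real n) * (NNI M (\<lambda>om. ennreal (\<bar>z n de (XS om) y - zb de y\<bar> * \<bar>av n 0 (XS om) y - pbar 0 y\<bar>)))"
   by (rule nn_integral_cmult) measurable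
  also have "... <= ennreal (real n) * ennreal (5 / 2 * norm de * ex 8 y * f y / real n)"
   by (intro mult_left_mono z_cross n d) simp
  also have "... = ennreal (5 / 2 * norm de * (ex 8 y * f y))"
   using n ex_nonneg f_nonneg by (simp flip: ennreal_mult)
  finally show "(NNI M (\<lambda>om. ennreal (real n) * ennreal (\<bar>z n de (XS om) y - zb de y\<bar> * \<bar>av n 0 (XS om) y - pbar 0 y\<bar>)))
   <= ennreal (5 / 2 * norm de * (ex 8 y * f y))" .
 qed
 also have "... = ennreal (5 / 2 * norm de * J 8)" by (rule nn_J_cmult) simp
 finally show ?thesis .
qed

text \<open>The factors |z - zb| and |z + zb| are of order |de| / sqrt n and |de|, so n terms give
  sqrt n |de|^2. This vanishes when |de| is of order n^(-1/2).\<close>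

lemma z_sq_diff:
 "(NNI M (\<lambda>om. ennreal \<bar>(\<Sum>j<n. (z n de (XS om) (Yt j om))^2) - (\<Sum>j<n. (zb de (Yt j om))^2)\<bar>))
  <= ennreal (5 * sqrt (real n) * (norm de)^2 * J 9)"
proof -
 have pt: "(NNI M (\<lambda>om. ennreal \<bar>(z n de (XS om) y)\<^sup>2 - (zb de y)\<^sup>2\<bar>)) <= ennreal (5 * (norm de)^2 / sqrt (real n) * ex 8 y)" for y
 proof -
  \<comment> \<open>The weight sqrt n balances the two parts of Young's inequality, because (z -
    zb)^2 has mean of order 1/n.\<close>
  define q where "q = sqrt (real n)"
  have q: "q > 0" "q * q = real n" using n by (auto simp: q_def)
  define v where "v = norm de * ex 2 y"
  have le: "\<bar>(z n de (XS om) y)\<^sup>2 - (zb de y)\<^sup>2\<bar> <= q * (z n de (XS om) y - zb de y)^2 + v^2 / q" for om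
  proof -
   define u where "u = \<bar>z n de (XS om) y - zb de y\<bar>"
   have "\<bar>z n de (XS om) y + zb de y\<bar> <= 2 * v"
    using z_abs[OF n d, where x="XS om", OF Xt_le, of y] zb_abs[OF d, of y] by (simp add: v_def)
   then have "u * \<bar>z n de (XS om) y + zb de y\<bar> <= u * (2 * v)" by (intro mult_left_mono) (auto simp: u_def)
   moreover have "\<bar>(z n de (XS om) y)\<^sup>2 - (zb de y)\<^sup>2\<bar> = u * \<bar>z n de (XS om) y + zb de y\<bar>"
    by (simp add: u_def abs_mult[symmetric] power2_eq_square algebra_simps)
   moreover have "u * (2 * v) <= q * u^2 + v^2 / q"
   proof -
    have "0 <= (q * u - v)^2 / q" using q by simp
    also have "... = q * u^2 + v^2 / q - u * (2 * v)" using q by (simp add: power2_eq_square field_simps)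
    finally show ?thesis by simp
   qed
   ultimately show ?thesis by (simp add: u_def)
  qed
  have "(NNI M (\<lambda>om. ennreal \<bar>(z n de (XS om) y)\<^sup>2 - (zb de y)\<^sup>2\<bar>))
   <= (NNI M (\<lambda>om. ennreal q * ennreal ((z n de (XS om) y - zb de y)^2) + ennreal (v^2 / q)))"
   using le q by (intro nn_integral_mono) (simp flip: ennreal_mult ennreal_plus add: ennreal_leI)
  also have "... = ennreal q * (NNI M (\<lambda>om. ennreal ((z n de (XS om) y - zb de y)^2))) + ennreal (v^2 / q)"
   by (subst nn_integral_add) (auto simp: nn_integral_cmult emeasure_space_1)
  also have "... <= ennreal q * ennreal (4 * (norm de)^2 * ex 8 y / real n) + ennreal (v^2 / q)"
   by (intro add_right_mono mult_left_mono z_mean_sq n d) simp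
  also have "... = ennreal (q * (4 * (norm de)^2 * ex 8 y / real n) + v^2 / q)"
   using q ex_nonneg by (simp flip: ennreal_mult ennreal_plus)
  also have "q * (4 * (norm de)^2 * ex 8 y / real n) + v^2 / q = (norm de)^2 / q * (4 * ex 8 y + ex 4 y)"
   unfolding q(2)[symmetric] using q(1) by (simp add: v_def power_mult_distrib ex_power field_simps)
  also have "... <= (norm de)^2 / q * (4 * ex 8 y + ex 8 y)"
   using q ex_mono[of 4 8 y] by (intro mult_left_mono add_left_mono) auto
  finally show ?thesis by (simp add: q_def algebra_simps ennreal_leI)
 qed
 have "(NNI M (\<lambda>om. ennreal \<bar>(\<Sum>j<n. (z n de (XS om) (Yt j om))^2) - (\<Sum>j<n. (zb de (Yt j om))^2)\<bar>))
  <= (NNI M (\<lambda>om. (\<Sum>j<n. ennreal \<bar>(z n de (XS om) (Yt j om))\<^sup>2 - (zb de (Yt j om))\<^sup>2\<bar>)))"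
  by (intro nn_integral_mono) (simp add: sum_subtractf[symmetric] ennreal_leI)
 also have "... = (\<Sum>j<n. (NNI M (\<lambda>om. ennreal \<bar>(z n de (XS om) (Yt j om))\<^sup>2 - (zb de (Yt j om))\<^sup>2\<bar>)))"
  by (rule nn_integral_sum) measurable
 also have "... <= (\<Sum>j<n. ennreal (5 * (norm de)^2 / sqrt (real n) * J (Suc 8)))"
 proof (rule sum_mono)
  fix j
  have "(NNI M (\<lambda>om. ennreal \<bar>(z n de (XS om) (Yt j om))\<^sup>2 - (zb de (Yt j om))\<^sup>2\<bar>)) =
   (NNI lborel (\<lambda>y. ennreal (pbar 0 y) * (NNI M (\<lambda>om. ennreal \<bar>(z n de (XS om) y)\<^sup>2 - (zb de y)\<^sup>2\<bar>))))"
   by (rule decouple_XY) measurable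
  also have "... <= ennreal (5 * (norm de)^2 / sqrt (real n) * J (Suc 8))"
   by (intro nn_pbar_bound pt) simp
  finally show "(NNI M (\<lambda>om. ennreal \<bar>(z n de (XS om) (Yt j om))\<^sup>2 - (zb de (Yt j om))\<^sup>2\<bar>)) <= ..." .
 qed
 also have "... = ennreal (real n * (5 * (norm de)^2 / sqrt (real n) * J 9))"
  using J_nonneg[of 9] by (subst ennreal_mult) (auto simp: ennreal_of_nat_eq_real_of_nat)
 also have "real n * (5 * (norm de)^2 / sqrt (real n) * J 9) = 5 * sqrt (real n) * (norm de)^2 * J 9"
  using n real_sqrt_mult_self[of "real n"] by (simp add: field_simps)
 finally show ?thesis .
qed

lemma ln_remainder:
 "(NNI M (\<lambda>om. ennreal \<bar>(\<Sum>j<n. ln (av n de (XS om) (Yt j om) / av n 0 (XS om) (Yt j om))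
   - z n de (XS om) (Yt j om) + (z n de (XS om) (Yt j om))^2 / 2)\<bar>))
  <= ennreal (real n * (norm de ^ 3 * J 6))"
proof -
 have pt: "\<bar>ln (av n de (XS om) y / av n 0 (XS om) y) - z n de (XS om) y + (z n de (XS om) y)^2 / 2\<bar> <= norm de ^ 3 * ex 5 y" for om y
 proof -
  define l where "l = ln (av n de (XS om) y / av n 0 (XS om) y)"
  have pos: "av n de (XS om) y > 0" "av n 0 (XS om) y > 0" using av_pos[OF n d, where x="XS om", OF Xt_le] by auto
  have z: "z n de (XS om) y = exp l - 1" using pos by (simp add: l_def z_def diff_divide_distrib)
  have l: "\<bar>l\<bar> <= norm de * L y" unfolding l_def by (rule av_ratio[OF n d]) (rule Xt_le)
  have l1: "\<bar>l\<bar> <= norm de * ex 1 y" using l mult_left_mono[OF L_le_ex[of y] norm_ge_zero[of de]] by linarith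
  have "norm de * L y <= 1 * L y" using d L_nonneg by (intro mult_right_mono) auto
  then have l2: "exp (2 * \<bar>l\<bar>) <= ex 2 y" using l by (simp add: ex_def)
  have "\<bar>l\<bar> ^ 3 * exp (2 * \<bar>l\<bar>) <= (norm de * ex 1 y) ^ 3 * ex 2 y"
   using ex_nonneg by (intro mult_mono power_mono l1 l2) auto
  also have "... = norm de ^ 3 * ex 5 y" by (simp add: power_mult_distrib ex_power ex_mult mult.assoc)
  finally show ?thesis using ln_expansion_remainder[of l] unfolding z l_def[symmetric] by linarith
 qed
 have "(NNI M (\<lambda>om. ennreal \<bar>(\<Sum>j<n. ln (av n de (XS om) (Yt j om) / av n 0 (XS om) (Yt j om))
   - z n de (XS om) (Yt j om) + (z n de (XS om) (Yt j om))^2 / 2)\<bar>))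
  <= (NNI M (\<lambda>om. (\<Sum>j<n. ennreal (norm de ^ 3 * ex 5 (Yt j om)))))"
 proof (rule nn_integral_mono)
  fix om
  have "\<bar>\<Sum>j<n. ln (av n de (XS om) (Yt j om) / av n 0 (XS om) (Yt j om))
   - z n de (XS om) (Yt j om) + (z n de (XS om) (Yt j om))^2 / 2\<bar> <= (\<Sum>j<n. norm de ^ 3 * ex 5 (Yt j om))"
   using pt by (intro order_trans[OF sum_abs] sum_mono)
  then show "ennreal \<bar>\<Sum>j<n. ln (av n de (XS om) (Yt j om) / av n 0 (XS om) (Yt j om))
   - z n de (XS om) (Yt j om) + (z n de (XS om) (Yt j om))^2 / 2\<bar> <= (\<Sum>j<n. ennreal (norm de ^ 3 * ex 5 (Yt j om)))"
   using ex_nonneg by (subst sum_ennreal) (auto intro: ennreal_leI)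
 qed
 also have "... = (\<Sum>j<n. \<integral>\<^sup>+om. ennreal (norm de ^ 3 * ex 5 (Yt j om)) \<partial>M)"
  by (rule nn_integral_sum) measurable
 also have "... <= (\<Sum>j<n. ennreal (norm de ^ 3 * J (Suc 5)))"
  by (intro sum_mono nn_Y_bound) auto
 also have "... = ennreal (real n * (norm de ^ 3 * J 6))"
  using J_nonneg by (simp add: ennreal_mult' ennreal_of_nat_eq_real_of_nat)
 finally show ?thesis .
qed

end

end

section \<open>Sums over triangular arrays of independent variables\<close>

context prob_space
begin

text \<open>Second moments of centred independent sums add, so replacing \<open>ph k\<close> by s /
  sqrt m costs at most m q. That m q tends to zero is differentiability in quadratic mean along the
  sequence.\<close>

lemma L1_null_linear_part:
 fixes V :: "nat => 'a => 'c" and ph :: "nat => 'c => real"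
 assumes ind: "indep_vars (\<lambda>_. N) V UNIV" and D: "\<And>i. distr M N (V i) = distr M N (V 0)"
  and [measurable]: "\<And>k. ph k \<in> borel_measurable N" "s \<in> borel_measurable N"
  and sq: "\<forall>\<^sub>F k in sequentially. integrable M (\<lambda>om. (ph k (V 0 om))^2)" "integrable M (\<lambda>om. (s (V 0 om))^2)"
  and mean: "\<forall>\<^sub>F k in sequentially. expectation (\<lambda>om. ph k (V 0 om)) = 0" "expectation (\<lambda>om. s (V 0 om)) = 0"
  and nm: "\<forall>\<^sub>F k in sequentially. real (n k) <= m k"
  and q: "\<forall>\<^sub>F k in sequentially. (NNI M (\<lambda>om. ennreal ((ph k (V 0 om) - s (V 0 om) / sqrt (m k))^2))) <= ennreal (q k)"
  and mq: "(\<lambda>k. m k * q k) \<longlonglongrightarrow> 0" and q0: "\<And>k. q k >= 0"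
 shows "L1_null (\<lambda>k om. (\<Sum>i<n k. ph k (V i om)) - (\<Sum>i<n k. s (V i om)) / sqrt (m k))"
proof -
 have [measurable]: "V i \<in> measurable M N" for i using ind by (auto simp: indep_vars_def)
 show ?thesis
 proof (rule L1_null_of_sq[OF _ _ mq])
  show "\<forall>\<^sub>F k in sequentially. (NNI M (\<lambda>om. ennreal (((\<Sum>i<n k. ph k (V i om)) - (\<Sum>i<n k. s (V i om)) / sqrt (m k))^2))) <= ennreal (m k * q k)"
   using sq(1) mean(1) nm q
  proof eventually_elim
   case (elim k)
   define \<psi> where "\<psi> x = ph k x - s x / sqrt (m k)" for x
   have [measurable]: "\<psi> \<in> borel_measurable N" unfolding \<psi>_def by measurable
   have i1: "integrable M (\<lambda>om. ph k (V 0 om))" "integrable M (\<lambda>om. s (V 0 om))"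
    by (rule square_integrable_imp_integrable; use elim sq in simp)+
   have int: "integrable M (\<lambda>om. (\<psi> (V 0 om))^2)"
   proof (rule integrableI_bounded)
    show "(NNI M (\<lambda>om. ennreal (norm ((\<psi> (V 0 om))^2)))) < \<infinity>"
     using elim(4) by (auto simp: \<psi>_def less_top[symmetric] top_unique)
   qed simp
   have "(NNI M (\<lambda>om. ennreal ((\<Sum>i<n k. \<psi> (V i om))^2))) = ennreal (real (n k) * expectation (\<lambda>om. (\<psi> (V 0 om))^2))"
    using i1 elim mean by (intro iid_sum_sq[OF ind D _ int]) (auto simp: \<psi>_def)
   also have "... = ennreal (real (n k)) * (NNI M (\<lambda>om. ennreal ((\<psi> (V 0 om))^2)))"
    using nn_integral_eq_integral[OF int] by (simp add: ennreal_mult')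
   also have "... <= ennreal (m k) * ennreal (q k)"
    using elim by (intro mult_mono) (auto simp: \<psi>_def intro: ennreal_leI)
   also have "... = ennreal (m k * q k)"
    using q0[of k] by (simp add: ennreal_mult'')
   finally show ?case by (simp add: \<psi>_def sum_subtractf sum_divide_distrib)
  qed
 qed measurable
qed

text \<open>The inequality |u^2 - v^2| <= (1 + 1/e) (u - v)^2 + e v^2 reduces the sum of squares of
  \<open>ph k\<close> to that of s^2 / m. The law of large numbers then applies to s^2, which is why
  a fourth moment of \<open>s\<close> appears.\<close>

lemma L1_null_quadratic_part:
 fixes V :: "nat => 'a => 'c" and ph :: "nat => 'c => real"
 assumes ind: "indep_vars (\<lambda>_. N) V UNIV" and D: "\<And>i. distr M N (V i) = distr M N (V 0)"
  and [measurable]: "\<And>k. ph k \<in> borel_measurable N" "s \<in> borel_measurable N"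
  and s4: "integrable M (\<lambda>om. ((s (V 0 om))^2)^2)"
  and n: "filterlim n at_top sequentially"
  and nm: "\<forall>\<^sub>F k in sequentially. real (n k) <= m k"
  and q: "\<forall>\<^sub>F k in sequentially. (NNI M (\<lambda>om. ennreal ((ph k (V 0 om) - s (V 0 om) / sqrt (m k))^2))) <= ennreal (q k)"
  and mq: "(\<lambda>k. m k * q k) \<longlonglongrightarrow> 0" and q0: "\<And>k. q k >= 0"
 shows "L1_null (\<lambda>k om. (\<Sum>i<n k. (ph k (V i om))^2) - real (n k) / m k * expectation (\<lambda>om. (s (V 0 om))^2))"
proof -
 have [measurable]: "V i \<in> measurable M N" for i using ind by (auto simp: indep_vars_def)
 define sg where "sg = expectation (\<lambda>om. (s (V 0 om))^2)"
 have sg0: "sg >= 0" by (simp add: sg_def)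
 have s2: "integrable M (\<lambda>om. (s (V 0 om))^2)" by (rule square_integrable_imp_integrable) (use s4 in simp_all)
 have id: "(NNI M (\<lambda>om. \<psi> (V i om))) = (NNI M (\<lambda>om. \<psi> (V 0 om)))" if "\<psi> \<in> borel_measurable N" for \<psi> and i
  using D[of i] nn_integral_distr[of "V i" M N \<psi>] nn_integral_distr[of "V 0" M N \<psi>] that by simp
 have pos: "\<forall>\<^sub>F k in sequentially. 0 < n k" using eventually_ge_at_top[of 1]
  by (rule filterlim_iff[THEN iffD1, rule_format, OF n, THEN eventually_mono]) simp
 \<comment> \<open>It tends to zero, yet stays above sqrt (m q), so that m q / e is at most
   e.\<close>
 define e where "e k = sqrt (\<bar>m k * q k\<bar>) + 1 / real (Suc k)" for k
 have e0: "e k > 0" for k unfolding e_def by (simp add: add_nonneg_pos)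
 have e_lim: "e \<longlonglongrightarrow> 0"
 proof -
  have "(\<lambda>k. sqrt \<bar>m k * q k\<bar> + 1 / real (Suc k)) \<longlonglongrightarrow> sqrt \<bar>0\<bar> + 0"
   using LIMSEQ_inverse_real_of_nat unfolding inverse_eq_divide by (intro tendsto_intros mq)
  then show ?thesis by (simp add: e_def[abs_def])
 qed
 define b where "b k = m k * q k + e k + e k * sg" for k
 have b_lim: "b \<longlonglongrightarrow> 0"
  unfolding b_def[abs_def] using tendsto_add[OF tendsto_add[OF mq e_lim] tendsto_mult_right[OF e_lim, of sg]] by simp
 have 1: "L1_null (\<lambda>k om. (\<Sum>i<n k. (ph k (V i om))^2 - (s (V i om) / sqrt (m k))\<^sup>2))"
 proof (rule L1_nullI_real[OF _ _ b_lim])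
  show "\<forall>\<^sub>F k in sequentially. (NNI M (\<lambda>om. ennreal \<bar>\<Sum>i<n k. (ph k (V i om))^2 - (s (V i om) / sqrt (m k))\<^sup>2\<bar>)) <= ennreal (b k)"
   using nm q pos
  proof eventually_elim
   case (elim k)
   have mk: "m k > 0" using elim by linarith
   define t where "t x = s x / sqrt (m k)" for x
   have [measurable]: "t \<in> borel_measurable N" unfolding t_def by measurable
   have pt: "\<bar>u\<^sup>2 - v\<^sup>2\<bar> <= (1 + 1 / e k) * (u - v)^2 + e k * v^2" for u v :: real
   proof -
    have eq: "u^2 - v\<^sup>2 = (u - v)^2 + 2 * v * (u - v)" by (simp add: power2_eq_square algebra_simps)
    have "0 <= (\<bar>u - v\<bar> - e k * \<bar>v\<bar>)^2 / e k" using e0[of k] by simp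
    also have "... = 1 / e k * (u - v)^2 + e k * v^2 - 2 * \<bar>v\<bar> * \<bar>u - v\<bar>"
     using e0[of k] by (simp add: power2_diff power_mult_distrib field_simps power2_eq_square[of "e k"])
    finally have "2 * \<bar>v\<bar> * \<bar>u - v\<bar> <= 1 / e k * (u - v)^2 + e k * v^2" by simp
    moreover have "\<bar>u\<^sup>2 - v\<^sup>2\<bar> <= (u - v)^2 + 2 * \<bar>v\<bar> * \<bar>u - v\<bar>"
     unfolding eq by (rule order_trans[OF abs_triangle_ineq]) (simp add: abs_mult)
    ultimately show ?thesis by (simp add: algebra_simps)
   qed
   have "(NNI M (\<lambda>om. ennreal \<bar>\<Sum>i<n k. (ph k (V i om))^2 - (t (V i om))\<^sup>2\<bar>))
    <= (NNI M (\<lambda>om. (\<Sum>i<n k. ennreal (1 + 1 / e k) * ennreal ((ph k (V i om) - t (V i om))^2) + ennreal (e k) * ennreal ((t (V i om))^2))))"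
   proof (rule nn_integral_mono)
    fix om
    have "\<bar>\<Sum>i<n k. (ph k (V i om))^2 - (t (V i om))\<^sup>2\<bar> <= (\<Sum>i<n k. (1 + 1 / e k) * (ph k (V i om) - t (V i om))^2 + e k * (t (V i om))^2)"
     using pt by (intro order_trans[OF sum_abs] sum_mono)
    then have "ennreal \<bar>\<Sum>i<n k. (ph k (V i om))^2 - (t (V i om))\<^sup>2\<bar> <= ennreal (\<Sum>i<n k. (1 + 1 / e k) * (ph k (V i om) - t (V i om))^2 + e k * (t (V i om))^2)"
     by (rule ennreal_leI)
    also have "... = (\<Sum>i<n k. ennreal (1 + 1 / e k) * ennreal ((ph k (V i om) - t (V i om))^2) + ennreal (e k) * ennreal ((t (V i om))^2))"
     using e0[of k] by (subst sum_ennreal[symmetric]) (auto simp: ennreal_plus ennreal_mult intro!: sum.cong)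
    finally show "ennreal \<bar>\<Sum>i<n k. (ph k (V i om))^2 - (t (V i om))\<^sup>2\<bar> <= ..." .
   qed
   also have "... = (\<Sum>i<n k. ennreal (1 + 1 / e k) * (NNI M (\<lambda>om. ennreal ((ph k (V i om) - t (V i om))^2))) + ennreal (e k) * (NNI M (\<lambda>om. ennreal ((t (V i om))^2))))"
    by (simp add: nn_integral_sum nn_integral_add nn_integral_cmult)
   also have "... = (\<Sum>i<n k. ennreal (1 + 1 / e k) * (NNI M (\<lambda>om. ennreal ((ph k (V 0 om) - t (V 0 om))^2))) + ennreal (e k) * (NNI M (\<lambda>om. ennreal ((t (V 0 om))^2))))"
    by (intro sum.cong refl arg_cong2[where f="(+)"] arg_cong2[where f="(*)"]
      id[of "\<lambda>x. ennreal ((ph k x - t x)^2)"] id[of "\<lambda>x. ennreal ((t x)^2)"]) measurable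
   also have "... <= (\<Sum>i<n k. ennreal (1 + 1 / e k) * ennreal (q k) + ennreal (e k) * ennreal (sg / m k))"
   proof (intro sum_mono add_mono mult_left_mono)
    show "(NNI M (\<lambda>om. ennreal ((ph k (V 0 om) - t (V 0 om))^2))) <= ennreal (q k)" using elim(2) by (simp add: t_def)
    have "(NNI M (\<lambda>om. ennreal ((t (V 0 om))^2))) = ennreal (expectation (\<lambda>om. (t (V 0 om))^2))"
     using s2 by (intro nn_integral_eq_integral) (auto simp: t_def power_divide)
    also have "expectation (\<lambda>om. (t (V 0 om))^2) = sg / m k" using mk by (simp add: t_def power_divide sg_def)
    finally show "(NNI M (\<lambda>om. ennreal ((t (V 0 om))^2))) <= ennreal (sg / m k)" by simp
   qed auto
   also have "... = ennreal (real (n k) * ((1 + 1 / e k) * q k + e k * (sg / m k)))"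
   proof -
    have "0 <= 1 + 1 / e k" "0 <= e k" "0 <= sg / m k" using e0[of k] sg0 mk by auto
    with q0[of k] show ?thesis
     by (simp only: sum_constant card_lessThan ennreal_of_nat_eq_real_of_nat add_nonneg_nonneg mult_nonneg_nonneg
       of_nat_0_le_iff flip: ennreal_mult ennreal_plus)
   qed
   also have "... <= ennreal (m k * ((1 + 1 / e k) * q k + e k * (sg / m k)))"
    using elim(1) e0[of k] q0[of k] sg0 mk by (intro ennreal_leI mult_right_mono add_nonneg_nonneg mult_nonneg_nonneg) auto
   also have "... <= ennreal (b k)"
   proof (rule ennreal_leI)
    have "m k * q k <= (e k)^2"
    proof -
     have "m k * q k <= (sqrt \<bar>m k * q k\<bar>)^2" by simp
     also have "... <= (e k)^2" by (intro power_mono) (auto simp: e_def)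
     finally show ?thesis .
    qed
    then have "m k * q k / e k <= e k" using e0[of k] by (simp add: divide_le_eq power2_eq_square)
    then show "m k * ((1 + 1 / e k) * q k + e k * (sg / m k)) <= b k" using mk by (simp add: b_def algebra_simps)
   qed
   finally show ?case by (simp add: t_def)
  qed
 qed measurable
 have 2: "L1_null (\<lambda>k om. (\<Sum>i<n k. (s (V i om))^2 - sg) / m k)"
  unfolding sg_def by (rule L1_null_lln[OF ind D _ s4 n nm]) simp
 show ?thesis
 proof (rule L1_null_cong[OF L1_null_add[OF 1 2]])
  show "\<forall>\<^sub>F k in sequentially. \<forall>om\<in>space M. (\<Sum>i<n k. (ph k (V i om))^2) - real (n k) / m k * expectation (\<lambda>om. (s (V 0 om))^2)
   = (\<Sum>i<n k. (ph k (V i om))^2 - (s (V i om) / sqrt (m k))\<^sup>2) + (\<Sum>i<n k. (s (V i om))^2 - sg) / m k"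
   using nm pos
  proof eventually_elim
   case (elim k)
   then have "m k > 0" by linarith
   then show ?case
    by (auto simp: sum_subtractf power_divide sum_divide_distrib[symmetric] diff_divide_distrib sg_def)
  qed
 qed measurable
qed

end

context ssl_env
begin

subsection \<open>Score functions and differentiability in quadratic mean\<close>

text \<open>Score of one response: the conditional mean of the matched score g'(Y - \<beta>0 X) X
  given Y = y. There is no minus sign because g is minus the log-density and is differentiated in
  the coefficient.\<close>

definition sY :: "real => 'v" where
 "sY y = expectation (\<lambda>om. (g' (y - \<beta>0 \<bullet> Xt 0 om) * p 0 (Xt 0 om) y) *\<^sub>R Xt 0 om) /\<^sub>R pbar 0 y"

text \<open>Projection score: minus the conditional mean of \<open>sY\<close> given the covariate.
  It is the linear part of \<open>k1\<close>.\<close>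

definition w :: "'v => 'v" where "w x = - (LINT y|lborel. p 0 x y *\<^sub>R sY y)"

definition zm :: "'v => 'v => real => real" where "zm de x t = exp (g t - g (t - de \<bullet> x)) - 1"

definition rh :: "'v => 'v => real => real" where "rh de x t = zm de x t - (de \<bullet> x) * g' t"

text \<open>Second moment of the linearization error of the matched likelihood ratio. This one
  quantity bounds the quadratic-mean errors for responses, covariates and matched pairs.\<close>

definition Q3 :: "'v => real" where "Q3 de = expectation (\<lambda>om. (rh de (Xs 0 om) (es 0 om))^2)"

lemma sY_meas[measurable]: "sY \<in> borel_measurable borel" unfolding sY_def[abs_def] by measurable
lemma w_meas[measurable]: "w \<in> borel_measurable borel" unfolding w_def[abs_def] by measurable

lemma zm_meas[measurable (raw)]:
 assumes [measurable]: "x \<in> borel_measurable N" "t \<in> borel_measurable N"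
 shows "(\<lambda>om. zm de (x om) (t om)) \<in> borel_measurable N"
 unfolding zm_def by measurable

lemma rho_meas[measurable (raw)]:
 assumes [measurable]: "x \<in> borel_measurable N" "t \<in> borel_measurable N"
 shows "(\<lambda>om. rh de (x om) (t om)) \<in> borel_measurable N"
 unfolding rh_def by measurable

lemma inner_score: "norm x <= B ==> \<bar>de \<bullet> x\<bar> * \<bar>g' t\<bar> <= norm de * L t"
 and inner_score_shift: "norm x <= B ==> \<bar>de \<bullet> x\<bar> * \<bar>g' (t - \<beta>0 \<bullet> x)\<bar> <= norm de * L t"
proof -
 assume x: "norm x <= B"
 have *: "\<bar>de \<bullet> x\<bar> <= norm de * B"
  using Cauchy_Schwarz_ineq2[of de x] mult_left_mono[OF x norm_ge_zero[of de]] by linarith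
 have "\<bar>de \<bullet> x\<bar> * a <= norm de * l" if "B * a <= l" "a >= 0" for a l
  using mult_right_mono[OF * that(2)] mult_left_mono[OF that(1) norm_ge_zero[of de]] by (simp add: mult.assoc)
 then show "\<bar>de \<bullet> x\<bar> * \<bar>g' t\<bar> <= norm de * L t" "\<bar>de \<bullet> x\<bar> * \<bar>g' (t - \<beta>0 \<bullet> x)\<bar> <= norm de * L t"
  using L_score L_score_shift[OF x] by auto
qed

lemma exp_diff_bound:
 assumes "\<bar>l\<bar> <= norm de * L t" "norm de <= 1"
 shows "\<bar>exp l - 1\<bar> <= norm de * ex 2 t"
proof -
 have "norm de * L t <= 1 * L t" using assms L_nonneg by (intro mult_right_mono) auto
 then have l2: "exp \<bar>l\<bar> <= ex 1 t" using assms by (simp add: ex_def)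
 have l1: "\<bar>l\<bar> <= norm de * ex 1 t" using assms mult_left_mono[OF L_le_ex[of t] norm_ge_zero[of de]] by linarith
 have "\<bar>l\<bar> * exp \<bar>l\<bar> <= (norm de * ex 1 t) * ex 1 t"
  using ex_nonneg by (intro mult_mono l1 l2) auto
 also have "... = norm de * ex 2 t" by (simp add: mult.assoc ex_mult numeral_2_eq_2)
 finally show ?thesis using abs_exp_minus_one_le[of l] by linarith
qed

lemma L_ex2: "L t <= ex 2 t" using L_le_ex[of t] ex_mono[of 1 2 t] by simp

lemma zm_abs: "[|norm de <= 1; norm x <= B|] ==> \<bar>zm de x t\<bar> <= norm de * ex 2 t"
 unfolding zm_def using L_lip0[of de x t] by (intro exp_diff_bound) (auto simp: abs_minus_commute)

lemma rho_abs: "[|norm de <= 1; norm x <= B|] ==> \<bar>rh de x t\<bar> <= 2 * norm de * ex 2 t"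
proof -
 assume d: "norm de <= 1" and x: "norm x <= B"
 have "norm de * L t <= norm de * ex 2 t" using L_ex2 by (intro mult_left_mono) auto
 then have "\<bar>(de \<bullet> x) * g' t\<bar> <= norm de * ex 2 t" using inner_score[OF x, of de t] by (simp add: abs_mult)
 then show ?thesis using zm_abs[OF d x, of t] by (simp add: rh_def)
qed

lemma rho_shift_abs: "[|norm de <= 1; norm x <= B|] ==> \<bar>rh de x (y - \<beta>0 \<bullet> x)\<bar> <= 2 * norm de * ex 2 y"
proof -
 assume d: "norm de <= 1" and x: "norm x <= B"
 have "norm de * L y <= norm de * ex 2 y" using L_ex2 by (intro mult_left_mono) auto
 then have 1: "\<bar>(de \<bullet> x) * g' (y - \<beta>0 \<bullet> x)\<bar> <= norm de * ex 2 y" using inner_score_shift[OF x, of de y] by (simp add: abs_mult)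
 have eq: "y - \<beta>0 \<bullet> x - de \<bullet> x = y - (\<beta>0 + de) \<bullet> x" by (simp add: inner_add_left)
 have "\<bar>zm de x (y - \<beta>0 \<bullet> x)\<bar> <= norm de * ex 2 y"
  unfolding zm_def eq using L_lip[OF d x, of y] d by (intro exp_diff_bound) (auto simp: abs_minus_commute)
 then show ?thesis using 1 by (simp add: rh_def)
qed

lemma Q3_nonneg: "Q3 de >= 0" by (simp add: Q3_def)

lemma rho_sq_int: "norm de <= 1 ==> integrable M (\<lambda>om. (rh de (Xs j om) (es j om))^2)"
proof (rule integrable_e_bound[where c=4 and k=4 and ph="\<lambda>x t. (rh de x t)^2"])
 fix x :: 'v and t assume d: "norm de <= 1" and x: "norm x <= B"
 have "2 * norm de * ex 2 t <= 2 * 1 * ex 2 t" using d ex_nonneg by (intro mult_right_mono) auto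
 then have "\<bar>rh de x t\<bar> <= 2 * ex 2 t" using rho_abs[OF d x, of t] by simp
 from power_mono[OF this abs_ge_zero, of 2] show "\<bar>(rh de x t)\<^sup>2\<bar> <= 4 * ex 4 t"
  by (simp add: power_mult_distrib ex_power)
qed measurable

lemma nn_Q3: "norm de <= 1 ==> (NNI M (\<lambda>om. ennreal ((rh de (Xs j om) (es j om))^2))) = ennreal (Q3 de)"
proof -
 assume d: "norm de <= 1"
 have m: "(\<lambda>(x, t). ennreal ((rh de x t)^2)) \<in> borel_measurable borel"
  unfolding borel_prod[symmetric] by measurable
 have "(NNI M (\<lambda>om. ennreal ((rh de (Xs j om) (es j om))^2))) = (NNI M (\<lambda>om. ennreal ((rh de (Xs 0 om) (es 0 om))^2)))"
  using nn_integral_Z[OF m, of j] nn_integral_Z[OF m, of 0] by simp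
 also have "... = ennreal (Q3 de)" unfolding Q3_def by (intro nn_integral_eq_integral rho_sq_int d) simp
 finally show ?thesis .
qed

lemma score_int: "integrable M (\<lambda>om. (g' (y - \<beta>0 \<bullet> Xt i om) * p 0 (Xt i om) y) *\<^sub>R Xt i om)"
proof (rule integrable_const_bound[where B="L y * (ex 1 y * f y)"])
 show "AE om in M. norm ((g' (y - \<beta>0 \<bullet> Xt i om) * p 0 (Xt i om) y) *\<^sub>R Xt i om) <= L y * (ex 1 y * f y)"
 proof (rule AE_I2)
  fix om
  have "\<bar>g' (y - \<beta>0 \<bullet> Xt i om)\<bar> * norm (Xt i om) <= \<bar>g' (y - \<beta>0 \<bullet> Xt i om)\<bar> * B" using Xt_le by (intro mult_left_mono) auto
  also have "... <= L y" using L_score_shift[OF Xt_le, of y] by (simp add: mult.commute)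
  finally have "(\<bar>g' (y - \<beta>0 \<bullet> Xt i om)\<bar> * norm (Xt i om)) * \<bar>p 0 (Xt i om) y\<bar> <= L y * (ex 1 y * f y)"
   using L_nonneg by (intro mult_mono p_abs_le Xt_le) auto
  then show "norm ((g' (y - \<beta>0 \<bullet> Xt i om) * p 0 (Xt i om) y) *\<^sub>R Xt i om) <= L y * (ex 1 y * f y)"
   by (simp add: abs_mult mult_ac)
 qed
qed measurable

lemma norm_sY: "norm (sY y) <= L y"
proof -
 have "norm (expectation (\<lambda>om. (g' (y - \<beta>0 \<bullet> Xt 0 om) * p 0 (Xt 0 om) y) *\<^sub>R Xt 0 om))
  <= expectation (\<lambda>om. L y * p 0 (Xt 0 om) y)"
 proof (rule order_trans[OF integral_norm_bound integral_mono])
  fix om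
  have "\<bar>g' (y - \<beta>0 \<bullet> Xt 0 om)\<bar> * norm (Xt 0 om) <= \<bar>g' (y - \<beta>0 \<bullet> Xt 0 om)\<bar> * B" using Xt_le by (intro mult_left_mono) auto
  also have "... <= L y" using L_score_shift[OF Xt_le, of y] by (simp add: mult.commute)
  finally have "(\<bar>g' (y - \<beta>0 \<bullet> Xt 0 om)\<bar> * norm (Xt 0 om)) * p 0 (Xt 0 om) y <= L y * p 0 (Xt 0 om) y"
   using p_pos by (intro mult_right_mono) (auto intro: less_imp_le)
  then show "norm ((g' (y - \<beta>0 \<bullet> Xt 0 om) * p 0 (Xt 0 om) y) *\<^sub>R Xt 0 om) <= L y * p 0 (Xt 0 om) y"
   using p_pos[of 0 "Xt 0 om" y] by (simp add: abs_mult mult_ac)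
 qed (rule integrable_norm[OF score_int], use p_integrable[of 0] in simp)
 also have "... = L y * pbar 0 y" by (simp add: pbar_def)
 finally show ?thesis using pbar_pos[of 0 y] by (simp add: sY_def divide_simps mult.commute)
qed

lemma inner_sY: "de \<bullet> sY y = expectation (\<lambda>om. (de \<bullet> Xt 0 om) * g' (y - \<beta>0 \<bullet> Xt 0 om) * p 0 (Xt 0 om) y) / pbar 0 y"
proof -
 have "de \<bullet> sY y = (de \<bullet> expectation (\<lambda>om. (g' (y - \<beta>0 \<bullet> Xt 0 om) * p 0 (Xt 0 om) y) *\<^sub>R Xt 0 om)) / pbar 0 y"
  by (simp add: sY_def divide_inverse mult.commute)
 also have "de \<bullet> expectation (\<lambda>om. (g' (y - \<beta>0 \<bullet> Xt 0 om) * p 0 (Xt 0 om) y) *\<^sub>R Xt 0 om)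
  = expectation (\<lambda>om. de \<bullet> ((g' (y - \<beta>0 \<bullet> Xt 0 om) * p 0 (Xt 0 om) y) *\<^sub>R Xt 0 om))"
  by (rule integral_inner_right[symmetric]) (rule score_int)
 finally show ?thesis by (simp add: mult_ac)
qed

lemma sY_p_int: "norm x <= B ==> integrable lborel (\<lambda>y. p 0 x y *\<^sub>R sY y)"
proof (rule Bochner_Integration.integrable_bound[OF J_int[of 2]])
 assume x: "norm x <= B"
 show "AE y in lborel. norm (p 0 x y *\<^sub>R sY y) <= norm (ex 2 y * f y)"
 proof (rule AE_I2)
  fix y
  have "\<bar>p 0 x y\<bar> * norm (sY y) <= (ex 1 y * f y) * ex 1 y"
   using x ex_nonneg f_nonneg by (intro mult_mono p_abs_le order_trans[OF norm_sY L_le_ex]) auto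
  also have "... = ex 2 y * f y" using ex_mult[of 1 y 1] by (simp add: mult_ac numeral_2_eq_2)
  finally show "norm (p 0 x y *\<^sub>R sY y) <= norm (ex 2 y * f y)" using ex_nonneg f_nonneg by simp
 qed
qed measurable

lemma norm_w: "norm x <= B ==> norm (w x) <= J 2"
proof -
 assume x: "norm x <= B"
 have "norm (w x) <= (LINT y|lborel. ex 2 y * f y)"
  unfolding w_def norm_minus_cancel
 proof (rule order_trans[OF integral_norm_bound integral_mono])
  fix y
  have "\<bar>p 0 x y\<bar> * norm (sY y) <= (ex 1 y * f y) * ex 1 y"
   using x ex_nonneg f_nonneg by (intro mult_mono p_abs_le order_trans[OF norm_sY L_le_ex]) auto
  also have "... = ex 2 y * f y" using ex_mult[of 1 y 1] by (simp add: mult_ac numeral_2_eq_2)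
  finally show "norm (p 0 x y *\<^sub>R sY y) <= ex 2 y * f y" by simp
 qed (rule integrable_norm[OF sY_p_int[OF x]], rule J_int)
 then show ?thesis by (simp add: J_def)
qed

text \<open>Passing from the matched pair to \<^term>\<open>Y\<close> alone, and then to the conditional mean given the
 covariate, can only decrease the quadratic-mean error.\<close>

lemma zb_quadratic_mean:
 assumes d: "norm de <= 1"
 shows "(NNI M (\<lambda>om. ennreal ((zb de (Yt j om) - de \<bullet> sY (Yt j om))^2))) <= ennreal (Q3 de)"
proof -
 have pt: "ennreal (pbar 0 y) * ennreal ((zb de y - de \<bullet> sY y)^2)
  <= (NNI M (\<lambda>om. ennreal (p 0 (Xt 0 om) y * (rh de (Xt 0 om) (y - \<beta>0 \<bullet> Xt 0 om))^2)))" for y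
 proof -
  define r where "r om = rh de (Xt 0 om) (y - \<beta>0 \<bullet> Xt 0 om)" for om
  define q where "q om = p 0 (Xt 0 om) y" for om
  have [measurable]: "r \<in> borel_measurable M" "q \<in> borel_measurable M" unfolding r_def q_def by measurable
  have q: "q om > 0" "\<bar>q om\<bar> <= ex 1 y * f y" for om using p_pos p_abs_le[OF _ Xt_le, of 0] by (auto simp: q_def)
  have r: "\<bar>r om\<bar> <= 2 * norm de * ex 2 y" for om unfolding r_def by (rule rho_shift_abs[OF d Xt_le])
  have r2: "\<bar>(r om)\<^sup>2\<bar> <= (2 * norm de * ex 2 y)^2" for om using power_mono[OF r abs_ge_zero, of om 2] by simp
  have iq: "integrable M q" using q by (intro integrable_const_bound[where B="ex 1 y * f y"]) auto
  have irq: "integrable M (\<lambda>om. r om * q om)"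
   using r q ex_nonneg by (intro integrable_const_bound[where B="2 * norm de * ex 2 y * (ex 1 y * f y)"])
    (auto simp: abs_mult intro!: AE_I2 mult_mono)
  have ir2q: "integrable M (\<lambda>om. (r om)^2 * q om)"
   using r2 q ex_nonneg by (intro integrable_const_bound[where B="(2 * norm de * ex 2 y)^2 * (ex 1 y * f y)"])
    (auto simp: abs_mult intro!: AE_I2 mult_mono)
  have Eq: "expectation q = pbar 0 y" by (simp add: q_def[abs_def] pbar_def)
  have pb: "pbar 0 y > 0" by (rule pbar_pos) simp
  \<comment> \<open>Weighted by \<open>p 0\<close>, the relative error r becomes the error of the
    density increment itself, whose mean over the covariates is the error for
    \<open>pbar\<close>.\<close>
  have rq: "r om * q om = p de (Xt 0 om) y - p 0 (Xt 0 om) y - (de \<bullet> Xt 0 om) * g' (y - \<beta>0 \<bullet> Xt 0 om) * p 0 (Xt 0 om) y" for om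
  proof -
   have eq: "y - \<beta>0 \<bullet> Xt 0 om - de \<bullet> Xt 0 om = y - (\<beta>0 + de) \<bullet> Xt 0 om" by (simp add: inner_add_left)
   have "exp (g (y - \<beta>0 \<bullet> Xt 0 om) - g (y - \<beta>0 \<bullet> Xt 0 om - de \<bullet> Xt 0 om)) * p 0 (Xt 0 om) y = p de (Xt 0 om) y"
    unfolding eq p_def f_def mult_exp_exp by simp
   then show ?thesis by (simp add: r_def q_def rh_def zm_def algebra_simps)
  qed
  have isc: "integrable M (\<lambda>om. (de \<bullet> Xt 0 om) * g' (y - \<beta>0 \<bullet> Xt 0 om) * p 0 (Xt 0 om) y)"
   using integrable_inner_right[OF score_int[of y 0], of de] by (simp add: mult_ac)
  have "expectation (\<lambda>om. r om * q om) = pbar de y - pbar 0 y - (de \<bullet> sY y) * pbar 0 y"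
   unfolding rq using p_integrable[OF d, of 0] p_integrable[of 0 0] isc pb by (simp add: pbar_def[symmetric] inner_sY)
  also have "pbar de y - pbar 0 y = zb de y * pbar 0 y" using pb by (simp add: zb_def)
  also have "zb de y * pbar 0 y - (de \<bullet> sY y) * pbar 0 y = (zb de y - de \<bullet> sY y) * pbar 0 y"
   by (rule left_diff_distrib[symmetric])
  finally have "((zb de y - de \<bullet> sY y) * pbar 0 y)^2 <= expectation (\<lambda>om. (r om)^2 * q om) * pbar 0 y"
   using weighted_Cauchy_Schwarz[OF iq _ irq ir2q] q(1) pb by (simp add: Eq less_imp_le)
  then have "pbar 0 y * (zb de y - de \<bullet> sY y)^2 <= expectation (\<lambda>om. (r om)^2 * q om)"
   using pb by (simp add: power_mult_distrib power2_eq_square[of "pbar 0 y"] mult_ac)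
  then have "ennreal (pbar 0 y * (zb de y - de \<bullet> sY y)^2) <= ennreal (expectation (\<lambda>om. (r om)^2 * q om))" by (rule ennreal_leI)
  also have "... = (NNI M (\<lambda>om. ennreal ((r om)^2 * q om)))"
   using q(1) by (intro nn_integral_eq_integral[symmetric] ir2q AE_I2) (simp add: less_imp_le)
  finally show ?thesis using pb by (simp add: r_def q_def mult.commute ennreal_mult'')
 qed
 have "(NNI M (\<lambda>om. ennreal ((zb de (Yt j om) - de \<bullet> sY (Yt j om))^2))) = (NNI lborel (\<lambda>y. ennreal (pbar 0 y) * ennreal ((zb de y - de \<bullet> sY y)^2)))"
  by (rule nn_integral_Y) measurable
 also have "... <= (NNI lborel (\<lambda>y. \<integral>\<^sup>+om. ennreal (p 0 (Xt 0 om) y * (rh de (Xt 0 om) (y - \<beta>0 \<bullet> Xt 0 om))^2) \<partial>M))"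
  by (intro nn_integral_mono pt)
 also have "... = (NNI M (\<lambda>om. \<integral>\<^sup>+y. ennreal (p 0 (Xt 0 om) y * (rh de (Xt 0 om) (y - \<beta>0 \<bullet> Xt 0 om))^2) \<partial>lborel))"
  by (rule fubini_M_lborel[symmetric]) measurable
 also have "... = (NNI M (\<lambda>om. \<integral>\<^sup>+t. ennreal (f t) * ennreal ((rh de (Xt 0 om) t)^2) \<partial>lborel))"
 proof (rule nn_integral_cong)
  fix om
  show "(NNI lborel (\<lambda>y. ennreal (p 0 (Xt 0 om) y * (rh de (Xt 0 om) (y - \<beta>0 \<bullet> Xt 0 om))^2))) = (NNI lborel (\<lambda>t. ennreal (f t) * ennreal ((rh de (Xt 0 om) t)^2)))"
   using nn_integral_translate[of "\<lambda>t. ennreal (f t) * ennreal ((rh de (Xt 0 om) t)^2)" "\<beta>0 \<bullet> Xt 0 om"]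
   by (simp add: p_def f_nonneg ennreal_mult)
 qed
 also have "... = (NNI M (\<lambda>om. ennreal ((rh de (Xs 0 om) (es 0 om))^2)))"
  by (rule nn_integral_Z[symmetric]) (unfold borel_prod[symmetric], measurable)
 also have "... = ennreal (Q3 de)" by (rule nn_Q3[OF d])
 finally show ?thesis .
qed

text \<open>Jensen's inequality once more, with \<open>p 0 x\<close> as a probability density in y.
  Averaging over the covariate turns it into the density of the response, where the previous bound
  applies.\<close>

lemma k1_quadratic_mean:
 assumes d: "norm de <= 1"
 shows "(NNI M (\<lambda>om. ennreal ((k1 de (Xt i om) - de \<bullet> w (Xt i om))^2))) <= ennreal (Q3 de)"
proof -
 define r where "r y = zb de y - de \<bullet> sY y" for y
 have [measurable]: "r \<in> borel_measurable borel" unfolding r_def by measurable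
 have dn: "norm de * a <= a" if "a >= 0" for a using mult_right_mono[OF d that] by simp
 have r: "\<bar>r y\<bar> <= 2 * ex 2 y" for y
 proof -
  have "\<bar>de \<bullet> sY y\<bar> <= norm de * L y"
   using Cauchy_Schwarz_ineq2[of de "sY y"] mult_left_mono[OF norm_sY[of y] norm_ge_zero[of de]] by linarith
  then show ?thesis using zb_abs[OF d, of y] dn[OF L_nonneg[of y]] dn[OF ex_nonneg[of 2 y]] L_ex2[of y] by (simp add: r_def)
 qed
 have r2: "\<bar>(r y)\<^sup>2\<bar> <= 4 * ex 4 y" for y
  using power_mono[OF r abs_ge_zero, of y 2] by (simp add: power_mult_distrib ex_power)
 have "ennreal ((k1 de (Xt i om) - de \<bullet> w (Xt i om))^2) <= (NNI lborel (\<lambda>y. ennreal (p 0 (Xt i om) y * (r y)^2)))" for om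
 proof -
  let ?p = "p 0 (Xt i om)"
  have bd: "\<bar>u * ?p y\<bar> <= c * (ex (Suc k) y * f y)" if "\<bar>u\<bar> <= c * ex k y" for u c k y
  proof -
   have "\<bar>u\<bar> * \<bar>?p y\<bar> <= (c * ex k y) * (ex 1 y * f y)"
    using that by (intro mult_mono p_abs_le Xt_le) auto
   also have "... = c * (ex (Suc k) y * f y)" using ex_mult[of k y 1] by (simp add: mult_ac)
   finally show ?thesis by (simp add: abs_mult)
  qed
  have i1: "integrable lborel (\<lambda>y. r y * ?p y)" using bd r by (intro integrable_J_bound[where c=2 and k=3]) (auto simp: eval_nat_numeral)
  have i2: "integrable lborel (\<lambda>y. (r y)^2 * ?p y)" by (rule integrable_J_bound[where c=4 and k="Suc 4"], measurable) (rule bd, use r2 in simp)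
  have i3: "integrable lborel (\<lambda>y. zb de y * ?p y)"
   by (rule integrable_J_bound[where c=1 and k="Suc 2"], measurable)
    (rule bd, unfold mult_1, rule order_trans[OF zb_abs[OF d] dn[OF ex_nonneg]])
  have i4: "integrable lborel (\<lambda>y. (de \<bullet> sY y) * ?p y)"
   using integrable_inner_right[OF sY_p_int[OF Xt_le], of de i om] by (simp add: mult.commute)
  have w: "de \<bullet> w (Xt i om) = - (LINT y|lborel. (de \<bullet> sY y) * ?p y)"
   unfolding w_def inner_minus_right integral_inner_right[OF sY_p_int[OF Xt_le], symmetric]
   by (simp add: mult.commute)
  have "k1 de (Xt i om) - de \<bullet> w (Xt i om) = - (LINT y|lborel. r y * ?p y)"
   using i3 i4 by (simp add: k1_def w r_def left_diff_distrib)
  then have "(k1 de (Xt i om) - de \<bullet> w (Xt i om))^2 <= (LINT y|lborel. (r y)^2 * ?p y)"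
   using weighted_Cauchy_Schwarz[OF integrable_p _ i1 i2] p_pos by (simp add: integral_p less_imp_le)
  then have "ennreal ((k1 de (Xt i om) - de \<bullet> w (Xt i om))^2) <= ennreal (LINT y|lborel. (r y)^2 * ?p y)" by (rule ennreal_leI)
  also have "... = (NNI lborel (\<lambda>y. ennreal ((r y)^2 * ?p y)))"
   using p_pos by (intro nn_integral_eq_integral[symmetric] i2 AE_I2) (simp add: less_imp_le)
  finally show ?thesis by (simp add: mult.commute)
 qed
 then have "(NNI M (\<lambda>om. ennreal ((k1 de (Xt i om) - de \<bullet> w (Xt i om))^2))) <= (NNI M (\<lambda>om. \<integral>\<^sup>+y. ennreal (p 0 (Xt i om) y * (r y)^2) \<partial>lborel))"
  by (rule nn_integral_mono)
 also have "... = (NNI lborel (\<lambda>y. \<integral>\<^sup>+om. ennreal (p 0 (Xt i om) y * (r y)^2) \<partial>M))"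
  by (rule fubini_M_lborel) measurable
 also have "... = (NNI lborel (\<lambda>y. ennreal (pbar 0 y) * ennreal ((r y)^2)))"
 proof (rule nn_integral_cong)
  fix y
  have "(NNI M (\<lambda>om. ennreal (p 0 (Xt i om) y * (r y)^2))) = (NNI M (\<lambda>om. ennreal (p 0 (Xt i om) y) * ennreal ((r y)^2)))"
   by (simp add: ennreal_mult'')
  also have "... = (NNI M (\<lambda>om. ennreal (p 0 (Xt i om) y))) * ennreal ((r y)^2)" by (rule nn_integral_multc) measurable
  also have "(NNI M (\<lambda>om. ennreal (p 0 (Xt i om) y))) = ennreal (expectation (\<lambda>om. p 0 (Xt i om) y))"
   using p_pos by (intro nn_integral_eq_integral p_integrable AE_I2) (auto intro: less_imp_le)
  also have "expectation (\<lambda>om. p 0 (Xt i om) y) = pbar 0 y"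
   using Xt_law[of i] integral_distr[of "Xt i" M borel "\<lambda>x. p 0 x y"] integral_distr[of "Xt 0" M borel "\<lambda>x. p 0 x y"]
   by (simp add: pbar_def)
  finally show "(NNI M (\<lambda>om. ennreal (p 0 (Xt i om) y * (r y)^2))) = ennreal (pbar 0 y) * ennreal ((r y)^2)" .
 qed
 also have "... = (NNI M (\<lambda>om. ennreal ((zb de (Yt 0 om) - de \<bullet> sY (Yt 0 om))^2)))"
  unfolding r_def by (rule nn_integral_Y[symmetric]) measurable
 also have "... <= ennreal (Q3 de)" by (rule zb_quadratic_mean[OF d])
 finally show ?thesis .
qed

text \<open>Errors have a density, so the possible kink at the origin is met with probability
  zero.\<close>

lemma e_nonzero: "AE om in M. es k om \<noteq> 0"
proof -
 have "(NNI M (\<lambda>om. indicator {0} (es k om))) = (NNI lborel (\<lambda>t. ennreal (f t) * indicator {0} t))"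
  by (rule nn_integral_e) simp
 also have "... = 0" by (simp add: nn_integral_0_iff_AE AE_lborel_singleton indicator_def) (use AE_lborel_singleton[of 0] in auto)
 finally have "AE om in M. indicator {0} (es k om) = (0::ennreal)" by (subst (asm) nn_integral_0_iff_AE) auto
 then show ?thesis by (auto simp: indicator_def split: if_splits elim!: AE_mp)
qed

text \<open>At every e other than the kink, the difference quotient of s |-> exp (g e - g (e - s c))
  at 0 converges to c g'(e), and the envelope dominates its squared error. Dominated convergence
  gives differentiability in quadratic mean without a second derivative.\<close>

lemma Q3_limit: "(\<lambda>n. real n * Q3 (h /\<^sub>R sqrt (real n))) \<longlonglongrightarrow> 0"
proof -
 define u where "u n om = (if norm h <= sqrt (real n) then real n * (rh (h /\<^sub>R sqrt (real n)) (Xs 0 om) (es 0 om))^2 else 0)" for n om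
 have [measurable]: "u n \<in> borel_measurable M" for n unfolding u_def by measurable
 have lim: "(\<lambda>n. expectation (u n)) \<longlonglongrightarrow> expectation (\<lambda>_. 0 :: real)"
 proof (rule integral_dominated_convergence[where w="\<lambda>om. 4 * (norm h)^2 * ex 4 (es 0 om)"])
  show "integrable M (\<lambda>om. 4 * (norm h)^2 * ex 4 (es 0 om))"
   using integrable_e_bound[of "\<lambda>x t. ex 4 t" 1 4 0] ex_nonneg by simp
  show "AE om in M. norm (u n om) <= 4 * (norm h)^2 * ex 4 (es 0 om)" for n
  proof (rule AE_I2)
   fix om
   show "norm (u n om) <= 4 * (norm h)^2 * ex 4 (es 0 om)"
   proof (cases "norm h <= sqrt (real n) \<and> n > 0")
    case True
    then have d: "norm (h /\<^sub>R sqrt (real n)) <= 1" by (simp add: divide_simps)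
    have "\<bar>rh (h /\<^sub>R sqrt (real n)) (Xs 0 om) (es 0 om)\<bar>\<^sup>2 <= (2 * norm (h /\<^sub>R sqrt (real n)) * ex 2 (es 0 om))^2"
     by (intro power_mono rho_abs d Xs_le) simp
    then have "real n * (rh (h /\<^sub>R sqrt (real n)) (Xs 0 om) (es 0 om))^2 <= real n * (2 * norm (h /\<^sub>R sqrt (real n)) * ex 2 (es 0 om))^2"
     by (intro mult_left_mono) auto
    also have "... = 4 * (norm h)^2 * ex 4 (es 0 om)"
     using True by (simp add: power_mult_distrib ex_power field_simps)
    finally show ?thesis using True by (simp add: u_def)
   next
    case False
    then show ?thesis using ex_nonneg[of 4 "es 0 om"] by (auto simp: u_def)
   qed
  qed
  show "AE om in M. (\<lambda>n. u n om) \<longlonglongrightarrow> 0"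
   using e_nonzero[of 0]
  proof eventually_elim
   case (elim om)
   define c where "c = h \<bullet> Xs 0 om"
   define F where "F s = exp (g (es 0 om) - g (es 0 om - s * c))" for s
   have "((\<lambda>s. g (es 0 om - s * c)) has_real_derivative g' (es 0 om) * (- c)) (at 0)"
    by (rule DERIV_chain2[where f=g]) (use g_deriv[OF elim] in \<open>auto intro!: derivative_eq_intros\<close>)
   then have "(F has_real_derivative c * g' (es 0 om)) (at 0)"
    unfolding F_def[abs_def] by (auto intro!: derivative_eq_intros)
   then have "((\<lambda>s. (F (0 + s) - F 0) / s) \<longlongrightarrow> c * g' (es 0 om)) (at 0)" unfolding DERIV_def .
   moreover have "filterlim (\<lambda>n. 1 / sqrt (real n)) (at 0) sequentially"
   proof (rule filterlim_atI)
    show "(\<lambda>n. 1 / sqrt (real n)) \<longlonglongrightarrow> 0"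
     by (intro real_tendsto_divide_at_top[OF tendsto_const] filterlim_compose[OF sqrt_at_top filterlim_real_sequentially])
    show "\<forall>\<^sub>F n in sequentially. 1 / sqrt (real n) \<noteq> 0" using eventually_gt_at_top[of 0] by eventually_elim simp
   qed
   ultimately have "(\<lambda>n. (F (0 + 1 / sqrt (real n)) - F 0) / (1 / sqrt (real n))) \<longlonglongrightarrow> c * g' (es 0 om)"
    by (rule filterlim_compose)
   then have "(\<lambda>n. ((F (0 + 1 / sqrt (real n)) - F 0) / (1 / sqrt (real n)) - c * g' (es 0 om))^2) \<longlonglongrightarrow> (c * g' (es 0 om) - c * g' (es 0 om))^2"
    by (intro tendsto_intros)
   then have lim: "(\<lambda>n. ((F (0 + 1 / sqrt (real n)) - F 0) / (1 / sqrt (real n)) - c * g' (es 0 om))^2) \<longlonglongrightarrow> 0" by simp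
   show "(\<lambda>n. u n om) \<longlonglongrightarrow> 0"
   proof (rule Lim_transform_eventually[OF lim])
    show "\<forall>\<^sub>F n in sequentially. ((F (0 + 1 / sqrt (real n)) - F 0) / (1 / sqrt (real n)) - c * g' (es 0 om))^2 = u n om"
     using eventually_gt_at_top[of "nat \<lceil>(norm h)\<^sup>2\<rceil>"]
    proof eventually_elim
     case (elim n)
     then have n: "(norm h)^2 <= real n" "n > 0" by linarith+
     then have "norm h <= sqrt (real n)" by (simp add: real_le_rsqrt)
     then have "u n om = (sqrt (real n) * rh (h /\<^sub>R sqrt (real n)) (Xs 0 om) (es 0 om))^2"
      by (simp add: u_def power_mult_distrib)
     also have "sqrt (real n) * rh (h /\<^sub>R sqrt (real n)) (Xs 0 om) (es 0 om)
      = (F (0 + 1 / sqrt (real n)) - F 0) / (1 / sqrt (real n)) - c * g' (es 0 om)"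
      using n by (simp add: rh_def zm_def F_def c_def field_simps)
     finally show ?case by simp
    qed
   qed
  qed
 qed measurable
 have "\<forall>\<^sub>F n in sequentially. expectation (u n) = real n * Q3 (h /\<^sub>R sqrt (real n))"
  using eventually_gt_at_top[of "nat \<lceil>(norm h)\<^sup>2\<rceil>"]
 proof eventually_elim
  case (elim n)
  then have "(norm h)^2 <= real n" by linarith
  then have "norm h <= sqrt (real n)" by (simp add: real_le_rsqrt)
  then show ?case by (simp add: u_def[abs_def] Q3_def)
 qed
 with lim show ?thesis by (simp add: Lim_transform_eventually)
qed

end

context ssl_env
begin

subsection \<open>Centred scores\<close>

lemma expectation_zm: "norm de <= 1 ==> expectation (\<lambda>om. zm de (Xs k om) (es k om)) = 0"
 and integrable_zm: "norm de <= 1 ==> integrable M (\<lambda>om. zm de (Xs k om) (es k om))"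
 and integrable_zm_sq: "norm de <= 1 ==> integrable M (\<lambda>om. (zm de (Xs k om) (es k om))^2)"
proof -
 assume d: "norm de <= 1"
 have z: "\<bar>zm de x t\<bar> <= 1 * ex 2 t" if "norm x <= B" for x t
  using zm_abs[OF d that, of t] mult_right_mono[OF d ex_nonneg[of 2 t]] by linarith
 show i: "integrable M (\<lambda>om. zm de (Xs k om) (es k om))"
  by (rule integrable_e_bound[where ph="zm de" and c=1 and k=2, OF _ z]) measurable
 show "integrable M (\<lambda>om. (zm de (Xs k om) (es k om))^2)"
 proof (rule integrable_e_bound[where ph="\<lambda>x t. (zm de x t)^2" and c=1 and k=4])
  show "\<bar>(zm de x t)\<^sup>2\<bar> <= 1 * ex 4 t" if "norm x <= B" for x t
   using power_mono[OF z[OF that, of t] abs_ge_zero, of 2] by (simp add: ex_power)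
 qed measurable
 have "(NNI M (\<lambda>om. ennreal (zm de (Xs k om) (es k om) + 1))) = (NNI M (\<lambda>om. \<integral>\<^sup>+t. ennreal (f t) * ennreal (zm de (Xt 0 om) t + 1) \<partial>lborel))"
  by (rule nn_integral_Z) (unfold borel_prod[symmetric], measurable)
 also have "... = (NNI M (\<lambda>om. \<integral>\<^sup>+t. ennreal (f (t - de \<bullet> Xt 0 om)) \<partial>lborel))"
 proof (intro nn_integral_cong)
  fix om t
  show "ennreal (f t) * ennreal (zm de (Xt 0 om) t + 1) = ennreal (f (t - de \<bullet> Xt 0 om))"
   by (simp add: zm_def f_def mult_exp_exp flip: ennreal_mult)
 qed
 also have "... = 1" by (simp add: nn_integral_f_shift emeasure_space_1)
 finally have "(NNI M (\<lambda>om. ennreal (zm de (Xs k om) (es k om) + 1))) = 1" .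
 moreover have "(NNI M (\<lambda>om. ennreal (zm de (Xs k om) (es k om) + 1))) = ennreal (expectation (\<lambda>om. zm de (Xs k om) (es k om) + 1))"
 proof (rule nn_integral_eq_integral)
  show "integrable M (\<lambda>om. zm de (Xs k om) (es k om) + 1)" using i by simp
 qed (simp add: zm_def)
 ultimately have "ennreal (expectation (\<lambda>om. zm de (Xs k om) (es k om) + 1)) = ennreal 1" by simp
 moreover have "0 <= expectation (\<lambda>om. zm de (Xs k om) (es k om) + 1)"
  by (intro Bochner_Integration.integral_nonneg) (simp add: zm_def)
 ultimately have "expectation (\<lambda>om. zm de (Xs k om) (es k om) + 1) = 1" by (simp only: ennreal_inj zero_le_one)
 then show "expectation (\<lambda>om. zm de (Xs k om) (es k om)) = 0" using i by (simp add: prob_space)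
qed

lemma zb_abs1: "norm de <= 1 ==> \<bar>zb de y\<bar> <= 1 * ex 2 y"
 using zb_abs[of de y] mult_right_mono[OF _ ex_nonneg[of 2 y], of "norm de" 1] by simp

lemma integrable_zb: "norm de <= 1 ==> integrable M (\<lambda>om. zb de (Yt k om))"
 by (rule integrable_Y_bound[OF _ zb_abs1]) auto

lemma integrable_zb_sq: "norm de <= 1 ==> integrable M (\<lambda>om. (zb de (Yt k om))^2)"
proof (rule integrable_Y_bound[where c=1 and k=4])
 assume d: "norm de <= 1"
 show "\<bar>(zb de y)\<^sup>2\<bar> <= 1 * ex 4 y" for y using power_mono[OF zb_abs1[OF d] abs_ge_zero, of y 2] by (simp add: ex_power)
qed measurable

lemma integral_zb: "norm de <= 1 ==> (LINT y|lborel. pbar 0 y * zb de y) = 0"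
proof -
 assume d: "norm de <= 1"
 have "pbar 0 y * zb de y = pbar de y - pbar 0 y" for y using pbar_pos[of 0 y] by (simp add: zb_def)
 then show ?thesis using integrable_pbar[OF d] integrable_pbar[of 0] integral_pbar[OF d] integral_pbar[of 0] by simp
qed

lemma expectation_zb: "norm de <= 1 ==> expectation (\<lambda>om. zb de (Yt k om)) = 0"
 by (subst expectation_Y) (auto simp: integral_zb)

lemma k1_abs: "norm de <= 1 ==> norm x <= B ==> \<bar>k1 de x\<bar> <= J 3"
 and zb_p_abs: "norm de <= 1 ==> norm x <= B ==> \<bar>zb de y * p 0 x y\<bar> <= 1 * (ex 3 y * f y)"
proof -
 assume d: "norm de <= 1" and x: "norm x <= B"
 show b: "\<bar>zb de y * p 0 x y\<bar> <= 1 * (ex 3 y * f y)" for y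
 proof -
  have "\<bar>zb de y\<bar> * \<bar>p 0 x y\<bar> <= (1 * ex 2 y) * (ex 1 y * f y)"
   using ex_nonneg x by (intro mult_mono zb_abs1 d p_abs_le) auto
  then show ?thesis by (simp add: abs_mult ex_mult_left)
 qed
 have i: "integrable lborel (\<lambda>y. zb de y * p 0 x y)"
  by (rule integrable_J_bound[OF _ b]) measurable
 have "\<bar>LINT y|lborel. zb de y * p 0 x y\<bar> <= (LINT y|lborel. ex 3 y * f y)"
  by (rule order_trans[OF integral_abs_bound integral_mono])
   (use integrable_abs[OF i] J_int b in \<open>auto simp: abs_mult\<close>)
 then show "\<bar>k1 de x\<bar> <= J 3" by (simp add: k1_def J_def)
qed

lemma integrable_k1: "norm de <= 1 ==> integrable M (\<lambda>om. k1 de (Xt i om))"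
 by (intro integrable_const_bound[where B="J 3"]) (auto intro!: AE_I2 k1_abs Xt_le)

lemma integrable_k1_sq: "norm de <= 1 ==> integrable M (\<lambda>om. (k1 de (Xt i om))^2)"
proof (rule integrable_const_bound[where B="(J 3)^2"])
 assume d: "norm de <= 1"
 show "AE om in M. norm ((k1 de (Xt i om))^2) <= (J 3)^2"
  using power_mono[OF k1_abs[OF d Xt_le] abs_ge_zero, of _ _ 2] by (auto intro!: AE_I2)
qed measurable

lemma expectation_k1: "norm de <= 1 ==> expectation (\<lambda>om. k1 de (Xt 0 om)) = 0"
proof -
 assume d: "norm de <= 1"
 interpret PL: pair_sigma_finite M "lborel :: real measure" by standard
 have int: "integrable (M \<Otimes>\<^sub>M lborel) (\<lambda>(om, y). zb de y * p 0 (Xt 0 om) y)"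
 proof (rule integrableI_bounded)
  have "(NNI ((M \<Otimes>\<^sub>M lborel)) (\<lambda>z. ennreal (norm (case z of (om, y) => zb de y * p 0 (Xt 0 om) y))))
   = (NNI M (\<lambda>om. \<integral>\<^sup>+y. ennreal \<bar>zb de y * p 0 (Xt 0 om) y\<bar> \<partial>lborel))"
   by (subst lborel.nn_integral_fst[symmetric]) (auto simp: split_beta')
  also have "... <= (NNI M (\<lambda>om. \<integral>\<^sup>+y. ennreal (1 * (ex 3 y * f y)) \<partial>lborel))"
   by (intro nn_integral_mono ennreal_leI zb_p_abs d Xt_le)
  also have "... = ennreal (J 3)" using nn_J[of 3] by (simp add: emeasure_space_1)
  finally show "(NNI ((M \<Otimes>\<^sub>M lborel)) (\<lambda>z. ennreal (norm (case z of (om, y) => zb de y * p 0 (Xt 0 om) y)))) < \<infinity>"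
   by (auto simp: less_top[symmetric] top_unique)
 qed measurable
 have "expectation (\<lambda>om. k1 de (Xt 0 om)) = - (LINT om|M. LINT y|lborel. zb de y * p 0 (Xt 0 om) y)"
  by (simp add: k1_def)
 also have "(LINT om|M. LINT y|lborel. zb de y * p 0 (Xt 0 om) y) = (LINT y|lborel. LINT om|M. zb de y * p 0 (Xt 0 om) y)"
  by (rule PL.Fubini_integral[OF int, symmetric])
 also have "... = (LINT y|lborel. pbar 0 y * zb de y)" by (simp add: pbar_def mult.commute)
 finally show ?thesis by (simp add: integral_zb[OF d])
qed

lemma expectation_sq_le:
 assumes [measurable]: "W \<in> borel_measurable M" and "(NNI M (\<lambda>om. ennreal ((W om)^2))) <= ennreal c" "c >= 0"
 shows "(expectation W)^2 <= c"
proof -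
 have i: "integrable M (\<lambda>om. (W om)^2)"
  by (rule integrableI_bounded) (use assms(2) in \<open>auto simp: less_top[symmetric] top_unique\<close>)
 have "ennreal (expectation (\<lambda>om. (W om)^2)) <= ennreal c" using nn_integral_eq_integral[OF i] assms(2) by simp
 then have "expectation (\<lambda>om. (W om)^2) <= c" using assms(3) by simp
 moreover have "(expectation W)^2 <= expectation (\<lambda>om. (W om)^2)"
  using variance_positive[of W] variance_eq[OF square_integrable_imp_integrable[OF _ i] i] by simp
 ultimately show ?thesis by simp
qed

text \<open>Scores are shown to be centred without differentiating under an integral. The exact
  increments are centred, so the mean m of their linear part satisfies m(de)^2 <= Q3 de. By
  homogeneity m(h)^2 = n m(h / sqrt n)^2 <= n Q3 (h / sqrt n), which tends to zero.\<close>

lemma eq_0_if_sq_le_Q3: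
 fixes m :: "'v => real"
 assumes scale: "\<And>c h. m (c *\<^sub>R h) = c * m h" and le: "\<And>de. norm de <= 1 ==> (m de)^2 <= Q3 de"
 shows "m h = 0"
proof -
 have "(m h)^2 <= 0"
 proof (rule LIMSEQ_le_const[OF Q3_limit[of h]])
  have "(m h)^2 <= real n * Q3 (h /\<^sub>R sqrt (real n))" if "n >= nat \<lceil>(norm h)\<^sup>2\<rceil> + 1" for n
  proof -
   have n: "(norm h)^2 <= real n" "n > 0" using that by linarith+
   then have "norm h <= sqrt (real n)" by (simp add: real_le_rsqrt)
   then have "norm (h /\<^sub>R sqrt (real n)) <= 1" using n by (simp add: divide_simps)
   from le[OF this] have "real n * (m (h /\<^sub>R sqrt (real n)))^2 <= real n * Q3 (h /\<^sub>R sqrt (real n))"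
    by (intro mult_left_mono) auto
   moreover have "real n * (m (h /\<^sub>R sqrt (real n)))^2 = (m h)^2"
    using n by (simp add: scale power_mult_distrib power_inverse)
   ultimately show ?thesis by simp
  qed
  then show "\<exists>N. \<forall>n\<ge>N. (m h)^2 <= real n * Q3 (h /\<^sub>R sqrt (real n))" by blast
 qed
 then show ?thesis by simp
qed

lemma sM_abs: "norm (x::'v) <= B ==> \<bar>(h \<bullet> x) * g' t\<bar> <= norm h * ex 1 t"
 using inner_score[of x h t] mult_left_mono[OF L_le_ex[of t] norm_ge_zero[of h]] by (simp add: abs_mult)

lemma sY_abs: "\<bar>h \<bullet> sY y\<bar> <= norm h * ex 1 y"
 using Cauchy_Schwarz_ineq2[of h "sY y"] mult_left_mono[OF order_trans[OF norm_sY[of y] L_le_ex] norm_ge_zero[of h]] by linarith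

lemma w_abs: "norm (x::'v) <= B ==> \<bar>h \<bullet> w x\<bar> <= norm h * J 2"
 using Cauchy_Schwarz_ineq2[of h "w x"] mult_left_mono[OF norm_w[of x] norm_ge_zero[of h]] by linarith

lemma integrable_sM_power: "integrable M (\<lambda>om. ((h \<bullet> Xs k om) * g' (es k om)) ^ q)"
proof (rule integrable_e_bound[where ph="\<lambda>x t. ((h \<bullet> x) * g' t) ^ q" and c="norm h ^ q" and k=q])
 show "\<bar>((h \<bullet> x) * g' t) ^ q\<bar> <= norm h ^ q * ex q t" if "norm x <= B" for x t
  using power_mono[OF sM_abs[OF that, of h t] abs_ge_zero, of q]
  by (simp add: power_abs power_mult_distrib[of "norm h"] ex_power)
qed measurable

lemma integrable_sY_power: "integrable M (\<lambda>om. (h \<bullet> sY (Yt k om)) ^ q)"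
proof (rule integrable_Y_bound[where ph="\<lambda>y. (h \<bullet> sY y) ^ q" and c="norm h ^ q" and k=q])
 show "\<bar>(h \<bullet> sY y) ^ q\<bar> <= norm h ^ q * ex q y" for y
  using power_mono[OF sY_abs[of h y] abs_ge_zero, of q]
  by (simp add: power_abs power_mult_distrib[of "norm h"] ex_power)
qed measurable

lemma integrable_w_power: "integrable M (\<lambda>om. (h \<bullet> w (Xt k om)) ^ q)"
proof (rule integrable_const_bound[where B="(norm h * J 2) ^ q"])
 show "AE om in M. norm ((h \<bullet> w (Xt k om)) ^ q) <= (norm h * J 2) ^ q"
  using power_mono[OF w_abs[OF Xt_le, of h] abs_ge_zero, of _ _ q] by (auto intro!: AE_I2 simp: power_abs)
qed measurable

lemma expectation_sM: "expectation (\<lambda>om. (h \<bullet> Xs 0 om) * g' (es 0 om)) = 0"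
proof (rule eq_0_if_sq_le_Q3[where m="\<lambda>h. expectation (\<lambda>om. (h \<bullet> Xs 0 om) * g' (es 0 om))"])
 fix de :: 'v assume d: "norm de <= 1"
 have "expectation (\<lambda>om. rh de (Xs 0 om) (es 0 om)) = - expectation (\<lambda>om. (de \<bullet> Xs 0 om) * g' (es 0 om))"
  unfolding rh_def using integrable_sM_power[of de 0 1] integrable_zm[OF d, of 0] expectation_zm[OF d, of 0] by simp
 moreover have "(expectation (\<lambda>om. rh de (Xs 0 om) (es 0 om)))^2 <= Q3 de"
  by (rule expectation_sq_le) (use nn_Q3[OF d] Q3_nonneg in auto)
 ultimately show "(expectation (\<lambda>om. (de \<bullet> Xs 0 om) * g' (es 0 om)))^2 <= Q3 de" by simp
qed (simp add: mult.assoc)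

lemma expectation_sY: "expectation (\<lambda>om. h \<bullet> sY (Yt 0 om)) = 0"
proof (rule eq_0_if_sq_le_Q3[where m="\<lambda>h. expectation (\<lambda>om. h \<bullet> sY (Yt 0 om))"])
 fix de :: 'v assume d: "norm de <= 1"
 have "expectation (\<lambda>om. zb de (Yt 0 om) - de \<bullet> sY (Yt 0 om)) = - expectation (\<lambda>om. de \<bullet> sY (Yt 0 om))"
  using integrable_sY_power[of de 0 1] integrable_zb[OF d, of 0] expectation_zb[OF d, of 0] by simp
 moreover have "(expectation (\<lambda>om. zb de (Yt 0 om) - de \<bullet> sY (Yt 0 om)))^2 <= Q3 de"
  by (rule expectation_sq_le) (use zb_quadratic_mean[OF d] Q3_nonneg in auto)
 ultimately show "(expectation (\<lambda>om. de \<bullet> sY (Yt 0 om)))^2 <= Q3 de" by simp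
qed simp

lemma expectation_w: "expectation (\<lambda>om. h \<bullet> w (Xt 0 om)) = 0"
proof (rule eq_0_if_sq_le_Q3[where m="\<lambda>h. expectation (\<lambda>om. h \<bullet> w (Xt 0 om))"])
 fix de :: 'v assume d: "norm de <= 1"
 have "expectation (\<lambda>om. k1 de (Xt 0 om) - de \<bullet> w (Xt 0 om)) = - expectation (\<lambda>om. de \<bullet> w (Xt 0 om))"
  using integrable_w_power[of de 0 1] integrable_k1[OF d, of 0] expectation_k1[OF d] by simp
 moreover have "(expectation (\<lambda>om. k1 de (Xt 0 om) - de \<bullet> w (Xt 0 om)))^2 <= Q3 de"
  by (rule expectation_sq_le) (use k1_quadratic_mean[OF d] Q3_nonneg in auto)
 ultimately show "(expectation (\<lambda>om. de \<bullet> w (Xt 0 om)))^2 <= Q3 de" by simp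
qed simp

text \<open>Quadratic forms of the three score covariances. In the concrete model they are those of
  \<Gamma>1, \<Gamma>2 and \<Sigma>2, in this order.\<close>

definition vY :: "'v => real" where "vY h = expectation (\<lambda>om. (h \<bullet> sY (Yt 0 om))^2)"
definition vX :: "'v => real" where "vX h = expectation (\<lambda>om. (h \<bullet> w (Xt 0 om))^2)"
definition vM :: "'v => real" where "vM h = expectation (\<lambda>om. ((h \<bullet> Xs 0 om) * g' (es 0 om))^2)"

text \<open>The criterion times n + m, relative to its value at \<beta>0. Written in errors, the
  matched part no longer mentions \<beta>0.\<close>

definition LLR :: "nat => nat => 'v => 'a => real" where
 "LLR n m de om = (\<Sum>j<n. ln (av n de (XS om) (Yt j om) / av n 0 (XS om) (Yt j om)))
  + (\<Sum>k<m. g (es k om) - g (es k om - de \<bullet> Xs k om))"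

definition SN :: "nat => nat => 'a => 'v" where
 "SN n m om = ((\<Sum>j<n. sY (Yt j om)) + (\<Sum>i<n. w (Xt i om)) + (\<Sum>k<m. g' (es k om) *\<^sub>R Xs k om)) /\<^sub>R sqrt (real (n + m))"

lemma LLR_meas[measurable]: "LLR n m de \<in> borel_measurable M" unfolding LLR_def[abs_def] by measurable
lemma SN_meas[measurable]: "SN n m \<in> borel_measurable M" unfolding SN_def[abs_def] by measurable

lemma matched_remainder:
 assumes d: "norm de <= 1"
 shows "(NNI M (\<lambda>om. ennreal \<bar>\<Sum>k<m. (g (es k om) - g (es k om - de \<bullet> Xs k om))
   - zm de (Xs k om) (es k om) + (zm de (Xs k om) (es k om))^2 / 2\<bar>))
  <= ennreal (real m * (norm de ^ 3 * J 5))"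
proof -
 have pt: "\<bar>(g t - g (t - de \<bullet> x)) - zm de x t + (zm de x t)^2 / 2\<bar> <= norm de ^ 3 * ex 5 t" if x: "norm x <= B" for x t
 proof -
  define l where "l = g t - g (t - de \<bullet> x)"
  have l: "\<bar>l\<bar> <= norm de * L t" unfolding l_def using L_lip0[OF d x, of t] by (simp add: abs_minus_commute)
  have l1: "\<bar>l\<bar> <= norm de * ex 1 t" using l mult_left_mono[OF L_le_ex[of t] norm_ge_zero[of de]] by linarith
  have "norm de * L t <= 1 * L t" using d L_nonneg by (intro mult_right_mono) auto
  then have l2: "exp (2 * \<bar>l\<bar>) <= ex 2 t" using l by (simp add: ex_def)
  have "\<bar>l\<bar> ^ 3 * exp (2 * \<bar>l\<bar>) <= (norm de * ex 1 t) ^ 3 * ex 2 t"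
   using ex_nonneg by (intro mult_mono power_mono l1 l2) auto
  also have "... = norm de ^ 3 * ex 5 t" by (simp add: power_mult_distrib ex_power ex_mult mult.assoc)
  finally show ?thesis using ln_expansion_remainder[of l] unfolding zm_def l_def[symmetric] by linarith
 qed
 have "(NNI M (\<lambda>om. ennreal \<bar>\<Sum>k<m. (g (es k om) - g (es k om - de \<bullet> Xs k om))
   - zm de (Xs k om) (es k om) + (zm de (Xs k om) (es k om))^2 / 2\<bar>))
  <= (NNI M (\<lambda>om. (\<Sum>k<m. ennreal (norm de ^ 3 * ex 5 (es k om)))))"
 proof (rule nn_integral_mono)
  fix om
  have "\<bar>\<Sum>k<m. (g (es k om) - g (es k om - de \<bullet> Xs k om))
   - zm de (Xs k om) (es k om) + (zm de (Xs k om) (es k om))^2 / 2\<bar> <= (\<Sum>k<m. norm de ^ 3 * ex 5 (es k om))"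
   using pt[OF Xs_le] by (intro order_trans[OF sum_abs] sum_mono)
  then show "ennreal \<bar>\<Sum>k<m. (g (es k om) - g (es k om - de \<bullet> Xs k om))
   - zm de (Xs k om) (es k om) + (zm de (Xs k om) (es k om))^2 / 2\<bar> <= (\<Sum>k<m. ennreal (norm de ^ 3 * ex 5 (es k om)))"
   using ex_nonneg by (subst sum_ennreal) (auto intro: ennreal_leI)
 qed
 also have "... = (\<Sum>k<m. \<integral>\<^sup>+om. ennreal (norm de ^ 3 * ex 5 (es k om)) \<partial>M)"
  by (rule nn_integral_sum) measurable
 also have "... <= (\<Sum>k<m. ennreal (norm de ^ 3 * J 5))"
  by (intro sum_mono nn_e_bound) auto
 also have "... = ennreal (real m * (norm de ^ 3 * J 5))"
  using J_nonneg by (simp add: ennreal_mult' ennreal_of_nat_eq_real_of_nat)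
 finally show ?thesis .
qed

end

section \<open>Growing sample sizes and the local scale\<close>

locale ssl_seq = ssl_env M g g' \<beta>0 B Xt Yt Xs es L
 for M :: "'a measure" and g g' :: "real => real" and \<beta>0 :: "'v::euclidean_space" and B :: real
  and Xt :: "nat => 'a => 'v" and Yt :: "nat => 'a => real"
  and Xs :: "nat => 'a => 'v" and es :: "nat => 'a => real" and L :: "real => real" +
 fixes nn mm :: "nat => nat" and lam :: real
 assumes nn_lim: "filterlim nn at_top sequentially" and mm_lim: "filterlim mm at_top sequentially"
  and ratio: "(\<lambda>k. real (mm k) / real (nn k)) \<longlonglongrightarrow> lam" and lam_pos: "lam > 0"
begin

abbreviation "NN k \<equiv> nn k + mm k"
abbreviation "rN k \<equiv> real (NN k)"
abbreviation "LLRk k \<equiv> LLR (nn k) (mm k)"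
abbreviation "SNk k \<equiv> SN (nn k) (mm k)"
abbreviation "LLR_max k om b \<equiv> \<forall>de. LLRk k de om <= LLRk k b om"

lemma nn_pos: "\<forall>\<^sub>F k in sequentially. nn k > 0" and mm_pos: "\<forall>\<^sub>F k in sequentially. mm k > 0"
 using eventually_gt_at_top[of 0] nn_lim mm_lim by (auto simp: filterlim_iff)

lemma NN_lim: "filterlim NN at_top sequentially"
 by (rule filterlim_at_top_mono[OF nn_lim]) auto

lemma rNN_lim: "filterlim (\<lambda>k. rN k) at_top sequentially"
 using filterlim_compose[OF filterlim_real_sequentially NN_lim] .

lemma sNN_lim: "filterlim (\<lambda>k. sqrt (rN k)) at_top sequentially"
 using filterlim_compose[OF sqrt_at_top rNN_lim] .

lemma n_frac: "(\<lambda>k. real (nn k) / rN k) \<longlonglongrightarrow> 1 / (1 + lam)"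
proof -
 have "(\<lambda>k. 1 / (1 + real (mm k) / real (nn k))) \<longlonglongrightarrow> 1 / (1 + lam)"
  using ratio lam_pos by (intro tendsto_intros) auto
 moreover have "\<forall>\<^sub>F k in sequentially. 1 / (1 + real (mm k) / real (nn k)) = real (nn k) / rN k"
  using nn_pos by eventually_elim (simp add: field_simps)
 ultimately show ?thesis by (rule Lim_transform_eventually)
qed

lemma m_frac: "(\<lambda>k. real (mm k) / rN k) \<longlonglongrightarrow> lam / (1 + lam)"
proof -
 have "(\<lambda>k. 1 - real (nn k) / rN k) \<longlonglongrightarrow> 1 - 1 / (1 + lam)" by (intro tendsto_intros n_frac)
 moreover have "1 - 1 / (1 + lam) = lam / (1 + lam)" using lam_pos by (simp add: field_simps)
 moreover have "\<forall>\<^sub>F k in sequentially. 1 - real (nn k) / rN k = real (mm k) / rN k"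
  using nn_pos by eventually_elim (simp add: field_simps)
 ultimately show ?thesis by (auto intro: Lim_transform_eventually)
qed

definition dl :: "'v => nat => 'v" where "dl h k = h /\<^sub>R sqrt (rN k)"

lemma dl_le: "r > 0 ==> \<forall>\<^sub>F k in sequentially. norm (dl h k) <= r"
proof -
 assume r: "r > 0"
 have "\<forall>\<^sub>F k in sequentially. sqrt (rN k) > norm h / r" 
  using sNN_lim by (simp add: filterlim_at_top_dense)
 then show ?thesis using nn_pos
 proof eventually_elim
  case (elim k)
  then have "sqrt (rN k) > 0" by simp
  then show ?case using elim r by (simp add: dl_def divide_simps mult.commute)
 qed
qed

lemma inner_dl: "dl h k \<bullet> x = (h \<bullet> x) / sqrt (rN k)"
 by (simp add: dl_def divide_inverse mult.commute)

lemma Q3_seq: "(\<lambda>k. rN k * Q3 (dl h k)) \<longlonglongrightarrow> 0"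
 using filterlim_compose[OF Q3_limit[of h] NN_lim] by (simp add: dl_def)

lemma c_over_sNN: "(\<lambda>k. c / sqrt (rN k)) \<longlonglongrightarrow> 0"
 by (intro real_tendsto_divide_at_top[OF tendsto_const] sNN_lim)

subsection \<open>Local asymptotic normality\<close>

text \<open>The curvature contains \<open>vY\<close> and \<open>vM\<close> but not
  \<open>vX\<close>. The projection changes the conditional mean of the increments, hence the linear
  term, whereas their squares can be replaced by those of \<open>zb\<close> at no cost.\<close>

lemma LAN_finite:
 "L1_null (\<lambda>k om. LLRk k (dl h k) om - (h \<bullet> SNk k om
  - (real (nn k) / rN k * vY h + real (mm k) / rN k * vM h) / 2))"
proof -
 let ?z = "\<lambda>k om j. z (nn k) (dl h k) (XS om) (Yt j om)"
 let ?l = "\<lambda>k om j. ln (av (nn k) (dl h k) (XS om) (Yt j om) / av (nn k) 0 (XS om) (Yt j om))"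
 note ev = nn_pos dl_le[of 1 h, OF zero_less_one]
 have nd: "norm (dl h k) = norm h / sqrt (rN k)" for k by (simp add: dl_def divide_inverse mult.commute)
 \<comment> \<open>At the local scale N |de|^3 is of order N^(-1/2), which disposes of the cubic
   remainders.\<close>
 have cube: "real q * norm (dl h k) ^ 3 <= norm h ^ 3 / sqrt (rN k)" if "q <= NN k" "NN k > 0" for q k
 proof -
  define s where "s = sqrt (rN k)"
  have s: "s > 0" "s * s = rN k" using that by (auto simp: s_def)
  have "real q * norm (dl h k) ^ 3 <= (s * s) * (norm h / s) ^ 3"
   unfolding s(2) nd s_def using that by (intro mult_right_mono) auto
  also have "... = norm h ^ 3 / s" using s(1) by (simp add: field_simps power3_eq_cube)
  finally show ?thesis by (simp add: s_def)
 qed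
 \<comment> \<open>A1 expands the logarithm, A2 and A3 move the linear term from z to zb plus the
   projection \<open>k1\<close>, A4 moves the squares from z to zb, A5 and A6 insert the scores, and
   A7 is a law of large numbers. M1 to M3 do the same for the matched pairs, where no mixture
   intervenes.\<close>
 have A1: "L1_null (\<lambda>k om. \<Sum>j<nn k. ?l k om j - ?z k om j + (?z k om j)^2 / 2)"
 proof (rule L1_nullI_real[OF _ _ c_over_sNN[of "norm h ^ 3 * J 6"]])
  show "\<forall>\<^sub>F k in sequentially. (NNI M (\<lambda>om. ennreal \<bar>\<Sum>j<nn k. ?l k om j - ?z k om j + (?z k om j)^2 / 2\<bar>)) <= ennreal (norm h ^ 3 * J 6 / sqrt (rN k))"
   using ev
  proof eventually_elim
   case (elim k)
   have "(NNI M (\<lambda>om. ennreal \<bar>\<Sum>j<nn k. ?l k om j - ?z k om j + (?z k om j)^2 / 2\<bar>)) <= ennreal (real (nn k) * (norm (dl h k) ^ 3 * J 6))"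
    by (rule ln_remainder) (use elim in auto)
   also have "... <= ennreal (norm h ^ 3 * J 6 / sqrt (rN k))"
    using mult_right_mono[OF cube[of "nn k" k] J_nonneg[of 6]] elim by (intro ennreal_leI) (simp add: mult_ac)
   finally show ?case .
  qed
 qed measurable
 have A2: "L1_null (\<lambda>k om. (\<Sum>j<nn k. ?z k om j - zb (dl h k) (Yt j om)) - real (nn k) * mz (nn k) (dl h k) (XS om))"
 proof (rule L1_null_of_sq)
  show "\<forall>\<^sub>F k in sequentially. (NNI M (\<lambda>om. ennreal (((\<Sum>j<nn k. ?z k om j - zb (dl h k) (Yt j om)) - real (nn k) * mz (nn k) (dl h k) (XS om))^2)))
   <= ennreal (4 * (norm h / sqrt (rN k))^2 * J 9)"
   using ev
  proof eventually_elim
   case (elim k)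
   show ?case unfolding nd[symmetric] by (rule zeta_sum_sq) (use elim in auto)
  qed
  have "(\<lambda>k. 4 * (norm h / sqrt (rN k))^2 * J 9) \<longlonglongrightarrow> 4 * 0^2 * J 9"
   by (intro tendsto_intros c_over_sNN)
  then show "(\<lambda>k. 4 * (norm h / sqrt (rN k))^2 * J 9) \<longlonglongrightarrow> 0" by simp
 qed measurable
 have A3: "L1_null (\<lambda>k om. real (nn k) * mz (nn k) (dl h k) (XS om) - (\<Sum>i<nn k. k1 (dl h k) (Xt i om)))"
 proof (rule L1_nullI_real)
  show "\<forall>\<^sub>F k in sequentially. (NNI M (\<lambda>om. ennreal \<bar>real (nn k) * mz (nn k) (dl h k) (XS om) - (\<Sum>i<nn k. k1 (dl h k) (Xt i om))\<bar>))
   <= ennreal (5 / 2 * (norm h / sqrt (rN k)) * J 8)"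
   using ev
  proof eventually_elim
   case (elim k)
   show ?case unfolding nd[symmetric] by (rule mz_k1) (use elim in auto)
  qed
  have "(\<lambda>k. 5 / 2 * (norm h / sqrt (rN k)) * J 8) \<longlonglongrightarrow> 5 / 2 * 0 * J 8"
   by (intro tendsto_intros c_over_sNN)
  then show "(\<lambda>k. 5 / 2 * (norm h / sqrt (rN k)) * J 8) \<longlonglongrightarrow> 0" by simp
 qed measurable
 have A4: "L1_null (\<lambda>k om. (\<Sum>j<nn k. (?z k om j)^2) - (\<Sum>j<nn k. (zb (dl h k) (Yt j om))^2))"
 proof (rule L1_nullI_real[OF _ _ c_over_sNN[of "5 * (norm h)^2 * J 9"]])
  show "\<forall>\<^sub>F k in sequentially. (NNI M (\<lambda>om. ennreal \<bar>(\<Sum>j<nn k. (?z k om j)^2) - (\<Sum>j<nn k. (zb (dl h k) (Yt j om))^2)\<bar>))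
   <= ennreal (5 * (norm h)^2 * J 9 / sqrt (rN k))"
   using ev
  proof eventually_elim
   case (elim k)
   define s where "s = sqrt (rN k)"
   have s: "s > 0" using elim by (auto simp: s_def)
   have "(NNI M (\<lambda>om. ennreal \<bar>(\<Sum>j<nn k. (?z k om j)^2) - (\<Sum>j<nn k. (zb (dl h k) (Yt j om))^2)\<bar>)) <= ennreal (5 * sqrt (real (nn k)) * (norm (dl h k))^2 * J 9)"
    by (rule z_sq_diff) (use elim in auto)
   also have "... <= ennreal (5 * s * (norm h / s)^2 * J 9)"
    unfolding nd s_def using J_nonneg by (intro ennreal_leI mult_right_mono mult_left_mono) auto
   also have "5 * s * (norm h / s)^2 * J 9 = 5 * (norm h)^2 * J 9 / s" using s by (simp add: field_simps power2_eq_square)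
   finally show ?case by (simp add: s_def)
  qed
 qed measurable
 have qY: "\<forall>\<^sub>F k in sequentially. (NNI M (\<lambda>om. ennreal ((zb (dl h k) (Yt 0 om) - (h \<bullet> sY (Yt 0 om)) / sqrt (rN k))^2))) <= ennreal (Q3 (dl h k))"
  using dl_le[of 1 h, OF zero_less_one] by eventually_elim (unfold inner_dl[symmetric], rule zb_quadratic_mean)
 have qX: "\<forall>\<^sub>F k in sequentially. (NNI M (\<lambda>om. ennreal ((k1 (dl h k) (Xt 0 om) - (h \<bullet> w (Xt 0 om)) / sqrt (rN k))^2))) <= ennreal (Q3 (dl h k))"
  using dl_le[of 1 h, OF zero_less_one] by eventually_elim (unfold inner_dl[symmetric], rule k1_quadratic_mean)
 have A5: "L1_null (\<lambda>k om. (\<Sum>j<nn k. zb (dl h k) (Yt j om)) - (\<Sum>j<nn k. h \<bullet> sY (Yt j om)) / sqrt (rN k))"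
 proof (rule L1_null_linear_part[OF iid_Y Y_law, where s="\<lambda>y. h \<bullet> sY y" and q="\<lambda>k. Q3 (dl h k)"])
  show "\<forall>\<^sub>F k in sequentially. integrable M (\<lambda>om. (zb (dl h k) (Yt 0 om))^2)"
   using dl_le[of 1 h, OF zero_less_one] by eventually_elim (rule integrable_zb_sq)
  show "\<forall>\<^sub>F k in sequentially. expectation (\<lambda>om. zb (dl h k) (Yt 0 om)) = 0"
   using dl_le[of 1 h, OF zero_less_one] by eventually_elim (rule expectation_zb)
 qed (use qY Q3_seq Q3_nonneg expectation_sY integrable_sY_power[of h 0 2] in auto)
 have A6: "L1_null (\<lambda>k om. (\<Sum>i<nn k. k1 (dl h k) (Xt i om)) - (\<Sum>i<nn k. h \<bullet> w (Xt i om)) / sqrt (rN k))"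
 proof (rule L1_null_linear_part[OF iid_X Xt_law, where s="\<lambda>y. h \<bullet> w y" and q="\<lambda>k. Q3 (dl h k)"])
  show "\<forall>\<^sub>F k in sequentially. integrable M (\<lambda>om. (k1 (dl h k) (Xt 0 om))^2)"
   using dl_le[of 1 h, OF zero_less_one] by eventually_elim (rule integrable_k1_sq)
  show "\<forall>\<^sub>F k in sequentially. expectation (\<lambda>om. k1 (dl h k) (Xt 0 om)) = 0"
   using dl_le[of 1 h, OF zero_less_one] by eventually_elim (rule expectation_k1)
 qed (use qX Q3_seq Q3_nonneg expectation_w integrable_w_power[of h 0 2] in auto)
 have p4: "(a^2)^2 = a ^ 4" for a :: real by simp
 have A7: "L1_null (\<lambda>k om. (\<Sum>j<nn k. (zb (dl h k) (Yt j om))^2) - real (nn k) / rN k * vY h)"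
  unfolding vY_def
  by (rule L1_null_quadratic_part[OF iid_Y Y_law, where s="\<lambda>y. h \<bullet> sY y" and q="\<lambda>k. Q3 (dl h k)" and m="\<lambda>k. rN k"])
   (use qY Q3_seq Q3_nonneg nn_lim integrable_sY_power[of h 0 4] in \<open>auto simp: p4\<close>)
 let ?zm = "\<lambda>k om j. zm (dl h k) (Xs j om) (es j om)"
 have M1: "L1_null (\<lambda>k om. \<Sum>j<mm k. (g (es j om) - g (es j om - dl h k \<bullet> Xs j om)) - ?zm k om j + (?zm k om j)^2 / 2)"
 proof (rule L1_nullI_real[OF _ _ c_over_sNN[of "norm h ^ 3 * J 5"]])
  show "\<forall>\<^sub>F k in sequentially. (NNI M (\<lambda>om. ennreal \<bar>\<Sum>j<mm k. (g (es j om) - g (es j om - dl h k \<bullet> Xs j om)) - ?zm k om j + (?zm k om j)^2 / 2\<bar>))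
   <= ennreal (norm h ^ 3 * J 5 / sqrt (rN k))"
   using ev
  proof eventually_elim
   case (elim k)
   have "(NNI M (\<lambda>om. ennreal \<bar>\<Sum>j<mm k. (g (es j om) - g (es j om - dl h k \<bullet> Xs j om)) - ?zm k om j + (?zm k om j)^2 / 2\<bar>)) <= ennreal (real (mm k) * (norm (dl h k) ^ 3 * J 5))"
    by (rule matched_remainder) (use elim in auto)
   also have "... <= ennreal (norm h ^ 3 * J 5 / sqrt (rN k))"
    using mult_right_mono[OF cube[of "mm k" k] J_nonneg[of 5]] elim by (intro ennreal_leI) (simp add: mult_ac)
   finally show ?case .
  qed
 qed measurable
 have qM: "\<forall>\<^sub>F k in sequentially. (NNI M (\<lambda>om. ennreal ((zm (dl h k) (Xs 0 om) (es 0 om) - ((h \<bullet> Xs 0 om) * g' (es 0 om)) / sqrt (rN k))^2))) <= ennreal (Q3 (dl h k))"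
  using dl_le[of 1 h, OF zero_less_one]
 proof eventually_elim
  case (elim k)
  show ?case using nn_Q3[OF elim, of 0] by (simp add: rh_def inner_dl)
 qed
 have mz[measurable]: "(\<lambda>(x, t). zm de x t) \<in> borel_measurable (borel :: ('v \<times> real) measure)"
  "(\<lambda>(x, t). (h \<bullet> x) * g' t) \<in> borel_measurable (borel :: ('v \<times> real) measure)" for de
  unfolding borel_prod[symmetric] by measurable
 have M2: "L1_null (\<lambda>k om. (\<Sum>j<mm k. ?zm k om j) - (\<Sum>j<mm k. (h \<bullet> Xs j om) * g' (es j om)) / sqrt (rN k))"
 proof -
  have "L1_null (\<lambda>k om. (\<Sum>j<mm k. (\<lambda>(x, t). zm (dl h k) x t) (Xs j om, es j om)) - (\<Sum>j<mm k. (\<lambda>(x, t). (h \<bullet> x) * g' t) (Xs j om, es j om)) / sqrt (rN k))"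
  proof (rule L1_null_linear_part[OF iid_Z Z_law, where q="\<lambda>k. Q3 (dl h k)"])
   show "\<forall>\<^sub>F k in sequentially. integrable M (\<lambda>om. ((\<lambda>(x, t). zm (dl h k) x t) (Xs 0 om, es 0 om))^2)"
    using dl_le[of 1 h, OF zero_less_one] by eventually_elim (use integrable_zm_sq in auto)
   show "\<forall>\<^sub>F k in sequentially. expectation (\<lambda>om. (\<lambda>(x, t). zm (dl h k) x t) (Xs 0 om, es 0 om)) = 0"
    using dl_le[of 1 h, OF zero_less_one] by eventually_elim (use expectation_zm in auto)
  qed (use qM Q3_seq Q3_nonneg expectation_sM integrable_sM_power[of h 0 2] mz in auto)
  then show ?thesis by simp
 qed
 have M3: "L1_null (\<lambda>k om. (\<Sum>j<mm k. (?zm k om j)^2) - real (mm k) / rN k * vM h)"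
 proof -
  have "L1_null (\<lambda>k om. (\<Sum>j<mm k. ((\<lambda>(x, t). zm (dl h k) x t) (Xs j om, es j om))^2)
   - real (mm k) / rN k * expectation (\<lambda>om. ((\<lambda>(x, t). (h \<bullet> x) * g' t) (Xs 0 om, es 0 om))^2))"
   by (rule L1_null_quadratic_part[OF iid_Z Z_law, where q="\<lambda>k. Q3 (dl h k)" and m="\<lambda>k. rN k"])
    (use qM Q3_seq Q3_nonneg mm_lim mz integrable_sM_power[of h 0 4] in \<open>auto simp: p4\<close>)
  then show ?thesis by (simp add: vM_def)
 qed
 note S1 = L1_null_add[OF L1_null_add[OF L1_null_add[OF A1 A2] A3] L1_null_add[OF A5 A6]]
 note S2 = L1_null_cmult[OF L1_null_add[OF A4 A7], of "1/2"]
 note S3 = L1_null_diff[OF L1_null_add[OF M1 M2] L1_null_cmult[OF M3, of "1/2"]]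
 have hS: "h \<bullet> SN n m om = (\<Sum>j<n. h \<bullet> sY (Yt j om)) / sqrt (real (n + m)) + (\<Sum>i<n. h \<bullet> w (Xt i om)) / sqrt (real (n + m))
   + (\<Sum>j<m. (h \<bullet> Xs j om) * g' (es j om)) / sqrt (real (n + m))" for n m om
  by (simp add: SN_def inner_add_right inner_sum_right divide_inverse algebra_simps)
 show ?thesis
 \<comment> \<open>The remainder is the telescoping sum of the null sequences above, with weight 1/2
   on those that concern squares.\<close>
 proof (rule L1_null_cong[OF L1_null_add[OF L1_null_diff[OF S1 S2] S3]])
  show "\<forall>\<^sub>F k in sequentially. \<forall>om\<in>space M. LLRk k (dl h k) om - (h \<bullet> SNk k om
  - (real (nn k) / rN k * vY h + real (mm k) / rN k * vM h) / 2) =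
  ((\<Sum>j<nn k. ?l k om j - ?z k om j + (?z k om j)^2 / 2) +
   ((\<Sum>j<nn k. ?z k om j - zb (dl h k) (Yt j om)) - real (nn k) * mz (nn k) (dl h k) (XS om)) +
   (real (nn k) * mz (nn k) (dl h k) (XS om) - (\<Sum>i<nn k. k1 (dl h k) (Xt i om))) +
   ((\<Sum>j<nn k. zb (dl h k) (Yt j om)) - (\<Sum>j<nn k. h \<bullet> sY (Yt j om)) / sqrt (rN k) +
    ((\<Sum>i<nn k. k1 (dl h k) (Xt i om)) - (\<Sum>i<nn k. h \<bullet> w (Xt i om)) / sqrt (rN k)))) -
   1 / 2 * ((\<Sum>j<nn k. (?z k om j)^2) - (\<Sum>j<nn k. (zb (dl h k) (Yt j om))^2) +
    ((\<Sum>j<nn k. (zb (dl h k) (Yt j om))^2) - real (nn k) / rN k * vY h)) +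
   ((\<Sum>j<mm k. (g (es j om) - g (es j om - dl h k \<bullet> Xs j om)) - ?zm k om j + (?zm k om j)^2 / 2) +
   ((\<Sum>j<mm k. ?zm k om j) - (\<Sum>j<mm k. (h \<bullet> Xs j om) * g' (es j om)) / sqrt (rN k)) -
   1 / 2 * ((\<Sum>j<mm k. (?zm k om j)^2) - real (mm k) / rN k * vM h))"
   by (intro always_eventually allI ballI)
    (simp add: LLR_def hS sum.distrib sum_subtractf sum_divide_distrib[symmetric] algebra_simps add_divide_distrib)
 qed measurable
qed

end

text \<open>The exact convexity surplus of the squared norm. It is what K/2 |x|^2 contributes to
  offset a semiconcavity loss of the same form.\<close>

lemma norm_sq_convex_comb:
 fixes x y :: "'c::real_inner"
 shows "(norm ((1 - s) *\<^sub>R x + s *\<^sub>R y))^2 = (1 - s) * (norm x)^2 + s * (norm y)^2 - s * (1 - s) * (norm (x - y))^2"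
 unfolding power2_norm_eq_inner
 by (simp add: inner_add_left inner_add_right inner_diff_left inner_diff_right inner_commute[of y x] algebra_simps power2_eq_square)


context ssl_env
begin

lemma env_subset: "env r La ==> s <= r ==> env s La"
 unfolding env_def by (meson order_trans)

subsection \<open>Semiconcavity of the log-likelihood ratio\<close>

lemma g_convex_comb: "0 <= s ==> s <= 1 ==> g ((1 - s) * a + s * b) <= (1 - s) * g a + s * g b"
 using convex_onD[OF g_convex, of s a b] by simp

text \<open>The matched part is concave because g is convex. Each unmatched term is a log-sum-exp of
  concave functions, with exponents differing by at most La |de1 - de2| between the two end points,
  and loses half the square of this times s (1 - s).\<close>

lemma LLR_semiconcave:
 assumes La: "env r La" and n: "n > 0" and d: "norm de1 <= r" "norm de2 <= r" and s: "0 <= s" "s <= 1"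
 shows "(1 - s) * LLR n m de1 om + s * LLR n m de2 om
   - (\<Sum>j<n. (La (Yt j om))^2) * (norm (de1 - de2))^2 / 2 * (s * (1 - s))
  <= LLR n m ((1 - s) *\<^sub>R de1 + s *\<^sub>R de2) om"
proof -
 define de where "de = (1 - s) *\<^sub>R de1 + s *\<^sub>R de2"
 define F where "F de y = ln (\<Sum>i<n. exp (- g (y - (\<beta>0 + de) \<bullet> Xt i om)))" for de y
 have ln_eq: "ln (av n de (XS om) y / av n 0 (XS om) y) = F de y - ln (real n) - ln (av n 0 (XS om) y)" for de y
 proof -
  have pos: "(\<Sum>i<n. exp (- g (y - (\<beta>0 + de) \<bullet> Xt i om))) > 0" using n by (intro sum_pos) auto
  have "av n 0 (XS om) y > 0" unfolding av_def p_def f_def using n by (intro divide_pos_pos sum_pos) auto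
  moreover have "av n de (XS om) y = (\<Sum>i<n. exp (- g (y - (\<beta>0 + de) \<bullet> Xt i om))) / real n"
   by (simp add: av_def p_def f_def)
  ultimately show ?thesis using pos n by (simp add: ln_div ln_mult F_def)
 qed
 have conv: "y - (\<beta>0 + de) \<bullet> x = (1 - s) * (y - (\<beta>0 + de1) \<bullet> x) + s * (y - (\<beta>0 + de2) \<bullet> x)" for x y
  by (simp add: de_def inner_add_left algebra_simps)
 have conv0: "e - de \<bullet> x = (1 - s) * (e - de1 \<bullet> x) + s * (e - de2 \<bullet> x)" for x e
  by (simp add: de_def inner_add_left algebra_simps)
 have F: "(1 - s) * F de1 y + s * F de2 y - (norm (de1 - de2) * La y)\<^sup>2 / 2 * (s * (1 - s)) <= F de y" for y
  unfolding F_def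
 proof (rule log_sum_exp_semiconcave)
  show "(1 - s) * - g (y - (\<beta>0 + de1) \<bullet> Xt i om) + s * - g (y - (\<beta>0 + de2) \<bullet> Xt i om) <= - g (y - (\<beta>0 + de) \<bullet> Xt i om)" for i
   using g_convex_comb[OF s, of "y - (\<beta>0 + de1) \<bullet> Xt i om" "y - (\<beta>0 + de2) \<bullet> Xt i om"] unfolding conv by simp
  show "\<bar>- g (y - (\<beta>0 + de1) \<bullet> Xt i om) - - g (y - (\<beta>0 + de2) \<bullet> Xt i om)\<bar> <= norm (de1 - de2) * La y" for i
  proof -
   have "\<bar>g (y - (\<beta>0 + de1) \<bullet> Xt i om) - g (y - (\<beta>0 + de2) \<bullet> Xt i om)\<bar> <= norm (de1 - de2) * La y"
    using La d Xt_le[of i om] unfolding env_def by blast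
   then show ?thesis by (simp add: abs_minus_commute)
  qed
 qed (use n s in auto)
 have U: "(1 - s) * (\<Sum>j<n. F de1 (Yt j om) - ln (real n) - ln (av n 0 (XS om) (Yt j om)))
   + s * (\<Sum>j<n. F de2 (Yt j om) - ln (real n) - ln (av n 0 (XS om) (Yt j om)))
   - (\<Sum>j<n. (La (Yt j om))^2) * (norm (de1 - de2))^2 / 2 * (s * (1 - s))
  <= (\<Sum>j<n. F de (Yt j om) - ln (real n) - ln (av n 0 (XS om) (Yt j om)))"
 proof -
  define q where "q = (\<Sum>j<n. (La (Yt j om))^2) * (norm (de1 - de2))^2 / 2 * (s * (1 - s))"
  have q: "(\<Sum>j<n. (norm (de1 - de2) * La (Yt j om))^2 / 2 * (s * (1 - s))) = q"
  proof -
   have "(norm (de1 - de2) * La y)^2 / 2 * (s * (1 - s)) = (La y)^2 * ((norm (de1 - de2))^2 / 2 * (s * (1 - s)))" for y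
    by (simp add: power_mult_distrib)
   then show ?thesis by (simp only: sum_distrib_right[symmetric]) (simp add: q_def)
  qed
  have "(\<Sum>j<n. (1 - s) * F de1 (Yt j om) + s * F de2 (Yt j om) - (norm (de1 - de2) * La (Yt j om))\<^sup>2 / 2 * (s * (1 - s))) <= (\<Sum>j<n. F de (Yt j om))"
   by (intro sum_mono F)
  then have base: "(1 - s) * (\<Sum>j<n. F de1 (Yt j om)) + s * (\<Sum>j<n. F de2 (Yt j om)) - q <= (\<Sum>j<n. F de (Yt j om))"
   by (simp only: sum_subtractf sum.distrib sum_distrib_left[symmetric] q)
  have arith: "(1 - s) * (a - b - c) + s * (a' - b - c) - q <= a0 - b - c" if "(1 - s) * a + s * a' - q <= a0" for a a' a0 b c
   using that by (simp add: algebra_simps)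
  show ?thesis unfolding sum_subtractf q_def[symmetric] by (rule arith[OF base])
 qed
 have "(\<Sum>k<m. (1 - s) * (g (es k om) - g (es k om - de1 \<bullet> Xs k om)) + s * (g (es k om) - g (es k om - de2 \<bullet> Xs k om)))
  <= (\<Sum>k<m. g (es k om) - g (es k om - de \<bullet> Xs k om))"
 proof (rule sum_mono)
  fix k
  show "(1 - s) * (g (es k om) - g (es k om - de1 \<bullet> Xs k om)) + s * (g (es k om) - g (es k om - de2 \<bullet> Xs k om)) <= g (es k om) - g (es k om - de \<bullet> Xs k om)"
   using g_convex_comb[OF s, of "es k om - de1 \<bullet> Xs k om" "es k om - de2 \<bullet> Xs k om"] unfolding conv0 by (simp add: algebra_simps)
 qed
 then have V: "(1 - s) * (\<Sum>k<m. g (es k om) - g (es k om - de1 \<bullet> Xs k om)) + s * (\<Sum>k<m. g (es k om) - g (es k om - de2 \<bullet> Xs k om))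
  <= (\<Sum>k<m. g (es k om) - g (es k om - de \<bullet> Xs k om))"
  by (simp add: sum.distrib sum_distrib_left)
 have comb: "(1 - s) * (u1 + v1) + s * (u2 + v2) - q <= u + v"
  if "(1 - s) * u1 + s * u2 - q <= u" "(1 - s) * v1 + s * v2 <= v" for u1 u2 u v1 v2 v q
  using that by (simp add: algebra_simps)
 show ?thesis unfolding LLR_def ln_eq de_def[symmetric] by (rule comb[OF U V])
qed

subsection \<open>Square roots of likelihood ratios\<close>

text \<open>Chi-square distance of the true response density from the empirical mixture. It prices
  the use of likelihood ratios relative to the wrong density; n times it is bounded in mean.\<close>

definition chi :: "nat => (nat => 'v) => real" where
 "chi n x = (LINT y|lborel. (pbar 0 y - av n 0 x y)^2 / av n 0 x y)"

lemma chi_meas[measurable (raw)]: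
 assumes [measurable]: "\<And>i. (\<lambda>om. x om i) \<in> borel_measurable N"
 shows "(\<lambda>om. chi n (x om)) \<in> borel_measurable N"
 unfolding chi_def by measurable

context
 fixes n :: nat
 assumes n: "n > 0"
begin

lemma av_XS_pos: "av n et (XS om) y > 0"
 unfolding av_def using n p_pos by (intro divide_pos_pos sum_pos) auto

lemma av_XS_le: "av n 0 (XS om) y <= ex 1 y * f y" and av_XS_ge: "f y <= ex 1 y * av n 0 (XS om) y"
 using av_le[OF n, of 0 "XS om", OF _ Xt_le, of 0 y] av_ge[OF n, of 0 "XS om", OF _ Xt_le, of y] by auto

lemma ex_3: "ex 1 y * ex 2 y = ex 3 y" proof -
 have "(1::nat) + 2 = 3" by simp
 then show ?thesis by (simp only: ex_mult)
qed

lemma ennreal_affine: "ennreal (h * (u + v) + c + h * q) = ennreal h * (ennreal u + ennreal v) + ennreal c + ennreal h * ennreal q"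
 if "h >= 0" "u >= 0" "v >= 0" "c >= 0" "q >= 0" for h u v c q :: real
 using that by (simp add: ennreal_plus ennreal_mult)

lemma chi_integrand: "\<bar>(pbar 0 y - av n 0 (XS om) y)\<^sup>2 / av n 0 (XS om) y\<bar> <= ex 1 y / f y * (av n 0 (XS om) y - pbar 0 y)^2"
 "\<bar>(pbar 0 y - av n 0 (XS om) y)\<^sup>2 / av n 0 (XS om) y\<bar> <= 1 * (ex 3 y * f y)"
proof -
 have "1 / av n 0 (XS om) y <= ex 1 y / f y"
  using av_XS_ge[of y om] av_XS_pos[of 0 om y] f_pos[of y] by (simp add: divide_simps mult.commute)
 then have "(pbar 0 y - av n 0 (XS om) y)^2 * (1 / av n 0 (XS om) y) <= (pbar 0 y - av n 0 (XS om) y)^2 * (ex 1 y / f y)"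
  by (intro mult_left_mono) auto
 then show 1: "\<bar>(pbar 0 y - av n 0 (XS om) y)\<^sup>2 / av n 0 (XS om) y\<bar> <= ex 1 y / f y * (av n 0 (XS om) y - pbar 0 y)^2"
  using av_XS_pos[of 0 om y] by (simp add: abs_divide power2_commute[of "av n 0 (XS om) y"] mult.commute)
 have "\<bar>av n 0 (XS om) y - pbar 0 y\<bar> <= ex 1 y * f y"
  using av_XS_le[of om y] av_XS_pos[of 0 om y] pbar_le[of 0 y] pbar_pos[of 0 y] by auto
 from power_mono[OF this abs_ge_zero, of 2] have "(av n 0 (XS om) y - pbar 0 y)^2 <= ex 2 y * (f y)^2"
  by (simp add: power_mult_distrib ex_power)
 then have "ex 1 y / f y * (av n 0 (XS om) y - pbar 0 y)^2 <= ex 1 y / f y * (ex 2 y * (f y)^2)"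
  using ex_nonneg f_nonneg by (intro mult_left_mono) auto
 also have "... = 1 * (ex 3 y * f y)" using f_pos[of y] ex_3[of y] by (simp add: power2_eq_square)
 finally show "\<bar>(pbar 0 y - av n 0 (XS om) y)\<^sup>2 / av n 0 (XS om) y\<bar> <= 1 * (ex 3 y * f y)" using 1 by linarith
qed

lemma chi_int: "integrable lborel (\<lambda>y. (pbar 0 y - av n 0 (XS om) y)^2 / av n 0 (XS om) y)"
 by (rule integrable_J_bound[OF _ chi_integrand(2)]) measurable

lemma nn_chi: "(NNI lborel (\<lambda>y. ennreal ((pbar 0 y - av n 0 (XS om) y)^2 / av n 0 (XS om) y))) = ennreal (chi n (XS om))"
 unfolding chi_def using av_XS_pos[of 0 om]
 by (intro nn_integral_eq_integral chi_int) (auto intro!: AE_I2 divide_nonneg_pos)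

lemma chi_nonneg: "chi n (XS om) >= 0"
 unfolding chi_def using av_XS_pos[of 0 om]
 by (intro Bochner_Integration.integral_nonneg divide_nonneg_pos) auto

lemma chi_mean: "(NNI M (\<lambda>om. ennreal (real n * chi n (XS om)))) <= ennreal (J 3)"
proof -
 have "(NNI M (\<lambda>om. ennreal (real n * chi n (XS om)))) = (NNI M (\<lambda>om. ennreal (real n) * (NNI lborel (\<lambda>y. ennreal ((pbar 0 y - av n 0 (XS om) y)^2 / av n 0 (XS om) y)))))"
  unfolding nn_chi using chi_nonneg by (simp add: ennreal_mult)
 also have "... = ennreal (real n) * (NNI M (\<lambda>om. \<integral>\<^sup>+y. ennreal ((pbar 0 y - av n 0 (XS om) y)^2 / av n 0 (XS om) y) \<partial>lborel))"
  by (rule nn_integral_cmult) measurable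
 also have "(NNI M (\<lambda>om. \<integral>\<^sup>+y. ennreal ((pbar 0 y - av n 0 (XS om) y)^2 / av n 0 (XS om) y) \<partial>lborel)) =
  (NNI lborel (\<lambda>y. \<integral>\<^sup>+om. ennreal ((pbar 0 y - av n 0 (XS om) y)^2 / av n 0 (XS om) y) \<partial>M))"
  by (rule fubini_M_lborel) measurable
 also have "... <= (NNI lborel (\<lambda>y. ennreal (1 / real n * (ex 3 y * f y))))"
 proof (rule nn_integral_mono)
  fix y
  have "(NNI M (\<lambda>om. ennreal ((pbar 0 y - av n 0 (XS om) y)^2 / av n 0 (XS om) y)))
   <= (NNI M (\<lambda>om. ennreal (ex 1 y / f y) * ennreal ((av n 0 (XS om) y - pbar 0 y)^2)))"
  proof (rule nn_integral_mono)
   fix om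
   have "(pbar 0 y - av n 0 (XS om) y)^2 / av n 0 (XS om) y <= ex 1 y / f y * (av n 0 (XS om) y - pbar 0 y)^2"
    using chi_integrand(1)[of y om] by linarith
   then show "ennreal ((pbar 0 y - av n 0 (XS om) y)^2 / av n 0 (XS om) y) <= ennreal (ex 1 y / f y) * ennreal ((av n 0 (XS om) y - pbar 0 y)^2)"
    using ex_nonneg f_nonneg by (simp flip: ennreal_mult add: ennreal_leI)
  qed
  also have "... = ennreal (ex 1 y / f y) * (NNI M (\<lambda>om. ennreal ((av n 0 (XS om) y - pbar 0 y)^2)))"
   by (rule nn_integral_cmult) measurable
  also have "... <= ennreal (ex 1 y / f y) * ennreal (ex 2 y * (f y)^2 / real n)"
   by (intro mult_left_mono av_mean_sq[OF n, of 0]) auto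
  also have "... = ennreal (ex 1 y / f y * (ex 2 y * (f y)^2 / real n))"
   using ex_nonneg f_nonneg by (intro ennreal_mult[symmetric]) auto
  also have "ex 1 y / f y * (ex 2 y * (f y)^2 / real n) = 1 / real n * (ex 3 y * f y)"
   using f_pos[of y] ex_3[of y] by (simp add: power2_eq_square)
  finally show "(NNI M (\<lambda>om. ennreal ((pbar 0 y - av n 0 (XS om) y)^2 / av n 0 (XS om) y))) <= ennreal (1 / real n * (ex 3 y * f y))" .
 qed
 also have "... = ennreal (1 / real n * J 3)" by (rule nn_J_cmult) simp
 also have "ennreal (real n) * ... = ennreal (J 3)" using n J_nonneg by (simp flip: ennreal_mult)
 finally show ?thesis by (simp add: mult_left_mono)
qed

lemma nn_integral_av: "(NNI lborel (\<lambda>y. ennreal (av n de (XS om) y))) = 1"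
proof -
 have i: "integrable lborel (av n de (XS om))" "(LINT y|lborel. av n de (XS om) y) = 1"
  unfolding av_def[abs_def] using n integrable_p integral_p by auto
 show ?thesis using av_XS_pos[of de om] i by (subst nn_integral_eq_integral) (auto intro: less_imp_le)
qed

text \<open>Responses have density \<open>pbar 0\<close>, but the ratio is taken relative to the
  empirical mixture, which costs half the chi-square distance. The bound has no decay in
  \<open>de\<close>; decay is left to the matched sample.\<close>

lemma unmatched_affinity:
 "(NNI M (\<lambda>om2. ennreal (sqrt (av n de (XS om) (Yt j om2) / av n 0 (XS om) (Yt j om2))))) <= ennreal (1 + chi n (XS om) / 2)"
proof -
 let ?a = "\<lambda>y. av n 0 (XS om) y" and ?b = "\<lambda>y. av n de (XS om) y"
 \<comment> \<open>One is added as the integral of the empirical mixture, to reach the form of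
   \<open>sqrt_ratio_le\<close> without subtraction in \<open>ennreal\<close>.\<close>
 have "(NNI M (\<lambda>om2. ennreal (sqrt (?b (Yt j om2) / ?a (Yt j om2))))) + 1
  = (NNI lborel (\<lambda>y. ennreal (pbar 0 y) * ennreal (sqrt (?b y / ?a y)))) + (NNI lborel (\<lambda>y. ennreal (?a y)))"
  unfolding nn_integral_av by (subst nn_integral_Y[of "\<lambda>y. ennreal (sqrt (?b y / ?a y))"]) auto
 also have "... = (NNI lborel (\<lambda>y. ennreal (sqrt (?b y / ?a y) * pbar 0 y + ?a y)))"
  using av_XS_pos[of _ om] pbar_nonneg[of 0]
  by (subst nn_integral_add[symmetric])
   (auto simp: ennreal_plus ennreal_mult mult.commute less_imp_le intro!: nn_integral_cong)
 also have "... <= (NNI lborel (\<lambda>y. ennreal (1/2) * (ennreal (?a y) + ennreal (?b y)) + ennreal (pbar 0 y) + ennreal (1/2) * ennreal ((pbar 0 y - ?a y)^2 / ?a y)))"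
 proof (rule nn_integral_mono)
  fix y
  have pos: "?a y > 0" "?b y > 0" using av_XS_pos by auto
  have "sqrt (?b y / ?a y) * pbar 0 y + ?a y <= (?a y + ?b y) / 2 + pbar 0 y + (pbar 0 y - ?a y)^2 / (2 * ?a y)"
   using pos by (intro sqrt_ratio_le) auto
  also have "... = 1/2 * (?a y + ?b y) + pbar 0 y + 1/2 * ((pbar 0 y - ?a y)^2 / ?a y)" by simp
  finally have "ennreal (sqrt (?b y / ?a y) * pbar 0 y + ?a y) <= ennreal (1/2 * (?a y + ?b y) + pbar 0 y + 1/2 * ((pbar 0 y - ?a y)^2 / ?a y))"
   by (rule ennreal_leI)
  also have "... = ennreal (1/2) * (ennreal (?a y) + ennreal (?b y)) + ennreal (pbar 0 y) + ennreal (1/2) * ennreal ((pbar 0 y - ?a y)^2 / ?a y)"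
   using pos pbar_nonneg[of 0 y] by (intro ennreal_affine) auto
  finally show "ennreal (sqrt (?b y / ?a y) * pbar 0 y + ?a y) <= ..." .
 qed
 also have "... = ennreal (1/2) * (1 + 1) + 1 + ennreal (1/2) * ennreal (chi n (XS om))"
  by (simp add: nn_integral_add nn_integral_cmult nn_integral_av nn_integral_pbar nn_chi)
 also have "... = ennreal (1 + chi n (XS om) / 2) + 1"
 proof -
  have "ennreal (1/2) * (1 + 1) + 1 + ennreal (1/2) * ennreal (chi n (XS om)) = ennreal (1/2 * (1 + 1) + 1 + 1/2 * chi n (XS om))"
   using ennreal_affine[of "1/2" 1 1 1 "chi n (XS om)"] chi_nonneg[of om] by simp
  also have "1/2 * (1 + 1) + 1 + 1/2 * chi n (XS om) = (1 + chi n (XS om) / 2) + 1" by simp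
  also have "ennreal ... = ennreal (1 + chi n (XS om) / 2) + ennreal 1"
   using chi_nonneg[of om] by (intro ennreal_plus) auto
  finally show ?thesis by simp
 qed
 finally show ?thesis by (simp add: add.commute[of _ 1] ennreal_add_left_cancel_le)
qed

end

lemma LLR_split: "n > 0 ==> exp (LLR n m de om / 2) =
 (\<Prod>j<n. sqrt (av n de (XS om) (Yt j om) / av n 0 (XS om) (Yt j om)))
 * (\<Prod>k<m. exp ((g (es k om) - g (es k om - de \<bullet> Xs k om)) / 2))"
proof -
 assume n: "n > 0"
 have "exp (ln (av n de (XS om) y / av n 0 (XS om) y) / 2) = sqrt (av n de (XS om) y / av n 0 (XS om) y)" for y
  using av_XS_pos[OF n, of de om y] av_XS_pos[OF n, of 0 om y] by (simp add: ln_sqrt[symmetric])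
 then show ?thesis
  by (simp add: LLR_def add_divide_distrib sum_divide_distrib exp_add exp_sum)
qed

lemma matched_affinity:
 assumes c: "\<And>s. \<bar>s\<bar> <= R * B ==> (NNI lborel (\<lambda>t. ennreal (exp (- (g (t - s) + g t) / 2)))) <= ennreal (1 - c * s^2)"
  and c0: "\<And>v. c0 * (norm v)^2 <= expectation (\<lambda>om. (v \<bullet> Xt 0 om)^2)"
  and pos: "c > 0" and d: "norm de <= R"
 shows "(NNI M (\<lambda>om. ennreal (exp ((g (es k om) - g (es k om - de \<bullet> Xs k om)) / 2)))) <= ennreal (exp (- (c * c0 * (norm de)^2)))"
proof -
 have ip: "\<bar>de \<bullet> Xt i om\<bar> <= R * B" for i om
 proof -
  have "norm de * norm (Xt i om) <= R * B" using d Xt_le B by (intro mult_mono) (auto intro: order_trans[OF norm_ge_zero])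
  then show ?thesis using Cauchy_Schwarz_ineq2[of de "Xt i om"] by linarith
 qed
 \<comment> \<open>Guards against \<open>ennreal\<close> clipping negative numbers: were c (de x)^2
   above one, the affinity would be zero although its integrand is positive.\<close>
 have le1: "c * (de \<bullet> Xt i om)^2 <= 1" for i om
 proof (rule ccontr)
  assume "\<not> ?thesis"
  then have "(NNI lborel (\<lambda>t. ennreal (exp (- (g (t - de \<bullet> Xt i om) + g t) / 2)))) <= 0"
   using c[OF ip, of i om] by (simp add: ennreal_neg)
  then have "AE t in (lborel :: real measure). False"
   by (subst (asm) le_zero_eq, subst (asm) nn_integral_0_iff_AE) auto
  then have "emeasure lborel (UNIV :: real set) = 0" by (simp add: AE_iff_measurable[OF _ refl])
  then show False by simp
 qed
 have bd: "(de \<bullet> Xt 0 om)^2 <= (R * B)^2" for om using power_mono[OF ip abs_ge_zero, of 0 om 2] by simp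
 have sqi: "integrable M (\<lambda>om. (de \<bullet> Xt 0 om)^2)"
  by (rule integrable_const_bound[where B="(R * B)^2"]) (use bd in auto)
 have "(NNI M (\<lambda>om. ennreal (exp ((g (es k om) - g (es k om - de \<bullet> Xs k om)) / 2))))
  = (NNI M (\<lambda>om. \<integral>\<^sup>+t. ennreal (f t) * ennreal (exp ((g t - g (t - de \<bullet> Xt 0 om)) / 2)) \<partial>lborel))"
  by (rule nn_integral_Z) (unfold borel_prod[symmetric], measurable)
 also have "... = (NNI M (\<lambda>om. \<integral>\<^sup>+t. ennreal (exp (- (g (t - de \<bullet> Xt 0 om) + g t) / 2)) \<partial>lborel))"
 proof (intro nn_integral_cong)
  fix om t
  have "f t * exp ((g t - g (t - de \<bullet> Xt 0 om)) / 2) = exp (- (g (t - de \<bullet> Xt 0 om) + g t) / 2)"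
   unfolding f_def mult_exp_exp by (simp add: field_simps)
  then show "ennreal (f t) * ennreal (exp ((g t - g (t - de \<bullet> Xt 0 om)) / 2)) = ennreal (exp (- (g (t - de \<bullet> Xt 0 om) + g t) / 2))"
   using ennreal_mult[OF f_nonneg[of t], of "exp ((g t - g (t - de \<bullet> Xt 0 om)) / 2)"] by simp
 qed
 also have "... <= (NNI M (\<lambda>om. ennreal (1 - c * (de \<bullet> Xt 0 om)^2)))"
  by (intro nn_integral_mono c ip)
 also have "... = ennreal (expectation (\<lambda>om. 1 - c * (de \<bullet> Xt 0 om)^2))"
  using le1 sqi by (intro nn_integral_eq_integral) auto
 also have "... <= ennreal (exp (- (c * c0 * (norm de)^2)))"
 proof (rule ennreal_leI)
  have "expectation (\<lambda>om. 1 - c * (de \<bullet> Xt 0 om)^2) = 1 - c * expectation (\<lambda>om. (de \<bullet> Xt 0 om)^2)"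
   using sqi by (simp add: prob_space)
  also have "... <= 1 - c * (c0 * (norm de)^2)" using mult_left_mono[OF c0[of de] less_imp_le[OF pos]] by simp
  also have "... <= exp (- (c * (c0 * (norm de)^2)))" using exp_ge_add_one_self[of "- (c * (c0 * (norm de)^2))"] by simp
  finally show "expectation (\<lambda>om. 1 - c * (de \<bullet> Xt 0 om)^2) <= exp (- (c * c0 * (norm de)^2))" by (simp add: mult.assoc)
 qed
 finally show ?thesis .
qed

text \<open>Given the covariates all factors are independent. On the event n chi <= C the unmatched
  ones contribute at most (1 + chi / 2)^n <= exp (C / 2), and each matched one has mean at most exp
  (- c c0 |de|^2).\<close>

lemma sqrt_LR_bound:
 assumes c: "\<And>s. \<bar>s\<bar> <= R * B ==> (NNI lborel (\<lambda>t. ennreal (exp (- (g (t - s) + g t) / 2)))) <= ennreal (1 - c * s^2)"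
  and c0: "\<And>v. c0 * (norm v)^2 <= expectation (\<lambda>om. (v \<bullet> Xt 0 om)^2)"
  and pos: "c > 0" and d: "norm de <= R" and n: "n > 0"
 shows "(NNI M (\<lambda>om. indicator {x. real n * chi n x <= C} (XS om) * ennreal (exp (LLR n m de om / 2))))
  <= ennreal (exp (C / 2 - real m * (c * c0 * (norm de)^2)))"
proof -
 define PhY where "PhY x y = (\<Prod>j<n. sqrt (av n de x (y j) / av n 0 x (y j)))" for x and y :: "nat => real"
 define PhZ where "PhZ z = (\<Prod>k<m. exp ((g (snd (z k)) - g (snd (z k) - de \<bullet> fst (z k))) / 2))" for z :: "nat => 'v \<times> real"
 define I where "I x = (indicator {x. real n * chi n x <= C} x :: ennreal)" for x
 define a where "a = exp (- (c * c0 * (norm de)^2))"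
 have [measurable]: "(\<lambda>(x, y, z). I x * (ennreal (PhY x y) * ennreal (PhZ z))) \<in> borel_measurable
   (PiM UNIV (\<lambda>_. borel) \<Otimes>\<^sub>M PiM UNIV (\<lambda>_. borel) \<Otimes>\<^sub>M PiM UNIV (\<lambda>_. borel))"
  unfolding I_def PhY_def PhZ_def borel_prod[symmetric] by measurable
 have Z: "(NNI M (\<lambda>om3. ennreal (PhZ (\<lambda>k. (Xs k om3, es k om3))))) <= ennreal (a ^ m)"
 proof -
  have "(NNI M (\<lambda>om3. ennreal (PhZ (\<lambda>k. (Xs k om3, es k om3))))) = (NNI M (\<lambda>om3. (\<Prod>k<m. ennreal (exp ((g (es k om3) - g (es k om3 - de \<bullet> Xs k om3)) / 2)))))"
   by (simp add: PhZ_def prod_ennreal)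
  also have "... = (\<Prod>k<m. \<integral>\<^sup>+om3. ennreal (exp ((g (es k om3) - g (es k om3 - de \<bullet> Xs k om3)) / 2)) \<partial>M)"
  proof (rule indep_vars_nn_integral)
   have m: "(\<lambda>z. ennreal (exp ((g (snd z) - g (snd z - de \<bullet> fst z)) / 2))) \<in> borel_measurable (borel :: ('v \<times> real) measure)"
    unfolding borel_prod[symmetric] by measurable
   have "indep_vars (\<lambda>_. borel) (\<lambda>k om. (\<lambda>z. ennreal (exp ((g (snd z) - g (snd z - de \<bullet> fst z)) / 2))) (Xs k om, es k om)) {..<m}"
    by (rule indep_vars_compose2[OF indep_vars_subset[OF iid_Z]]) (use m in auto)
   then show "indep_vars (\<lambda>_. borel) (\<lambda>k om3. ennreal (exp ((g (es k om3) - g (es k om3 - de \<bullet> Xs k om3)) / 2))) {..<m}" by simp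
  qed auto
  also have "... <= (\<Prod>k<m. ennreal a)"
  proof (rule prod_mono_ennreal)
   show "(NNI M (\<lambda>om3. ennreal (exp ((g (es k om3) - g (es k om3 - de \<bullet> Xs k om3)) / 2)))) <= ennreal a" for k
    unfolding a_def by (rule matched_affinity[where R=R, OF _ c0 pos d]) (rule c)
  qed
  finally show ?thesis by (simp add: a_def ennreal_power)
 qed
 have Y: "I (XS om) * (NNI M (\<lambda>om2. ennreal (PhY (XS om) (\<lambda>j. Yt j om2)))) <= ennreal (exp (C / 2))" for om
 proof (cases "real n * chi n (XS om) <= C")
  case False
  then show ?thesis by (simp add: I_def)
 next
  case True
  have pos: "0 <= av n de (XS om) y / av n 0 (XS om) y" for y
   using av_XS_pos[OF n, of de om y] av_XS_pos[OF n, of 0 om y] by simp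
  have "(NNI M (\<lambda>om2. ennreal (PhY (XS om) (\<lambda>j. Yt j om2)))) = (NNI M (\<lambda>om2. (\<Prod>j<n. ennreal (sqrt (av n de (XS om) (Yt j om2) / av n 0 (XS om) (Yt j om2))))))"
   unfolding PhY_def using pos by (subst prod_ennreal) auto
  also have "... = (\<Prod>j<n. \<integral>\<^sup>+om2. ennreal (sqrt (av n de (XS om) (Yt j om2) / av n 0 (XS om) (Yt j om2))) \<partial>M)"
   by (rule indep_vars_nn_integral) (auto intro!: indep_vars_compose2[OF indep_vars_subset[OF iid_Y]])
  also have "... <= (\<Prod>j<n. ennreal (1 + chi n (XS om) / 2))"
   by (intro prod_mono_ennreal unmatched_affinity[OF n])
  also have "... = ennreal ((1 + chi n (XS om) / 2) ^ n)" using chi_nonneg[OF n, of om]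
   by (simp only: prod_constant card_lessThan) (rule ennreal_power, simp)
  also have "... <= ennreal (exp (C / 2))"
  proof (rule ennreal_leI)
   have "(1 + chi n (XS om) / 2) ^ n <= exp (chi n (XS om) / 2) ^ n"
    using chi_nonneg[OF n, of om] exp_ge_add_one_self[of "chi n (XS om) / 2"] by (intro power_mono) auto
   also have "... = exp (real n * chi n (XS om) / 2)" by (simp add: exp_of_nat_mult[symmetric])
   also have "... <= exp (C / 2)" using True by simp
   finally show "(1 + chi n (XS om) / 2) ^ n <= exp (C / 2)" .
  qed
  finally show ?thesis using True by (simp add: I_def)
 qed
 have "(NNI M (\<lambda>om. indicator {x. real n * chi n x <= C} (XS om) * ennreal (exp (LLR n m de om / 2))))
  = (NNI M (\<lambda>om. I (XS om) * (ennreal (PhY (XS om) (\<lambda>j. Yt j om)) * ennreal (PhZ (\<lambda>k. (Xs k om, es k om))))))"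
  unfolding LLR_split[OF n] I_def PhY_def PhZ_def
  by (intro nn_integral_cong arg_cong2[where f="(*)"] refl) (simp add: ennreal_mult'' prod_nonneg)
 also have "... = (NNI M (\<lambda>om1. \<integral>\<^sup>+om2. \<integral>\<^sup>+om3. I (XS om1) * (ennreal (PhY (XS om1) (\<lambda>j. Yt j om2)) * ennreal (PhZ (\<lambda>k. (Xs k om3, es k om3)))) \<partial>M \<partial>M))"
  by (rule decouple3) measurable
 also have "... = (NNI M (\<lambda>om1. I (XS om1) * (NNI M (\<lambda>om2. ennreal (PhY (XS om1) (\<lambda>j. Yt j om2)))) * (NNI M (\<lambda>om3. ennreal (PhZ (\<lambda>k. (Xs k om3, es k om3)))))))"
 proof (rule nn_integral_cong)
  fix om1
  have [measurable]: "(\<lambda>om3. ennreal (PhZ (\<lambda>k. (Xs k om3, es k om3)))) \<in> borel_measurable M"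
   "(\<lambda>om2. ennreal (PhY (XS om1) (\<lambda>j. Yt j om2))) \<in> borel_measurable M"
   unfolding PhZ_def PhY_def by measurable
  show "(NNI M (\<lambda>om2. \<integral>\<^sup>+om3. I (XS om1) * (ennreal (PhY (XS om1) (\<lambda>j. Yt j om2)) * ennreal (PhZ (\<lambda>k. (Xs k om3, es k om3)))) \<partial>M))
   = I (XS om1) * (NNI M (\<lambda>om2. ennreal (PhY (XS om1) (\<lambda>j. Yt j om2)))) * (NNI M (\<lambda>om3. ennreal (PhZ (\<lambda>k. (Xs k om3, es k om3)))))"
   by (simp add: nn_integral_cmult nn_integral_multc mult.assoc)
 qed
 also have "... <= (NNI M (\<lambda>om1. ennreal (exp (C / 2)) * ennreal (a ^ m)))"
  by (intro nn_integral_mono mult_mono Y Z) auto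
 also have "... = ennreal (exp (C / 2) * a ^ m)" by (simp add: a_def emeasure_space_1 flip: ennreal_mult)
 also have "exp (C / 2) * a ^ m = exp (C / 2 - real m * (c * c0 * (norm de)^2))"
  unfolding a_def exp_of_nat_mult[symmetric] mult_exp_exp by simp
 finally show ?thesis .
qed

end

text \<open>Markov's inequality for variables that may be infinite, as is conceivable for the tail
  integral over local parameters.\<close>

lemma (in prob_space) hp_ennreal_less:
 fixes W :: "nat => 'a => ennreal"
 assumes [measurable]: "\<And>k. W k \<in> borel_measurable M"
  and W: "\<forall>\<^sub>F k in sequentially. (NNI M (\<lambda>om. W k om)) <= ennreal c"
  and "c >= 0" "t > 0" "c / t <= ep"
 shows "hp ep (\<lambda>k om. W k om < ennreal t)"
 using W unfolding hp_def
proof eventually_elim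
 case (elim k)
 have iff: "W k om >= ennreal t \<longleftrightarrow> 1 <= ennreal (1/t) * W k om" for om
 proof
  assume "W k om >= ennreal t"
  then have "ennreal (1/t) * ennreal t <= ennreal (1/t) * W k om" by (rule mult_left_mono) simp
  then show "1 <= ennreal (1/t) * W k om" using \<open>t > 0\<close> by (simp flip: ennreal_mult)
 next
  assume "1 <= ennreal (1/t) * W k om"
  then have "ennreal t * 1 <= ennreal t * (ennreal (1/t) * W k om)" by (rule mult_left_mono) simp
  then show "W k om >= ennreal t" using \<open>t > 0\<close> by (simp add: mult.assoc[symmetric] flip: ennreal_mult)
 qed
 have "emeasure M {om\<in>space M. W k om >= ennreal t} <= ennreal (1/t) * (NNI M (\<lambda>om. W k om * indicator (space M) om))"
  unfolding iff by (rule nn_integral_Markov_inequality) auto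
 also have "(NNI M (\<lambda>om. W k om * indicator (space M) om)) = (NNI M (\<lambda>om. W k om))" by (intro nn_integral_cong) auto
 also have "ennreal (1/t) * ... <= ennreal (1/t) * ennreal c" using elim by (intro mult_left_mono) auto
 also have "... = ennreal (c / t)" using assms by (simp flip: ennreal_mult)
 finally have "prob {om\<in>space M. W k om >= ennreal t} <= c / t" using assms by (simp add: emeasure_eq_measure)
 moreover have "prob (space M - {om\<in>space M. W k om >= ennreal t}) = 1 - prob {om\<in>space M. W k om >= ennreal t}"
  by (subst prob_compl) auto
 ultimately show ?case using assms by (intro bexI[of _ "space M - {om\<in>space M. W k om >= ennreal t}"]) auto
qed

context ssl_seq
begin

subsection \<open>Coercivity of the criterion\<close>

lemma matched_fraction: "\<exists>ka>0. \<forall>\<^sub>F k in sequentially. ka * rN k <= real (mm k)"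
proof -
 define q where "q = lam / (1 + lam)"
 have q: "q > 0" using lam_pos by (simp add: q_def)
 define ka where "ka = q / 2"
 have ka0: "ka > 0" and ka1: "ka < lam / (1 + lam)" using q by (auto simp: ka_def simp flip: q_def)
 note ka = ka0 ka1
 have "\<forall>\<^sub>F k in sequentially. ka < real (mm k) / rN k" using order_tendstoD(1)[OF m_frac ka(2)] .
 then have "\<forall>\<^sub>F k in sequentially. ka * rN k <= real (mm k)"
  using nn_pos by eventually_elim (auto simp: less_divide_eq)
 then show ?thesis using ka by blast
qed

lemma g_moment:
 assumes C: "\<And>t. - C <= g t"
 shows "\<exists>K\<ge>0. \<forall>j. (NNI M (\<lambda>om. ennreal (C + g (Yt j om)))) <= ennreal K \<and> (NNI M (\<lambda>om. ennreal (C + g (es j om)))) <= ennreal K"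
proof -
 \<comment> \<open>From C + g <= 2 exp ((C + g) / 2): half the exponent of the density is spent on
   g, and the envelope assumption integrates the other half.\<close>
 define F where "F y = 2 * exp (C / 2) * exp (1 * L y - g y / 2)" for y
 have F_int: "integrable lborel F"
  unfolding F_def using env1 unfolding env_def by (intro integrable_mult_right) (metis of_nat_1)
 have F0: "F y >= 0" for y by (simp add: F_def)
 have bd: "ex 1 y * f y * (C + g y) <= F y" for y
 proof -
  have "u <= exp u" for u :: real using exp_ge_add_one_self[of u] by linarith
  from mult_left_mono[OF this, of 2 "(C + g y) / 2"] have "C + g y <= 2 * exp ((C + g y) / 2)" by simp
  then have "ex 1 y * f y * (C + g y) <= ex 1 y * f y * (2 * exp ((C + g y) / 2))"
   using ex_nonneg f_nonneg by (intro mult_left_mono) auto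
  also have "... = 2 * (exp (L y) * exp (- g y) * exp ((C + g y) / 2))" by (simp add: ex_def f_def)
  also have "... = F y" unfolding F_def mult.assoc mult_exp_exp by (simp add: field_simps)
  finally show ?thesis .
 qed
 define K where "K = (LINT y|lborel. F y)"
 have K0: "K >= 0" unfolding K_def by (intro Bochner_Integration.integral_nonneg F0)
 have main: "(NNI lborel (\<lambda>y. ennreal (q y) * ennreal (C + g y))) <= ennreal K" if q: "\<And>y. q y <= ex 1 y * f y" "\<And>y. q y >= 0" for q :: "real => real"
 proof -
  have "(NNI lborel (\<lambda>y. ennreal (q y) * ennreal (C + g y))) <= (NNI lborel (\<lambda>y. ennreal (F y)))"
  proof (rule nn_integral_mono)
   fix y
   have "q y * (C + g y) <= ex 1 y * f y * (C + g y)" using q(1)[of y] C[of y] by (intro mult_right_mono) auto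
   then have "ennreal (q y * (C + g y)) <= ennreal (F y)" using bd[of y] by (intro ennreal_leI) linarith
   then show "ennreal (q y) * ennreal (C + g y) <= ennreal (F y)" using q(2)[of y] C[of y] by (subst ennreal_mult[symmetric]) auto
  qed
  also have "... = ennreal K" unfolding K_def by (intro nn_integral_eq_integral F_int AE_I2 F0)
  finally show ?thesis .
 qed
 have "(NNI M (\<lambda>om. ennreal (C + g (Yt j om)))) <= ennreal K" for j
  using main[of "pbar 0"] pbar_le[of 0] pbar_nonneg[of 0] nn_integral_Y[of "\<lambda>y. ennreal (C + g y)" j] by simp
 moreover have "(NNI M (\<lambda>om. ennreal (C + g (es j om)))) <= ennreal K" for j
 proof -
  have "f y <= ex 1 y * f y" for y using mult_right_mono[OF ex_ge_1[of 1 y] f_nonneg[of y]] by simp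
  then show ?thesis using main[of f] f_nonneg nn_integral_e[of "\<lambda>y. ennreal (C + g y)" j] by simp
 qed
 ultimately show ?thesis using K0 by blast
qed

lemma expectation_Xs_sq: "expectation (\<lambda>om. (v \<bullet> Xs 0 om)^2) = expectation (\<lambda>om. (v \<bullet> Xt 0 om)^2)"
proof -
 have m: "(\<lambda>(x :: 'v, t :: real). ennreal ((v \<bullet> x)^2)) \<in> borel_measurable borel"
  unfolding borel_prod[symmetric] by measurable
 have "(NNI M (\<lambda>om. ennreal ((v \<bullet> Xs 0 om)^2))) = (NNI M (\<lambda>om. \<integral>\<^sup>+t. ennreal (f t) * ennreal ((v \<bullet> Xt 0 om)^2) \<partial>lborel))"
  using nn_integral_Z[OF m, of 0] .
 also have "... = (NNI M (\<lambda>om. ennreal ((v \<bullet> Xt 0 om)^2)))" by (simp add: nn_integral_multc nn_integral_f)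
 finally show ?thesis by (simp add: integral_eq_nn_integral)
qed

text \<open>The law of large numbers for finitely many products of coordinates gives the bound for
  all v at once. A tolerance of c0 / (2 D^2) in each of the D^2 entries adds up to c0/2
  |v|^2.\<close>

lemma design_bounded_below:
 assumes "ep > 0" and c0: "c0 > 0" "\<And>v. c0 * (norm v)^2 <= expectation (\<lambda>om. (v \<bullet> Xt 0 om)^2)"
 shows "hp ep (\<lambda>k om. \<forall>v. real (mm k) * (c0 / 2 * (norm v)^2) <= (\<Sum>l<mm k. (v \<bullet> Xs l om)^2))"
proof -
 define D where "D = real DIM('v)"
 have D: "D > 0" by (simp add: D_def)
 define e where "e i j = expectation (\<lambda>om. (i \<bullet> Xs 0 om) * (j \<bullet> Xs 0 om))" for i j
 define W where "W ij k om = (\<Sum>l<mm k. (fst ij \<bullet> Xs l om) * (snd ij \<bullet> Xs l om) - e (fst ij) (snd ij)) / real (mm k)" for ij k om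
 have bd: "\<bar>i \<bullet> Xs l om\<bar> <= norm i * B" for i l om
  using Cauchy_Schwarz_ineq2[of i "Xs l om"] mult_left_mono[OF Xs_le norm_ge_zero[of i]] by (meson order_trans)
 have bd2: "\<bar>(i \<bullet> Xs l om) * (j \<bullet> Xs l om)\<bar> <= norm i * B * (norm j * B)" for i j l om
  unfolding abs_mult using bd B by (intro mult_mono) auto
 have int: "integrable M (\<lambda>om. (i \<bullet> Xs l om) * (j \<bullet> Xs l om))" for i j l
  using bd2 by (intro integrable_const_bound[where B="norm i * B * (norm j * B)"]) auto
 have null: "L1_null (W ij)" for ij
 proof -
  define ph where "ph z = (fst ij \<bullet> fst z) * (snd ij \<bullet> fst z)" for z :: "'v \<times> real"
  have m: "ph \<in> borel_measurable borel" unfolding ph_def borel_prod[symmetric] by measurable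
  have "\<bar>(ph (Xs 0 om, es 0 om))\<^sup>2\<bar> <= (norm (fst ij) * B * (norm (snd ij) * B))^2" for om
   using power_mono[OF bd2[of "fst ij" 0 om "snd ij"] abs_ge_zero, of 2] by (simp add: ph_def)
  then have "integrable M (\<lambda>om. (ph (Xs 0 om, es 0 om))^2)"
   using measurable_compose[OF _ m] by (intro integrable_const_bound[where B="(norm (fst ij) * B * (norm (snd ij) * B))^2"])
    (auto intro!: borel_measurable_power measurable_compose[OF _ m] simp flip: borel_prod)
  from L1_null_lln[OF iid_Z Z_law m this mm_lim, of "\<lambda>k. real (mm k)"] show ?thesis
   by (simp add: W_def[abs_def] ph_def e_def)
 qed
 have "hp ep (\<lambda>k om. \<forall>ij\<in>Basis \<times> Basis. \<bar>W ij k om\<bar> < c0 / (2 * D^2))"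
  using null c0(1) D \<open>ep > 0\<close> by (intro hp_finite_Ball hp_L1_null) auto
 then show ?thesis
 proof (rule hp_mono)
  show "\<forall>\<^sub>F k in sequentially. \<forall>om\<in>space M. (\<forall>ij\<in>Basis \<times> Basis. \<bar>W ij k om\<bar> < c0 / (2 * D^2)) -->
   (\<forall>v. real (mm k) * (c0 / 2 * (norm v)^2) <= (\<Sum>l<mm k. (v \<bullet> Xs l om)^2))"
   using mm_pos
  proof (eventually_elim, intro ballI impI allI)
   fix k om v assume m: "0 < mm k" and W: "\<forall>ij\<in>Basis \<times> Basis. \<bar>W ij k om\<bar> < c0 / (2 * D^2)"
   have ex: "(v \<bullet> x)^2 = (\<Sum>i\<in>Basis. \<Sum>j\<in>Basis. (v \<bullet> i) * (v \<bullet> j) * ((i \<bullet> x) * (j \<bullet> x)))" for x :: 'v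
   proof -
    have "v \<bullet> x = (\<Sum>i\<in>Basis. (v \<bullet> i) * (i \<bullet> x))" by (subst euclidean_inner) (simp add: inner_commute)
    then show ?thesis by (simp add: power2_eq_square sum_product mult_ac)
   qed
   have Eq: "expectation (\<lambda>om. (v \<bullet> Xs 0 om)^2) = (\<Sum>i\<in>Basis. \<Sum>j\<in>Basis. (v \<bullet> i) * (v \<bullet> j) * e i j)"
    unfolding ex e_def using int by (simp add: Bochner_Integration.integral_sum)
   have S: "(\<Sum>l<mm k. (v \<bullet> Xs l om)^2) = real (mm k) * (\<Sum>i\<in>Basis. \<Sum>j\<in>Basis. (v \<bullet> i) * (v \<bullet> j) * (e i j + W (i, j) k om))"
   proof -
    have "real (mm k) * (e i j + W (i, j) k om) = (\<Sum>l<mm k. (i \<bullet> Xs l om) * (j \<bullet> Xs l om))" for i j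
     using m by (simp add: W_def sum_subtractf field_simps)
    then have "real (mm k) * (\<Sum>i\<in>Basis. \<Sum>j\<in>Basis. (v \<bullet> i) * (v \<bullet> j) * (e i j + W (i, j) k om))
     = (\<Sum>i\<in>Basis. \<Sum>j\<in>Basis. (v \<bullet> i) * (v \<bullet> j) * (\<Sum>l<mm k. (i \<bullet> Xs l om) * (j \<bullet> Xs l om)))"
     by (simp add: sum_distrib_left mult.left_commute[of "real (mm k)"])
    also have "... = (\<Sum>i\<in>Basis. \<Sum>l<mm k. \<Sum>j\<in>Basis. (v \<bullet> i) * (v \<bullet> j) * ((i \<bullet> Xs l om) * (j \<bullet> Xs l om)))"
     unfolding sum_distrib_left by (intro sum.cong refl sum.swap)
    also have "... = (\<Sum>l<mm k. (v \<bullet> Xs l om)^2)" unfolding ex by (rule sum.swap)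
    finally show ?thesis by simp
   qed
   have err: "\<bar>\<Sum>i\<in>Basis. \<Sum>j\<in>Basis. (v \<bullet> i) * (v \<bullet> j) * W (i, j) k om\<bar> <= c0 / 2 * (norm v)^2"
   proof -
    have "\<bar>\<Sum>i\<in>Basis. \<Sum>j\<in>Basis. (v \<bullet> i) * (v \<bullet> j) * W (i, j) k om\<bar> <= (\<Sum>i\<in>(Basis::'v set). \<Sum>j\<in>(Basis::'v set). (norm v * norm v) * (c0 / (2 * D^2)))"
    proof (intro order_trans[OF sum_abs] sum_mono)
     fix i j :: 'v assume i: "i \<in> Basis" and j: "j \<in> Basis"
     have "\<bar>v \<bullet> i\<bar> <= norm v" "\<bar>v \<bullet> j\<bar> <= norm v" using i j by (auto intro: Basis_le_norm)
     then show "\<bar>(v \<bullet> i) * (v \<bullet> j) * W (i, j) k om\<bar> <= norm v * norm v * (c0 / (2 * D^2))"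
      unfolding abs_mult using W i j c0(1) D by (intro mult_mono) (auto intro: less_imp_le)
    qed
    also have "... = c0 / 2 * (norm v)^2" using D by (simp add: D_def power2_eq_square field_simps)
    finally show ?thesis .
   qed
   have "c0 / 2 * (norm v)^2 <= (\<Sum>i\<in>Basis. \<Sum>j\<in>Basis. (v \<bullet> i) * (v \<bullet> j) * (e i j + W (i, j) k om))"
    using err c0(2)[of v] unfolding expectation_Xs_sq[symmetric] Eq
    by (simp add: distrib_left sum.distrib abs_le_iff)
   then show "real (mm k) * (c0 / 2 * (norm v)^2) <= (\<Sum>l<mm k. (v \<bullet> Xs l om)^2)"
    unfolding S by (intro mult_left_mono) auto
  qed
 qed simp
qed

text \<open>The matched terms together fall at least linearly in |de|, by linear growth of g and the
  nondegenerate design; the unmatched ones are bounded above by a sum of order N free of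
  \<open>de\<close>. Maximizers are thus confined to a fixed ball, on which the Hellinger bound
  holds with one constant.\<close>

lemma coercive:
 assumes "ep > 0"
 shows "\<exists>R>0. hp ep (\<lambda>k om. \<forall>de. R <= norm de --> LLRk k de om < 0)"
proof -
 obtain c C where cC: "c > 0" "\<And>t. c * \<bar>t\<bar> - C <= g t" using g_lower by blast
 have C: "- C <= g t" for t using cC(2)[of t] mult_nonneg_nonneg[of c "\<bar>t\<bar>"] cC(1) by linarith
 obtain K where K: "K >= 0" "\<And>j. (NNI M (\<lambda>om. ennreal (C + g (Yt j om)))) <= ennreal K"
  "\<And>j. (NNI M (\<lambda>om. ennreal (C + g (es j om)))) <= ennreal K" using g_moment[OF C] by blast
 obtain ka where ka: "ka > 0" "\<forall>\<^sub>F k in sequentially. ka * rN k <= real (mm k)" using matched_fraction by blast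
 obtain c0 where c0: "c0 > 0" "\<And>v. c0 * (norm v)^2 <= expectation (\<lambda>om. (v \<bullet> Xt 0 om)^2)" using nondeg by blast
 define W where "W k om = ((\<Sum>j<nn k. (C + g (Yt j om)) + L (Yt j om)) + (\<Sum>j<mm k. 2 * (C + g (es j om)))) / rN k" for k om
 have [measurable]: "W k \<in> borel_measurable M" for k unfolding W_def by measurable
 define K2 where "K2 = 3 * K + J 2"
 have K2: "K2 >= 0" using K J_nonneg by (simp add: K2_def)
 have W_le: "\<forall>\<^sub>F k in sequentially. (NNI M (\<lambda>om. ennreal (W k om))) <= ennreal K2"
  using nn_pos
 proof eventually_elim
  case (elim k)
  have L2: "(NNI M (\<lambda>om. ennreal (L (Yt j om)))) <= ennreal (J 2)" for j
   using nn_Y_bound[of L 1 1 j] L_le_ex by (simp add: numeral_2_eq_2)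
  have "(NNI M (\<lambda>om. ennreal (W k om))) = (NNI M (\<lambda>om. ennreal (1 / rN k) * ((\<Sum>j<nn k. ennreal (C + g (Yt j om)) + ennreal (L (Yt j om))) + (\<Sum>j<mm k. ennreal 2 * ennreal (C + g (es j om))))))"
  proof (rule nn_integral_cong)
   fix om
   have pos: "0 <= C + g t" for t using C[of t] by simp
   have h1: "0 <= (C + g (Yt j om)) + L (Yt j om)" for j by (rule add_nonneg_nonneg[OF pos L_nonneg])
   have h2: "0 <= 2 * (C + g (es j om))" for j using pos by (intro mult_nonneg_nonneg) auto
   have S: "0 <= (\<Sum>j<nn k. (C + g (Yt j om)) + L (Yt j om))" "0 <= (\<Sum>j<mm k. 2 * (C + g (es j om)))"
    by (intro sum_nonneg h1 h2)+
   have "ennreal (W k om) = ennreal (1 / rN k) * ennreal ((\<Sum>j<nn k. (C + g (Yt j om)) + L (Yt j om)) + (\<Sum>j<mm k. 2 * (C + g (es j om))))"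
    unfolding W_def using S by (subst ennreal_mult[symmetric]) auto
   also have "ennreal ((\<Sum>j<nn k. (C + g (Yt j om)) + L (Yt j om)) + (\<Sum>j<mm k. 2 * (C + g (es j om))))
    = ennreal (\<Sum>j<nn k. (C + g (Yt j om)) + L (Yt j om)) + ennreal (\<Sum>j<mm k. 2 * (C + g (es j om)))"
    using S by (rule ennreal_plus)
   also have "... = (\<Sum>j<nn k. ennreal ((C + g (Yt j om)) + L (Yt j om))) + (\<Sum>j<mm k. ennreal (2 * (C + g (es j om))))"
    using h1 h2 by (intro arg_cong2[where f="(+)"] sum_ennreal[symmetric])
   also have "... = (\<Sum>j<nn k. ennreal (C + g (Yt j om)) + ennreal (L (Yt j om))) + (\<Sum>j<mm k. ennreal 2 * ennreal (C + g (es j om)))"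
    using pos L_nonneg by (intro arg_cong2[where f="(+)"] sum.cong refl ennreal_plus ennreal_mult) auto
   finally show "ennreal (W k om) = ennreal (1 / rN k) * ((\<Sum>j<nn k. ennreal (C + g (Yt j om)) + ennreal (L (Yt j om))) + (\<Sum>j<mm k. ennreal 2 * ennreal (C + g (es j om))))" .
  qed
  also have "... = ennreal (1 / rN k) * ((\<Sum>j<nn k. (NNI M (\<lambda>om. ennreal (C + g (Yt j om)))) + (NNI M (\<lambda>om. ennreal (L (Yt j om))))) + (\<Sum>j<mm k. ennreal 2 * (NNI M (\<lambda>om. ennreal (C + g (es j om))))))"
   by (simp add: nn_integral_cmult nn_integral_add nn_integral_sum)
  also have "... <= ennreal (1 / rN k) * ((\<Sum>j<nn k. ennreal K + ennreal (J 2)) + (\<Sum>j<mm k. ennreal 2 * ennreal K))"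
   using K L2 by (intro mult_left_mono add_mono sum_mono) auto
  also have "... = ennreal (1 / rN k * ((\<Sum>j<nn k. K + J 2) + (\<Sum>j<mm k. 2 * K)))"
  proof -
   have "(\<Sum>j<nn k. ennreal K + ennreal (J 2)) = ennreal (\<Sum>j<nn k. K + J 2)" "(\<Sum>j<mm k. ennreal 2 * ennreal K) = ennreal (\<Sum>j<mm k. 2 * K)"
    using K J_nonneg[of 2] by (subst sum_ennreal[symmetric]; simp add: ennreal_plus ennreal_mult)+
   note e = this
   have T: "0 <= (\<Sum>j<nn k. K + J 2)" "0 <= (\<Sum>j<mm k. 2 * K)"
    using K J_nonneg[of 2] by (auto intro!: sum_nonneg simp del: sum_constant)
   show ?thesis unfolding e
    by (subst ennreal_plus[symmetric, OF T]) (rule ennreal_mult[symmetric], simp, rule add_nonneg_nonneg[OF T])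
  qed
  also have "... <= ennreal K2"
  proof (rule ennreal_leI)
   have "(\<Sum>j<nn k. K + J 2) + (\<Sum>j<mm k. 2 * K) <= rN k * K2"
    using K J_nonneg[of 2] by (simp add: K2_def algebra_simps)
   then show "1 / rN k * ((\<Sum>j<nn k. K + J 2) + (\<Sum>j<mm k. 2 * K)) <= K2"
    using elim by (simp add: divide_le_eq mult.commute)
  qed
  finally show ?case .
 qed
 define t where "t = 2 * K2 / ep + 1"
 have t: "t > 0" "K2 / t <= ep / 2"
 proof -
  show "t > 0" using K2 assms by (simp add: t_def add_nonneg_pos)
  then show "K2 / t <= ep / 2" using K2 assms by (simp add: t_def field_simps)
 qed
 \<comment> \<open>Chosen so that t N is at most m c c0 R / (2 B), using m >= ka N.\<close>
 define R where "R = 2 * B * t / (c * c0 * ka) + 1"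
 have R: "R > 0" using t B cC c0 ka by (simp add: R_def add_nonneg_pos)
 have "hp (ep/2 + ep/2) (\<lambda>k om. W k om < t \<and> (\<forall>v. real (mm k) * (c0 / 2 * (norm v)^2) <= (\<Sum>l<mm k. (v \<bullet> Xs l om)^2)))"
  using assms t K2 c0 by (intro hp_conj hp_bounded[OF _ W_le] design_bounded_below) auto
 then have "hp ep (\<lambda>k om. \<forall>de. R <= norm de --> LLRk k de om < 0)"
 proof (rule hp_mono)
  show "\<forall>\<^sub>F k in sequentially. \<forall>om\<in>space M. W k om < t \<and> (\<forall>v. real (mm k) * (c0 / 2 * (norm v)^2) <= (\<Sum>l<mm k. (v \<bullet> Xs l om)^2)) -->
   (\<forall>de. R <= norm de --> LLRk k de om < 0)"
   using nn_pos ka(2)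
  proof (eventually_elim, intro ballI impI allI)
   fix k om and de :: 'v
   assume n: "0 < nn k" and kak: "ka * rN k <= real (mm k)"
    and H: "W k om < t \<and> (\<forall>v. real (mm k) * (c0 / 2 * (norm v)^2) <= (\<Sum>l<mm k. (v \<bullet> Xs l om)^2))" and de: "R <= norm de"
   have de0: "norm de > 0" using de R by linarith
   have N: "rN k > 0" using n by simp
   \<comment> \<open>The mixture at \<open>de\<close> is at most exp C, which bounds the density,
     and the mixture at 0 is at least exp (- (g + L)).\<close>
   have un: "ln (av (nn k) de (XS om) y / av (nn k) 0 (XS om) y) <= (C + g y) + L y" for y
   proof -
    have "av (nn k) de (XS om) y <= exp C"
    proof -
     have "(\<Sum>i<nn k. p de (Xt i om) y) <= (\<Sum>i<nn k. exp C)"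
      by (intro sum_mono) (simp add: p_def f_def, use C in \<open>simp add: minus_le_iff\<close>)
     then show ?thesis using n by (simp add: av_def divide_le_eq mult.commute)
    qed
    then have "ln (av (nn k) de (XS om) y) <= ln (exp C)" by (intro ln_mono) (auto simp: av_XS_pos[OF n])
    then have 1: "ln (av (nn k) de (XS om) y) <= C" by simp
    have "exp (- (g y + L y)) <= av (nn k) 0 (XS om) y"
    proof -
     have "exp (- L y) * f y <= exp (- L y) * (ex 1 y * av (nn k) 0 (XS om) y)"
      by (intro mult_left_mono av_XS_ge[OF n]) simp
     also have "... = av (nn k) 0 (XS om) y" by (simp add: ex_def exp_minus)
     finally show ?thesis by (simp add: f_def mult_exp_exp algebra_simps)
    qed
    then have "ln (exp (- (g y + L y))) <= ln (av (nn k) 0 (XS om) y)" by (intro ln_mono) (auto simp: av_XS_pos[OF n])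
    then have 2: "- (g y + L y) <= ln (av (nn k) 0 (XS om) y)" by simp
    show ?thesis using 1 2 av_XS_pos[OF n, of de om y] av_XS_pos[OF n, of 0 om y] by (simp add: ln_div)
   qed
   \<comment> \<open>Since |de x| <= |de| B, the linear quantity |de x| is at least (de x)^2 / (|de|
     B). This brings in the quadratic lower bound for the design.\<close>
   have ma: "g (es l om) - g (es l om - de \<bullet> Xs l om) <= 2 * (C + g (es l om)) - c / (norm de * B) * (de \<bullet> Xs l om)^2" for l
   proof -
    have 1: "c * \<bar>es l om - de \<bullet> Xs l om\<bar> - C <= g (es l om - de \<bullet> Xs l om)" "c * \<bar>es l om\<bar> - C <= g (es l om)" using cC by auto
    have "c * \<bar>de \<bullet> Xs l om\<bar> <= c * (\<bar>es l om - de \<bullet> Xs l om\<bar> + \<bar>es l om\<bar>)" using cC by (intro mult_left_mono) auto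
    then have 2: "c * \<bar>de \<bullet> Xs l om\<bar> <= c * \<bar>es l om - de \<bullet> Xs l om\<bar> + c * \<bar>es l om\<bar>" by (simp add: distrib_left)
    have "\<bar>de \<bullet> Xs l om\<bar> <= norm de * B"
     using Cauchy_Schwarz_ineq2[of de "Xs l om"] mult_left_mono[OF Xs_le norm_ge_zero[of de]] by (meson order_trans)
    from mult_right_mono[OF this abs_ge_zero[of "de \<bullet> Xs l om"]]
    have "(de \<bullet> Xs l om)^2 <= norm de * B * \<bar>de \<bullet> Xs l om\<bar>" by (simp add: power2_eq_square abs_mult[symmetric])
    then have "(de \<bullet> Xs l om)^2 / (norm de * B) <= \<bar>de \<bullet> Xs l om\<bar>" using de0 B by (simp add: divide_le_eq mult.commute)
    from mult_left_mono[OF this less_imp_le[OF cC(1)]]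
    have "c / (norm de * B) * (de \<bullet> Xs l om)^2 <= c * \<bar>de \<bullet> Xs l om\<bar>" by simp
    moreover have "x <= d ==> a - C <= g1 ==> b - C <= g0 ==> d <= a + b ==> g0 - g1 <= 2 * (C + g0) - x" for x d a b g1 g0 :: real
     by simp
    ultimately show ?thesis using 1 2 by blast
   qed
   have "LLRk k de om <= (\<Sum>j<nn k. (C + g (Yt j om)) + L (Yt j om)) + (\<Sum>l<mm k. 2 * (C + g (es l om)) - c / (norm de * B) * (de \<bullet> Xs l om)^2)"
    unfolding LLR_def by (intro add_mono sum_mono un ma)
   also have "... = W k om * rN k - c / (norm de * B) * (\<Sum>l<mm k. (de \<bullet> Xs l om)^2)"
    using N by (simp add: W_def sum_subtractf sum_distrib_left)
   also have "... < t * rN k - c / (norm de * B) * (real (mm k) * (c0 / 2 * (norm de)^2))"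
   proof -
    have "W k om * rN k < t * rN k" using H N by (intro mult_strict_right_mono) auto
    moreover have "c / (norm de * B) * (real (mm k) * (c0 / 2 * (norm de)^2)) <= c / (norm de * B) * (\<Sum>l<mm k. (de \<bullet> Xs l om)^2)"
     using H cC B de0 by (intro mult_left_mono) auto
    ultimately show ?thesis by (rule less_le_trans[OF diff_strict_right_mono diff_left_mono])
   qed
   also have "... <= 0"
   proof -
    have eq: "c / (norm de * B) * (real (mm k) * (c0 / 2 * (norm de)^2)) = real (mm k) * (c * c0 / (2 * B) * norm de)"
     using de0 B by (simp add: power2_eq_square field_simps)
    have "t <= c * c0 * ka / (2 * B) * R" using cC c0 ka B by (simp add: R_def field_simps)
    also have "... <= c * c0 * ka / (2 * B) * norm de" using de cC c0 ka B by (intro mult_left_mono) auto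
    finally have "t * rN k <= (c * c0 * ka / (2 * B) * norm de) * rN k" by (intro mult_right_mono) auto
    also have "... = (ka * rN k) * (c * c0 / (2 * B) * norm de)" by simp
    also have "... <= real (mm k) * (c * c0 / (2 * B) * norm de)" using kak cC c0 B by (intro mult_right_mono) auto
    finally show ?thesis unfolding eq by simp
   qed
   finally show "LLRk k de om < 0" .
  qed
 qed simp
 then show ?thesis using R by blast
qed

section \<open>Stochastic boundedness of score and curvature\<close>

lemma score_tight:
 assumes "ep > 0"
 shows "\<exists>s>0. hp ep (\<lambda>k om. norm (SNk k om) < s)"
proof -
 \<comment> \<open>The 3 collects the ones from Young's inequality with e = 1, applied to each of
   the three sums in the score.\<close>
 define C where "C = (\<Sum>b\<in>(Basis::'v set). 3 + vY b + vX b + vM b)"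
 have v0: "vY b >= 0" "vX b >= 0" "vM b >= 0" for b by (auto simp: vY_def vX_def vM_def)
 have C0: "C >= 0" unfolding C_def using v0 by (intro sum_nonneg) (auto intro!: add_nonneg_nonneg)
 have part: "(NNI M (\<lambda>om. ennreal \<bar>(\<Sum>i<n. ph (V i om)) / sqrt (real N)\<bar>)) <= ennreal (1 + expectation (\<lambda>om. (ph (V 0 om))^2))"
  if V: "indep_vars (\<lambda>_. D) V UNIV" "\<And>i. distr M D (V i) = distr M D (V 0)" and [measurable]: "ph \<in> borel_measurable D"
   and i: "integrable M (\<lambda>om. (ph (V 0 om))^2)" and e: "expectation (\<lambda>om. ph (V 0 om)) = 0" and N: "n <= N" "N > 0"
  for n N :: nat and D :: "'d measure" and V :: "nat => 'a => 'd" and ph :: "'d => real"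
 proof -
  have [measurable]: "V i \<in> measurable M D" for i using V(1) by (auto simp: indep_vars_def)
  define sg where "sg = expectation (\<lambda>om. (ph (V 0 om))^2)"
  have sg: "sg >= 0" by (simp add: sg_def)
  have "(NNI M (\<lambda>om. ennreal (((\<Sum>i<n. ph (V i om)) / sqrt (real N))^2))) = ennreal (1 / real N) * (NNI M (\<lambda>om. ennreal ((\<Sum>i<n. ph (V i om))^2)))"
   using N by (subst nn_integral_cmult[symmetric]) (auto simp: power_divide simp flip: ennreal_mult)
  also have "... = ennreal (1 / real N) * ennreal (real n * sg)"
   unfolding sg_def by (subst iid_sum_sq[OF V _ i e]) auto
  also have "... = ennreal (real n * sg / real N)" using sg by (simp flip: ennreal_mult)
  also have "... <= ennreal sg" using N sg by (intro ennreal_leI) (use mult_right_mono[of "real n" "real N" sg] in \<open>simp add: divide_le_eq mult.commute\<close>)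
  finally have "(NNI M (\<lambda>om. ennreal (((\<Sum>i<n. ph (V i om)) / sqrt (real N))^2))) <= ennreal sg" .
  then have "(NNI M (\<lambda>om. ennreal \<bar>(\<Sum>i<n. ph (V i om)) / sqrt (real N)\<bar>)) <= ennreal 1 + ennreal (1/1) * ennreal sg"
   by (intro order_trans[OF nn_integral_abs_le_sq[of _ 1]] add_left_mono mult_left_mono) auto
  also have "... = ennreal (1 + sg)" using sg by (simp add: ennreal_plus)
  finally show ?thesis by (simp add: sg_def)
 qed
 have mz: "(\<lambda>(x, t). (b \<bullet> x) * g' t) \<in> borel_measurable (borel :: ('v \<times> real) measure)" for b
  unfolding borel_prod[symmetric] by measurable
 have b_le: "(NNI M (\<lambda>om. ennreal \<bar>b \<bullet> SNk k om\<bar>)) <= ennreal (3 + vY b + vX b + vM b)" if "nn k > 0" for b k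
 proof -
  let ?Y = "\<lambda>om. (\<Sum>j<nn k. b \<bullet> sY (Yt j om)) / sqrt (rN k)" and ?X = "\<lambda>om. (\<Sum>j<nn k. b \<bullet> w (Xt j om)) / sqrt (rN k)"
   and ?Z = "\<lambda>om. (\<Sum>j<mm k. (b \<bullet> Xs j om) * g' (es j om)) / sqrt (rN k)"
  have hS: "b \<bullet> SNk k om = ?Y om + ?X om + ?Z om" for om
   by (simp add: SN_def inner_add_right inner_sum_right divide_inverse algebra_simps)
  have "(NNI M (\<lambda>om. ennreal \<bar>b \<bullet> SNk k om\<bar>)) <= (NNI M (\<lambda>om. ennreal \<bar>?Y om\<bar> + ennreal \<bar>?X om\<bar> + ennreal \<bar>?Z om\<bar>))"
  proof (rule nn_integral_mono)
   have e3: "ennreal \<bar>u + v + q\<bar> <= ennreal \<bar>u\<bar> + ennreal \<bar>v\<bar> + ennreal \<bar>q\<bar>" for u v q :: real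
    by (simp flip: ennreal_plus add: ennreal_leI)
   show "ennreal \<bar>b \<bullet> SNk k om\<bar> <= ennreal \<bar>?Y om\<bar> + ennreal \<bar>?X om\<bar> + ennreal \<bar>?Z om\<bar>" for om
    unfolding hS by (rule e3)
  qed
  also have "... = (NNI M (\<lambda>om. ennreal \<bar>?Y om\<bar>)) + (NNI M (\<lambda>om. ennreal \<bar>?X om\<bar>)) + (NNI M (\<lambda>om. ennreal \<bar>?Z om\<bar>))"
   by (simp add: nn_integral_add)
  also have "... <= ennreal (1 + vY b) + ennreal (1 + vX b) + ennreal (1 + vM b)"
  proof (intro add_mono)
   show "(NNI M (\<lambda>om. ennreal \<bar>?Y om\<bar>)) <= ennreal (1 + vY b)" unfolding vY_def
    by (rule part[OF iid_Y Y_law]) (use that integrable_sY_power[of b 0 2] expectation_sY in auto)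
   show "(NNI M (\<lambda>om. ennreal \<bar>?X om\<bar>)) <= ennreal (1 + vX b)" unfolding vX_def
    by (rule part[OF iid_X Xt_law]) (use that integrable_w_power[of b 0 2] expectation_w in auto)
   show "(NNI M (\<lambda>om. ennreal \<bar>?Z om\<bar>)) <= ennreal (1 + vM b)"
    using part[OF iid_Z Z_law mz[of b], of "mm k" "NN k"] that integrable_sM_power[of b 0 2] expectation_sM
    by (simp add: vM_def)
  qed
  also have "... = ennreal (3 + vY b + vX b + vM b)" using v0 by (simp flip: ennreal_plus)
  finally show ?thesis .
 qed
 define t where "t = C / ep + 1"
 have t: "t > 0" "C / t <= ep"
 proof -
  show "t > 0" using C0 assms by (simp add: t_def add_nonneg_pos)
  then show "C / t <= ep" using C0 assms by (simp add: t_def field_simps)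
 qed
 have "hp ep (\<lambda>k om. (\<Sum>b\<in>Basis. \<bar>b \<bullet> SNk k om\<bar>) < t)"
 proof (rule hp_bounded[OF _ _ assms C0 t])
  show "\<forall>\<^sub>F k in sequentially. (NNI M (\<lambda>om. ennreal (\<Sum>b\<in>Basis. \<bar>b \<bullet> SNk k om\<bar>))) <= ennreal C"
   using nn_pos
  proof eventually_elim
   case (elim k)
   have "(NNI M (\<lambda>om. ennreal (\<Sum>b\<in>Basis. \<bar>b \<bullet> SNk k om\<bar>))) = (\<Sum>b\<in>Basis. \<integral>\<^sup>+om. ennreal \<bar>b \<bullet> SNk k om\<bar> \<partial>M)"
   proof -
    have "(NNI M (\<lambda>om. ennreal (\<Sum>b\<in>Basis. \<bar>b \<bullet> SNk k om\<bar>))) = (NNI M (\<lambda>om. (\<Sum>b\<in>Basis. ennreal \<bar>b \<bullet> SNk k om\<bar>)))"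
     by (intro nn_integral_cong) simp
    also have "... = (\<Sum>b\<in>Basis. \<integral>\<^sup>+om. ennreal \<bar>b \<bullet> SNk k om\<bar> \<partial>M)" by (rule nn_integral_sum) measurable
    finally show ?thesis .
   qed
   also have "... <= (\<Sum>b\<in>Basis. ennreal (3 + vY b + vX b + vM b))" by (intro sum_mono b_le elim)
   also have "... = ennreal C" unfolding C_def using v0 by (intro sum_ennreal) (auto intro!: add_nonneg_nonneg)
   finally show ?case .
  qed
 qed measurable
 then have "hp ep (\<lambda>k om. norm (SNk k om) < t)"
 proof (rule hp_mono)
  have "norm s <= (\<Sum>b\<in>Basis. \<bar>b \<bullet> s\<bar>)" for s :: 'v using norm_le_l1[of s] by (simp add: inner_commute)
  then show "\<forall>\<^sub>F k in sequentially. \<forall>om\<in>space M. (\<Sum>b\<in>Basis. \<bar>b \<bullet> SNk k om\<bar>) < t --> norm (SNk k om) < t"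
   by (intro always_eventually allI ballI impI) (rule le_less_trans)
 qed simp
 then show ?thesis using t by blast
qed

text \<open>\<open>La\<close> belongs to a larger radius, so it is an envelope for radius one too,
  and the moment bounds hold with \<open>La\<close> in place of \<open>L\<close>.\<close>

lemma curvature_tight:
 assumes "ep > 0" and La: "env r La" "r >= 1"
 shows "\<exists>K>0. hp ep (\<lambda>k om. (\<Sum>j<nn k. (La (Yt j om))^2) < K * rN k)"
proof -
 interpret E: ssl_env M g g' \<beta>0 B Xt Yt Xs es La
  by unfold_locales (use env_subset[OF La] in simp)
 define C where "C = E.J 3"
 have C0: "C >= 0" by (simp add: C_def E.J_nonneg)
 have sq: "(NNI M (\<lambda>om. ennreal ((La (Yt j om))^2))) <= ennreal C" for j
 proof -
  have "(La y)^2 <= 1 * E.ex 2 y" for y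
   using power_mono[OF E.L_le_ex E.L_nonneg, of y 2] by (simp add: E.ex_power)
  from E.nn_Y_bound[OF _ this, of j] show ?thesis by (simp add: C_def numeral_3_eq_3 numeral_2_eq_2)
 qed
 define t where "t = C / ep + 1"
 have t: "t > 0" "C / t <= ep"
 proof -
  show "t > 0" using C0 assms by (simp add: t_def add_nonneg_pos)
  then show "C / t <= ep" using C0 assms by (simp add: t_def field_simps)
 qed
 have "hp ep (\<lambda>k om. (\<Sum>j<nn k. (La (Yt j om))^2) / rN k < t)"
 proof (rule hp_bounded[OF _ _ assms(1) C0 t])
  show "\<forall>\<^sub>F k in sequentially. (NNI M (\<lambda>om. ennreal ((\<Sum>j<nn k. (La (Yt j om))^2) / rN k))) <= ennreal C"
   using nn_pos
  proof eventually_elim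
   case (elim k)
   have "(NNI M (\<lambda>om. ennreal ((\<Sum>j<nn k. (La (Yt j om))^2) / rN k))) = (NNI M (\<lambda>om. ennreal (1 / rN k) * (\<Sum>j<nn k. ennreal ((La (Yt j om))^2))))"
    by (intro nn_integral_cong) (simp add: sum_ennreal sum_nonneg flip: ennreal_mult)
   also have "... = ennreal (1 / rN k) * (\<Sum>j<nn k. \<integral>\<^sup>+om. ennreal ((La (Yt j om))^2) \<partial>M)"
    by (subst nn_integral_cmult, measurable) (subst nn_integral_sum, auto)
   also have "... <= ennreal (1 / rN k) * (\<Sum>j<nn k. ennreal C)" by (intro mult_left_mono sum_mono sq) simp
   also have "... = ennreal (1 / rN k * (\<Sum>j<nn k. C))" using C0
    by (subst sum_ennreal, simp) (rule ennreal_mult[symmetric], simp, rule sum_nonneg, simp)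
   also have "... <= ennreal C" using C0 elim by (intro ennreal_leI) (simp add: divide_le_eq algebra_simps)
   finally show ?case .
  qed
 qed measurable
 then have "hp ep (\<lambda>k om. (\<Sum>j<nn k. (La (Yt j om))^2) < t * rN k)"
 proof (rule hp_mono)
  show "\<forall>\<^sub>F k in sequentially. \<forall>om\<in>space M. (\<Sum>j<nn k. (La (Yt j om))^2) / rN k < t --> (\<Sum>j<nn k. (La (Yt j om))^2) < t * rN k"
   using nn_pos by eventually_elim (auto simp: divide_less_eq)
 qed simp
 then show ?thesis using t by blast
qed

end

text \<open>\<open>A\<close> is the limiting curvature as a linear map. \<open>dhat\<close> is the
  deviation of the estimator, required to maximize only where a maximizer exists; coercivity shows
  that one exists with high probability.\<close>

locale ssl_argmax = ssl_seq M g g' \<beta>0 B Xt Yt Xs es L nn mm lam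
 for M :: "'a measure" and g g' :: "real => real" and \<beta>0 :: "'v::euclidean_space" and B :: real
  and Xt :: "nat => 'a => 'v" and Yt :: "nat => 'a => real"
  and Xs :: "nat => 'a => 'v" and es :: "nat => 'a => real" and L :: "real => real"
  and nn mm :: "nat => nat" and lam :: real +
 fixes A Ainv :: "'v => 'v" and a0 :: real and dhat :: "nat => 'a => 'v"
 assumes A_linear: "linear A" and A_sym: "\<And>x y. x \<bullet> A y = A x \<bullet> y"
  and A_quad: "\<And>h. h \<bullet> A h = 1 / (1 + lam) * vY h + lam / (1 + lam) * vM h"
  and a0: "a0 > 0" and A_pos: "\<And>h. a0 * (norm h)^2 <= h \<bullet> A h"
  and A_inv: "\<And>s. A (Ainv s) = s"
  and dhat_max: "\<And>k. AE om in M. (\<exists>b. LLR_max k om b)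
    --> LLR_max k om (dhat k om)"
begin

lemma Ainv_le: "norm (Ainv s) <= norm s / a0"
proof -
 have "a0 * (norm (Ainv s))^2 <= Ainv s \<bullet> s" using A_pos[of "Ainv s"] A_inv by simp
 also have "... <= norm (Ainv s) * norm s" by (rule norm_cauchy_schwarz)
 finally have "norm (Ainv s) * (a0 * norm (Ainv s)) <= norm (Ainv s) * norm s" by (simp add: power2_eq_square algebra_simps)
 then have "a0 * norm (Ainv s) <= norm s" by (cases "norm (Ainv s) = 0") (auto simp: mult_le_cancel_left)
 then show ?thesis using a0 by (simp add: pos_le_divide_eq mult.commute)
qed

definition QF :: "nat => 'v => 'a => real" where
 "QF k h om = h \<bullet> SNk k om - (h \<bullet> A h) / 2"

section \<open>Quadratic approximation uniform on compact sets\<close>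

lemma LAN: "L1_null (\<lambda>k om. LLRk k (dl h k) om - QF k h om)"
proof -
 have "(\<lambda>k. (h \<bullet> A h) / 2 - (real (nn k) / rN k * vY h + real (mm k) / rN k * vM h) / 2) \<longlonglongrightarrow>
   (h \<bullet> A h) / 2 - (1 / (1 + lam) * vY h + lam / (1 + lam) * vM h) / 2"
  by (intro tendsto_intros n_frac m_frac) auto
 then have "(\<lambda>k. (h \<bullet> A h) / 2 - (real (nn k) / rN k * vY h + real (mm k) / rN k * vM h) / 2) \<longlonglongrightarrow> 0"
  by (simp add: A_quad)
 from L1_null_add[OF LAN_finite[of h] L1_null_const[OF this]] show ?thesis
  by (rule L1_null_cong) (auto simp: QF_def)
qed

lemma sNN_ge: "\<forall>\<^sub>F k in sequentially. c <= sqrt (rN k)"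
 using sNN_lim by (simp add: filterlim_at_top)

lemma norm_dl: "norm (dl h k) = norm h / sqrt (rN k)"
 by (simp add: dl_def divide_inverse mult.commute)

lemma dl_scale: "nn k > 0 ==> dl (sqrt (rN k) *\<^sub>R de) k = de"
 by (simp add: dl_def)

lemma dl_comb: "dl ((1 - s) *\<^sub>R x + s *\<^sub>R y) k = (1 - s) *\<^sub>R dl x k + s *\<^sub>R dl y k"
 by (simp add: dl_def scaleR_add_right mult.commute)

lemma dl_diff: "dl x k - dl y k = dl (x - y) k"
 by (simp add: dl_def scaleR_diff_right)

text \<open>At the local scale |dl x - dl y|^2 is |x - y|^2 / N, so a curvature sum below K N leaves
  a loss of order one.\<close>

lemma LLR_semiconcave_local:
 assumes La: "env r La" and n: "nn k > 0" and d: "norm (dl x k) <= r" "norm (dl y k) <= r" and s: "0 <= s" "s <= 1"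
  and K: "(\<Sum>j<nn k. (La (Yt j om))^2) < K * rN k"
 shows "(1 - s) * LLRk k (dl x k) om + s * LLRk k (dl y k) om - K * (norm (x - y))^2 / 2 * (s * (1 - s))
  <= LLRk k (dl ((1 - s) *\<^sub>R x + s *\<^sub>R y) k) om"
proof -
 have N: "rN k > 0" using n by simp
 have "(\<Sum>j<nn k. (La (Yt j om))^2) * ((norm (x - y))^2 / rN k) <= K * rN k * ((norm (x - y))^2 / rN k)"
  by (intro mult_right_mono less_imp_le[OF K]) simp
 also have "... = K * (norm (x - y))^2" using N by simp
 finally have "(\<Sum>j<nn k. (La (Yt j om))^2) * (norm (dl x k - dl y k))^2 <= K * (norm (x - y))^2"
  unfolding dl_diff norm_dl using N by (simp add: power_divide)
 then have "(\<Sum>j<nn k. (La (Yt j om))^2) * (norm (dl x k - dl y k))^2 / 2 * (s * (1 - s)) <= K * (norm (x - y))^2 / 2 * (s * (1 - s))"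
  using s by (intro mult_right_mono divide_right_mono) auto
 with LLR_semiconcave[OF La n d s, of "mm k" om] show ?thesis unfolding dl_comb by linarith
qed

lemma A_bound: obtains a1 where "a1 > 0" "\<And>x. norm (A x) <= a1 * norm x"
 using linear_bounded_pos[OF A_linear] by auto

lemma A_add: "A (x + y) = A x + A y" and A_diff: "A (x - y) = A x - A y"
 using A_linear by (auto simp: linear_add linear_diff)

lemma QF_lipschitz:
 assumes a1: "\<And>x. norm (A x) <= a1 * norm x" "a1 > 0" and s: "norm (SNk k om) < s"
  and xy: "norm x <= R" "norm y <= R"
 shows "\<bar>QF k x om - QF k y om\<bar> <= (s + a1 * R) * norm (x - y)"
proof -
 have 1: "\<bar>(x - y) \<bullet> SNk k om\<bar> <= norm (x - y) * s"
  using Cauchy_Schwarz_ineq2[of "x - y" "SNk k om"] mult_left_mono[OF less_imp_le[OF s] norm_ge_zero[of "x - y"]] by linarith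
 have "\<bar>(x - y) \<bullet> A (x + y)\<bar> <= norm (x - y) * norm (A (x + y))" by (rule Cauchy_Schwarz_ineq2)
 also have "... <= norm (x - y) * (a1 * (2 * R))"
 proof (intro mult_left_mono norm_ge_zero order_trans[OF a1(1)])
  show "norm (x + y) <= 2 * R" using norm_triangle_ineq[of x y] xy by linarith
 qed (use a1 in simp)
 finally have 2: "\<bar>(x - y) \<bullet> A (x + y)\<bar> <= norm (x - y) * (a1 * (2 * R))" .
 have "(x - y) \<bullet> A (x + y) = x \<bullet> A x - y \<bullet> A y"
  using A_sym[of x y] by (simp add: A_add inner_diff_left inner_add_right inner_commute[of "A x" y])
 then have e: "QF k x om - QF k y om = (x - y) \<bullet> SNk k om - ((x - y) \<bullet> A (x + y)) / 2"
  by (simp add: QF_def inner_diff_left diff_divide_distrib)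
 have "(s + a1 * R) * norm (x - y) = norm (x - y) * s + norm (x - y) * (a1 * (2 * R)) / 2" by (simp add: algebra_simps)
 then show ?thesis using 1 2 unfolding e abs_le_iff by linarith
qed

text \<open>On the event that the curvature sum is below K N, K/2 |h|^2 minus the ratio is convex.
  Adding the same square to both functions does not change their difference, so closeness at the
  finitely many points of \<open>G\<close> extends to the whole ball.\<close>

lemma uniform_LAN:
 assumes "ep > 0" "et > 0" "R > 0"
 shows "hp ep (\<lambda>k om. \<forall>h\<in>cball 0 R. \<bar>LLRk k (dl h k) om - QF k h om\<bar> <= et)"
proof -
 have e3: "ep / 3 > 0" using assms by simp
 obtain K where K: "K > 0" "hp (ep/3) (\<lambda>k om. (\<Sum>j<nn k. (L (Yt j om))^2) < K * rN k)"
  using curvature_tight[OF e3 env1] by auto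
 obtain s where s: "s > 0" "hp (ep/3) (\<lambda>k om. norm (SNk k om) < s)" using score_tight[OF e3] by auto
 obtain a1 where a1: "a1 > 0" "\<And>x. norm (A x) <= a1 * norm x" using A_bound by blast
 \<comment> \<open>Lipschitz constant of Q below on the ball of radius R + 1: the first summand from
   K/2 |x|^2, the rest from \<open>QF\<close>.\<close>
 define La where "La = K * (R + 1) + (s + a1 * (R + 1))"
 have La: "La > 0" unfolding La_def using K s a1 assms by (intro add_pos_pos mult_pos_pos) auto
 \<comment> \<open>The passage from \<open>G\<close> to the ball loses a factor 4.\<close>
 have "et / 4 > 0" using assms by simp
 from convex_finite_approx[OF La this, where R=R] obtain G :: "'v set"
  where G: "finite G" and GF: "\<And>F Q. convex_on (cball 0 (R + 1)) F ==>
   (\<forall>x\<in>cball 0 (R + 1). \<forall>y\<in>cball 0 (R + 1). \<bar>Q x - Q y\<bar> <= La * norm (x - y)) ==>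
   (\<forall>g\<in>G. \<bar>F g - Q g\<bar> <= et / 4) ==> (\<forall>x\<in>cball 0 R. \<bar>F x - Q x\<bar> <= 4 * (et / 4))" by blast
 have "hp (ep/3) (\<lambda>k om. \<forall>h\<in>G. \<bar>LLRk k (dl h k) om - QF k h om\<bar> < et / 4)"
  using G by (rule hp_finite_Ball) (rule hp_L1_null[OF LAN], use assms in auto)
 from hp_conj[OF this hp_conj[OF K(2) s(2)]]
 show ?thesis
 proof (rule hp_mono)
  show "\<forall>\<^sub>F k in sequentially. \<forall>om\<in>space M. (\<forall>h\<in>G. \<bar>LLRk k (dl h k) om - QF k h om\<bar> < et / 4) \<and>
    (\<Sum>j<nn k. (L (Yt j om))^2) < K * rN k \<and> norm (SNk k om) < s -->
   (\<forall>h\<in>cball 0 R. \<bar>LLRk k (dl h k) om - QF k h om\<bar> <= et)"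
   using nn_pos sNN_ge[of "R + 1"]
  proof (eventually_elim, intro ballI impI)
   fix k om and h :: 'v
   assume n: "0 < nn k" and Rk: "R + 1 <= sqrt (rN k)" and h: "h \<in> cball 0 R"
   assume H: "(\<forall>h\<in>G. \<bar>LLRk k (dl h k) om - QF k h om\<bar> < et / 4) \<and>
    (\<Sum>j<nn k. (L (Yt j om))^2) < K * rN k \<and> norm (SNk k om) < s"
   have N: "sqrt (rN k) > 0" using n by simp
   have dl1: "norm (dl x k) <= 1" if "norm x <= R + 1" for x
    unfolding norm_dl using N that Rk by (simp add: divide_le_eq)
   define F where "F x = K / 2 * (norm x)^2 - LLRk k (dl x k) om" for x
   define Q where "Q x = K / 2 * (norm x)^2 - QF k x om" for x
   have "convex_on (cball 0 (R + 1)) F"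
   proof (rule convex_onI)
    fix t :: real and x y :: 'v assume t: "0 < t" "t < 1" and xy: "x \<in> cball 0 (R+1)" "y \<in> cball 0 (R+1)"
    have "(1 - t) * LLRk k (dl x k) om + t * LLRk k (dl y k) om - K * (norm (x - y))^2 / 2 * (t * (1 - t))
     <= LLRk k (dl ((1 - t) *\<^sub>R x + t *\<^sub>R y) k) om"
     using t xy H by (intro LLR_semiconcave_local[OF env1 n]) (auto intro: dl1)
    then show "F ((1 - t) *\<^sub>R x + t *\<^sub>R y) <= (1 - t) * F x + t * F y"
     unfolding F_def norm_sq_convex_comb by (simp add: algebra_simps add_divide_distrib diff_divide_distrib)
   qed simp
   moreover have "\<forall>x\<in>cball 0 (R + 1). \<forall>y\<in>cball 0 (R + 1). \<bar>Q x - Q y\<bar> <= La * norm (x - y)"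
   proof (intro ballI)
    fix x y :: 'v assume xy: "x \<in> cball 0 (R+1)" "y \<in> cball 0 (R+1)"
    have 1: "\<bar>QF k x om - QF k y om\<bar> <= (s + a1 * (R + 1)) * norm (x - y)"
     using xy H by (intro QF_lipschitz a1) auto
    have "\<bar>norm x - norm y\<bar> * (norm x + norm y) <= norm (x - y) * (2 * (R + 1))"
     using xy by (intro mult_mono norm_triangle_ineq3) auto
    moreover have "\<bar>(norm x)\<^sup>2 - (norm y)\<^sup>2\<bar> = \<bar>norm x - norm y\<bar> * (norm x + norm y)"
     by (simp add: power2_eq_square square_diff_square_factored abs_mult mult.commute)
    ultimately have "\<bar>(norm x)\<^sup>2 - (norm y)\<^sup>2\<bar> <= norm (x - y) * (2 * (R + 1))" by simp
    then have "K / 2 * \<bar>(norm x)\<^sup>2 - (norm y)\<^sup>2\<bar> <= K / 2 * (norm (x - y) * (2 * (R + 1)))"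
     using K by (intro mult_left_mono) auto
    then have 2: "\<bar>K / 2 * ((norm x)^2 - (norm y)\<^sup>2)\<bar> <= K * (R + 1) * norm (x - y)"
    proof -
     assume *: "K / 2 * \<bar>(norm x)\<^sup>2 - (norm y)\<^sup>2\<bar> <= K / 2 * (norm (x - y) * (2 * (R + 1)))"
     have "\<bar>K / 2 * ((norm x)^2 - (norm y)\<^sup>2)\<bar> = K / 2 * \<bar>(norm x)\<^sup>2 - (norm y)\<^sup>2\<bar>" using K unfolding abs_mult by simp
     moreover have "K / 2 * (norm (x - y) * (2 * (R + 1))) = K * (R + 1) * norm (x - y)" by simp
     ultimately show ?thesis using * by (simp only:)
    qed
    have "Q x - Q y = K / 2 * ((norm x)^2 - (norm y)\<^sup>2) - (QF k x om - QF k y om)" by (simp add: Q_def algebra_simps)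
    then have "\<bar>Q x - Q y\<bar> <= \<bar>K / 2 * ((norm x)^2 - (norm y)\<^sup>2)\<bar> + \<bar>QF k x om - QF k y om\<bar>" by simp
    also have "... <= K * (R + 1) * norm (x - y) + (s + a1 * (R + 1)) * norm (x - y)" using 1 2 by (rule add_mono[OF _ _, rotated])
    finally show "\<bar>Q x - Q y\<bar> <= La * norm (x - y)" by (simp add: La_def distrib_right)
   qed
   moreover have "\<forall>g\<in>G. \<bar>F g - Q g\<bar> <= et / 4"
    using H by (auto simp: F_def Q_def abs_minus_commute intro: less_imp_le)
   ultimately have "\<forall>x\<in>cball 0 R. \<bar>F x - Q x\<bar> <= 4 * (et / 4)" by (rule GF)
   then show "\<bar>LLRk k (dl h k) om - QF k h om\<bar> <= et"
    using h by (auto simp: F_def Q_def abs_minus_commute)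
  qed
 qed simp
qed

subsection \<open>Consistency at the root-N scale\<close>

lemma LLR_joint_meas[measurable]:
 "(\<lambda>x. LLRk k (dl (fst x) k) (snd x)) \<in> borel_measurable (lborel \<Otimes>\<^sub>M M)"
 unfolding LLR_def av_def dl_def by measurable

text \<open>The mean of exp (LLR / 2) decays like exp (- ka |h|^2). Half of this rate pays for the
  weight exp (ka/2 |h|^2), the other half makes the mean integrable in h. The outer radius R sqrt N
  is the local image of the fixed ball to which coercivity confines the maximizer.\<close>

definition tailI :: "real => real => real => nat => 'a => ennreal" where
 "tailI ka R \<tau> k om = (NNI lborel (\<lambda>h. indicator {h. \<tau> <= norm h \<and> norm h <= R * sqrt (rN k)} h *
  ennreal (exp (LLRk k (dl h k) om / 2 + ka / 2 * (norm h)^2))))"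

lemma tail_mean:
 assumes c: "\<And>s. \<bar>s\<bar> <= R * B ==> (NNI lborel (\<lambda>t. ennreal (exp (- (g (t - s) + g t) / 2)))) <= ennreal (1 - c * s^2)"
  and c0: "\<And>v. c0 * (norm v)^2 <= expectation (\<lambda>om. (v \<bullet> Xt 0 om)^2)"
  and pos: "c > 0" "c0 > 0" and n: "nn k > 0" and ka: "ka * rN k <= real (mm k) * (c * c0)"
 shows "(NNI M (\<lambda>om. indicator {x. real (nn k) * chi (nn k) x <= C} (XS om) * tailI ka R \<tau> k om)) <=
  ennreal (exp (C / 2)) * (NNI lborel (\<lambda>h. ennreal (indicator {h::'v. \<tau> <= norm h} h * exp (- (ka / 2 * (norm h)^2)))))"
proof -
 let ?S = "{h::'v. \<tau> <= norm h \<and> norm h <= R * sqrt (rN k)}"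
 let ?i = "\<lambda>om. indicator {x. real (nn k) * chi (nn k) x <= C} (XS om) :: ennreal"
 interpret P: pair_sigma_finite lborel M ..
 have [measurable]: "{x. real (nn k) * chi (nn k) x <= C} \<in> sets (PiM UNIV (\<lambda>_. borel :: 'v measure))"
 proof -
  have "{x \<in> space (PiM UNIV (\<lambda>_. borel :: 'v measure)). real (nn k) * chi (nn k) x <= C} \<in> sets (PiM UNIV (\<lambda>_. borel :: 'v measure))"
   by measurable
  then show ?thesis by (simp add: space_PiM)
 qed
 have N: "sqrt (rN k) > 0" using n by simp
 have "(NNI M (\<lambda>om. ?i om * tailI ka R \<tau> k om)) = (NNI M (\<lambda>om. \<integral>\<^sup>+h. ?i om * (indicator ?S h *
  ennreal (exp (LLRk k (dl h k) om / 2 + ka / 2 * (norm h)^2))) \<partial>lborel))"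
  unfolding tailI_def LLR_def av_def dl_def by (intro nn_integral_cong nn_integral_cmult[symmetric]) measurable
 also have "... = (NNI lborel (\<lambda>h. \<integral>\<^sup>+om. ?i om * (indicator ?S h *
  ennreal (exp (LLRk k (dl h k) om / 2 + ka / 2 * (norm h)^2))) \<partial>M))"
  by (rule P.Fubini') measurable
 also have "... <= (NNI lborel (\<lambda>h. ennreal (exp (C / 2)) * ennreal (indicator {h::'v. \<tau> <= norm h} h * exp (- (ka / 2 * (norm h)^2)))))"
 proof (rule nn_integral_mono)
  fix h :: 'v
  show "(NNI M (\<lambda>om. ?i om * (indicator ?S h * ennreal (exp (LLRk k (dl h k) om / 2 + ka / 2 * (norm h)^2)))))
   <= ennreal (exp (C / 2)) * ennreal (indicator {h::'v. \<tau> <= norm h} h * exp (- (ka / 2 * (norm h)^2)))"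
  proof (cases "h \<in> ?S")
   case True
   then have d: "norm (dl h k) <= R" unfolding norm_dl using N by (simp add: divide_le_eq)
   have "(NNI M (\<lambda>om. ?i om * (indicator ?S h * ennreal (exp (LLRk k (dl h k) om / 2 + ka / 2 * (norm h)^2)))))
    = (NNI M (\<lambda>om. ennreal (exp (ka / 2 * (norm h)^2)) * (?i om * ennreal (exp (LLRk k (dl h k) om / 2)))))"
    using True by (intro nn_integral_cong) (simp add: exp_add ennreal_mult mult_ac)
   also have "... = ennreal (exp (ka / 2 * (norm h)^2)) * (NNI M (\<lambda>om. ?i om * ennreal (exp (LLRk k (dl h k) om / 2))))"
    by (rule nn_integral_cmult) measurable
   also have "... <= ennreal (exp (ka / 2 * (norm h)^2)) * ennreal (exp (C / 2 - real (mm k) * (c * c0 * (norm (dl h k))^2)))"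
    by (intro mult_left_mono sqrt_LR_bound[OF c c0 pos(1) d n]) auto
   also have "... = ennreal (exp (ka / 2 * (norm h)^2 + (C / 2 - real (mm k) * (c * c0 * (norm (dl h k))^2))))"
    by (simp add: exp_add flip: ennreal_mult)
   also have "... <= ennreal (exp (C / 2 + - (ka / 2 * (norm h)^2)))"
   proof -
    have "ka * (norm h)^2 = ka * rN k * ((norm h)^2 / rN k)" using n by simp
    also have "... <= real (mm k) * (c * c0) * ((norm h)^2 / rN k)" by (intro mult_right_mono ka) simp
    also have "... = real (mm k) * (c * c0 * (norm (dl h k))^2)" using n by (simp add: norm_dl power_divide)
    finally show ?thesis by (intro ennreal_leI) simp
   qed
   also have "... = ennreal (exp (C / 2)) * ennreal (indicator {h::'v. \<tau> <= norm h} h * exp (- (ka / 2 * (norm h)^2)))"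
    using True by (simp add: exp_add ennreal_mult del: add_uminus_conv_diff)
   finally show ?thesis .
  qed (simp add: indicator_def)
 qed
 also have "... = ennreal (exp (C / 2)) * (NNI lborel (\<lambda>h. ennreal (indicator {h::'v. \<tau> <= norm h} h * exp (- (ka / 2 * (norm h)^2)))))"
  by (rule nn_integral_cmult) measurable
 finally show ?thesis .
qed

text \<open>The order of quantifiers matters: \<open>ka\<close> is fixed before \<open>v\<close>,
  because the volume later inserted for \<open>v\<close> is computed from \<open>ka\<close>.\<close>

lemma tail_small:
 assumes "R > 0"
 shows "\<exists>ka>0. \<forall>ep>0. \<forall>v>0. \<exists>\<tau>>0. hp ep (\<lambda>k om. tailI ka R \<tau> k om < ennreal v)"
proof -
 obtain c where c: "c > 0" "\<And>s. \<bar>s\<bar> <= R * B ==> (NNI lborel (\<lambda>t. ennreal (exp (- (g (t - s) + g t) / 2)))) <= ennreal (1 - c * s^2)"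
  using g_hell[of "R * B"] by blast
 obtain c0 where c0: "c0 > 0" "\<And>v. c0 * (norm v)^2 <= expectation (\<lambda>om. (v \<bullet> Xt 0 om)^2)" using nondeg by blast
 obtain ka1 where ka1: "ka1 > 0" "\<forall>\<^sub>F k in sequentially. ka1 * rN k <= real (mm k)" using matched_fraction by blast
 define ka where "ka = ka1 * (c * c0)"
 have ka: "ka > 0" using ka1 c c0 by (simp add: ka_def)
 have "\<exists>\<tau>>0. hp ep (\<lambda>k om. tailI ka R \<tau> k om < ennreal v)" if e: "ep > 0" and v: "v > 0" for ep v
 proof -
  \<comment> \<open>Markov's inequality keeps n chi below C with probability at least 1 -
    ep/2.\<close>
  define C where "C = J 3 / (ep / 2) + 1"
  have C: "C > 0" "J 3 / C <= ep / 2"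
  proof -
   show "C > 0" using e J_nonneg[of 3] by (simp add: C_def add_nonneg_pos)
   then show "J 3 / C <= ep / 2" using e J_nonneg[of 3] by (simp add: C_def field_simps)
  qed
  have 1: "hp (ep / 2) (\<lambda>k om. real (nn k) * chi (nn k) (XS om) < C)"
   using e C by (intro hp_bounded[OF _ _ _ J_nonneg[of 3]] eventually_mono[OF nn_pos chi_mean]) auto
  \<comment> \<open>After the factor exp (C/2), a Gaussian tail below T is what Markov's inequality
    at level v needs for the remaining ep/2.\<close>
  define T where "T = v * (ep / 2) / exp (C / 2)"
  have T: "T > 0" using e v by (simp add: T_def)
  have int: "integrable lborel (\<lambda>h::'v. exp (- (ka / 2 * (norm h)^2)))" using ka by (intro integrable_exp_minus_norm_sq) simp
  from integral_tail_small[OF int _ T] obtain \<tau> where \<tau>: "\<tau> > 0"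
   "(LINT h|lborel. indicator {h::'v. norm h >= \<tau>} h * exp (- (ka / 2 * (norm h)^2))) < T" by auto
  have int2: "integrable lborel (\<lambda>h::'v. indicator {h::'v. norm h >= \<tau>} h * exp (- (ka / 2 * (norm h)^2)))"
   by (rule Bochner_Integration.integrable_bound[OF int]) (auto simp: indicator_def)
  have nnT: "(NNI lborel (\<lambda>h. ennreal (indicator {h::'v. \<tau> <= norm h} h * exp (- (ka / 2 * (norm h)^2))))) <= ennreal T"
   using \<tau> by (subst nn_integral_eq_integral[OF int2]) (auto simp: ennreal_leI)
  have [measurable]: "{x. real (nn k) * chi (nn k) x <= C} \<in> sets (PiM UNIV (\<lambda>_. borel :: 'v measure))" for k
  proof -
   have "{x \<in> space (PiM UNIV (\<lambda>_. borel :: 'v measure)). real (nn k) * chi (nn k) x <= C} \<in> sets (PiM UNIV (\<lambda>_. borel :: 'v measure))"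
    by measurable
   then show ?thesis by (simp add: space_PiM)
  qed
  have [measurable]: "tailI ka R \<tau> k \<in> borel_measurable M" for k
  proof -
   have [measurable]: "(\<lambda>x. LLRk k (dl (snd x) k) (fst x)) \<in> borel_measurable (M \<Otimes>\<^sub>M lborel)"
    unfolding LLR_def av_def dl_def by measurable
   have [measurable]: "(\<lambda>x. LLRk k (dl (snd x) k) (fst x)) \<in> borel_measurable (M \<Otimes>\<^sub>M borel)"
    using \<open>_ \<in> borel_measurable (M \<Otimes>\<^sub>M lborel)\<close> by (simp cong: measurable_cong_sets)
   show ?thesis unfolding tailI_def[abs_def] by measurable
  qed
  have "hp (ep / 2) (\<lambda>k om. indicator {x. real (nn k) * chi (nn k) x <= C} (XS om) * tailI ka R \<tau> k om < ennreal v)"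
  proof (rule hp_ennreal_less)
   show "\<forall>\<^sub>F k in sequentially. (NNI M (\<lambda>om. indicator {x. real (nn k) * chi (nn k) x <= C} (XS om) * tailI ka R \<tau> k om)) <= ennreal (exp (C / 2) * T)"
    using nn_pos ka1(2)
   proof eventually_elim
    case (elim k)
    have "ka1 * rN k * (c * c0) <= real (mm k) * (c * c0)" using elim c c0 by (intro mult_right_mono) auto
    then have kak: "ka * rN k <= real (mm k) * (c * c0)" by (simp add: ka_def mult_ac)
    have "(NNI M (\<lambda>om. indicator {x. real (nn k) * chi (nn k) x <= C} (XS om) * tailI ka R \<tau> k om)) <=
     ennreal (exp (C / 2)) * (NNI lborel (\<lambda>h. ennreal (indicator {h::'v. \<tau> <= norm h} h * exp (- (ka / 2 * (norm h)^2)))))"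
     by (rule tail_mean[OF c(2) c0(2) c(1) c0(1) elim(1) kak])
    also have "ennreal (exp (C / 2)) * (NNI lborel (\<lambda>h. ennreal (indicator {h::'v. \<tau> <= norm h} h * exp (- (ka / 2 * (norm h)^2)))))
     <= ennreal (exp (C / 2)) * ennreal T" by (intro mult_left_mono nnT) simp
    also have "... = ennreal (exp (C / 2) * T)" using T by (intro ennreal_mult[symmetric]) auto
    finally show ?case by simp
   qed
   show "exp (C / 2) * T / v <= ep / 2" using v by (simp add: T_def)
  qed (use T v in \<open>auto intro!: less_imp_le\<close>)
  from hp_conj[OF 1 this] have "hp ep (\<lambda>k om. tailI ka R \<tau> k om < ennreal v)"
   by (rule hp_mono) (auto simp: indicator_def)
  then show ?thesis using \<tau> by blast
 qed
 then show ?thesis using ka by blast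
qed

lemma LLR_zero[simp]: "nn k > 0 ==> LLR (nn k) m 0 om = 0"
 using av_XS_pos[of "nn k" 0 om] by (simp add: LLR_def less_imp_neq[symmetric])

lemma LLR_continuous:
 assumes n: "n > 0"
 shows "continuous_on S (\<lambda>de. LLR n m de om)"
proof -
 have gc: "continuous_on S (\<lambda>x. g (q x))" if "continuous_on S q" for q and S :: "'v set"
  using continuous_on_compose2[OF g_cont that] by auto
 have "continuous_on S (\<lambda>de. av n de (XS om) y)" for y
  unfolding av_def p_def f_def by (intro continuous_intros gc) (use n in auto)
 moreover have "av n de (XS om) y \<noteq> 0" for de y using av_XS_pos[OF n, of de om y] by simp
 ultimately show ?thesis unfolding LLR_def by (intro continuous_intros gc) auto
qed

text \<open>The value 0 at the origin beats everything outside the ball, so a maximum over the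
  compact ball is global.\<close>

lemma LLR_maximizer_exists:
 assumes n: "nn k > 0" and R: "R > 0" and neg: "\<forall>de. R <= norm de --> LLRk k de om < 0"
 shows "\<exists>b. LLR_max k om b"
proof -
 have "\<exists>b\<in>cball 0 R. \<forall>de\<in>cball 0 R. LLRk k de om <= LLRk k b om"
  using R by (intro continuous_attains_sup LLR_continuous n compact_cball) auto
 then obtain b where b: "\<forall>de\<in>cball 0 R. LLRk k de om <= LLRk k b om" by (elim bexE)
 have b0: "0 <= LLRk k b om" using bspec[OF b, of 0] n R by simp
 have "LLRk k de om <= LLRk k b om" for de
 proof (cases "norm de <= R")
  case True
  then show ?thesis using bspec[OF b, of de] by simp
 next
  case False
  then show ?thesis using spec[OF neg, of de] b0 by linarith
 qed
 then show ?thesis by blast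
qed

lemma dhat_localized:
 assumes "ep > 0"
 shows "\<exists>R>0. hp ep (\<lambda>k om. norm (dhat k om) < R \<and> LLR_max k om (dhat k om))"
proof -
 obtain R where R: "R > 0" "hp ep (\<lambda>k om. \<forall>de. R <= norm de --> LLRk k de om < 0)" using coercive[OF assms] by blast
 from hp_conj[OF R(2) hp_AE[OF dhat_max order_refl]]
 have "hp ep (\<lambda>k om. norm (dhat k om) < R \<and> LLR_max k om (dhat k om))"
 proof (rule hp_mono)
  show "\<forall>\<^sub>F k in sequentially. \<forall>om\<in>space M. (\<forall>de. R <= norm de --> LLRk k de om < 0) \<and>
   ((\<exists>b. LLR_max k om b)
    --> LLR_max k om (dhat k om)) -->
   norm (dhat k om) < R \<and> LLR_max k om (dhat k om)"
   using nn_pos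
  proof (eventually_elim, intro ballI impI)
   fix k om
   assume n: "0 < nn k" and H: "(\<forall>de. R <= norm de --> LLRk k de om < 0) \<and>
   ((\<exists>b. LLR_max k om b)
    --> LLR_max k om (dhat k om))"
   have mx: "LLR_max k om (dhat k om)"
    using H LLR_maximizer_exists[OF n R(1), of om] by blast
   moreover have "0 <= LLRk k (dhat k om) om" using mx[rule_format, of 0] n by simp
   ultimately show "norm (dhat k om) < R \<and> LLR_max k om (dhat k om)"
    using H by (meson not_less leD)
  qed
 qed simp
 then show ?thesis using R by blast
qed

text \<open>Suppose the maximizer X, in local scale, is far out. The ratio is at least 0 at X and at
  least - C0 on the unit ball. Semiconcavity along the segments from X to points of the unit ball
  bounds it below by - ka |y|^2 on a whole ball of radius \<open>et\<close> near X, so the integrand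
  of \<open>tailI\<close> is at least 1 there. The tail integral is then no less than the volume of
  that ball, a fixed number, against \<open>tail_small\<close>.\<close>

lemma dhat_tight:
 assumes "ep > 0"
 shows "\<exists>C>0. hp ep (\<lambda>k om. norm (sqrt (rN k) *\<^sub>R dhat k om) <= C)"
proof -
 \<comment> \<open>Five events are intersected: localization, curvature, score, approximation on the
   unit ball, and small tail.\<close>
 have e5: "ep / 5 > 0" using assms by simp
 obtain R0 where R0: "R0 > 0" "hp (ep/5) (\<lambda>k om. norm (dhat k om) < R0 \<and> LLR_max k om (dhat k om))"
  using dhat_localized[OF e5] by blast
 \<comment> \<open>One unit beyond the localization radius, since points y of the small ball satisfy
   |y| <= |X| + 1.\<close>
 define r where "r = R0 + 1"
 have r: "r > 0" "r >= 1" using R0 by (auto simp: r_def)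
 obtain La where La: "env r La" using env_exists[OF r(1)] by blast
 obtain K where K: "K > 0" "hp (ep/5) (\<lambda>k om. (\<Sum>j<nn k. (La (Yt j om))^2) < K * rN k)"
  using curvature_tight[OF e5 La r(2)] by auto
 obtain s where s: "s > 0" "hp (ep/5) (\<lambda>k om. norm (SNk k om) < s)" using score_tight[OF e5] by auto
 obtain a1 where a1: "a1 > 0" "\<And>x. norm (A x) <= a1 * norm x" using A_bound by blast
 have U: "hp (ep/5) (\<lambda>k om. \<forall>h\<in>cball 0 1. \<bar>LLRk k (dl h k) om - QF k h om\<bar> <= 1)"
  by (rule uniform_LAN[OF e5]) auto
 define C0 where "C0 = s + a1 + 1"
 have C0: "C0 > 0" using s a1 by (simp add: C0_def)
 obtain ka where ka: "ka > 0" "\<And>ep v. ep > 0 ==> v > 0 ==> \<exists>\<tau>>0. hp ep (\<lambda>k om. tailI ka r \<tau> k om < ennreal v)"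
  using tail_small[OF r(1)] by blast
 \<comment> \<open>The bound 1/4 keeps |y| between |X| / 2 and |X| + 1; the other bound makes the
   semiconcavity loss at most ka |X|^2 / 8.\<close>
 define et where "et = min (1/4) (ka / (16 * K))"
 have et: "et > 0" "et <= 1/4" "et * (16 * K) <= ka"
 proof -
  show "et > 0" "et <= 1/4" using ka K by (auto simp: et_def)
  have "et <= ka / (16 * K)" by (simp add: et_def)
  then show "et * (16 * K) <= ka" using K by (simp add: pos_le_divide_eq)
 qed
 define v where "v = unit_ball_vol (real DIM('v)) * et ^ DIM('v)"
 have v: "v > 0" "\<And>c::'v. emeasure lborel (ball c et) = ennreal v"
  using et by (auto simp: v_def emeasure_ball)
 obtain \<tau> where \<tau>: "\<tau> > 0" "hp (ep/5) (\<lambda>k om. tailI ka r \<tau> k om < ennreal v)" using ka(2)[OF e5 v(1)] by blast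
 \<comment> \<open>The summands ensure |X| >= 1, C0 <= ka |X|^2 / 8 and |y| >= |X| / 2 >=
   \<tau>.\<close>
 define C where "C = 1 + 8 * C0 / ka + 2 * \<tau>"
 have C: "C >= 1" "2 * \<tau> <= C" "8 * C0 / ka <= C" using C0 ka \<tau> by (auto simp: C_def)
 have "hp ep (\<lambda>k om. norm (sqrt (rN k) *\<^sub>R dhat k om) <= C)"
 proof (rule hp_mono[OF hp_conj[OF R0(2) hp_conj[OF K(2) hp_conj[OF s(2) hp_conj[OF U \<tau>(2)]]]]])
  show "\<forall>\<^sub>F k in sequentially. \<forall>om\<in>space M. (norm (dhat k om) < R0 \<and> LLR_max k om (dhat k om)) \<and>
    (\<Sum>j<nn k. (La (Yt j om))^2) < K * rN k \<and> norm (SNk k om) < s \<and>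
    (\<forall>h\<in>cball 0 1. \<bar>LLRk k (dl h k) om - QF k h om\<bar> <= 1) \<and> tailI ka r \<tau> k om < ennreal v -->
   norm (sqrt (rN k) *\<^sub>R dhat k om) <= C"
   using nn_pos sNN_ge[of 1]
  proof (eventually_elim, intro ballI impI)
   fix k om
   assume n: "0 < nn k" and sN1: "1 <= sqrt (rN k)"
   assume H: "(norm (dhat k om) < R0 \<and> LLR_max k om (dhat k om)) \<and>
    (\<Sum>j<nn k. (La (Yt j om))^2) < K * rN k \<and> norm (SNk k om) < s \<and>
    (\<forall>h\<in>cball 0 1. \<bar>LLRk k (dl h k) om - QF k h om\<bar> <= 1) \<and> tailI ka r \<tau> k om < ennreal v"
   define X where "X = sqrt (rN k) *\<^sub>R dhat k om"
   have dX: "dl X k = dhat k om" unfolding X_def by (rule dl_scale[OF n])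
   have LX: "LLRk k (dl X k) om >= 0"
    unfolding dX using H n by (metis LLR_zero)
   have "norm (dhat k om) <= R0" using H by linarith
   from mult_right_mono[OF this, of "sqrt (rN k)"] have nX: "norm X <= R0 * sqrt (rN k)"
    by (simp add: X_def mult.commute)
   have Lu: "LLRk k (dl u k) om >= - C0" if u: "norm u <= 1" for u
   proof -
    have "\<bar>QF k u om - QF k 0 om\<bar> <= (s + a1 * 1) * norm (u - 0)"
     by (rule QF_lipschitz[OF a1(2,1)]) (use H u in auto)
    also have "... <= (s + a1 * 1) * 1" using s a1 u by (intro mult_left_mono) auto
    finally have "\<bar>QF k u om\<bar> <= s + a1" by (simp add: QF_def)
    moreover have "\<bar>LLRk k (dl u k) om - QF k u om\<bar> <= 1" using H u by auto
    ultimately show ?thesis unfolding C0_def by linarith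
   qed
   show "norm (sqrt (rN k) *\<^sub>R dhat k om) <= C"
   proof (rule ccontr)
    assume "\<not> ?thesis"
    then have XC: "norm X > C" by (simp add: X_def)
    have X1: "norm X >= 1" using XC C by linarith
    have "ennreal v = (NNI lborel (\<lambda>h. indicator (ball ((1 - et) *\<^sub>R X) et) h))" by (simp add: v)
    also have "... <= tailI ka r \<tau> k om"
     unfolding tailI_def
    proof (rule nn_integral_mono)
     fix y :: 'v
     show "indicator (ball ((1 - et) *\<^sub>R X) et) y <= indicator {h. \<tau> <= norm h \<and> norm h <= r * sqrt (rN k)} y *
      ennreal (exp (LLRk k (dl y k) om / 2 + ka / 2 * (norm y)^2))"
     proof (cases "y \<in> ball ((1 - et) *\<^sub>R X) et")
      case True
      define u where "u = (y - (1 - et) *\<^sub>R X) /\<^sub>R et"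
      have y: "y = (1 - et) *\<^sub>R X + et *\<^sub>R u" using et by (simp add: u_def)
      have "norm (et *\<^sub>R u) < et" using True by (simp add: y dist_norm)
      then have u: "norm u <= 1" using et by (simp add: mult_less_cancel_left2)
      have n1: "norm ((1 - et) *\<^sub>R X) = (1 - et) * norm X" using et by simp
      have n2: "norm (et *\<^sub>R u) <= 1/4" using \<open>norm (et *\<^sub>R u) < et\<close> et by linarith
      have n3: "3/4 * norm X <= (1 - et) * norm X" "(1 - et) * norm X <= 1 * norm X" using et by (intro mult_right_mono; simp)+
      have y_up: "norm y <= norm X + 1"
       unfolding y using norm_triangle_ineq[of "(1 - et) *\<^sub>R X" "et *\<^sub>R u"] n1 n2 n3 by linarith
      have y_lo: "norm X / 2 <= norm y"
       unfolding y using norm_diff_ineq[of "(1 - et) *\<^sub>R X" "et *\<^sub>R u"] n1 n2 n3 X1 by linarith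
      have "norm y <= r * sqrt (rN k)"
       unfolding r_def distrib_right using y_up nX sN1 by linarith
      moreover have "\<tau> <= norm y" using y_lo XC C by linarith
      ultimately have yS: "y \<in> {h. \<tau> <= norm h \<and> norm h <= r * sqrt (rN k)}" by simp
      have du: "norm (dl u k) <= r"
      proof -
       have "norm (dl u k) <= 1" unfolding norm_dl using order_trans[OF u sN1] sN1 by (simp add: divide_le_eq)
       then show ?thesis using r by linarith
      qed
      have dXr: "norm (dl X k) <= r" unfolding dX r_def using H by linarith
      have et1: "0 <= et" "et <= 1" using et by auto
      have KH: "(\<Sum>j<nn k. (La (Yt j om))^2) < K * rN k" using H by blast
      have "norm (X - u) <= 2 * norm X" using norm_triangle_ineq4[of X u] u X1 by linarith
      then have "(norm (X - u))^2 <= (2 * norm X)^2" by (rule power_mono) simp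
      then have "K * (norm (X - u))^2 / 2 * (et * (1 - et)) <= K * (2 * norm X)^2 / 2 * (et * 1)"
       using K et by (intro mult_mono divide_right_mono) auto
      also have "... = et * (16 * K) * ((norm X)^2 / 8)" by (simp add: power2_eq_square)
      also have "... <= ka * ((norm X)^2 / 8)" using et by (intro mult_right_mono) auto
      finally have q1: "K * (norm (X - u))^2 / 2 * (et * (1 - et)) <= ka * (norm X)^2 / 8" by simp
      have q2: "C0 <= ka * (norm X)^2 / 8"
      proof -
       have "8 * C0 / ka <= norm X" using XC C by linarith
       also have "norm X * 1 <= norm X * norm X" using X1 by (intro mult_left_mono) auto
       finally have "8 * C0 / ka <= (norm X)^2" by (simp add: power2_eq_square)
       then show ?thesis using ka by (simp add: pos_divide_le_eq mult.commute)
      qed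
      have q3: "ka * (norm X)^2 / 4 <= ka * (norm y)^2"
      proof -
       have "(norm X / 2)^2 <= (norm y)^2" using y_lo by (rule power_mono) simp
       from mult_left_mono[OF this less_imp_le[OF ka(1)]] show ?thesis by (simp add: power_divide)
      qed
      have q4: "0 <= (1 - et) * LLRk k (dl X k) om" using LX et by simp
      have "et * (- C0) <= et * LLRk k (dl u k) om" using Lu[OF u] et by (intro mult_left_mono) auto
      moreover have "et * C0 <= 1 * C0" using et C0 by (intro mult_right_mono) auto
      ultimately have q5: "- C0 <= et * LLRk k (dl u k) om" by linarith
      have "- (ka * (norm y)^2) <= LLRk k (dl y k) om"
       using LLR_semiconcave_local[OF La n dXr du et1 KH] q1 q2 q3 q4 q5 unfolding y[symmetric] by linarith
      then have "exp 0 <= exp (LLRk k (dl y k) om / 2 + ka / 2 * (norm y)^2)" by (subst exp_le_cancel_iff) (simp add: field_simps)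
      then show ?thesis using yS by (simp add: indicator_def)
     qed (simp add: indicator_def)
    qed
    finally show False using H by auto
   qed
  qed
 qed simp
 then show ?thesis using C by (intro exI[of _ C]) auto
qed

text \<open>Completing the square at Y = Ainv S: \<open>QF\<close> at Y minus \<open>QF\<close> at X
  is half the form of \<open>A\<close> at X - Y. As X maximizes the ratio and the ratio is uniformly
  close to \<open>QF\<close>, this form is small, and \<open>A\<close> is coercive.\<close>

theorem maximizer_close:
 assumes "ep > 0" "et > 0"
 shows "hp ep (\<lambda>k om. norm (sqrt (rN k) *\<^sub>R dhat k om - Ainv (SNk k om)) <= et)"
proof -
 have e4: "ep / 4 > 0" using assms by simp
 obtain C where C: "C > 0" "hp (ep/4) (\<lambda>k om. norm (sqrt (rN k) *\<^sub>R dhat k om) <= C)" using dhat_tight[OF e4] by blast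
 obtain s where s: "s > 0" "hp (ep/4) (\<lambda>k om. norm (SNk k om) < s)" using score_tight[OF e4] by auto
 obtain R where R: "hp (ep/4) (\<lambda>k om. norm (dhat k om) < R \<and> LLR_max k om (dhat k om))"
  using dhat_localized[OF e4] by blast
 \<comment> \<open>Two approximation errors of size et1 leave a0 |X - Y|^2 / 2 <= 2 et1, which is a0
   et^2 / 2.\<close>
 define et1 where "et1 = a0 * et\<^sup>2 / 4"
 have et1: "et1 > 0" using a0 assms by (simp add: et1_def)
 \<comment> \<open>This radius covers both X and Y, as |Ainv S| <= |S| / a0.\<close>
 have C': "C + s / a0 > 0" using C s a0 by (simp add: add_pos_pos)
 show ?thesis
 proof (rule hp_mono[OF hp_conj[OF R hp_conj[OF C(2) hp_conj[OF s(2) uniform_LAN[OF e4 et1 C']]]]])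
  show "\<forall>\<^sub>F k in sequentially. \<forall>om\<in>space M. (norm (dhat k om) < R \<and> LLR_max k om (dhat k om)) \<and>
    norm (sqrt (rN k) *\<^sub>R dhat k om) <= C \<and> norm (SNk k om) < s \<and>
    (\<forall>h\<in>cball 0 (C + s / a0). \<bar>LLRk k (dl h k) om - QF k h om\<bar> <= et1) -->
   norm (sqrt (rN k) *\<^sub>R dhat k om - Ainv (SNk k om)) <= et"
   using nn_pos
  proof (eventually_elim, intro ballI impI)
   fix k om
   assume n: "0 < nn k" and H: "(norm (dhat k om) < R \<and> LLR_max k om (dhat k om)) \<and>
    norm (sqrt (rN k) *\<^sub>R dhat k om) <= C \<and> norm (SNk k om) < s \<and>
    (\<forall>h\<in>cball 0 (C + s / a0). \<bar>LLRk k (dl h k) om - QF k h om\<bar> <= et1)"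
   define X where "X = sqrt (rN k) *\<^sub>R dhat k om"
   define S where "S = SNk k om"
   define Y where "Y = Ainv S"
   have dX: "dl X k = dhat k om" unfolding X_def by (rule dl_scale[OF n])
   have "0 <= s / a0" using s a0 by simp
   moreover have "norm X <= C" using H by (simp add: X_def)
   ultimately have "X \<in> cball 0 (C + s / a0)" unfolding mem_cball_0 by linarith
   then have 1: "\<bar>LLRk k (dl X k) om - QF k X om\<bar> <= et1" using H by blast
   have "norm S <= s" using H by (simp add: S_def)
   then have "norm S / a0 <= s / a0" using a0 by (intro divide_right_mono) auto
   then have "Y \<in> cball 0 (C + s / a0)" using Ainv_le[of S] C(1) unfolding Y_def mem_cball_0 by linarith
   then have 2: "\<bar>LLRk k (dl Y k) om - QF k Y om\<bar> <= et1" using H by blast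
   have 3: "LLRk k (dl Y k) om <= LLRk k (dl X k) om" unfolding dX using H by blast
   have SY: "S = A Y" by (simp add: Y_def A_inv)
   have "QF k Y om - QF k X om = ((X - Y) \<bullet> A (X - Y)) / 2"
    using A_sym[of X Y] unfolding QF_def S_def[symmetric] SY
    by (simp add: A_diff inner_diff_left inner_diff_right inner_commute field_simps)
   then have "a0 * (norm (X - Y))^2 / 2 <= 2 * et1" using A_pos[of "X - Y"] 1 2 3 by linarith
   then have "a0 * (norm (X - Y))^2 <= a0 * et\<^sup>2" by (simp add: et1_def)
   then have "(norm (X - Y))^2 <= et\<^sup>2" using a0 by simp
   then show "norm (sqrt (rN k) *\<^sub>R dhat k om - Ainv (SNk k om)) <= et"
    using assms unfolding X_def[symmetric] S_def[symmetric] Y_def[symmetric] by (simp add: power2_le_iff_abs_le)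
  qed
 qed simp
qed

end

subsection \<open>Asymptotic normality\<close>

lemma norm_cis_diff_le: "cmod (cis a - cis b) <= \<bar>a - b\<bar>"
proof -
 have "cis a - cis b = cis b * (cis (a - b) - 1)" by (simp add: right_diff_distrib cis_mult)
 also have "cmod ... = cmod (cis (a - b) - 1)" by (simp add: norm_mult)
 also have "... <= \<bar>a - b\<bar>" using iexp_approx1[of "a - b" 0] by (simp add: cis_conv_exp)
 finally show ?thesis .
qed

context prob_space
begin

lemma integrable_cis[simp]: "X \<in> borel_measurable M ==> integrable M (\<lambda>om. cis (X om))"
 by (rule integrable_const_bound[where B=1]) auto

lemma norm_expectation_cis_le: "X \<in> borel_measurable M ==> cmod (LINT om|M. cis (X om)) <= 1"
 using integral_norm_bound[of M "\<lambda>om. cis (X om)"] by (simp add: prob_space)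

text \<open>Central limit theorem for n_k summands scaled by sqrt N_k with n/N convergent, since
  every sample is scaled by the total size. Powers are compared through |a^n - b^n| <= n |a - b| for
  numbers of modulus at most one.\<close>

lemma char_power_limit:
 assumes [measurable]: "X \<in> borel_measurable M" and X2: "integrable M (\<lambda>om. (X om)^2)" and X0: "expectation X = 0"
  and N: "filterlim N at_top sequentially" and q: "(\<lambda>k. real (n k) / real (N k)) \<longlonglongrightarrow> q"
 shows "(\<lambda>k. (LINT om|M. cis (X om / sqrt (real (N k)))) ^ n k) \<longlonglongrightarrow> complex_of_real (exp (- (q * expectation (\<lambda>om. (X om)^2)) / 2))"
proof -
 define v where "v = expectation (\<lambda>om. (X om)^2)"
 have v0: "v >= 0" unfolding v_def by (intro Bochner_Integration.integral_nonneg) simp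
 have X1: "integrable M X" using square_integrable_imp_integrable[OF _ X2] by simp
 define t where "t k = 1 / sqrt (real (N k))" for k
 define ph where "ph k = (LINT om|M. cis (X om / sqrt (real (N k))))" for k
 \<comment> \<open>Error term of the quadratic approximation of the characteristic function. The
   branch 6 X^2 gives domination and the cubic branch convergence to zero, so second moments are
   enough.\<close>
 define e where "e k = expectation (\<lambda>om. min (6 * (X om)^2) (\<bar>t k\<bar> * \<bar>X om\<bar> ^ 3))" for k
 have sN: "filterlim (\<lambda>k. sqrt (real (N k))) at_top sequentially"
  by (intro filterlim_compose[OF sqrt_at_top] filterlim_compose[OF filterlim_real_sequentially] N)
 have t_lim: "t \<longlonglongrightarrow> 0" unfolding t_def by (intro real_tendsto_divide_at_top[OF tendsto_const] sN)
 have iN: "(\<lambda>k. 1 / real (N k)) \<longlonglongrightarrow> 0"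
  by (intro real_tendsto_divide_at_top[OF tendsto_const] filterlim_compose[OF filterlim_real_sequentially] N)
 have e_lim: "e \<longlonglongrightarrow> 0"
 proof -
  have "(\<lambda>k. expectation (\<lambda>om. min (6 * (X om)^2) (\<bar>t k\<bar> * \<bar>X om\<bar> ^ 3))) \<longlonglongrightarrow> expectation (\<lambda>om. 0)"
  proof (rule integral_dominated_convergence)
   show "integrable M (\<lambda>om. 6 * (X om)^2)" using X2 by simp
   show "AE om in M. (\<lambda>k. min (6 * (X om)^2) (\<bar>t k\<bar> * \<bar>X om\<bar> ^ 3)) \<longlonglongrightarrow> 0"
   proof (rule AE_I2)
    fix om
    have "(\<lambda>k. min (6 * (X om)^2) (\<bar>t k\<bar> * \<bar>X om\<bar> ^ 3)) \<longlonglongrightarrow> min (6 * (X om)^2) (\<bar>0\<bar> * \<bar>X om\<bar> ^ 3)"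
     by (intro tendsto_intros t_lim)
    then show "(\<lambda>k. min (6 * (X om)^2) (\<bar>t k\<bar> * \<bar>X om\<bar> ^ 3)) \<longlonglongrightarrow> 0" by simp
   qed
   show "AE om in M. norm (min (6 * (X om)^2) (\<bar>t k\<bar> * \<bar>X om\<bar> ^ 3)) <= 6 * (X om)^2" for k
    by (intro AE_I2) (simp add: min_def)
  qed measurable
  then show ?thesis unfolding e_def[abs_def] by simp
 qed
 have bd: "cmod (ph k ^ n k - complex_of_real (exp (- (v / real (N k)) / 2)) ^ n k) <=
   real (n k) / real (N k) * (e k / 6 + v^2 / 4 * (1 / real (N k)))" for k
 proof -
  have t2: "(t k)^2 = 1 / real (N k)" by (simp add: t_def power_divide)
  have 1: "cmod (ph k - (1 - (t k)\<^sup>2 * v / 2)) <= (t k)^2 / 6 * e k"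
  proof -
   have "ph k = char (distr M borel X) (t k)"
    unfolding char_def by (subst integral_distr) (auto simp: ph_def t_def cis_conv_exp)
   then show ?thesis
    using char_approx3'[of X v "distr M borel X" "t k"] X1 X2 X0 unfolding e_def v_def by simp
  qed
  define x where "x = v / real (N k) / 2"
  have x0: "x >= 0" using v0 by (simp add: x_def)
  have "exp (- x) <= 1 - x + x^2"
  proof -
   have "exp (- x) = inverse (exp x)" by (rule exp_minus)
   also have "... <= inverse (1 + x)" using x0 by (intro le_imp_inverse_le) auto
   also have "... <= 1 - x + x^2"
   proof -
    have "(1 - x + x^2) * (1 + x) = 1 + x ^ 3" by (simp add: algebra_simps power2_eq_square power3_eq_cube)
    then show ?thesis using x0 by (simp add: inverse_eq_divide pos_divide_le_eq)
   qed
   finally show ?thesis .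
  qed
  moreover have "1 - x <= exp (- x)" using exp_ge_add_one_self[of "- x"] by simp
  ultimately have "\<bar>(1 - x) - exp (- x)\<bar> <= x^2" by linarith
  then have "cmod (complex_of_real ((1 - x) - exp (- x))) <= x^2" by (simp only: norm_of_real)
  moreover have "ph k - complex_of_real (exp (- x)) = (ph k - (1 - (t k)\<^sup>2 * v / 2)) + complex_of_real ((1 - x) - exp (- x))"
   by (simp add: x_def t2)
  ultimately have 2: "cmod (ph k - complex_of_real (exp (- x))) <= (t k)^2 / 6 * e k + x^2"
   using 1 by (simp only:) (rule order_trans[OF norm_triangle_ineq], rule add_mono)
  have "cmod (ph k ^ n k - complex_of_real (exp (- x)) ^ n k) <= real (n k) * cmod (ph k - complex_of_real (exp (- x)))"
   using x0 by (intro norm_power_diff) (auto simp: ph_def intro!: norm_expectation_cis_le)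
  also have "... <= real (n k) * ((t k)^2 / 6 * e k + x^2)" by (intro mult_left_mono 2) simp
  also have "... = real (n k) / real (N k) * (e k / 6 + v^2 / 4 * (1 / real (N k)))"
   unfolding t2 x_def by (simp add: power2_eq_square algebra_simps)
  finally show ?thesis by (simp add: x_def)
 qed
 have "(\<lambda>k. real (n k) / real (N k) * (e k / 6 + v^2 / 4 * (1 / real (N k)))) \<longlonglongrightarrow> q * (0 / 6 + v^2 / 4 * 0)"
  by (intro tendsto_intros q e_lim iN) auto
 then have "(\<lambda>k. real (n k) / real (N k) * (e k / 6 + v^2 / 4 * (1 / real (N k)))) \<longlonglongrightarrow> 0" by simp
 then have "(\<lambda>k. ph k ^ n k - complex_of_real (exp (- (v / real (N k)) / 2)) ^ n k) \<longlonglongrightarrow> 0"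
  by (rule Lim_null_comparison[rotated]) (intro always_eventually allI bd)
 moreover have "complex_of_real (exp (- (v / real (N k)) / 2)) ^ n k = complex_of_real (exp (- (real (n k) / real (N k) * v) / 2))" for k
  by (simp flip: of_real_power exp_of_nat_mult)
 moreover have "(\<lambda>k. complex_of_real (exp (- (real (n k) / real (N k) * v) / 2))) \<longlonglongrightarrow> complex_of_real (exp (- (q * v) / 2))"
  by (intro tendsto_intros q) auto
 ultimately have "(\<lambda>k. (ph k ^ n k - complex_of_real (exp (- (real (n k) / real (N k) * v) / 2))) + complex_of_real (exp (- (real (n k) / real (N k) * v) / 2)))
   \<longlonglongrightarrow> 0 + complex_of_real (exp (- (q * v) / 2))" by (intro tendsto_add) auto
 then show ?thesis by (simp add: ph_def v_def)
qed

text \<open>Characters are bounded and 1-Lipschitz, so variables that are close with high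
  probability have nearby characteristic functions. This is the Slutsky step.\<close>

lemma hp_cis_close:
 assumes [measurable]: "\<And>k. X k \<in> borel_measurable M" "\<And>k. Y k \<in> borel_measurable M"
  and close: "\<And>ep et. ep > 0 ==> et > 0 ==> hp ep (\<lambda>k om. \<bar>X k om - Y k om\<bar> <= et)"
  and lim: "(\<lambda>k. LINT om|M. cis (Y k om)) \<longlonglongrightarrow> l"
 shows "(\<lambda>k. LINT om|M. cis (X k om)) \<longlonglongrightarrow> l"
proof -
 have "(\<lambda>k. (LINT om|M. cis (X k om)) - (LINT om|M. cis (Y k om))) \<longlonglongrightarrow> 0"
 proof (rule tendstoI)
  fix e :: real assume e: "e > 0"
  have "hp (e/8) (\<lambda>k om. \<bar>X k om - Y k om\<bar> <= e/4)" by (rule close) (use e in auto)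
  then show "\<forall>\<^sub>F k in sequentially. dist ((LINT om|M. cis (X k om)) - (LINT om|M. cis (Y k om))) 0 < e"
   unfolding hp_def
  proof eventually_elim
   case (elim k)
   then obtain E where E[measurable]: "E \<in> sets M" and pE: "1 - e/8 <= prob E" and cl: "\<And>om. om \<in> E ==> \<bar>X k om - Y k om\<bar> <= e/4" by blast
   have "cmod ((LINT om|M. cis (X k om)) - (LINT om|M. cis (Y k om))) = cmod (LINT om|M. cis (X k om) - cis (Y k om))"
    by (subst Bochner_Integration.integral_diff) auto
   also have "... <= (LINT om|M. cmod (cis (X k om) - cis (Y k om)))" by (rule integral_norm_bound)
   also have "... <= (LINT om|M. e/4 + 2 * indicator (space M - E) om)"
   proof (rule integral_mono)
    show "norm (cis (X k om) - cis (Y k om)) <= e/4 + 2 * indicator (space M - E) om" if "om \<in> space M" for om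
    proof (cases "om \<in> E")
     case True
     then show ?thesis using order_trans[OF norm_cis_diff_le cl[OF True]] by simp
    next
     case False
     then show ?thesis using that e norm_triangle_ineq4[of "cis (X k om)" "cis (Y k om)"] by simp
    qed
    show "integrable M (\<lambda>om. e/4 + 2 * indicator (space M - E) om)"
     by (intro Bochner_Integration.integrable_add integrable_mult_right integrable_const) (auto simp: integrable_indicator_iff less_top[symmetric])
   qed auto
   also have "... = e/4 + 2 * (1 - prob E)"
    by (subst Bochner_Integration.integral_add) (auto simp: prob_space prob_compl less_top[symmetric])
   also have "... < e"
   proof -
    have "e/4 + 2 * (1 - P) < e" if "1 - e/8 <= P" for P using that e by simp
    then show ?thesis using pE .
   qed
   finally show ?case by (simp add: dist_norm)
  qed
 qed
 from tendsto_add[OF this lim] show ?thesis by simp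
qed

end

context ssl_env
begin

text \<open>Responses, unmatched covariates and matched pairs are members of one independent family,
  so the characteristic function factorizes. In particular the projection scores are independent of
  the response scores, and the limit has no cross covariance.\<close>

lemma char_SN:
 fixes t :: 'v
 shows "(LINT om|M. cis (t \<bullet> SN n m om)) =
  (LINT om|M. cis ((t \<bullet> sY (Yt 0 om)) / sqrt (real (n + m)))) ^ n * (LINT om|M. cis ((t \<bullet> w (Xt 0 om)) / sqrt (real (n + m)))) ^ n *
  (LINT om|M. cis (((t \<bullet> Xs 0 om) * g' (es 0 om)) / sqrt (real (n + m)))) ^ m"
proof -
 define N where "N = sqrt (real (n + m))"
 define V where "V s om = (case s of Inl i => (Xt i om, 0::real)
    | Inr (Inl j) => (0::'v, Yt j om) | Inr (Inr k) => (Xs k om, es k om))" for s and om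
 define F :: "nat + nat + nat => 'v \<times> real => complex" where
  "F s v = (case s of Inl i => cis ((t \<bullet> w (fst v)) / N) | Inr (Inl j) => cis ((t \<bullet> sY (snd v)) / N)
    | Inr (Inr k) => cis (((t \<bullet> fst v) * g' (snd v)) / N))" for s v
 let ?I = "{..<n} <+> ({..<n} <+> {..<m})"
 have F_meas: "F s \<in> borel_measurable borel" for s
 proof -
  have "(\<lambda>v::'v \<times> real. cis ((t \<bullet> w (fst v)) / N)) \<in> borel_measurable borel" unfolding borel_prod[symmetric] by measurable
  moreover have "(\<lambda>v::'v \<times> real. cis ((t \<bullet> sY (snd v)) / N)) \<in> borel_measurable borel" unfolding borel_prod[symmetric] by measurable
  moreover have "(\<lambda>v::'v \<times> real. cis (((t \<bullet> fst v) * g' (snd v)) / N)) \<in> borel_measurable borel" unfolding borel_prod[symmetric] by measurable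
  ultimately have "F (Inl i) \<in> borel_measurable borel" "F (Inr (Inl i)) \<in> borel_measurable borel" "F (Inr (Inr i)) \<in> borel_measurable borel" for i
   by (simp_all add: F_def[abs_def])
  then show ?thesis by (metis sumE)
 qed
 have "indep_vars (\<lambda>_. borel) (\<lambda>s om. F s (V s om)) UNIV"
  using samples unfolding V_def by (rule indep_vars_compose2) (rule F_meas)
 then have ind: "indep_vars (\<lambda>_. borel) (\<lambda>s om. F s (V s om)) ?I" by (rule indep_vars_subset) simp
 have V_meas: "V s \<in> borel_measurable M" for s
  using samples unfolding indep_vars_def V_def by auto
 have nF: "norm (F s v) <= 1" for s v by (auto simp: F_def split: sum.split)
 have int: "integrable M (\<lambda>om. F s (V s om))" for s
  by (rule integrable_const_bound[where B=1]) (auto simp: nF intro!: measurable_compose[OF V_meas F_meas])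
 have "cis (t \<bullet> SN n m om) = (\<Prod>s\<in>?I. F s (V s om))" for om
 proof -
  have cs: "cis (sum q I) = (\<Prod>i\<in>I. cis (q i))" if "finite I" for q and I :: "nat set"
   using that by (induction I) (auto simp: cis_mult[symmetric])
  have "t \<bullet> SN n m om = (\<Sum>j<n. (t \<bullet> sY (Yt j om)) / N) + (\<Sum>i<n. (t \<bullet> w (Xt i om)) / N) + (\<Sum>k<m. ((t \<bullet> Xs k om) * g' (es k om)) / N)"
   unfolding SN_def N_def[symmetric]
   by (simp add: inner_add_right inner_sum_right sum_distrib_left divide_inverse algebra_simps)
  then have "cis (t \<bullet> SN n m om) = (\<Prod>j<n. cis ((t \<bullet> sY (Yt j om)) / N)) * (\<Prod>i<n. cis ((t \<bullet> w (Xt i om)) / N)) * (\<Prod>k<m. cis (((t \<bullet> Xs k om) * g' (es k om)) / N))"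
   by (simp add: cs flip: cis_mult)
  also have "... = (\<Prod>s\<in>?I. F s (V s om))"
   by (simp add: prod.Plus F_def V_def o_def mult_ac)
  finally show ?thesis .
 qed
 then have "(LINT om|M. cis (t \<bullet> SN n m om)) = (LINT om|M. (\<Prod>s\<in>?I. F s (V s om)))" by simp
 also have "... = (\<Prod>s\<in>?I. LINT om|M. F s (V s om))"
  by (rule indep_vars_lebesgue_integral[OF _ ind int]) simp
 also have "... = (\<Prod>i<n. LINT om|M. cis ((t \<bullet> w (Xt i om)) / N)) * ((\<Prod>j<n. LINT om|M. cis ((t \<bullet> sY (Yt j om)) / N)) *
   (\<Prod>k<m. LINT om|M. cis (((t \<bullet> Xs k om) * g' (es k om)) / N)))"
  by (simp add: prod.Plus F_def V_def o_def)
 finally have calc: "(LINT om|M. cis (t \<bullet> SN n m om)) = (\<Prod>i<n. LINT om|M. cis ((t \<bullet> w (Xt i om)) / N)) * ((\<Prod>j<n. LINT om|M. cis ((t \<bullet> sY (Yt j om)) / N)) *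
   (\<Prod>k<m. LINT om|M. cis (((t \<bullet> Xs k om) * g' (es k om)) / N)))" .
 have hX: "(LINT om|M. cis ((t \<bullet> w (Xt i om)) / N)) = (LINT om|M. cis ((t \<bullet> w (Xt 0 om)) / N))" for i
 proof -
  have "(LINT om|M. cis ((t \<bullet> w (Xt i om)) / N)) = (LINT x|distr M borel (Xt i). cis ((t \<bullet> w x) / N))" by (subst integral_distr) auto
  also have "... = (LINT om|M. cis ((t \<bullet> w (Xt 0 om)) / N))" unfolding Xt_law[of i] by (subst integral_distr) auto
  finally show ?thesis .
 qed
 have hY: "(LINT om|M. cis ((t \<bullet> sY (Yt i om)) / N)) = (LINT om|M. cis ((t \<bullet> sY (Yt 0 om)) / N))" for i
 proof -
  have "(LINT om|M. cis ((t \<bullet> sY (Yt i om)) / N)) = (LINT x|distr M borel (Yt i). cis ((t \<bullet> sY x) / N))" by (subst integral_distr) auto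
  also have "... = (LINT om|M. cis ((t \<bullet> sY (Yt 0 om)) / N))" unfolding Y_law[of i] by (subst integral_distr) auto
  finally show ?thesis .
 qed
 have hZ: "(LINT om|M. cis (((t \<bullet> Xs i om) * g' (es i om)) / N)) = (LINT om|M. cis (((t \<bullet> Xs 0 om) * g' (es 0 om)) / N))" for i
 proof -
  have m: "(\<lambda>z::'v \<times> real. cis (((t \<bullet> fst z) * g' (snd z)) / N)) \<in> borel_measurable borel"
   unfolding borel_prod[symmetric] by measurable
  have p: "(\<lambda>om. (Xs i om, es i om)) \<in> borel_measurable M" for i unfolding borel_prod[symmetric] by measurable
  have "(LINT om|M. cis (((t \<bullet> Xs i om) * g' (es i om)) / N)) = (LINT z|distr M borel (\<lambda>om. (Xs i om, es i om)). cis (((t \<bullet> fst z) * g' (snd z)) / N))"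
   by (subst integral_distr[OF p m]) simp
  also have "... = (LINT om|M. cis (((t \<bullet> Xs 0 om) * g' (es 0 om)) / N))" unfolding Z_law[of i] by (subst integral_distr[OF p m]) simp
  finally show ?thesis .
 qed
 have "(\<Prod>i<n. LINT om|M. cis ((t \<bullet> w (Xt i om)) / N)) = (\<Prod>i<n. LINT om|M. cis ((t \<bullet> w (Xt 0 om)) / N))"
  by (intro prod.cong refl hX)
 moreover have "(\<Prod>i<n. LINT om|M. cis ((t \<bullet> sY (Yt i om)) / N)) = (\<Prod>i<n. LINT om|M. cis ((t \<bullet> sY (Yt 0 om)) / N))"
  by (intro prod.cong refl hY)
 moreover have "(\<Prod>i<m. LINT om|M. cis (((t \<bullet> Xs i om) * g' (es i om)) / N)) = (\<Prod>i<m. LINT om|M. cis (((t \<bullet> Xs 0 om) * g' (es 0 om)) / N))"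
  by (intro prod.cong refl hZ)
 ultimately show ?thesis using calc by (simp add: N_def mult_ac)
qed

end

context ssl_seq
begin

lemma char_SN_limit:
 "(\<lambda>k. LINT om|M. cis (t \<bullet> SNk k om)) \<longlonglongrightarrow>
  complex_of_real (exp (- (1 / (1 + lam) * (vY t + vX t) + lam / (1 + lam) * vM t) / 2))"
proof -
 have "(\<lambda>k. LINT om|M. cis (t \<bullet> SNk k om)) \<longlonglongrightarrow>
  complex_of_real (exp (- (1 / (1 + lam) * vY t) / 2)) * complex_of_real (exp (- (1 / (1 + lam) * vX t) / 2)) *
   complex_of_real (exp (- (lam / (1 + lam) * vM t) / 2))"
  unfolding char_SN vY_def vX_def vM_def
  by (intro tendsto_mult char_power_limit NN_lim n_frac m_frac expectation_sY expectation_w expectation_sM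
   integrable_sY_power integrable_w_power integrable_sM_power) measurable
 also have "complex_of_real (exp (- (1 / (1 + lam) * vY t) / 2)) * complex_of_real (exp (- (1 / (1 + lam) * vX t) / 2)) *
   complex_of_real (exp (- (lam / (1 + lam) * vM t) / 2)) =
  complex_of_real (exp (- (1 / (1 + lam) * (vY t + vX t) + lam / (1 + lam) * vM t) / 2))"
 proof -
  have "exp (- (a * x) / 2) * exp (- (a * y) / 2) * exp (- (b * z) / 2) = exp (- (a * (x + y) + b * z) / 2)" for a b x y z :: real
   unfolding exp_add[symmetric] by (simp add: add_divide_distrib distrib_left)
  then show ?thesis unfolding of_real_mult[symmetric] by (rule arg_cong)
 qed
 finally show ?thesis .
qed

end

context ssl_argmax
begin

lemma Ainv_adjoint: "t \<bullet> Ainv s = Ainv t \<bullet> s"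
 using A_sym[of "Ainv t" "Ainv s"] by (simp add: A_inv)

text \<open>The estimator is close to Ainv S, and symmetry moves the inverse from the score to the
  argument t, where the limit of the characteristic function of S is known. The continuity theorem
  concludes.\<close>

theorem asymptotic_normality:
 fixes q :: "'v => real"
 assumes [measurable]: "\<And>k. dhat k \<in> borel_measurable M"
  and \<mu>: "prob_space \<mu>" "sets \<mu> = sets borel"
  and cf: "\<And>t. (LINT x|\<mu>. cis (t \<bullet> x)) =
   complex_of_real (exp (- (1 / (1 + lam) * (vY (Ainv t) + vX (Ainv t)) + lam / (1 + lam) * vM (Ainv t)) / 2))"
  and q: "continuous_on UNIV q" "bounded (range q)"
 shows "(\<lambda>k. expectation (\<lambda>om. q (sqrt (rN k) *\<^sub>R dhat k om))) \<longlonglongrightarrow> (LINT x|\<mu>. q x)"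
proof -
 define \<nu> where "\<nu> k = distr M borel (\<lambda>om. sqrt (rN k) *\<^sub>R dhat k om)" for k
 have q_meas[measurable]: "q \<in> borel_measurable borel" by (rule borel_measurable_continuous_onI[OF q(1)])
 have "(\<lambda>k. LINT z|\<nu> k. q z) \<longlonglongrightarrow> (LINT z|\<mu>. q z)"
 proof (rule levy_continuity_euclidean)
  show "prob_space (\<nu> k)" "sets (\<nu> k) = sets borel" for k by (auto simp: \<nu>_def intro!: prob_space_distr)
  fix t :: 'v
  have "(\<lambda>k. LINT om|M. cis (t \<bullet> (sqrt (rN k) *\<^sub>R dhat k om))) \<longlonglongrightarrow> (LINT z|\<mu>. cis (t \<bullet> z))"
   unfolding cf
  proof (rule hp_cis_close[OF _ _ _ char_SN_limit])
   fix ep et :: real assume e: "ep > 0" "et > 0"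
   have "et / (norm t + 1) > 0" using e by (simp add: add_nonneg_pos)
   from maximizer_close[OF e(1) this]
   show "hp ep (\<lambda>k om. \<bar>t \<bullet> (sqrt (rN k) *\<^sub>R dhat k om) - Ainv t \<bullet> SNk k om\<bar> <= et)"
   proof (rule hp_mono)
    show "\<forall>\<^sub>F k in sequentially. \<forall>om\<in>space M. norm (sqrt (rN k) *\<^sub>R dhat k om - Ainv (SNk k om)) <= et / (norm t + 1) -->
     \<bar>t \<bullet> (sqrt (rN k) *\<^sub>R dhat k om) - Ainv t \<bullet> SNk k om\<bar> <= et"
    proof (intro always_eventually allI ballI impI)
     fix k om assume H: "norm (sqrt (rN k) *\<^sub>R dhat k om - Ainv (SNk k om)) <= et / (norm t + 1)"
     have "\<bar>t \<bullet> (sqrt (rN k) *\<^sub>R dhat k om) - Ainv t \<bullet> SNk k om\<bar>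
      = \<bar>t \<bullet> (sqrt (rN k) *\<^sub>R dhat k om - Ainv (SNk k om))\<bar>"
      by (simp only: inner_diff_right Ainv_adjoint)
     also have "... <= norm t * norm (sqrt (rN k) *\<^sub>R dhat k om - Ainv (SNk k om))" by (rule Cauchy_Schwarz_ineq2)
     also have "... <= (norm t + 1) * (et / (norm t + 1))" by (intro mult_mono H) auto
     also have "... = et" by (simp add: add_nonneg_eq_0_iff)
     finally show "\<bar>t \<bullet> (sqrt (rN k) *\<^sub>R dhat k om) - Ainv t \<bullet> SNk k om\<bar> <= et" .
    qed
   qed simp
  qed measurable
  then show "(\<lambda>k. LINT z|\<nu> k. cis (t \<bullet> z)) \<longlonglongrightarrow> (LINT z|\<mu>. cis (t \<bullet> z))"
   by (simp add: \<nu>_def integral_distr)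
 qed (use \<mu> q in auto)
 then show ?thesis by (simp add: \<nu>_def integral_distr)
qed

end

subsection \<open>Exponential power noise\<close>

lemma convex_abs_power:
 fixes n :: nat
 shows "convex_on UNIV (\<lambda>x::real. \<bar>x\<bar> ^ n)"
proof (cases "even n")
 case True
 then show ?thesis using convex_power_even[OF True] by (simp add: power_even_abs)
next
 case False
 show ?thesis
 proof (rule convex_onI)
  fix t x y :: real assume t: "0 < t" "t < 1"
  have "\<bar>(1 - t) * x + t * y\<bar> <= \<bar>(1 - t) * x\<bar> + \<bar>t * y\<bar>" by (rule abs_triangle_ineq)
  also have "... = (1 - t) * \<bar>x\<bar> + t * \<bar>y\<bar>" using t by (simp add: abs_mult)
  finally have "\<bar>(1 - t) * x + t * y\<bar> ^ n <= ((1 - t) * \<bar>x\<bar> + t * \<bar>y\<bar>) ^ n" by (rule power_mono) simp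
  also have "... <= (1 - t) * \<bar>x\<bar> ^ n + t * \<bar>y\<bar> ^ n"
   using convex_onD[OF convex_power_odd[OF False], of t "\<bar>x\<bar>" "\<bar>y\<bar>"] t by simp
  finally show "\<bar>(1 - t) *\<^sub>R x + t *\<^sub>R y\<bar> ^ n <= (1 - t) * \<bar>x\<bar> ^ n + t * \<bar>y\<bar> ^ n" by simp
 qed simp
qed

lemma abs_power_diff_le:
 fixes x y m :: real
 assumes "\<bar>x\<bar> <= m" "\<bar>y\<bar> <= m"
 shows "\<bar>\<bar>x\<bar> ^ n - \<bar>y\<bar> ^ n\<bar> <= real n * m ^ (n - 1) * \<bar>x - y\<bar>"
proof -
 have "\<bar>\<bar>x\<bar> ^ n - \<bar>y\<bar> ^ n\<bar> = \<bar>\<bar>x\<bar> - \<bar>y\<bar>\<bar> * \<bar>\<Sum>i<n. \<bar>y\<bar> ^ (n - Suc i) * \<bar>x\<bar> ^ i\<bar>"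
  unfolding power_diff_sumr2 by (rule abs_mult)
 also have "... <= \<bar>x - y\<bar> * (real n * m ^ (n - 1))"
 proof (rule mult_mono)
  have "\<bar>\<Sum>i<n. \<bar>y\<bar> ^ (n - Suc i) * \<bar>x\<bar> ^ i\<bar> <= (\<Sum>i<n. m ^ (n - 1))"
  proof (rule order_trans[OF sum_abs sum_mono])
   fix i assume i: "i \<in> {..<n}"
   have "\<bar>\<bar>y\<bar> ^ (n - Suc i) * \<bar>x\<bar> ^ i\<bar> = \<bar>y\<bar> ^ (n - Suc i) * \<bar>x\<bar> ^ i" by simp
   also have "... <= m ^ (n - Suc i) * m ^ i" using assms by (intro mult_mono power_mono) auto
   also have "... = m ^ (n - 1)" using i by (simp flip: power_add)
   finally show "\<bar>\<bar>y\<bar> ^ (n - Suc i) * \<bar>x\<bar> ^ i\<bar> <= m ^ (n - 1)" .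
  qed
  then show "\<bar>\<Sum>i<n. \<bar>y\<bar> ^ (n - Suc i) * \<bar>x\<bar> ^ i\<bar> <= real n * m ^ (n - 1)" by simp
 qed (auto simp: abs_triangle_ineq3)
 finally show ?thesis by (simp add: mult_ac)
qed

lemma abs_le_power: "1 <= n ==> \<bar>x::real\<bar> - 1 <= \<bar>x\<bar> ^ n"
proof (cases "1 <= \<bar>x\<bar>")
 case True
 assume "1 <= n"
 then have "\<bar>x\<bar> ^ 1 <= \<bar>x\<bar> ^ n" using True by (intro power_increasing) auto
 then show ?thesis by simp
qed (smt (verit) zero_le_power abs_ge_zero)

text \<open>Comparison with a two-sided exponential density, through |x| - 1 <= |x|^n.\<close>

lemma integrable_exp_minus_abs_power:
 fixes b :: real
 assumes "b > 0" "1 <= n"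
 shows "integrable lborel (\<lambda>x. exp (- (b * \<bar>x\<bar> ^ n)))"
proof -
 let ?e = "exponential_density b"
 interpret E: prob_space "density lborel ?e" by (rule prob_space_exponential_density[OF assms(1)])
 have e: "integrable lborel ?e"
 proof (rule integrableI_nonneg)
  show "(NNI lborel (\<lambda>x. ennreal (?e x))) < \<infinity>"
   using E.emeasure_space_1 by (simp add: emeasure_density)
 qed (use assms in \<open>auto intro!: AE_I2 exponential_density_nonneg\<close>)
 have "integrable lborel (\<lambda>x. ?e (0 + (-1) * x))" by (rule lborel_integrable_real_affine[OF e]) simp
 then have F: "integrable lborel (\<lambda>x. exp b / b * (?e x + ?e (- x)))" using e by simp
 show ?thesis
 proof (rule Bochner_Integration.integrable_bound[OF F])
  show "AE x in lborel. norm (exp (- (b * \<bar>x\<bar> ^ n))) <= norm (exp b / b * (?e x + ?e (- x)))"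
  proof (rule AE_I2)
   fix x :: real
   have "b * (\<bar>x\<bar> - 1) <= b * \<bar>x\<bar> ^ n" using assms abs_le_power[of n x] by (intro mult_left_mono) auto
   then have "exp (- (b * \<bar>x\<bar> ^ n)) <= exp (b - b * \<bar>x\<bar>)" by (subst exp_le_cancel_iff) (simp add: algebra_simps)
   also have "... = exp b / b * (b * exp (- \<bar>x\<bar> * b))" using assms by (simp add: exp_diff exp_minus field_simps)
   also have "... <= exp b / b * (?e x + ?e (- x))"
    using assms by (intro mult_left_mono) (auto simp: exponential_density_def)
   also have "... <= norm (exp b / b * (?e x + ?e (- x)))" unfolding real_norm_def by (rule abs_ge_self)
   finally show "norm (exp (- (b * \<bar>x\<bar> ^ n))) <= norm (exp b / b * (?e x + ?e (- x)))" unfolding real_norm_def abs_exp_cancel .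
  qed
 qed measurable
qed

context
 fixes \<alpha> :: nat and d :: real
 assumes \<alpha>: "\<alpha> >= 1" and d: "d > 0"
begin

definition ga :: real where "ga = d powr (- real \<alpha>)"
definition gn :: "real => real" where "gn t = ga * \<bar>t\<bar> ^ \<alpha> - ln (gn_const \<alpha> d)"
text \<open>The factor \<open>sgn t\<close> forces the value 0 at the origin, also for \<alpha> = 1,
  where the power is 1 there.\<close>

definition gn' :: "real => real" where "gn' t = ga * (real \<alpha> * \<bar>t\<bar> ^ (\<alpha> - 1) * sgn t)"

lemma ga_pos: "ga > 0" using d by (simp add: ga_def)
lemma gn_const_pos: "gn_const \<alpha> d > 0" using \<alpha> d by (simp add: gn_const_def Gamma_real_pos)

lemma exp_gn: "exp (- gn t) = gn_density \<alpha> d t"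
 using gn_const_pos by (simp add: gn_def gn_density_def ga_def exp_diff exp_minus field_simps)

lemma gn_deriv: "t \<noteq> 0 ==> (gn has_real_derivative gn' t) (at t)"
proof -
 assume t: "t \<noteq> 0"
 have "((\<lambda>x::real. \<bar>x\<bar>) has_real_derivative sgn t) (at t)"
 proof (cases "t > 0")
  case True
  have "((\<lambda>x::real. \<bar>x\<bar>) has_real_derivative 1) (at t)"
   by (rule has_field_derivative_transform_within_open[where f="\<lambda>x. x" and S="{0<..}"]) (use True in auto)
  then show ?thesis using True by simp
 next
  case False
  have "((\<lambda>x::real. \<bar>x\<bar>) has_real_derivative - 1) (at t)"
   by (rule has_field_derivative_transform_within_open[where f="\<lambda>x. - x" and S="{..<0}"])
    (use False t in \<open>auto intro!: derivative_eq_intros\<close>)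
  then show ?thesis using False t by simp
 qed
 from DERIV_diff[OF DERIV_cmult[OF DERIV_power[OF this, of \<alpha>], of ga] DERIV_const[of "ln (gn_const \<alpha> d)"]] show ?thesis
  unfolding gn_def[abs_def] gn'_def by (simp add: mult_ac)
qed

lemma deriv_gn_density: "t \<noteq> 0 ==> deriv (gn_density \<alpha> d) t = - gn' t * gn_density \<alpha> d t"
proof -
 assume "t \<noteq> 0"
 then have "((\<lambda>t. exp (- gn t)) has_real_derivative (exp (- gn t) * (- gn' t))) (at t)"
  by (auto intro!: derivative_eq_intros gn_deriv)
 then show ?thesis unfolding exp_gn by (intro DERIV_imp_deriv) (simp add: mult.commute)
qed

lemma gn_density_meas: "gn_density \<alpha> d \<in> borel_measurable borel"
 unfolding gn_density_def[abs_def] by measurable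

lemma gn'_meas: "gn' \<in> borel_measurable borel"
 unfolding gn'_def[abs_def] by measurable

text \<open>For \<alpha> = 1 the value of \<open>deriv\<close> at the origin is unspecified, but a
  change at one point does not affect measurability.\<close>

lemma deriv_gn_density_meas: "deriv (gn_density \<alpha> d) \<in> borel_measurable borel"
proof -
 note [measurable] = gn_density_meas gn'_meas
 have "deriv (gn_density \<alpha> d) = (\<lambda>t. if t = 0 then deriv (gn_density \<alpha> d) 0 else - gn' t * gn_density \<alpha> d t)"
  by (auto simp: deriv_gn_density)
 also have "... \<in> borel_measurable borel" by measurable
 finally show ?thesis .
qed

text \<open>The Lipschitz constant grows like |y|^(\<alpha> - 1), which is of lower order than
  |y|^\<alpha>. Hence any natural multiple of it is absorbed by a fraction of g.\<close>

lemma gn_envelope: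
 "\<exists>La\<in>borel_measurable borel. (\<forall>y. La y >= 0) \<and>
  (\<forall>y s s'. \<bar>s\<bar> <= R --> \<bar>s'\<bar> <= R --> \<bar>gn (y - s) - gn (y - s')\<bar> <= \<bar>s - s'\<bar> * La y) \<and>
  (\<forall>k::nat. integrable lborel (\<lambda>y. exp (real k * La y - gn y / 2)))"
proof -
 define La where "La y = ga * (real \<alpha> * (\<bar>R\<bar> + \<bar>y\<bar>) ^ (\<alpha> - 1))" for y
 have Lam[measurable]: "La \<in> borel_measurable borel" unfolding La_def[abs_def] by measurable
 have "\<bar>gn (y - s) - gn (y - s')\<bar> <= \<bar>s - s'\<bar> * La y" if "\<bar>s\<bar> <= R" "\<bar>s'\<bar> <= R" for y s s'
 proof -
  have "\<bar>\<bar>y - s\<bar> ^ \<alpha> - \<bar>y - s'\<bar> ^ \<alpha>\<bar> <= real \<alpha> * (\<bar>R\<bar> + \<bar>y\<bar>) ^ (\<alpha> - 1) * \<bar>(y - s) - (y - s')\<bar>"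
   by (rule abs_power_diff_le) (use that in auto)
  from mult_left_mono[OF this less_imp_le[OF ga_pos]]
  have "\<bar>ga * (\<bar>y - s\<bar> ^ \<alpha> - \<bar>y - s'\<bar> ^ \<alpha>)\<bar> <= ga * (real \<alpha> * (\<bar>R\<bar> + \<bar>y\<bar>) ^ (\<alpha> - 1) * \<bar>s - s'\<bar>)"
   using ga_pos by (simp add: abs_mult abs_minus_commute)
  then show ?thesis by (simp add: gn_def La_def right_diff_distrib mult_ac)
 qed
 moreover have "integrable lborel (\<lambda>y. exp (real k * La y - gn y / 2))" for k
 proof -
  \<comment> \<open>Beyond T the term k La is at most ga/4 |y|^\<alpha>, half of what g/2 offers;
    the other half remains for integrability.\<close>
  define T where "T = max \<bar>R\<bar> (4 * real k * real \<alpha> * 2 ^ (\<alpha> - 1))"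
  define C where "C = real k * La T + ln (gn_const \<alpha> d) / 2"
  have bd: "real k * La y - gn y / 2 <= C - ga / 4 * \<bar>y\<bar> ^ \<alpha>" for y
  proof -
   have "real k * La y <= real k * La T + ga / 4 * \<bar>y\<bar> ^ \<alpha>"
   proof (cases "\<bar>y\<bar> <= T")
    case True
    have "T >= 0" by (simp add: T_def)
    then have "La y <= La T" unfolding La_def using True ga_pos by (intro mult_left_mono power_mono) auto
    then have "real k * La y <= real k * La T" by (intro mult_left_mono) auto
    moreover have "0 <= ga / 4 * \<bar>y\<bar> ^ \<alpha>" using ga_pos by simp
    ultimately show ?thesis by linarith
   next
    case False
    then have y: "\<bar>R\<bar> <= \<bar>y\<bar>" "4 * real k * real \<alpha> * 2 ^ (\<alpha> - 1) <= \<bar>y\<bar>" by (auto simp: T_def)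
    have "(\<bar>R\<bar> + \<bar>y\<bar>) ^ (\<alpha> - 1) <= (2 * \<bar>y\<bar>) ^ (\<alpha> - 1)" using y by (intro power_mono) auto
    then have "real k * La y <= real k * (ga * (real \<alpha> * (2 * \<bar>y\<bar>) ^ (\<alpha> - 1)))"
     unfolding La_def using ga_pos by (intro mult_left_mono) auto
    also have "... = ga / 4 * (4 * real k * real \<alpha> * 2 ^ (\<alpha> - 1)) * \<bar>y\<bar> ^ (\<alpha> - 1)" by (simp add: power_mult_distrib)
    also have "... <= ga / 4 * \<bar>y\<bar> * \<bar>y\<bar> ^ (\<alpha> - 1)" using y ga_pos by (intro mult_right_mono mult_left_mono) auto
    also have "... = ga / 4 * \<bar>y\<bar> ^ \<alpha>" using \<alpha> by (cases \<alpha>) auto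
    finally have "real k * La y <= ga / 4 * \<bar>y\<bar> ^ \<alpha>" .
    moreover have "0 <= real k * La T" unfolding La_def T_def using ga_pos by (intro mult_nonneg_nonneg) auto
    ultimately show ?thesis by linarith
   qed
   then show ?thesis unfolding gn_def C_def by (simp add: field_simps)
  qed
  have "integrable lborel (\<lambda>y. exp C * exp (- (ga / 4 * \<bar>y\<bar> ^ \<alpha>)))"
   using ga_pos \<alpha> by (intro integrable_mult_right integrable_exp_minus_abs_power) auto
  then show ?thesis
   by (rule Bochner_Integration.integrable_bound)
    (use bd in \<open>auto simp: gn_def[abs_def] exp_add[symmetric] intro!: AE_I2\<close>)
 qed
 moreover have "La y >= 0" for y unfolding La_def using ga_pos by simp
 ultimately show ?thesis using Lam by blast
qed

text \<open>With q the root of the density, one minus the affinity is half the integral of (q t - q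
  (t - s))^2. On an interval of length one, so far out that t - s is at least 1 and the kink is
  avoided, |q'| is at least m, and the integrand is at least m^2 s^2.\<close>

lemma gn_hellinger:
 assumes norm: "(NNI lborel (\<lambda>t. ennreal (gn_density \<alpha> d t))) = 1"
 shows "\<exists>c>0. \<forall>s. \<bar>s\<bar> <= S --> (NNI lborel (\<lambda>t. ennreal (exp (- (gn (t - s) + gn t) / 2)))) <= ennreal (1 - c * s^2)"
proof -
 define q where "q t = exp (- gn t / 2)" for t
 have gnm[measurable]: "gn \<in> borel_measurable borel" unfolding gn_def[abs_def] by measurable
 have q_meas[measurable]: "q \<in> borel_measurable borel" unfolding q_def[abs_def] by measurable
 have q2: "(q t)^2 = gn_density \<alpha> d t" for t unfolding exp_gn[symmetric] by (simp add: q_def flip: exp_double)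
 have qq: "q (t - s) * q t = exp (- (gn (t - s) + gn t) / 2)" for s t by (simp add: q_def add_divide_distrib flip: exp_add)
 \<comment> \<open>Upper bound for t and t - s when t <= 2 + |S| and |s| <= |S|.\<close>
 define b where "b = 2 + 2 * \<bar>S\<bar>"
 define m where "m = ga * real \<alpha> / 2 * exp (- gn b / 2)"
 have m: "m > 0" using ga_pos \<alpha> by (simp add: m_def)
 have q_deriv: "(q has_real_derivative q t * (- gn' t / 2)) (at t)" if "t \<noteq> 0" for t
  unfolding q_def[abs_def] using that by (auto intro!: derivative_eq_intros gn_deriv)
 have q_low: "m <= \<bar>q t * (- gn' t / 2)\<bar>" if t: "1 <= t" "t <= b" for t
 proof -
  have "t ^ \<alpha> <= b ^ \<alpha>" using t by (intro power_mono) auto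
  then have "gn t <= gn b" unfolding gn_def using t ga_pos by (simp add: mult_left_mono)
  then have 1: "exp (- gn b / 2) <= q t" by (simp add: q_def)
  have "ga * (real \<alpha> * 1 * 1) <= ga * (real \<alpha> * \<bar>t\<bar> ^ (\<alpha> - 1) * sgn t)"
   using t ga_pos by (intro mult_left_mono mult_mono) (auto simp: one_le_power)
  then have 2: "ga * real \<alpha> / 2 <= gn' t / 2" by (simp add: gn'_def)
  have "0 <= ga * real \<alpha> / 2" using ga_pos by simp
  then have "m <= gn' t / 2 * q t" unfolding m_def using 1 2 by (intro mult_mono order_trans[OF _ 2]) auto
  also have "... <= \<bar>q t * (- gn' t / 2)\<bar>" by (simp add: mult.commute)
  finally show ?thesis .
 qed
 have q_diff: "m * \<bar>s\<bar> <= \<bar>q t - q (t - s)\<bar>" if s: "\<bar>s\<bar> <= S" and t: "1 + \<bar>S\<bar> <= t" "t <= 2 + \<bar>S\<bar>" for s t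
 proof -
  have *: "m * (y - x) <= \<bar>q y - q x\<bar>" if xy: "x < y" "1 <= x" "y <= b" for x y
  proof -
   obtain z where z: "x < z" "z < y" "q y - q x = (y - x) * (q z * (- gn' z / 2))"
    using MVT2[of x y q "\<lambda>t. q t * (- gn' t / 2)"] xy q_deriv by auto
   have "m * (y - x) <= \<bar>q z * (- gn' z / 2)\<bar> * (y - x)" using z xy by (intro mult_right_mono q_low) auto
   also have "... = \<bar>q y - q x\<bar>" using xy unfolding z(3) abs_mult by simp
   finally show ?thesis .
  qed
  consider "s = 0" | "s > 0" | "s < 0" by linarith
  then show ?thesis
  proof cases
   case 2
   then show ?thesis using *[of "t - s" t] s t by (simp add: b_def)
  next
   case 3
   then show ?thesis using *[of t "t - s"] s t by (simp add: b_def abs_minus_commute)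
  qed simp
 qed
 have F: "integrable lborel (\<lambda>t. (q t)^2)" and F1: "(LINT t|lborel. (q t)^2) = 1"
 proof -
  have *: "(NNI lborel (\<lambda>t. ennreal ((q t)^2))) = ennreal 1" using norm by (simp add: q2)
  have "integrable lborel (\<lambda>t. (q t)^2) \<and> (LINT t|lborel. (q t)^2) = 1"
   using * by (subst (asm) nn_integral_eq_integrable) auto
  then show "integrable lborel (\<lambda>t. (q t)^2)" "(LINT t|lborel. (q t)^2) = 1" by auto
 qed
 have "(NNI lborel (\<lambda>t. ennreal (exp (- (gn (t - s) + gn t) / 2)))) <= ennreal (1 - m\<^sup>2 / 2 * s^2)" if s: "\<bar>s\<bar> <= S" for s
 proof -
  have G: "integrable lborel (\<lambda>t. (q (t - s))^2)" and G1: "(LINT t|lborel. (q (t - s))^2) = 1"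
   using lborel_integrable_real_affine[OF F, of 1 "- s"] lborel_integral_real_affine[of 1 "\<lambda>t. (q t)^2" "- s"] F1 by (auto simp: add.commute)
  have GF: "integrable lborel (\<lambda>t. q (t - s) * q t)"
  proof (rule Bochner_Integration.integrable_bound[OF Bochner_Integration.integrable_add[OF G F]])
   show "AE t in lborel. norm (q (t - s) * q t) <= norm ((q (t - s))^2 + (q t)^2)"
   proof (rule AE_I2)
    fix t
    have "0 <= q (t - s) * q t" by (simp add: q_def)
    moreover have "2 * (q (t - s) * q t) <= (q (t - s))^2 + (q t)^2" using sum_squares_bound[of "q (t - s)" "q t"] by simp
    ultimately show "norm (q (t - s) * q t) <= norm ((q (t - s))^2 + (q t)^2)" by (simp add: abs_of_nonneg)
   qed
  qed measurable
  have D: "integrable lborel (\<lambda>t. (q t - q (t - s))^2)" "(LINT t|lborel. (q t - q (t - s))^2) = 2 - 2 * (LINT t|lborel. q (t - s) * q t)"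
  proof -
   have "(q t - q (t - s))^2 = ((q (t - s))^2 + (q t)^2) - 2 * (q (t - s) * q t)" for t by (simp add: power2_diff)
   then show "integrable lborel (\<lambda>t. (q t - q (t - s))^2)" "(LINT t|lborel. (q t - q (t - s))^2) = 2 - 2 * (LINT t|lborel. q (t - s) * q t)"
    using G F GF F1 G1 by simp_all
  qed
  let ?I = "{1 + \<bar>S\<bar>..2 + \<bar>S\<bar>}"
  have "m^2 * s^2 = (LINT t|lborel. indicator ?I t * (m^2 * s^2))" by simp
  also have "... <= (LINT t|lborel. (q t - q (t - s))^2)"
  proof (rule integral_mono[OF _ D(1)])
   fix t
   have "m^2 * s^2 <= (q t - q (t - s))^2" if "t \<in> ?I"
    using power_mono[OF q_diff[OF s], of t 2] that m by (simp add: power_mult_distrib)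
   then show "indicator ?I t * (m^2 * s^2) <= (q t - q (t - s))^2" by (simp add: indicator_def)
  qed simp
  finally have "(LINT t|lborel. q (t - s) * q t) <= 1 - m\<^sup>2 / 2 * s^2" unfolding D(2) by simp
  then show ?thesis unfolding qq[symmetric]
   by (subst nn_integral_eq_integral[OF GF]) (auto intro: ennreal_leI simp: q_def)
 qed
 then show ?thesis using m by (intro exI[of _ "m^2 / 2"]) auto
qed

lemma gn_noise:
 assumes norm: "(NNI lborel (\<lambda>t. ennreal (gn_density \<alpha> d t))) = 1"
 shows "noise gn gn'"
proof
 show "convex_on UNIV gn"
  unfolding gn_def[abs_def] using convex_on_cmul[OF less_imp_le[OF ga_pos] convex_abs_power[of \<alpha>]]
  by (intro convex_on_diff) (auto intro: concave_on_const[THEN iffD2])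
 show "gn' \<in> borel_measurable borel" unfolding gn'_def[abs_def] by measurable
 show "\<exists>c>0. \<exists>C. \<forall>t. c * \<bar>t\<bar> - C <= gn t"
 proof (intro exI conjI allI)
  fix t
  have "ga * (\<bar>t\<bar> - 1) <= ga * \<bar>t\<bar> ^ \<alpha>" using abs_le_power[OF \<alpha>, of t] ga_pos by (intro mult_left_mono) auto
  then show "ga * \<bar>t\<bar> - (ga + ln (gn_const \<alpha> d)) <= gn t" by (simp add: gn_def algebra_simps)
 qed (rule ga_pos)
qed (use gn_deriv gn_envelope gn_hellinger[OF norm] norm in \<open>auto simp: gn'_def exp_gn\<close>)

text \<open>The substitution x = ga t^\<alpha> on the positive half line leads to the integral of
  the Gamma function, and the negative half line contributes the same by symmetry.\<close>

lemma gamma_power_integral: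
 fixes q :: nat
 defines "h \<equiv> \<lambda>t::real. \<bar>t\<bar> ^ q * exp (- (ga * \<bar>t\<bar> ^ \<alpha>))" and "r \<equiv> (real q + 1) / real \<alpha>"
 shows "(LINT t|lborel. h t) = 2 / real \<alpha> * ga powr (- r) * Gamma r"
proof -
 have r: "r > 0" using \<alpha> by (simp add: r_def)
 define G where "G t = indicator {0..} t * t powr (r - 1) / exp t" for t :: real
 have G: "integrable lborel G" "(LINT t|lborel. G t) = Gamma r"
 proof -
  have "(NNI lborel (\<lambda>t. ennreal (G t))) = ennreal (Gamma r)"
   using Gamma_conv_nn_integral_real[OF r] by (simp add: G_def)
  moreover have "G \<in> borel_measurable lborel" unfolding G_def[abs_def] by measurable
  moreover have "AE t in lborel. 0 <= G t" by (simp add: G_def)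
  ultimately have "integrable lborel G \<and> (LINT t|lborel. G t) = Gamma r"
   using r Gamma_real_pos[OF r] by (subst (asm) nn_integral_eq_integrable) (auto intro: less_imp_le)
  then show "integrable lborel G" "(LINT t|lborel. G t) = Gamma r" by auto
 qed
 define u where "u x = (x / ga) powr (1 / real \<alpha>)" for x
 define u' where "u' x = 1 / real \<alpha> * (x / ga) powr (1 / real \<alpha> - 1) / ga" for x
 define C where "C = 1 / real \<alpha> * ga powr (- r)"
 have hu: "h (u x) * u' x = C * G x" if x: "x > 0" for x
 proof -
  have y: "x / ga > 0" using x ga_pos by simp
  have p: "u x ^ j = (x / ga) powr (real j / real \<alpha>)" for j
  proof -
   have "u x ^ j = u x powr real j" using y by (subst powr_realpow) (auto simp: u_def)
   then show ?thesis by (simp add: u_def powr_powr)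
  qed
  have "u x ^ \<alpha> = x / ga" using p[of \<alpha>] y \<alpha> x ga_pos by simp
  then have e: "ga * u x ^ \<alpha> = x" using ga_pos by simp
  have "\<bar>u x\<bar> = u x" by (simp add: u_def)
  then have "h (u x) = u x ^ q * exp (- x)" unfolding h_def by (simp only: e)
  then have "h (u x) * u' x = (x / ga) powr (real q / real \<alpha>) * exp (- x) * u' x" by (simp only: p)
  also have "... = (1 / real \<alpha> / ga) * exp (- x) * ((x / ga) powr (real q / real \<alpha>) * (x / ga) powr (1 / real \<alpha> - 1))" by (simp add: u'_def)
  also have "(x / ga) powr (real q / real \<alpha>) * (x / ga) powr (1 / real \<alpha> - 1) = (x / ga) powr (r - 1)"
   by (simp add: r_def add_divide_distrib add_diff_eq flip: powr_add)
  also have "... = x powr (r - 1) * ga powr (- (r - 1))" unfolding powr_minus_divide using x ga_pos by (simp add: powr_divide)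
  also have "ga powr (- (r - 1)) = ga powr (- r) * ga" using ga_pos by (simp add: powr_add[of ga "- r" 1, simplified] add.commute)
  also have "(1 / real \<alpha> / ga) * exp (- x) * (x powr (r - 1) * (ga powr (- r) * ga)) = C * G x"
   using x ga_pos by (simp add: C_def G_def exp_minus field_simps)
  finally show ?thesis .
 qed
 have hc: "isCont h t" for t unfolding h_def by (intro continuous_intros)
 have ind: "indicator {0<..} x *\<^sub>R (h (u x) * u' x) = C * G x" for x
  using hu[of x] by (auto simp: indicator_def G_def)
 have lim0: "(u \<longlongrightarrow> 0) (at_right 0)"
 proof -
  have "((\<lambda>x. (x / ga) powr (1 / real \<alpha>)) \<longlongrightarrow> (0 / ga) powr (1 / real \<alpha>)) (at_right 0)"
   using \<alpha> ga_pos by (intro tendsto_powr' tendsto_intros disjI2 conjI) (auto simp: eventually_at_right_less intro: exI[of _ 1] eventually_mono[OF eventually_at_right_less])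
  then show ?thesis using \<alpha> by (simp add: u_def[abs_def])
 qed
 have limT: "LIM x at_top. u x :> at_top"
 proof -
  have "1 / real \<alpha> > 0" using \<alpha> by simp
  then show ?thesis unfolding u_def[abs_def] using ga_pos by real_asymp
 qed
 have sub: "set_integrable lborel (einterval 0 \<infinity>) h" "(LBINT x=0..\<infinity>. h x) = (LBINT x=0..\<infinity>. h (u x) * u' x)"
 proof -
  have I: "set_integrable lborel (einterval 0 \<infinity>) (\<lambda>x. h (u x) * u' x)"
   unfolding zero_ereal_def einterval_eq set_integrable_def ind using G(1) by simp
  have d: "(u has_real_derivative u' x) (at x)" if "0 < ereal x" for x
   using that ga_pos \<alpha> unfolding u_def[abs_def] u'_def by (auto intro!: derivative_eq_intros)
  have c: "isCont u' x" if "0 < ereal x" for x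
   using that ga_pos \<alpha> unfolding u'_def[abs_def] by (auto intro!: continuous_intros)
  have A: "((ereal \<circ> u \<circ> real_of_ereal) \<longlongrightarrow> 0) (at_right 0)" unfolding zero_ereal_def ereal_tendsto_simps using lim0 .
  have B: "((ereal \<circ> u \<circ> real_of_ereal) \<longlongrightarrow> \<infinity>) (at_left \<infinity>)" unfolding ereal_tendsto_simps using limT .
  have u'0: "0 <= u' x" for x unfolding u'_def using ga_pos by simp
  have h0: "0 <= h x" for x by (simp add: h_def)
  show "set_integrable lborel (einterval 0 \<infinity>) h" "(LBINT x=0..\<infinity>. h x) = (LBINT x=0..\<infinity>. h (u x) * u' x)"
   by (rule interval_integral_substitution_nonneg[OF _ d hc c h0 u'0 A B I]; simp)+
 qed
 define H where "H t = indicator {0<..} t * h t" for t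
 have H: "integrable lborel H" "(LINT t|lborel. H t) = C * Gamma r"
 proof -
  show "integrable lborel H" using sub(1) unfolding zero_ereal_def einterval_eq set_integrable_def by (simp add: H_def[abs_def])
  have "(LINT t|lborel. H t) = (LINT t|lborel. C * G t)"
   using sub(2) unfolding interval_lebesgue_integral_def zero_ereal_def einterval_eq set_lebesgue_integral_def ind by (simp add: H_def)
  then show "(LINT t|lborel. H t) = C * Gamma r" using G by simp
 qed
 have "(LINT t|lborel. h t) = (LINT t|lborel. H t + H (0 + (-1) * t))"
 proof (rule integral_cong_AE)
  show "AE t in lborel. h t = H t + H (0 + (-1) * t)"
   using AE_lborel_singleton[of 0] by eventually_elim (auto simp: H_def h_def indicator_def)
 qed (auto simp: H_def[abs_def] h_def)
 also have "... = (LINT t|lborel. H t) + (LINT t|lborel. H (0 + (-1) * t))"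
  by (intro Bochner_Integration.integral_add H lborel_integrable_real_affine) simp
 also have "(LINT t|lborel. H (0 + (-1) * t)) = (LINT t|lborel. H t)"
  using lborel_integral_real_affine[of "-1" H 0] by simp
 finally show ?thesis using H by (simp add: C_def)
qed

text \<open>Almost everywhere f'^2 / f equals f g'^2, a constant times |t|^(2 \<alpha> - 2) exp (-
  ga |t|^\<alpha>), to which \<open>gamma_power_integral\<close> applies. The factor ga^2 cancels
  d^(2 \<alpha>); one 1/d remains from the integral and one comes from the normalizing
  constant.\<close>

lemma gn_fisher_information:
 "(LINT t|lborel. (deriv (gn_density \<alpha> d) t)^2 / gn_density \<alpha> d t) =
  (real \<alpha>)^2 / d^2 * (Gamma (2 - 1 / real \<alpha>) / Gamma (1 / real \<alpha>))"
 and gn'_sq: "(LINT t|lborel. (deriv (gn_density \<alpha> d) t)^2 / gn_density \<alpha> d t) = (LINT t|lborel. gn_density \<alpha> d t * (gn' t)^2)"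
proof -
 let ?q = "2 * \<alpha> - 2" and ?K = "gn_const \<alpha> d * (ga * real \<alpha>)^2"
 have fpos: "gn_density \<alpha> d t > 0" for t unfolding exp_gn[symmetric] by simp
 have [measurable]: "gn_density \<alpha> d \<in> borel_measurable borel" "gn' \<in> borel_measurable borel"
   "deriv (gn_density \<alpha> d) \<in> borel_measurable borel"
  by (rule gn_density_meas gn'_meas deriv_gn_density_meas)+
 have ae: "AE t in lborel. (deriv (gn_density \<alpha> d) t)^2 / gn_density \<alpha> d t = gn_density \<alpha> d t * (gn' t)^2"
  using AE_lborel_singleton[of 0]
 proof eventually_elim
  case (elim t)
  show ?case using fpos[of t] by (simp add: deriv_gn_density[OF elim] power2_eq_square)
 qed
 have K: "gn_density \<alpha> d t * (gn' t)^2 = ?K * (\<bar>t\<bar> ^ ?q * exp (- (ga * \<bar>t\<bar> ^ \<alpha>)))" if "t \<noteq> 0" for t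
 proof -
  have "(\<bar>t\<bar> ^ (\<alpha> - 1))^2 = \<bar>t\<bar> ^ ?q" by (simp add: diff_mult_distrib2 mult.commute flip: power_mult)
  moreover have "(sgn t)^2 = 1" using that by (simp add: sgn_real_def)
  ultimately show ?thesis by (simp add: gn_density_def gn'_def power_mult_distrib ga_def mult_ac)
 qed
 have ae2: "AE t in lborel. gn_density \<alpha> d t * (gn' t)^2 = ?K * (\<bar>t\<bar> ^ ?q * exp (- (ga * \<bar>t\<bar> ^ \<alpha>)))"
  using AE_lborel_singleton[of 0] by eventually_elim (rule K)
 show 1: "(LINT t|lborel. (deriv (gn_density \<alpha> d) t)^2 / gn_density \<alpha> d t) = (LINT t|lborel. gn_density \<alpha> d t * (gn' t)^2)"
  by (rule integral_cong_AE[OF _ _ ae]) measurable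
 have "(LINT t|lborel. gn_density \<alpha> d t * (gn' t)^2) = (LINT t|lborel. ?K * (\<bar>t\<bar> ^ ?q * exp (- (ga * \<bar>t\<bar> ^ \<alpha>))))"
  by (rule integral_cong_AE[OF _ _ ae2]) measurable
 also have "... = ?K * (2 / real \<alpha> * ga powr (- ((real ?q + 1) / real \<alpha>)) * Gamma ((real ?q + 1) / real \<alpha>))"
  by (subst integral_mult_right_zero) (simp only: gamma_power_integral)
 also have "(real ?q + 1) / real \<alpha> = 2 - 1 / real \<alpha>" using \<alpha> by (simp add: of_nat_diff field_simps)
 also have "ga powr (- (2 - 1 / real \<alpha>)) = d powr (2 * real \<alpha> - 1)"
  using \<alpha> by (simp add: ga_def powr_powr algebra_simps)
 also have "... = d powr (2 * real \<alpha>) / d" using d by (simp add: powr_diff)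
 also have "?K * (2 / real \<alpha> * (d powr (2 * real \<alpha>) / d) * Gamma (2 - 1 / real \<alpha>)) =
  (real \<alpha>)^2 / d^2 * (Gamma (2 - 1 / real \<alpha>) / Gamma (1 / real \<alpha>))"
 proof -
  have "ga^2 * d powr (2 * real \<alpha>) = 1" using d by (simp add: ga_def power2_eq_square flip: powr_add)
  then have "?K * (2 / real \<alpha> * (d powr (2 * real \<alpha>) / d) * Gamma (2 - 1 / real \<alpha>)) =
   gn_const \<alpha> d * (real \<alpha>)^2 * (2 / real \<alpha> / d * Gamma (2 - 1 / real \<alpha>))"
   by (simp add: power_mult_distrib)
  also have "... = (real \<alpha>)^2 / d^2 * (Gamma (2 - 1 / real \<alpha>) / Gamma (1 / real \<alpha>))"
   using \<alpha> d by (simp add: gn_const_def power2_eq_square mult_ac)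
  finally show ?thesis .
 qed
 finally show "(LINT t|lborel. (deriv (gn_density \<alpha> d) t)^2 / gn_density \<alpha> d t) =
  (real \<alpha>)^2 / d^2 * (Gamma (2 - 1 / real \<alpha>) / Gamma (1 / real \<alpha>))" unfolding 1 .
qed

end

subsection \<open>Moment matrices and location models\<close>

lemma quadratic_moment_matrix:
 fixes F :: "'b => real^'p"
 assumes "\<And>i j. integrable N (\<lambda>x. F x $ i * F x $ j * c x)"
 shows "(LINT x|N. (h \<bullet> F x)^2 * c x) = h \<bullet> ((\<chi> i j. LINT x|N. F x $ i * F x $ j * c x) *v h)"
proof -
 have "(h \<bullet> F x)^2 * c x = (\<Sum>i\<in>UNIV. \<Sum>j\<in>UNIV. h $ i * h $ j * (F x $ i * F x $ j * c x))" for x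
  by (simp add: inner_vec_def power2_eq_square sum_product sum_distrib_right sum_distrib_left mult_ac)
 then have "(LINT x|N. (h \<bullet> F x)^2 * c x) = (\<Sum>i\<in>UNIV. \<Sum>j\<in>UNIV. h $ i * h $ j * (LINT x|N. F x $ i * F x $ j * c x))"
  using assms by (simp add: Bochner_Integration.integral_sum)
 then show ?thesis by (simp add: inner_vec_def matrix_vector_mult_def sum_distrib_left mult_ac)
qed

lemma integrable_products:
 fixes F :: "'b => real^'p"
 assumes [measurable]: "F \<in> borel_measurable N" "c \<in> borel_measurable N" and c: "\<And>x. c x >= 0"
  and sq: "\<And>h. integrable N (\<lambda>x. (h \<bullet> F x)^2 * c x)"
 shows "integrable N (\<lambda>x. F x $ i * F x $ j * c x)"
proof (rule Bochner_Integration.integrable_bound)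
 show "integrable N (\<lambda>x. (axis i 1 \<bullet> F x)^2 * c x + (axis j 1 \<bullet> F x)^2 * c x)" by (intro Bochner_Integration.integrable_add sq)
 have [measurable]: "(\<lambda>x. F x $ i) \<in> borel_measurable N" for i
  by (rule borel_measurable_continuous_on[OF _ assms(1)]) (intro continuous_intros)
 show "(\<lambda>x. F x $ i * F x $ j * c x) \<in> borel_measurable N" by measurable
 show "AE x in N. norm (F x $ i * F x $ j * c x) <= norm ((axis i 1 \<bullet> F x)^2 * c x + (axis j 1 \<bullet> F x)^2 * c x)"
 proof (rule AE_I2)
  fix x
  have "2 * \<bar>F x $ i * F x $ j\<bar> <= (F x $ i)^2 + (F x $ j)^2"
   using sum_squares_bound[of "\<bar>F x $ i\<bar>" "\<bar>F x $ j\<bar>"] by (simp only: abs_mult power2_abs mult.assoc)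
  then have "\<bar>F x $ i * F x $ j\<bar> <= (F x $ i)^2 + (F x $ j)^2" using abs_ge_zero[of "F x $ i * F x $ j"] by linarith
  then have "\<bar>F x $ i * F x $ j\<bar> * c x <= ((F x $ i)^2 + (F x $ j)^2) * c x" by (rule mult_right_mono[OF _ c])
  then show "norm (F x $ i * F x $ j * c x) <= norm ((axis i 1 \<bullet> F x)^2 * c x + (axis j 1 \<bullet> F x)^2 * c x)"
   using c[of x] unfolding inner_axis' real_norm_def by (simp add: abs_mult algebra_simps)
 qed
qed

lemma matrix_inv_right:
 fixes A :: "real^'p^'p"
 assumes "\<And>x. A *v x = 0 ==> x = 0"
 shows "A ** matrix_inv A = mat 1"
proof -
 have "invertible A" unfolding invertible_left_inverse matrix_left_invertible_ker using assms by blast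
 then show ?thesis unfolding matrix_inv_def invertible_def by (rule someI2_ex) blast
qed

lemma symmetric_matrix_inner:
 fixes A :: "real^'p^'p"
 assumes "\<And>i j. A $ i $ j = A $ j $ i"
 shows "x \<bullet> (A *v y) = (A *v x) \<bullet> y"
proof -
 have "transpose A = A" using assms by (simp add: transpose_def vec_eq_iff)
 then show ?thesis using dot_lmul_matrix[of x A y] by (metis transpose_matrix_vector)
qed

text \<open>Used to discard the covariates at which \<open>deriv f\<close> is evaluated at the
  kink.\<close>

lemma AE_lborel_hyperplane:
 fixes a :: "'v::euclidean_space"
 assumes "a \<noteq> 0 \<or> b \<noteq> 0"
 shows "AE x in lborel. a \<bullet> x \<noteq> b"
proof -
 have "{x. a \<bullet> x = b} \<in> null_sets lebesgue" using negligible_hyperplane[OF assms] by (simp add: negligible_iff_null_sets)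
 then have "{x. a \<bullet> x = b} \<in> null_sets lborel"
  using closed_hyperplane[of a b] by (auto simp: null_sets_def)
 from AE_not_in[OF this] show ?thesis by simp
qed

context prob_space
begin

text \<open>By compactness the form attains its minimum on the unit sphere. Were the minimum zero, X
  would lie almost surely in a hyperplane.\<close>

lemma second_moment_coercive:
 fixes X :: "'a => real^'p"
 assumes [measurable]: "X \<in> borel_measurable M" and bd: "AE om in M. norm (X om) <= B"
  and hyper: "\<And>v. v \<noteq> 0 ==> measure M {om \<in> space M. v \<bullet> X om = 0} = 0"
 shows "\<exists>c>0. \<forall>v. c * (norm v)^2 <= expectation (\<lambda>om. (v \<bullet> X om)^2)"
proof -
 have int: "integrable M (\<lambda>om. (v \<bullet> X om)^2)" for v
 proof (rule integrable_const_bound[where B="(norm v * B)^2"])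
  show "AE om in M. norm ((v \<bullet> X om)^2) <= (norm v * B)^2"
   using bd
  proof eventually_elim
   case (elim om)
   have "\<bar>v \<bullet> X om\<bar> <= norm v * B"
    using Cauchy_Schwarz_ineq2[of v "X om"] mult_left_mono[OF elim norm_ge_zero[of v]] by linarith
   from power_mono[OF this abs_ge_zero, of 2] show ?case by simp
  qed
 qed measurable
 have prod: "integrable M (\<lambda>om. X om $ i * X om $ j * 1)" for i j
  by (rule integrable_products) (auto simp: int)
 define V where "V = ((\<chi> i j. LINT om|M. X om $ i * X om $ j * 1) :: real^'p^'p)"
 define q where "q v = v \<bullet> (V *v v)" for v
 have q: "expectation (\<lambda>om. (v \<bullet> X om)^2) = q v" for v
  using quadratic_moment_matrix[OF prod, of v] by (simp add: q_def V_def)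
 have cont: "continuous_on S q" for S
  unfolding q_def by (intro continuous_intros linear_continuous_on matrix_vector_mul_bounded_linear)
 have "axis undefined 1 \<in> sphere (0::real^'p) 1" by (simp add: norm_axis_1)
 then have "\<exists>v0\<in>sphere 0 1. \<forall>v\<in>sphere 0 1. q v0 <= q v"
  by (intro continuous_attains_inf cont compact_sphere) auto
 then obtain v0 where v0: "norm v0 = 1" "\<And>v. norm v = 1 ==> q v0 <= q v" by auto
 have "q v0 >= 0" unfolding q[symmetric] by (intro Bochner_Integration.integral_nonneg) simp
 moreover have "q v0 \<noteq> 0"
 proof
  assume "q v0 = 0"
  then have "AE om in M. (v0 \<bullet> X om)^2 = 0"
   using integral_nonneg_eq_0_iff_AE[OF int[of v0]] by (simp add: q)
  then have "prob {om \<in> space M. v0 \<bullet> X om = 0} = 1" by (subst prob_Collect_eq_1) auto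
  moreover have "v0 \<noteq> 0" using v0 by auto
  ultimately show False using hyper by simp
 qed
 ultimately have pos: "q v0 > 0" by simp
 have "q v0 * (norm v)^2 <= q v" for v
 proof (cases "v = 0")
  case False
  have "q v0 <= q (v /\<^sub>R norm v)" using False by (intro v0) simp
  also have "... = q v / (norm v)^2" unfolding q[symmetric] by (simp add: power_mult_distrib divide_inverse power_inverse mult.commute)
  finally show ?thesis using False by (simp add: pos_le_divide_eq)
 qed (simp add: q_def)
 then show ?thesis using pos by (auto simp: q)
qed

lemma expectation_density_eq:
 fixes ph :: "real^'p => 'b::{banach, second_countable_topology}"
 assumes D: "distributed M lborel X (\<lambda>x. ennreal (fX x))" and "\<And>x. fX x >= 0" and [measurable]: "ph \<in> borel_measurable borel"
 shows "(LINT x|lborel. fX x *\<^sub>R ph x) = (LINT om|M. ph (X om))"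
proof -
 have [measurable]: "fX \<in> borel_measurable borel" using distributed_real_measurable[OF _ D] assms by simp
 have X[measurable]: "X \<in> measurable M lborel" using distributed_measurable[OF D] by simp
 have "(LINT om|M. ph (X om)) = (LINT x|distr M lborel X. ph x)" by (rule integral_distr[symmetric]) measurable
 also have "... = (LINT x|lborel. fX x *\<^sub>R ph x)"
  unfolding distributed_distr_eq_density[OF D] by (rule integral_density) (use assms in auto)
 finally show ?thesis ..
qed

lemma location_law:
 fixes X :: "'a => 'v::euclidean_space"
 assumes [measurable]: "X \<in> borel_measurable M" "e \<in> borel_measurable M" "q \<in> borel_measurable borel"
  and law: "distr M borel (\<lambda>om. (X om, e om)) = distr M borel X \<Otimes>\<^sub>M density lborel (\<lambda>t. ennreal (q t))"
  and e: "distr M borel e = density lborel (\<lambda>t. ennreal (q t))"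
  and q: "\<And>t. 0 <= q t" "\<And>t. q t <= K"
 shows "distr M borel (\<lambda>om. b \<bullet> X om + e om) = density lborel (\<lambda>y. ennreal (expectation (\<lambda>om. q (y - b \<bullet> X om))))"
proof (rule measure_eqI)
 fix S assume "S \<in> sets (distr M borel (\<lambda>om. b \<bullet> X om + e om))"
 then have S[measurable]: "S \<in> sets borel" by simp
 interpret E: prob_space "density lborel (\<lambda>t. ennreal (q t))" unfolding e[symmetric] by (rule prob_space_distr) measurable
 interpret pair_sigma_finite M "lborel :: real measure" ..
 have sX: "sets (distr M borel X \<Otimes>\<^sub>M density lborel (\<lambda>t. ennreal (q t))) = sets (borel :: ('v \<times> real) measure)"
  unfolding borel_prod[symmetric] by (intro sets_pair_measure_cong) auto
 have m: "(\<lambda>z::'v \<times> real. indicator S (b \<bullet> fst z + snd z) :: ennreal) \<in> borel_measurable borel" unfolding borel_prod[symmetric] by measurable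
 have p: "(\<lambda>om. (X om, e om)) \<in> borel_measurable M" unfolding borel_prod[symmetric] by measurable
 have "emeasure (distr M borel (\<lambda>om. b \<bullet> X om + e om)) S = (NNI M (\<lambda>om. indicator S (b \<bullet> X om + e om)))"
  by (subst nn_integral_indicator[symmetric], simp) (subst nn_integral_distr, auto)
 also have "... = (NNI (distr M borel (\<lambda>om. (X om, e om))) (\<lambda>z. indicator S (b \<bullet> fst z + snd z)))"
  by (subst nn_integral_distr[OF p]) (use m in auto)
 also have "... = (NNI (distr M borel X) (\<lambda>x. \<integral>\<^sup>+t. indicator S (b \<bullet> x + t) \<partial>density lborel (\<lambda>t. ennreal (q t))))"
  unfolding law using m by (subst E.nn_integral_fst[symmetric]) (auto simp: measurable_cong_sets[OF sX refl])
 also have "... = (NNI (distr M borel X) (\<lambda>x. \<integral>\<^sup>+y. ennreal (q (y - b \<bullet> x)) * indicator S y \<partial>lborel))"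
 proof (rule nn_integral_cong)
  fix x
  have "(NNI (density lborel (\<lambda>t. ennreal (q t))) (\<lambda>t. indicator S (b \<bullet> x + t))) = (NNI lborel (\<lambda>t. ennreal (q t) * indicator S (b \<bullet> x + t)))"
   by (rule nn_integral_density) measurable
  also have "... = (NNI lborel (\<lambda>y. ennreal (q (y - b \<bullet> x)) * indicator S y))"
   using nn_integral_real_affine[of "\<lambda>t. ennreal (q t) * indicator S (b \<bullet> x + t)" 1 "- (b \<bullet> x)"] by simp
  finally show "(NNI (density lborel (\<lambda>t. ennreal (q t))) (\<lambda>t. indicator S (b \<bullet> x + t))) = (NNI lborel (\<lambda>y. ennreal (q (y - b \<bullet> x)) * indicator S y))" .
 qed
 also have "... = (NNI M (\<lambda>om. \<integral>\<^sup>+y. ennreal (q (y - b \<bullet> X om)) * indicator S y \<partial>lborel))"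
  by (rule nn_integral_distr) measurable
 also have "... = (NNI lborel (\<lambda>y. \<integral>\<^sup>+om. ennreal (q (y - b \<bullet> X om)) * indicator S y \<partial>M))"
  by (rule Fubini'[symmetric]) measurable
 also have "... = (NNI lborel (\<lambda>y. ennreal (expectation (\<lambda>om. q (y - b \<bullet> X om))) * indicator S y))"
 proof (rule nn_integral_cong)
  fix y
  have i: "integrable M (\<lambda>om. q (y - b \<bullet> X om))"
   by (rule integrable_const_bound[where B=K]) (use q in auto)
  have "(NNI M (\<lambda>om. ennreal (q (y - b \<bullet> X om)) * indicator S y)) = (NNI M (\<lambda>om. ennreal (q (y - b \<bullet> X om)))) * indicator S y"
   by (rule nn_integral_multc) measurable
  then show "(NNI M (\<lambda>om. ennreal (q (y - b \<bullet> X om)) * indicator S y)) = ennreal (expectation (\<lambda>om. q (y - b \<bullet> X om))) * indicator S y"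
   using nn_integral_eq_integral[OF i] q by simp
 qed
 also have "... = emeasure (density lborel (\<lambda>y. ennreal (expectation (\<lambda>om. q (y - b \<bullet> X om))))) S"
  by (subst emeasure_density) auto
 finally show "emeasure (distr M borel (\<lambda>om. b \<bullet> X om + e om)) S = emeasure (density lborel (\<lambda>y. ennreal (expectation (\<lambda>om. q (y - b \<bullet> X om))))) S" .
qed simp

end

section \<open>Transfer from the abstract model to exponential power noise\<close>

theorem theorem2:
  fixes M :: "'a measure"
    and \<alpha> :: nat and d :: real and lam :: real
    and \<beta>0 :: "real^'p"
    and fX :: "real^'p \<Rightarrow> real"
    and X :: "'a \<Rightarrow> real^'p" and eps :: "'a \<Rightarrow> real"
    and Xt :: "nat \<Rightarrow> 'a \<Rightarrow> real^'p" and Yt :: "nat \<Rightarrow> 'a \<Rightarrow> real"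
    and Xs :: "nat \<Rightarrow> 'a \<Rightarrow> real^'p" and Ys :: "nat \<Rightarrow> 'a \<Rightarrow> real"
    and nn mm :: "nat \<Rightarrow> nat"
    and \<beta>hat :: "nat \<Rightarrow> 'a \<Rightarrow> real^'p"
  defines "f \<equiv> gn_density \<alpha> d"
  defines "Y \<equiv> (\<lambda>\<omega>. \<beta>0 \<bullet> X \<omega> + eps \<omega>)"
  defines "fY \<equiv> (\<lambda>y. LINT x|lborel. f (y - \<beta>0 \<bullet> x) * fX x)"
  defines "u \<equiv> (\<lambda>y. LINT x|lborel. (deriv f (y - \<beta>0 \<bullet> x) * fX x) *\<^sub>R x)"
  defines "w \<equiv> (\<lambda>x. LINT y|lborel. (f (y - \<beta>0 \<bullet> x) / fY y) *\<^sub>R u y)"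
  defines "\<Gamma>1 \<equiv> (\<chi> i j. LINT y|lborel. u y $ i * u y $ j / fY y) :: real^'p^'p"
  defines "\<Gamma>2 \<equiv> (\<chi> i j. LINT x|lborel. w x $ i * w x $ j * fX x) :: real^'p^'p"
  defines "EXX \<equiv> (\<chi> i j. LINT \<omega>|M. X \<omega> $ i * X \<omega> $ j) :: real^'p^'p"
  defines "\<Sigma>2 \<equiv> (LINT t|lborel. (deriv f t)\<^sup>2 / f t) *\<^sub>R EXX"
  defines "A \<equiv> (1 / (1 + lam)) *\<^sub>R \<Gamma>1 + (lam / (1 + lam)) *\<^sub>R \<Sigma>2"
  defines "\<Sigma>SSL \<equiv> matrix_inv A ** ((1 / (1 + lam)) *\<^sub>R (\<Gamma>1 + \<Gamma>2) + (lam / (1 + lam)) *\<^sub>R \<Sigma>2) ** matrix_inv A"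
  assumes M: "prob_space M"
    and \<alpha>: "\<alpha> \<ge> 1" and d: "d > 0"
    and fX_nonneg: "\<And>x. fX x \<ge> 0"
    and X_distr: "distributed M lborel X (\<lambda>x. ennreal (fX x))"
    and X_bdd: "\<exists>B>0. AE \<omega> in M. norm (X \<omega>) \<le> B"
    and X_hyper: "\<And>v. v \<noteq> 0 \<Longrightarrow> measure M {\<omega> \<in> space M. v \<bullet> X \<omega> = 0} = 0"
    and eps_distr: "distributed M lborel eps (\<lambda>t. ennreal (f t))"
    and X_eps_indep: "prob_space.indep_var M borel (\<lambda>\<omega>. (X \<omega>, 0::real)) borel (\<lambda>\<omega>. (0::real^'p, eps \<omega>))"
    and Xt_meas: "\<And>i. Xt i \<in> borel_measurable M"
    and Yt_meas: "\<And>j. Yt j \<in> borel_measurable M"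
    and Xs_meas: "\<And>k. Xs k \<in> borel_measurable M"
    and Ys_meas: "\<And>k. Ys k \<in> borel_measurable M"
    and Xt_copy: "\<And>i. distr M borel (Xt i) = distr M borel X"
    and Yt_copy: "\<And>j. distr M borel (Yt j) = distr M borel Y"
    and XYs_copy: "\<And>k. distr M borel (\<lambda>\<omega>. (Xs k \<omega>, Ys k \<omega>)) = distr M borel (\<lambda>\<omega>. (X \<omega>, Y \<omega>))"
    and samples_indep: "prob_space.indep_vars M (\<lambda>_. borel)
        (\<lambda>s \<omega>. case s of Inl i \<Rightarrow> (Xt i \<omega>, 0::real)
                       | Inr (Inl j) \<Rightarrow> (0::real^'p, Yt j \<omega>)
                       | Inr (Inr k) \<Rightarrow> (Xs k \<omega>, Ys k \<omega>)) UNIV"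
    and nn_lim: "filterlim nn at_top sequentially"
    and mm_lim: "filterlim mm at_top sequentially"
    and ratio: "(\<lambda>k. real (mm k) / real (nn k)) \<longlonglongrightarrow> lam"
    and lam: "0 < lam" "lam < 1"
    and \<beta>hat_meas: "\<And>k. \<beta>hat k \<in> borel_measurable M"
    and \<beta>hat_max: "\<And>k. AE \<omega> in M.
        (\<exists>b. \<forall>\<beta>. ssl_loglik f (nn k) (mm k) (\<lambda>i. Xt i \<omega>) (\<lambda>j. Yt j \<omega>) (\<lambda>k. Xs k \<omega>) (\<lambda>k. Ys k \<omega>) \<beta>
                 \<le> ssl_loglik f (nn k) (mm k) (\<lambda>i. Xt i \<omega>) (\<lambda>j. Yt j \<omega>) (\<lambda>k. Xs k \<omega>) (\<lambda>k. Ys k \<omega>) b)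
        \<longrightarrow> (\<forall>\<beta>. ssl_loglik f (nn k) (mm k) (\<lambda>i. Xt i \<omega>) (\<lambda>j. Yt j \<omega>) (\<lambda>k. Xs k \<omega>) (\<lambda>k. Ys k \<omega>) \<beta>
                 \<le> ssl_loglik f (nn k) (mm k) (\<lambda>i. Xt i \<omega>) (\<lambda>j. Yt j \<omega>) (\<lambda>k. Xs k \<omega>) (\<lambda>k. Ys k \<omega>) (\<beta>hat k \<omega>))"
  shows "\<Sigma>2 = ((real \<alpha>)\<^sup>2 / d\<^sup>2 * (Gamma (2 - 1 / real \<alpha>) / Gamma (1 / real \<alpha>))) *\<^sub>R EXX
    \<and> (\<exists>\<mu>. centered_normal \<Sigma>SSL \<mu> \<and>
          conv_in_distr M (\<lambda>k \<omega>. sqrt (real (nn k + mm k)) *\<^sub>R (\<beta>hat k \<omega> - \<beta>0)) \<mu>)"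
proof -
 interpret prob_space M by (rule M)
 note [measurable] = Xt_meas Yt_meas Xs_meas Ys_meas \<beta>hat_meas
 have X_meas[measurable]: "X \<in> borel_measurable M" using distributed_measurable[OF X_distr] by simp
 have eps_meas[measurable]: "eps \<in> borel_measurable M" using distributed_measurable[OF eps_distr] by simp
 have fX_meas[measurable]: "fX \<in> borel_measurable borel" using distributed_real_measurable[OF _ X_distr] fX_nonneg by simp
 have f_meas[measurable]: "f \<in> borel_measurable borel" unfolding f_def by (rule gn_density_meas[OF \<alpha> d])
 have f'_meas[measurable]: "deriv f \<in> borel_measurable borel" unfolding f_def by (rule deriv_gn_density_meas[OF \<alpha> d])
 have g'_meas[measurable]: "gn' \<alpha> d \<in> borel_measurable borel" by (rule gn'_meas[OF \<alpha> d])
 obtain B where B: "B > 0" and XB: "AE om in M. norm (X om) <= B" using X_bdd by blast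
 \<comment> \<open>Truncation makes the covariates bounded everywhere. It alters them on a null set
   only, so laws are unchanged.\<close>
 define tr :: "real^'p => real^'p" where "tr x = (if norm x <= B then x else 0)" for x
 have tr_meas[measurable]: "tr \<in> borel_measurable borel" unfolding tr_def[abs_def] by measurable
 have tr_le: "norm (tr x) <= B" for x using B by (simp add: tr_def)
 define Xt' where "Xt' i om = tr (Xt i om)" for i om
 define Xs' where "Xs' k om = tr (Xs k om)" for k om
 define es where "es k om = Ys k om - \<beta>0 \<bullet> Xs k om" for k om
 have pair_meas: "(\<lambda>om. (V om, W om)) \<in> borel_measurable M" if "V \<in> borel_measurable M" "W \<in> borel_measurable M" for V :: "'a => real^'p" and W :: "'a => real"
  unfolding borel_prod[symmetric] using that by measurable

 have trAE: "AE om in M. tr (V om) = V om" if "distr M borel V = distr M borel X" and [measurable]: "V \<in> borel_measurable M" for V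
 proof -
  have "AE x in distr M borel V. norm x <= B" unfolding that(1) using XB by (subst AE_distr_iff) auto
  then have "AE om in M. norm (V om) <= B" by (subst (asm) AE_distr_iff) auto
  then show ?thesis by eventually_elim (simp add: tr_def)
 qed
 have Xs_law: "distr M borel (Xs k) = distr M borel X" for k
 proof -
  have m: "(fst :: (real^'p) \<times> real => _) \<in> borel_measurable borel" unfolding borel_prod[symmetric] by measurable
  have Y_meas: "Y \<in> borel_measurable M" unfolding Y_def by measurable
  have "distr M borel (Xs k) = distr (distr M borel (\<lambda>om. (Xs k om, Ys k om))) borel fst"
   by (subst distr_distr[OF m pair_meas]) (auto simp: comp_def)
  also have "... = distr M borel X" unfolding XYs_copy by (subst distr_distr[OF m pair_meas]) (auto simp: comp_def Y_meas)
  finally show ?thesis .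
 qed
 have Xt'AE: "AE om in M. \<forall>i. Xt' i om = Xt i om" unfolding AE_all_countable Xt'_def by (intro allI trAE Xt_copy) measurable
 have Xs'AE: "AE om in M. \<forall>i. Xs' i om = Xs i om" unfolding AE_all_countable Xs'_def by (intro allI trAE Xs_law) measurable
 have Xt'_law: "distr M borel (Xt' i) = distr M borel X" for i
 proof -
  have "distr M borel (Xt' i) = distr M borel (Xt i)"
   unfolding Xt'_def[abs_def] by (rule distr_cong_AE) (auto intro: trAE Xt_copy)
  then show ?thesis by (simp add: Xt_copy)
 qed
 have EX: "(LINT om|M. ph (Xt' i om)) = (LINT om|M. ph (X om))" if [measurable]: "ph \<in> borel_measurable borel" for i and ph :: "real^'p => 'c::{banach, second_countable_topology}"
 proof -
  have [measurable]: "Xt' i \<in> borel_measurable M" unfolding Xt'_def[abs_def] by measurable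
  have "(LINT om|M. ph (Xt' i om)) = (LINT x|distr M borel (Xt' i). ph x)" by (rule integral_distr[symmetric]) measurable
  also have "... = (LINT om|M. ph (X om))" unfolding Xt'_law by (rule integral_distr) measurable
  finally show ?thesis .
 qed

 have eps_law: "distr M borel eps = density lborel (\<lambda>t. ennreal (f t))"
  using distributed_distr_eq_density[OF eps_distr] by (simp cong: distr_cong)
 \<comment> \<open>That f has mass one is read off from the assumption that it is the density of
   eps, with no Gamma integral.\<close>
 have norm1: "(NNI lborel (\<lambda>t. ennreal (gn_density \<alpha> d t))) = 1"
 proof -
  interpret E: prob_space "density lborel (\<lambda>t. ennreal (f t))" unfolding eps_law[symmetric] by (rule prob_space_distr) measurable
  have "(NNI lborel (\<lambda>t. ennreal (f t))) = emeasure (density lborel (\<lambda>t. ennreal (f t))) UNIV"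
   by (subst emeasure_density) auto
  then show ?thesis using E.emeasure_space_1 by (simp add: f_def)
 qed
 have XE: "distr M borel (\<lambda>om. (X om, eps om)) = distr M borel X \<Otimes>\<^sub>M density lborel (\<lambda>t. ennreal (f t))"
 proof -
  have m: "(fst :: (real^'p) \<times> real => _) \<in> borel_measurable borel" "(snd :: (real^'p) \<times> real => _) \<in> borel_measurable borel"
   unfolding borel_prod[symmetric] by (rule measurable_fst measurable_snd)+
  \<comment> \<open>Independence is given for the padded pairs; projecting their product law to the
    informative coordinates yields the product law of X and eps.\<close>
  let ?X = "\<lambda>om. (X om, 0::real)" and ?E = "\<lambda>om. (0::real^'p, eps om)"
  have pm: "?X \<in> borel_measurable M" "?E \<in> borel_measurable M" by (auto intro!: pair_meas)
  have DX: "distr (distr M borel ?X) borel fst = distr M borel X" using distr_distr[OF m(1) pm(1)] by (simp add: comp_def)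
  have DE: "distr (distr M borel ?E) borel snd = distr M borel eps" using distr_distr[OF m(2) pm(2)] by (simp add: comp_def)
  have sf: "sigma_finite_measure (distr (distr M borel ?E) borel snd)"
   unfolding DE by (intro prob_space_imp_sigma_finite prob_space_distr) measurable
  have "distr M borel X \<Otimes>\<^sub>M distr M borel eps =
   distr (distr M borel ?X \<Otimes>\<^sub>M distr M borel ?E) (borel \<Otimes>\<^sub>M borel) (\<lambda>(x, y). (fst x, snd y))"
   using pair_measure_distr[OF _ _ sf, of fst "distr M borel ?X" borel] m by (simp add: DX DE)
  also have "distr M borel ?X \<Otimes>\<^sub>M distr M borel ?E = distr M (borel \<Otimes>\<^sub>M borel) (\<lambda>om. (?X om, ?E om))"
   using X_eps_indep unfolding indep_var_distribution_eq by simp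
  also have "distr ... (borel \<Otimes>\<^sub>M borel) (\<lambda>(x, y). (fst x, snd y)) = distr M (borel \<Otimes>\<^sub>M borel) (\<lambda>om. (X om, eps om))"
  proof (subst distr_distr)
   show "(\<lambda>om. (?X om, ?E om)) \<in> M \<rightarrow>\<^sub>M borel \<Otimes>\<^sub>M borel" using pm by (rule measurable_Pair)
   show "(\<lambda>(x :: (real^'p) \<times> real, y :: (real^'p) \<times> real). (fst x, snd y)) \<in> borel \<Otimes>\<^sub>M borel \<rightarrow>\<^sub>M borel \<Otimes>\<^sub>M borel"
    unfolding split_beta' by (rule measurable_Pair[OF measurable_compose[OF measurable_fst m(1)] measurable_compose[OF measurable_snd m(2)]])
  qed (simp add: comp_def)
  finally show ?thesis unfolding eps_law borel_prod ..
 qed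
 have nondeg: "\<exists>c>0. \<forall>v. c * (norm v)^2 <= expectation (\<lambda>om. (v \<bullet> X om)^2)"
  by (rule second_moment_coercive[OF X_meas XB X_hyper])
 have f_gn: "f t = exp (- gn \<alpha> d t)" for t using exp_gn[OF \<alpha> d] by (simp add: f_def)

 have S: "ssl M (gn \<alpha> d) (gn' \<alpha> d) \<beta>0 B Xt' Yt Xs' es"
 proof (intro ssl.intro ssl_axioms.intro M gn_noise[OF \<alpha> d norm1] B)
  show "norm (Xt' i om) <= B" "norm (Xs' i om) <= B" for i om by (simp_all add: Xt'_def Xs'_def tr_le)
  \<comment> \<open>Acts on each observation separately, truncating covariates and turning matched
    responses into errors, so joint independence is preserved.\<close>
  define H :: "nat + nat + nat => (real^'p) \<times> real => (real^'p) \<times> real" where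
   "H s v = (case s of Inl i => (tr (fst v), 0) | Inr (Inl j) => (0, snd v) | Inr (Inr k) => (tr (fst v), snd v - \<beta>0 \<bullet> fst v))" for s v
  have h1: "(\<lambda>v::(real^'p) \<times> real. (tr (fst v), snd v - \<beta>0 \<bullet> fst v)) \<in> borel_measurable borel" unfolding borel_prod[symmetric] by measurable
  have h2: "(\<lambda>v::(real^'p) \<times> real. (tr (fst v), 0::real)) \<in> borel_measurable borel" unfolding borel_prod[symmetric] by measurable
  have h3: "(\<lambda>v::(real^'p) \<times> real. (0::real^'p, snd v)) \<in> borel_measurable borel" unfolding borel_prod[symmetric] by measurable
  have H_meas: "H s \<in> borel_measurable borel" for s
  proof -
   have "H (Inl i) \<in> borel_measurable borel" "H (Inr (Inl i)) \<in> borel_measurable borel" "H (Inr (Inr i)) \<in> borel_measurable borel" for i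
    using h1 h2 h3 by (simp_all add: H_def[abs_def])
   then show ?thesis by (metis sumE)
  qed
  have "indep_vars (\<lambda>_. borel) (\<lambda>s om. H s (case s of Inl i => (Xt i om, 0) | Inr (Inl j) => (0, Yt j om) | Inr (Inr k) => (Xs k om, Ys k om))) UNIV"
   by (rule indep_vars_compose2[OF samples_indep]) (rule H_meas)
  moreover have "(\<lambda>s om. H s (case s of Inl i => (Xt i om, 0) | Inr (Inl j) => (0, Yt j om) | Inr (Inr k) => (Xs k om, Ys k om))) =
   (\<lambda>s om. case s of Inl i => (Xt' i om, 0) | Inr (Inl j) => (0, Yt j om) | Inr (Inr k) => (Xs' k om, es k om))"
   by (auto simp: fun_eq_iff H_def Xt'_def Xs'_def es_def split: sum.split)
  ultimately show "indep_vars (\<lambda>_. borel) (\<lambda>s om. case s of Inl i => (Xt' i om, 0)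
    | Inr (Inl j) => (0, Yt j om) | Inr (Inr k) => (Xs' k om, es k om)) UNIV" by simp
  show "distr M borel (Xt' i) = distr M borel (Xt' 0)" for i by (simp add: Xt'_law)
  show "distr M borel (Yt j) = density lborel (\<lambda>y. ennreal (expectation (\<lambda>om. exp (- gn \<alpha> d (y - \<beta>0 \<bullet> Xt' 0 om)))))" for j
  proof -
   have "f t <= gn_const \<alpha> d" for t
    using gn_const_pos[OF \<alpha> d] by (simp add: f_def gn_density_def mult_le_cancel_left1)
   moreover have "0 <= f t" for t by (simp add: f_gn)
   ultimately have "distr M borel Y = density lborel (\<lambda>y. ennreal (expectation (\<lambda>om. f (y - \<beta>0 \<bullet> X om))))"
    unfolding Y_def by (intro location_law XE eps_law) auto
   moreover have "expectation (\<lambda>om. f (y - \<beta>0 \<bullet> X om)) = expectation (\<lambda>om. f (y - \<beta>0 \<bullet> Xt' 0 om))" for y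
    by (rule EX[symmetric]) measurable
   ultimately show ?thesis by (simp add: Yt_copy f_gn)
  qed
  show "distr M borel (\<lambda>om. (Xs' k om, es k om)) = distr M borel (Xt' 0) \<Otimes>\<^sub>M density lborel (\<lambda>t. ennreal (exp (- gn \<alpha> d t)))" for k
  proof -
   have Y_meas[measurable]: "Y \<in> borel_measurable M" unfolding Y_def by measurable
   have "distr M borel (\<lambda>om. (Xs' k om, es k om)) = distr (distr M borel (\<lambda>om. (Xs k om, Ys k om))) borel (\<lambda>v. (tr (fst v), snd v - \<beta>0 \<bullet> fst v))"
    by (subst distr_distr[OF h1 pair_meas]) (auto simp: comp_def Xs'_def es_def)
   also have "... = distr M borel (\<lambda>om. (tr (X om), eps om))"
    unfolding XYs_copy by (subst distr_distr[OF h1 pair_meas]) (auto simp: comp_def Y_def)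
   also have "... = distr M borel (\<lambda>om. (X om, eps om))"
   proof (rule distr_cong_AE)
    show "AE om in M. (tr (X om), eps om) = (X om, eps om)" using trAE[OF refl X_meas] by eventually_elim simp
   qed (auto intro!: pair_meas)
   finally show ?thesis by (simp add: XE Xt'_law f_gn)
  qed
  have "expectation (\<lambda>om. (v \<bullet> Xt' 0 om)^2) = expectation (\<lambda>om. (v \<bullet> X om)^2)" for v by (rule EX) measurable
  then show "\<exists>c>0. \<forall>v. c * (norm v)^2 <= expectation (\<lambda>om. (v \<bullet> Xt' 0 om)^2)" using nondeg by simp
 qed
 obtain L where L: "ssl.env (gn \<alpha> d) (gn' \<alpha> d) \<beta>0 B 1 L" using ssl.env_exists[OF S zero_less_one] by blast
 interpret E: ssl_env M "gn \<alpha> d" "gn' \<alpha> d" \<beta>0 B Xt' Yt Xs' es L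
  by (intro ssl_env.intro ssl_env_axioms.intro S L)
 have Ef: "E.f t = f t" for t by (simp add: E.f_def f_gn)
 have p0: "E.p 0 x y = f (y - \<beta>0 \<bullet> x)" for x y by (simp add: E.p_def Ef)
 have fY: "fY y = E.pbar 0 y" for y
 proof -
  have "fY y = (LINT x|lborel. fX x *\<^sub>R f (y - \<beta>0 \<bullet> x))" by (simp add: fY_def mult.commute)
  also have "... = E.pbar 0 y" unfolding E.pbar_def p0
   by (subst expectation_density_eq[OF X_distr fX_nonneg], measurable) (rule EX[symmetric], measurable)
  finally show ?thesis .
 qed
 have pb: "E.pbar 0 y > 0" for y by (rule E.pbar_pos) simp
 have u_meas[measurable]: "u \<in> borel_measurable borel" unfolding u_def by measurable
 have nth_meas[measurable (raw)]: "(\<lambda>x. F x $ i) \<in> borel_measurable N" if "F \<in> borel_measurable N" for F :: "'c => real^'p" and N i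
  by (rule borel_measurable_continuous_on[OF _ that]) (intro continuous_intros)
 \<comment> \<open>The sign comes from f' = - g' f. If \<beta>0 = 0, the argument of f' at y = 0 is
   the kink for every x, so the point y = 0 has to be excluded.\<close>
 have u: "AE y in lborel. u y = - (E.pbar 0 y *\<^sub>R E.sY y)"
  using AE_lborel_singleton[of 0]
 proof eventually_elim
  case (elim y)
  let ?ph = "\<lambda>x. (gn' \<alpha> d (y - \<beta>0 \<bullet> x) * E.p 0 x y) *\<^sub>R x"
  have "u y = (LINT x|lborel. - (fX x *\<^sub>R ?ph x))"
   unfolding u_def
  proof (rule integral_cong_AE)
   have "AE x in lborel. \<beta>0 \<bullet> x \<noteq> y" using elim by (intro AE_lborel_hyperplane) simp
   then show "AE x in lborel. (deriv f (y - \<beta>0 \<bullet> x) * fX x) *\<^sub>R x = - (fX x *\<^sub>R ?ph x)"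
   proof eventually_elim
    case (elim x)
    then have "deriv f (y - \<beta>0 \<bullet> x) = - gn' \<alpha> d (y - \<beta>0 \<bullet> x) * f (y - \<beta>0 \<bullet> x)"
     unfolding f_def by (intro deriv_gn_density[OF \<alpha> d]) auto
    then show ?case by (simp add: p0 mult_ac)
   qed
  qed measurable
  also have "... = - expectation (\<lambda>om. ?ph (X om))"
   by (subst integral_minus, subst expectation_density_eq[OF X_distr fX_nonneg]) auto
  also have "expectation (\<lambda>om. ?ph (X om)) = expectation (\<lambda>om. ?ph (Xt' 0 om))" by (rule EX[symmetric]) measurable
  also have "... = E.pbar 0 y *\<^sub>R E.sY y" using pb[of y] by (simp add: E.sY_def)
  finally show ?case .
 qed
 \<comment> \<open>The sign of u relative to \<open>E.sY\<close> is the one built into the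
   definition of \<open>E.w\<close>.\<close>
 have w: "w x = E.w x" for x
 proof -
  have "w x = (LINT y|lborel. - (E.p 0 x y *\<^sub>R E.sY y))"
   unfolding w_def fY
  proof (rule integral_cong_AE)
   show "AE y in lborel. (f (y - \<beta>0 \<bullet> x) / E.pbar 0 y) *\<^sub>R u y = - (E.p 0 x y *\<^sub>R E.sY y)"
    using u by eventually_elim (use pb in \<open>simp add: p0 less_imp_neq[symmetric]\<close>)
  qed measurable
  then show ?thesis by (simp add: E.w_def)
 qed
 have \<Gamma>1: "\<Gamma>1 = (\<chi> i j. LINT y|lborel. E.sY y $ i * E.sY y $ j * E.pbar 0 y)"
  unfolding \<Gamma>1_def vec_eq_iff
 proof (intro allI, simp, rule integral_cong_AE)
  fix i j
  show "AE y in lborel. u y $ i * u y $ j / fY y = E.sY y $ i * E.sY y $ j * E.pbar 0 y"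
   using u by eventually_elim (use pb in \<open>simp add: fY less_imp_neq[symmetric]\<close>)
 qed (unfold fY, measurable)
 have \<Gamma>2: "\<Gamma>2 = (\<chi> i j. LINT x|lborel. E.w x $ i * E.w x $ j * fX x)" unfolding \<Gamma>2_def w ..
 have \<Gamma>1_quad: "h \<bullet> (\<Gamma>1 *v h) = E.vY h" for h
 proof -
  have law: "distr M borel (Yt 0) = density lborel (\<lambda>y. ennreal (E.pbar 0 y))" using E.Yt_law[of 0] by (simp add: E.pbar_def E.p_def E.f_def)
  have "integrable lborel (\<lambda>y. (v \<bullet> E.sY y)^2 * E.pbar 0 y)" for v
  proof -
   have "integrable (distr M borel (Yt 0)) (\<lambda>y. (v \<bullet> E.sY y)^2)" using E.integrable_sY_power[of v 0 2] by (subst integrable_distr_eq) auto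
   then show ?thesis unfolding law using pb by (subst (asm) integrable_density) (auto simp: mult.commute intro: less_imp_le)
  qed
  then have "integrable lborel (\<lambda>y. E.sY y $ i * E.sY y $ j * E.pbar 0 y)" for i j
   by (intro integrable_products) (auto intro: less_imp_le[OF pb])
  from quadratic_moment_matrix[OF this, of h] show ?thesis
   unfolding \<Gamma>1 E.vY_def by (subst E.expectation_Y[where ph="\<lambda>y. (h \<bullet> E.sY y)^2"]) (auto simp: mult.commute)
 qed
 have \<Gamma>2_quad: "h \<bullet> (\<Gamma>2 *v h) = E.vX h" for h
 proof -
  have law: "distr M borel (Xt' 0) = density lborel (\<lambda>x. ennreal (fX x))"
   unfolding Xt'_law using distributed_distr_eq_density[OF X_distr] by (simp cong: distr_cong)
  have "integrable lborel (\<lambda>x. (v \<bullet> E.w x)^2 * fX x)" for v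
  proof -
   have "integrable (distr M borel (Xt' 0)) (\<lambda>y. (v \<bullet> E.w y)^2)" using E.integrable_w_power[of v 0 2] by (subst integrable_distr_eq) auto
   then show ?thesis unfolding law using fX_nonneg by (subst (asm) integrable_density) (auto simp: mult.commute)
  qed
  then have "integrable lborel (\<lambda>y. E.w y $ i * E.w y $ j * fX y)" for i j
   by (intro integrable_products) (auto intro: fX_nonneg)
  from quadratic_moment_matrix[OF this, of h]
  have "h \<bullet> (\<Gamma>2 *v h) = (LINT x|lborel. fX x *\<^sub>R (h \<bullet> E.w x)\<^sup>2)" unfolding \<Gamma>2 by (simp add: mult.commute)
  also have "... = E.vX h" unfolding E.vX_def
   by (subst expectation_density_eq[OF X_distr fX_nonneg], measurable) (rule EX[symmetric], measurable)
  finally show ?thesis .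
 qed
 define I where "I = (LINT t|lborel. (deriv f t)^2 / f t)"
 have I_eq: "I = (real \<alpha>)^2 / d^2 * (Gamma (2 - 1 / real \<alpha>) / Gamma (1 / real \<alpha>))"
  unfolding I_def f_def by (rule gn_fisher_information[OF \<alpha> d])
 have I_pos: "I > 0"
 proof -
  have "1 / real \<alpha> < 2" "1 / real \<alpha> > 0" using \<alpha> by (auto simp: divide_less_eq)
  then show ?thesis unfolding I_eq using \<alpha> d by (intro mult_pos_pos divide_pos_pos Gamma_real_pos) auto
 qed
 have I_nn: "(NNI lborel (\<lambda>t. ennreal (f t * (gn' \<alpha> d t)^2))) = ennreal I"
 proof -
  have I2: "I = (LINT t|lborel. f t * (gn' \<alpha> d t)^2)" unfolding I_def f_def by (rule gn'_sq[OF \<alpha> d])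
  \<comment> \<open>A positive value rules out that the integral is the default 0 of a function that
    is not integrable.\<close>
  have "integrable lborel (\<lambda>t. f t * (gn' \<alpha> d t)^2)" using I_pos I2 not_integrable_integral_eq by fastforce
  then show ?thesis unfolding I2 by (rule nn_integral_eq_integral) (simp add: f_gn)
 qed
 have Xsq: "integrable M (\<lambda>om. (h \<bullet> X om)^2)" for h
 proof (rule integrable_const_bound[where B="(norm h * B)^2"])
  show "AE om in M. norm ((h \<bullet> X om)^2) <= (norm h * B)^2"
   using XB
  proof eventually_elim
   case (elim om)
   have "\<bar>h \<bullet> X om\<bar> <= norm h * B"
    using Cauchy_Schwarz_ineq2[of h "X om"] mult_left_mono[OF elim norm_ge_zero[of h]] by linarith
   from power_mono[OF this abs_ge_zero, of 2] show ?case by simp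
  qed
 qed measurable
 \<comment> \<open>Covariate and error have a product law, so the second moment of the matched score
   factorizes.\<close>
 have vM: "E.vM h = I * expectation (\<lambda>om. (h \<bullet> X om)^2)" for h
 proof -
  have "ennreal (E.vM h) = (NNI M (\<lambda>om. ennreal (((h \<bullet> Xs' 0 om) * gn' \<alpha> d (es 0 om))^2)))"
   unfolding E.vM_def using E.integrable_sM_power[of h 0 2] by (intro nn_integral_eq_integral[symmetric]) auto
  also have "... = (NNI M (\<lambda>om. \<integral>\<^sup>+t. ennreal (E.f t) * ennreal (((h \<bullet> Xt' 0 om) * gn' \<alpha> d t)^2) \<partial>lborel))"
  proof (rule E.nn_integral_Z)
   show "(\<lambda>(x, t). ennreal (((h \<bullet> x) * gn' \<alpha> d t)^2)) \<in> borel_measurable borel" unfolding borel_prod[symmetric] by measurable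
  qed
  also have "... = (NNI M (\<lambda>om. ennreal ((h \<bullet> Xt' 0 om)^2) * (NNI lborel (\<lambda>t. ennreal (f t * (gn' \<alpha> d t)^2)))))"
  proof (rule nn_integral_cong)
   fix om
   have "(NNI lborel (\<lambda>t. ennreal (E.f t) * ennreal (((h \<bullet> Xt' 0 om) * gn' \<alpha> d t)^2))) =
    (NNI lborel (\<lambda>t. ennreal ((h \<bullet> Xt' 0 om)^2) * ennreal (f t * (gn' \<alpha> d t)^2)))"
    by (intro nn_integral_cong) (simp add: Ef f_gn power_mult_distrib mult_ac flip: ennreal_mult)
   then show "(NNI lborel (\<lambda>t. ennreal (E.f t) * ennreal (((h \<bullet> Xt' 0 om) * gn' \<alpha> d t)^2))) =
    ennreal ((h \<bullet> Xt' 0 om)^2) * (NNI lborel (\<lambda>t. ennreal (f t * (gn' \<alpha> d t)^2)))"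
    by (simp add: nn_integral_cmult)
  qed
  also have "... = (NNI M (\<lambda>om. ennreal ((h \<bullet> Xt' 0 om)^2))) * ennreal I" unfolding I_nn by (rule nn_integral_multc) measurable
  also have "(NNI M (\<lambda>om. ennreal ((h \<bullet> Xt' 0 om)^2))) = (NNI M (\<lambda>om. ennreal ((h \<bullet> X om)^2)))"
   using Xt'AE trAE[OF Xt_copy[of 0] Xt_meas[of 0]]
  proof -
   have "(NNI (distr M borel (Xt' 0)) (\<lambda>x. ennreal ((h \<bullet> x)^2))) = (NNI (distr M borel X) (\<lambda>x. ennreal ((h \<bullet> x)^2)))" by (simp only: Xt'_law)
   then show ?thesis by (simp add: nn_integral_distr)
  qed
  also have "... = ennreal (expectation (\<lambda>om. (h \<bullet> X om)^2))" by (rule nn_integral_eq_integral[OF Xsq]) simp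
  also have "... * ennreal I = ennreal (I * expectation (\<lambda>om. (h \<bullet> X om)^2))"
   using I_pos by (subst ennreal_mult) (auto simp: mult.commute)
  finally show ?thesis using I_pos by (subst (asm) ennreal_inj) (auto simp: E.vM_def)
 qed
 have EXX_quad: "h \<bullet> (EXX *v h) = expectation (\<lambda>om. (h \<bullet> X om)^2)" for h
 proof -
  have "integrable M (\<lambda>om. X om $ i * X om $ j * 1)" for i j by (rule integrable_products) (auto simp: Xsq)
  from quadratic_moment_matrix[OF this, of h] show ?thesis by (simp add: EXX_def)
 qed
 have quad_lin: "x \<bullet> ((a *\<^sub>R P + b *\<^sub>R Q) *v y) = a * (x \<bullet> (P *v y)) + b * (x \<bullet> (Q *v y))" for a b x y and P Q :: "real^'p^'p"
  by (simp add: matrix_vector_mult_add_rdistrib scaleR_matrix_vector_assoc[symmetric] inner_add_right)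
 have \<Sigma>2: "\<Sigma>2 = I *\<^sub>R EXX" by (simp add: \<Sigma>2_def I_def)
 have \<Sigma>2_quad: "h \<bullet> (\<Sigma>2 *v h) = E.vM h" for h
  by (simp add: \<Sigma>2 vM EXX_quad scaleR_matrix_vector_assoc[symmetric])
 have sym: "\<Gamma>1 $ i $ j = \<Gamma>1 $ j $ i" "\<Gamma>2 $ i $ j = \<Gamma>2 $ j $ i" "\<Sigma>2 $ i $ j = \<Sigma>2 $ j $ i" for i j
  by (simp_all add: \<Gamma>1_def \<Gamma>2_def \<Sigma>2 EXX_def mult.commute)
 have A_sym: "x \<bullet> (A *v y) = (A *v x) \<bullet> y" for x y
  by (rule symmetric_matrix_inner) (simp add: A_def sym[of _ j for j])
 have A_quad: "h \<bullet> (A *v h) = 1 / (1 + lam) * E.vY h + lam / (1 + lam) * E.vM h" for h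
  unfolding A_def quad_lin \<Gamma>1_quad \<Sigma>2_quad ..
 obtain c where c: "c > 0" "\<And>v. c * (norm v)^2 <= expectation (\<lambda>om. (v \<bullet> X om)^2)" using nondeg by blast
 \<comment> \<open>Coercivity of \<open>A\<close> is drawn from the matched part alone; the form of
   \<Gamma>1 is bounded below by zero.\<close>
 define a0 where "a0 = lam / (1 + lam) * (I * c)"
 have a0: "a0 > 0" using lam I_pos c by (simp add: a0_def)
 have A_pos: "a0 * (norm h)^2 <= h \<bullet> (A *v h)" for h
 proof -
  have "E.vY h >= 0" unfolding E.vY_def by (intro Bochner_Integration.integral_nonneg) simp
  then have "0 <= 1 / (1 + lam) * E.vY h" using lam by simp
  moreover have "lam / (1 + lam) * (I * (c * (norm h)^2)) <= lam / (1 + lam) * E.vM h"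
   unfolding vM using lam I_pos c by (intro mult_left_mono) auto
  ultimately show ?thesis unfolding A_quad a0_def by (simp add: mult_ac)
 qed
 have "x = 0" if "A *v x = 0" for x
 proof -
  have "a0 * (norm x)^2 <= 0" using A_pos[of x] that by simp
  then show ?thesis using a0 by (simp add: mult_le_0_iff)
 qed
 from matrix_inv_right[OF this] have A_inv: "A *v (matrix_inv A *v s) = s" for s by (simp add: matrix_vector_mul_assoc)

 \<comment> \<open>Up to a positive factor and a constant free of the parameter the ratio is the
   log-likelihood, so the maximizers correspond under translation by \<beta>0. For n + m = 0 both
   sides vanish.\<close>
 have LLR: "E.LLR n m de om = real (n + m) * (ll (\<beta>0 + de) - ll \<beta>0)"
  if eq: "\<forall>i. Xt' i om = Xt i om" "\<forall>i. Xs' i om = Xs i om" and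
   ll: "ll = ssl_loglik f n m (\<lambda>i. Xt i om) (\<lambda>j. Yt j om) (\<lambda>k. Xs k om) (\<lambda>k. Ys k om)" for n m de om ll
 proof -
  have av: "E.av n de' (\<lambda>i. Xt' i om) y = 1 / real n * (\<Sum>i<n. f (y - (\<beta>0 + de') \<bullet> Xt i om))" for de' y
   using eq by (simp add: E.av_def E.p_def Ef)
  have lf: "ln (f t) = - gn \<alpha> d t" for t by (simp add: f_gn)
  have N: "real (n + m) * (1 / real (n + m) * S1 + 1 / real (n + m) * S2 - (1 / real (n + m) * T1 + 1 / real (n + m) * T2)) = (S1 - T1) + (S2 - T2)"
   if "n + m \<noteq> 0" for S1 S2 T1 T2 :: real
   using that by (simp add: field_simps del: of_nat_add)
  have 1: "ln (E.av n de (\<lambda>i. Xt' i om) y / E.av n 0 (\<lambda>i. Xt' i om) y) = ln (E.av n de (\<lambda>i. Xt' i om) y) - ln (E.av n 0 (\<lambda>i. Xt' i om) y)"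
   if "n > 0" for y
   using E.av_XS_pos[OF that, of de om y] E.av_XS_pos[OF that, of 0 om y] by (simp add: ln_div)
  have 2: "gn \<alpha> d (es k om) - gn \<alpha> d (es k om - de \<bullet> Xs' k om) = ln (f (Ys k om - (\<beta>0 + de) \<bullet> Xs k om)) - ln (f (Ys k om - \<beta>0 \<bullet> Xs k om))" for k
   using eq by (simp add: lf es_def inner_add_left algebra_simps)
  show ?thesis
  proof (cases "n + m = 0")
   case False
   have "E.LLR n m de om = (\<Sum>j<n. ln (E.av n de (\<lambda>i. Xt' i om) (Yt j om)) - ln (E.av n 0 (\<lambda>i. Xt' i om) (Yt j om))) +
    (\<Sum>k<m. ln (f (Ys k om - (\<beta>0 + de) \<bullet> Xs k om)) - ln (f (Ys k om - \<beta>0 \<bullet> Xs k om)))"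
    unfolding E.LLR_def 2 by (intro arg_cong2[where f="(+)"] sum.cong refl 1) auto
   then show ?thesis unfolding ll ssl_loglik_def N[OF False] sum_subtractf av by simp
  qed (simp add: E.LLR_def)
 qed

 interpret S: ssl_argmax M "gn \<alpha> d" "gn' \<alpha> d" \<beta>0 B Xt' Yt Xs' es L nn mm lam "\<lambda>x. A *v x" "\<lambda>x. matrix_inv A *v x" a0 "\<lambda>k om. \<beta>hat k om - \<beta>0"
 proof (unfold_locales)
  show "AE om in M. (\<exists>b. \<forall>de. E.LLR (nn k) (mm k) de om <= E.LLR (nn k) (mm k) b om)
    --> (\<forall>de. E.LLR (nn k) (mm k) de om <= E.LLR (nn k) (mm k) (\<beta>hat k om - \<beta>0) om)" for k
   using Xt'AE Xs'AE \<beta>hat_max[of k]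
  proof eventually_elim
   case (elim om)
   define ll where "ll = ssl_loglik f (nn k) (mm k) (\<lambda>i. Xt i om) (\<lambda>j. Yt j om) (\<lambda>k. Xs k om) (\<lambda>k. Ys k om)"
   note LL = LLR[OF elim(1,2) ll_def]
   show ?case
   proof (cases "nn k + mm k = 0")
    case False
    then have N: "real (nn k + mm k) > 0" unfolding of_nat_0_less_iff by simp
    have iff: "E.LLR (nn k) (mm k) de om <= E.LLR (nn k) (mm k) de' om \<longleftrightarrow> ll (\<beta>0 + de) <= ll (\<beta>0 + de')" for de de'
     unfolding LL using N by (simp only: mult_le_cancel_left_pos) simp
    show ?thesis
    proof (intro impI allI)
     fix de assume "\<exists>b. \<forall>de. E.LLR (nn k) (mm k) de om <= E.LLR (nn k) (mm k) b om"
     then obtain b where b: "\<And>de. ll (\<beta>0 + de) <= ll (\<beta>0 + b)" unfolding iff by blast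
     have "\<forall>\<beta>. ll \<beta> <= ll (\<beta>0 + b)" using b[of "\<beta> - \<beta>0" for \<beta>] by simp
     then have "\<forall>\<beta>. ll \<beta> <= ll (\<beta>hat k om)" using elim(3) unfolding ll_def[symmetric] by blast
     then show "E.LLR (nn k) (mm k) de om <= E.LLR (nn k) (mm k) (\<beta>hat k om - \<beta>0) om" unfolding iff by simp
    qed
   next
    case True
    then have "E.LLR (nn k) (mm k) de om = 0" for de unfolding LL by simp
    then show ?thesis by (simp only: order_refl simp_thms)
   qed
  qed
 qed (use nn_lim mm_lim ratio lam a0 A_sym A_quad A_pos A_inv in \<open>auto simp: matrix_vector_right_distrib matrix_vector_mult_scaleR\<close>)

 define Mid where "Mid = (1 / (1 + lam)) *\<^sub>R (\<Gamma>1 + \<Gamma>2) + (lam / (1 + lam)) *\<^sub>R \<Sigma>2"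
 have Mid_sym: "x \<bullet> (Mid *v y) = (Mid *v x) \<bullet> y" for x y
  by (rule symmetric_matrix_inner) (simp add: Mid_def sym[of _ j for j])
 have Mid_quad: "h \<bullet> (Mid *v h) = 1 / (1 + lam) * (E.vY h + E.vX h) + lam / (1 + lam) * E.vM h" for h
 proof -
  have "h \<bullet> ((\<Gamma>1 + \<Gamma>2) *v h) = E.vY h + E.vX h"
   unfolding matrix_vector_mult_add_rdistrib inner_add_right \<Gamma>1_quad \<Gamma>2_quad ..
  then show ?thesis unfolding Mid_def quad_lin \<Sigma>2_quad by simp
 qed
 have SSL: "\<Sigma>SSL *v t = matrix_inv A *v (Mid *v (matrix_inv A *v t))" for t
  by (simp add: \<Sigma>SSL_def Mid_def matrix_vector_mul_assoc matrix_mul_assoc)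
 have SSL_quad: "t \<bullet> (\<Sigma>SSL *v t) = 1 / (1 + lam) * (E.vY (matrix_inv A *v t) + E.vX (matrix_inv A *v t)) + lam / (1 + lam) * E.vM (matrix_inv A *v t)" for t
  unfolding SSL S.Ainv_adjoint Mid_quad ..
 \<comment> \<open>\<Sigma>SSL is the middle matrix conjugated by the symmetric inverse of
   \<open>A\<close>. Its form at t is the middle form at \<open>matrix_inv A *v t\<close>, hence
   nonnegative, and a normal law with this covariance exists.\<close>
 have "\<exists>\<mu>. prob_space \<mu> \<and> sets \<mu> = sets borel \<and> (\<forall>t. (LINT x|\<mu>. cis (t \<bullet> x)) = complex_of_real (exp (- (t \<bullet> (\<Sigma>SSL *v t)) / 2)))"
 proof (rule ex_gaussian_psd)
  show "x \<bullet> (\<Sigma>SSL *v y) = (\<Sigma>SSL *v x) \<bullet> y" for x y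
   unfolding SSL by (metis S.Ainv_adjoint Mid_sym inner_commute)
  show "0 <= x \<bullet> (\<Sigma>SSL *v x)" for x
  proof -
   have "0 <= E.vY h" "0 <= E.vX h" "0 <= E.vM h" for h
    unfolding E.vY_def E.vX_def E.vM_def by (auto intro!: Bochner_Integration.integral_nonneg)
   then show ?thesis unfolding SSL_quad using lam by (intro add_nonneg_nonneg mult_nonneg_nonneg) auto
  qed
 qed (rule matrix_vector_mul_linear)
 then obtain \<mu> where \<mu>: "prob_space \<mu>" "sets \<mu> = sets borel"
  "\<And>t. (LINT x|\<mu>. cis (t \<bullet> x)) = complex_of_real (exp (- (t \<bullet> (\<Sigma>SSL *v t)) / 2))" by blast
 have "centered_normal \<Sigma>SSL \<mu>" using \<mu> by (simp add: centered_normal_def)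
 moreover have "conv_in_distr M (\<lambda>k om. sqrt (real (nn k + mm k)) *\<^sub>R (\<beta>hat k om - \<beta>0)) \<mu>"
  unfolding conv_in_distr_def
  by (intro allI impI S.asymptotic_normality \<mu>(1,2)) (auto simp: \<mu>(3) SSL_quad)
 moreover have "\<Sigma>2 = ((real \<alpha>)^2 / d^2 * (Gamma (2 - 1 / real \<alpha>) / Gamma (1 / real \<alpha>))) *\<^sub>R EXX"
  unfolding \<Sigma>2 I_eq ..
 ultimately show ?thesis by blast
qed

end
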